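(* Let $K$ and $\zeta_0$ satisfy $K\in C^2([0,+\infty))$, $0<K_0\le K(t)\le K_1$, $0<K'(t)\le K_2$ (with $K_0,K_1,K_2$ positive constants) and $\max_{t\in[0,T]}(K'(t))^2<\zeta_0/4$. Let $v_0,v_1\in H_0^2(\Omega)\cap H^4(\Omega)$, let $v=v(y,t)$ be the solution of the weak problem (W) with initial data $v_0,v_1$, and assume $$v',\,v''\in L^2(0,T;H^4(\Omega)),\qquad v'''\in L^\infty(0,T;H^1(\Omega)),\qquad v^{(iv)}\in L^\infty(0,T;L^2(\Omega)).$$ For each $h$ let $v_h:[0,T)\to V_h$ be the solution of the semi-discrete problem (SD) with initial data $v_{0h},v_{1h}\in V_h$ satisfying $$|v_{1h}-R_hv_1|_0\le c_1h^4,\qquad |\nabla v_{0h}-\nabla R_hv_0|_0\le c_2h^3,\qquad |\Delta v_{0h}-\Delta R_hv_0|_0\le c_3h^2,$$ with constants $c_1,c_2,c_3\ge 0$ independent of $h$. Let $e(t)=v(t)-v_h(t)$. Then there exists a constant $C>0$, which may depend on $v$ but is independent of $h$, such that $$\|e'\|_{L^\infty(0,T;L^2(\Omega))}+\|e\|_{L^\infty(0,T;H_0^2(\Omega))}\le C\,h^2 .$$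
   Context: Setting. $T>0$, $n\ge1$ (the paper treats the one- and two-dimensional cases), $\Omega=(0,1)^n\subset\mathbb{R}^n$, $V=H_0^2(\Omega)$; $(\cdot,\cdot)$ and $|\cdot|_0$ are the inner product and norm of $L^2(\Omega)$ (also for vector-valued functions). A prime denotes the time derivative. $\nu>0$, $\zeta_1>0$ are constants and $\zeta_0$ is a real constant. Repeated indices $i,j$ are summed from $1$ to $n$; $\nabla_{y_i}=\partial/\partial y_i$, $\nabla_{y_i,y_j}=\partial^2/\partial y_i\partial y_j$. Coefficients (with $K=K(t)$): $$b_1(t)=\frac{\zeta_1}{K^4},\quad b_2(t)=\frac1{K^4},\quad a_i^{(1)}(y,t)=\frac{1}{K^2}\big[\zeta_0-4(y_iK')^2\big],\quad a_{ij}^{(2)}(y,t)=4y_iy_j(K'/K)^2,$$ $$a_i^{(3)}(y,t)=\frac1{K^2}\big[2y_i(K')^2-y_iK(\nu K'+K'')\big],\quad a_i^{(4)}(y,t)=-2y_i\frac{K'}{K},\quad a_i^{(5)}=a_i^{(3)}+2\frac{K'}{K}a_i^{(4)} .$$ Weak problem (W): $v$ with $v(t)\in V$ satisfies, for all $w\in V$ and $t\in(0,T)$, $$(v'',w)+b_1(t)|\nabla v|_0^2(\nabla v,\nabla w)+b_2(t)(\Delta v,\Delta w)+\nu(v',w)+(a_i^{(1)}\nabla_{y_i}v,\nabla_{y_i}w)+(a_{ij}^{(2)}\nabla_{y_i,y_j}v,w)+(a_i^{(4)}\nabla_{y_i}v',w)+(a_i^{(5)}\nabla_{y_i}v,w)=0,$$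 with $v(0)=v_0$, $v'(0)=v_1$. (The boundary conditions $v=0$, $\nabla v=0$ on $\partial\Omega$ are contained in $v(t)\in V$.) Finite element spaces. $\{T_h\}$ is a family of polygonal partitions of $\Omega$ into elements, satisfying the minimum angle condition, $h$ being the maximal diameter of the elements. $V_h\subset V$ is the space of $C^1$ functions whose restriction to each element is a (Hermite) polynomial of degree at most $l=3$. The following approximation property (Douglas–Dupont) holds: for every $w:(0,T)\to H^4(\Omega)\cap V$ there is an interpolant $\widehat w_h:(0,T)\to V_h$ with $\|w(t)-\widehat w_h(t)\|_m\le C_1h^{4-m}\|w(t)\|_4$ for $0\le m\le 3$, where $\|\cdot\|_m$ is the $H^m(\Omega)$ seminorm (taken elementwise for $m=3$) and $C_1$ is independent of $h$. Semi-discrete problem (SD): find $v_h:[0,T)\to V_h$ such that, for all $w_h\in V_h$ and $t\in(0,T)$, $$(v_h'',w_h)+b_1(t)|\nabla v_h|_0^2(\nabla v_h,\nabla w_h)+b_2(t)(\Delta v_h,\Delta w_h)+\nu(v_h',w_h)+(a_i^{(1)}\nabla_{y_i}v_h,\nabla_{y_i}w_h)+(a_{ij}^{(2)}\nabla_{y_i,y_j}v_h,w_h)+(a_i^{(4)}\nabla_{y_i}v_h',w_h)+(a_i^{(5)}\nabla_{y_i}v_h,w_h)=0,$$ with $v_h(0)=v_{0h}$, $v_h'(0)=v_{1h}$. Ritz projection. For $t\in[0,T)$ and $\vartheta$ fixed, let $$a^{(\vartheta,t)}(\phi,w)=(a_i^{(1)}(t)\nabla_{y_i}\phi,\nabla_{y_i}w)+b_1(t)|\nabla\vartheta(t)|_0^2(\nabla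 \phi,\nabla w)+b_2(t)(\Delta \phi,\Delta w),\qquad \phi,w\in V.$$ $R_h:V\to V_h$ is defined by $a^{(\vartheta,t)}(\phi-R_h\phi,w_h)=0$ for all $w_h\in V_h$. In the conditions on the initial data, $R_h$ is taken with $\vartheta=v$ and $t=0$. *)

theory Defs
  imports "HOL-Analysis.Analysis" "HOL-Probability.Essential_Supremum"
begin

section \<open>Sobolev spaces\<close>

text \<open>
  Functions on an open set \<open>S\<close> are represented by total functions \<open>'a \<Rightarrow> real\<close>; their values
  outside \<open>S\<close> are irrelevant, and elements of $L^2(S)$ are identified only up to null sets.
  The coordinates of \<open>y\<close> are \<open>y \<bullet> i\<close> for \<open>i \<in> Basis\<close>, and the dimension is \<open>DIM('a)\<close>.
\<close>

definition L2_space :: "'a::euclidean_space set \<Rightarrow> ('a \<Rightarrow> real) set" where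
  "L2_space S = {f. f \<in> borel_measurable (lebesgue_on S) \<and> integrable (lebesgue_on S) (\<lambda>x. (f x)\<^sup>2)}"

definition L2_inner :: "'a::euclidean_space set \<Rightarrow> ('a \<Rightarrow> real) \<Rightarrow> ('a \<Rightarrow> real) \<Rightarrow> real" where
  "L2_inner S f g = (\<integral>x. f x * g x \<partial>(lebesgue_on S))"

definition L2_norm :: "'a::euclidean_space set \<Rightarrow> ('a \<Rightarrow> real) \<Rightarrow> real" where
  "L2_norm S f = sqrt (L2_inner S f f)"

text \<open>
  A multi-index of order \<open>m\<close> is given as the list of the \<open>m\<close> coordinate directions of
  differentiation, so mixed derivatives occur once for every order of differentiation.
  Thus the seminorm below is the $L^2$ norm of the full tensor of $m$-th derivatives.
\<close>

definition multi_indices :: "nat \<Rightarrow> 'a::euclidean_space list set" where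
  "multi_indices m = {\<alpha>. set \<alpha> \<subseteq> Basis \<and> length \<alpha> = m}"

definition iter_partial :: "'a::euclidean_space list \<Rightarrow> ('a \<Rightarrow> real) \<Rightarrow> 'a \<Rightarrow> real" where
  "iter_partial \<alpha> f = foldr (\<lambda>i g x. frechet_derivative g (at x) i) \<alpha> f"

definition smooth_fun :: "('a::euclidean_space \<Rightarrow> real) \<Rightarrow> bool" where
  "smooth_fun f \<longleftrightarrow> (\<forall>m. \<forall>\<alpha>\<in>multi_indices m. \<forall>x. iter_partial \<alpha> f differentiable (at x))"

definition test_functions :: "'a::euclidean_space set \<Rightarrow> ('a \<Rightarrow> real) set" where
  "test_functions S = {\<phi>. smooth_fun \<phi> \<and> compact (closure {x. \<phi> x \<noteq> 0}) \<and> closure {x. \<phi> x \<noteq> 0} \<subseteq> S}"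

definition is_weak_deriv ::
  "'a::euclidean_space set \<Rightarrow> 'a list \<Rightarrow> ('a \<Rightarrow> real) \<Rightarrow> ('a \<Rightarrow> real) \<Rightarrow> bool" where
  "is_weak_deriv S \<alpha> u g \<longleftrightarrow>
     (\<forall>\<phi>\<in>test_functions S. L2_inner S u (iter_partial \<alpha> \<phi>) = (-1) ^ length \<alpha> * L2_inner S g \<phi>)"

definition sobolev_space :: "'a::euclidean_space set \<Rightarrow> nat \<Rightarrow> ('a \<Rightarrow> real) set" where
  "sobolev_space S m =
     {u \<in> L2_space S. \<forall>k\<le>m. \<forall>\<alpha>\<in>multi_indices k. \<exists>g\<in>L2_space S. is_weak_deriv S \<alpha> u g}"

definition weak_deriv :: "'a::euclidean_space set \<Rightarrow> 'a list \<Rightarrow> ('a \<Rightarrow> real) \<Rightarrow> 'a \<Rightarrow> real" where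
  "weak_deriv S \<alpha> u = (SOME g. g \<in> L2_space S \<and> is_weak_deriv S \<alpha> u g)"

definition sobolev_seminorm :: "'a::euclidean_space set \<Rightarrow> nat \<Rightarrow> ('a \<Rightarrow> real) \<Rightarrow> real" where
  "sobolev_seminorm S m u = sqrt (\<Sum>\<alpha>\<in>multi_indices m. (L2_norm S (weak_deriv S \<alpha> u))\<^sup>2)"

definition sobolev_norm :: "'a::euclidean_space set \<Rightarrow> nat \<Rightarrow> ('a \<Rightarrow> real) \<Rightarrow> real" where
  "sobolev_norm S m u = sqrt (\<Sum>k\<le>m. (sobolev_seminorm S k u)\<^sup>2)"

text \<open>$H^m_0(S)$ is the closure of $C_c^\infty(S)$ in $H^m(S)$.\<close>

definition sobolev_space0 :: "'a::euclidean_space set \<Rightarrow> nat \<Rightarrow> ('a \<Rightarrow> real) set" where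
  "sobolev_space0 S m = {u \<in> sobolev_space S m. \<exists>\<phi>. (\<forall>k. \<phi> k \<in> test_functions S) \<and>
     (\<lambda>k. sobolev_norm S m (u - \<phi> k)) \<longlonglongrightarrow> 0}"


section \<open>The domain and its function spaces\<close>

abbreviation unit_cube :: "'a::euclidean_space set" where
  "unit_cube \<equiv> box 0 One"

abbreviation ip :: "('a::euclidean_space \<Rightarrow> real) \<Rightarrow> ('a \<Rightarrow> real) \<Rightarrow> real" where
  "ip \<equiv> L2_inner unit_cube"

abbreviation wd :: "'a::euclidean_space list \<Rightarrow> ('a \<Rightarrow> real) \<Rightarrow> 'a \<Rightarrow> real" where
  "wd \<equiv> weak_deriv unit_cube"

abbreviation V_space :: "('a::euclidean_space \<Rightarrow> real) set" where
  "V_space \<equiv> sobolev_space0 unit_cube 2"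

definition grad_inner :: "('a::euclidean_space \<Rightarrow> real) \<Rightarrow> ('a \<Rightarrow> real) \<Rightarrow> real" where
  "grad_inner u w = (\<Sum>i\<in>Basis. ip (wd [i] u) (wd [i] w))"

definition grad_norm :: "('a::euclidean_space \<Rightarrow> real) \<Rightarrow> real" where
  "grad_norm u = sqrt (grad_inner u u)"

definition laplacian :: "('a::euclidean_space \<Rightarrow> real) \<Rightarrow> 'a \<Rightarrow> real" where
  "laplacian u = (\<lambda>y. \<Sum>i\<in>Basis. wd [i, i] u y)"


section \<open>Functions of time with values in a function space\<close>

text \<open>
  \<open>X\<close> is a space of functions and \<open>N\<close> its norm. Strong (Bochner) measurability: almost
  everywhere limit, with respect to \<open>N\<close>, of \<open>X\<close>-valued simple functions.
\<close>

definition strongly_measurable ::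
  "real \<Rightarrow> ('a \<Rightarrow> real) set \<Rightarrow> (('a \<Rightarrow> real) \<Rightarrow> real) \<Rightarrow> (real \<Rightarrow> 'a \<Rightarrow> real) \<Rightarrow> bool" where
  "strongly_measurable T X N u \<longleftrightarrow>
     (AE t in lebesgue_on {0<..<T}. u t \<in> X) \<and>
     (\<exists>s. (\<forall>k. simple_function (lebesgue_on {0<..<T}) (s k) \<and> s k ` {0<..<T} \<subseteq> X) \<and>
          (AE t in lebesgue_on {0<..<T}. (\<lambda>k. N (u t - s k t)) \<longlonglongrightarrow> 0))"

definition Bochner_L2 ::
  "real \<Rightarrow> ('a \<Rightarrow> real) set \<Rightarrow> (('a \<Rightarrow> real) \<Rightarrow> real) \<Rightarrow> (real \<Rightarrow> 'a \<Rightarrow> real) set" where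
  "Bochner_L2 T X N =
     {u. strongly_measurable T X N u \<and> integrable (lebesgue_on {0<..<T}) (\<lambda>t. (N (u t))\<^sup>2)}"

definition Bochner_Linf ::
  "real \<Rightarrow> ('a \<Rightarrow> real) set \<Rightarrow> (('a \<Rightarrow> real) \<Rightarrow> real) \<Rightarrow> (real \<Rightarrow> 'a \<Rightarrow> real) set" where
  "Bochner_Linf T X N =
     {u. strongly_measurable T X N u \<and> (\<exists>B. AE t in lebesgue_on {0<..<T}. N (u t) \<le> B)}"

definition Bochner_L1loc ::
  "real \<Rightarrow> ('a \<Rightarrow> real) set \<Rightarrow> (('a \<Rightarrow> real) \<Rightarrow> real) \<Rightarrow> (real \<Rightarrow> 'a \<Rightarrow> real) set" where
  "Bochner_L1loc T X N =
     {u. strongly_measurable T X N u \<and>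
         (\<forall>a b. 0 < a \<and> b < T \<longrightarrow> integrable (lebesgue_on {a..b}) (\<lambda>t. N (u t)))}"

definition Linf_norm :: "real \<Rightarrow> (('a \<Rightarrow> real) \<Rightarrow> real) \<Rightarrow> (real \<Rightarrow> 'a \<Rightarrow> real) \<Rightarrow> ereal" where
  "Linf_norm T N u = esssup (lebesgue_on {0<..<T}) (\<lambda>t. ereal (N (u t)))"

text \<open>
  Time derivative in the sense of $L^2(\Omega)$-valued distributions on $(0,T)$: the identity
  $\int_0^T \varphi' u\,dt = -\int_0^T \varphi u'\,dt$ of Bochner integrals, read by pairing both
  sides with the elements $\psi$ of $L^2(\Omega)$.
\<close>

definition has_time_deriv ::
  "real \<Rightarrow> (real \<Rightarrow> 'a::euclidean_space \<Rightarrow> real) \<Rightarrow> (real \<Rightarrow> 'a \<Rightarrow> real) \<Rightarrow> bool" where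
  "has_time_deriv T u u' \<longleftrightarrow>
     u \<in> Bochner_L1loc T (L2_space unit_cube) (L2_norm unit_cube) \<and>
     u' \<in> Bochner_L1loc T (L2_space unit_cube) (L2_norm unit_cube) \<and>
     (\<forall>\<phi>\<in>test_functions {0<..<T}. \<forall>\<psi>\<in>L2_space unit_cube.
        (\<integral>t. deriv \<phi> t * ip (u t) \<psi> \<partial>(lebesgue_on {0<..<T})) =
        - (\<integral>t. \<phi> t * ip (u' t) \<psi> \<partial>(lebesgue_on {0<..<T})))"

definition L2_continuous :: "real \<Rightarrow> (real \<Rightarrow> 'a::euclidean_space \<Rightarrow> real) \<Rightarrow> bool" where
  "L2_continuous T u \<longleftrightarrow>
     (\<forall>t\<in>{0..<T}. u t \<in> L2_space unit_cube \<and>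
        ((\<lambda>s. L2_norm unit_cube (u s - u t)) \<longlongrightarrow> 0) (at t within {0..<T}))"


section \<open>The weak problem and its Galerkin approximation\<close>

definition coeff_b1 :: "real \<Rightarrow> (real \<Rightarrow> real) \<Rightarrow> real \<Rightarrow> real" where
  "coeff_b1 \<zeta>1 K t = \<zeta>1 / K t ^ 4"

definition coeff_b2 :: "(real \<Rightarrow> real) \<Rightarrow> real \<Rightarrow> real" where
  "coeff_b2 K t = 1 / K t ^ 4"

definition coeff_a1 ::
  "real \<Rightarrow> (real \<Rightarrow> real) \<Rightarrow> (real \<Rightarrow> real) \<Rightarrow> 'a::euclidean_space \<Rightarrow> 'a \<Rightarrow> real \<Rightarrow> real" where
  "coeff_a1 \<zeta>0 K K' i y t = 1 / (K t)\<^sup>2 * (\<zeta>0 - 4 * ((y \<bullet> i) * K' t)\<^sup>2)"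

definition coeff_a2 ::
  "(real \<Rightarrow> real) \<Rightarrow> (real \<Rightarrow> real) \<Rightarrow> 'a::euclidean_space \<Rightarrow> 'a \<Rightarrow> 'a \<Rightarrow> real \<Rightarrow> real" where
  "coeff_a2 K K' i j y t = 4 * (y \<bullet> i) * (y \<bullet> j) * (K' t / K t)\<^sup>2"

definition coeff_a3 ::
  "real \<Rightarrow> (real \<Rightarrow> real) \<Rightarrow> (real \<Rightarrow> real) \<Rightarrow> (real \<Rightarrow> real) \<Rightarrow>
   'a::euclidean_space \<Rightarrow> 'a \<Rightarrow> real \<Rightarrow> real" where
  "coeff_a3 \<nu> K K' K'' i y t =
     1 / (K t)\<^sup>2 * (2 * (y \<bullet> i) * (K' t)\<^sup>2 - (y \<bullet> i) * K t * (\<nu> * K' t + K'' t))"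

definition coeff_a4 ::
  "(real \<Rightarrow> real) \<Rightarrow> (real \<Rightarrow> real) \<Rightarrow> 'a::euclidean_space \<Rightarrow> 'a \<Rightarrow> real \<Rightarrow> real" where
  "coeff_a4 K K' i y t = - 2 * (y \<bullet> i) * (K' t / K t)"

definition coeff_a5 ::
  "real \<Rightarrow> (real \<Rightarrow> real) \<Rightarrow> (real \<Rightarrow> real) \<Rightarrow> (real \<Rightarrow> real) \<Rightarrow>
   'a::euclidean_space \<Rightarrow> 'a \<Rightarrow> real \<Rightarrow> real" where
  "coeff_a5 \<nu> K K' K'' i y t = coeff_a3 \<nu> K K' K'' i y t + 2 * (K' t / K t) * coeff_a4 K K' i y t"

definition beam_form ::
  "real \<Rightarrow> real \<Rightarrow> real \<Rightarrow> (real \<Rightarrow> real) \<Rightarrow> (real \<Rightarrow> real) \<Rightarrow> (real \<Rightarrow> real) \<Rightarrow> real \<Rightarrow>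
   ('a::euclidean_space \<Rightarrow> real) \<Rightarrow> ('a \<Rightarrow> real) \<Rightarrow> ('a \<Rightarrow> real) \<Rightarrow> ('a \<Rightarrow> real) \<Rightarrow> real" where
  "beam_form \<nu> \<zeta>0 \<zeta>1 K K' K'' t u u' u'' w =
     ip u'' w
     + coeff_b1 \<zeta>1 K t * (grad_norm u)\<^sup>2 * grad_inner u w
     + coeff_b2 K t * ip (laplacian u) (laplacian w)
     + \<nu> * ip u' w
     + (\<Sum>i\<in>Basis. ip (\<lambda>y. coeff_a1 \<zeta>0 K K' i y t * wd [i] u y) (wd [i] w))
     + (\<Sum>i\<in>Basis. \<Sum>j\<in>Basis. ip (\<lambda>y. coeff_a2 K K' i j y t * wd [i, j] u y) w)
     + (\<Sum>i\<in>Basis. ip (\<lambda>y. coeff_a4 K K' i y t * wd [i] u' y) w)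
     + (\<Sum>i\<in>Basis. ip (\<lambda>y. coeff_a5 \<nu> K K' K'' i y t * wd [i] u y) w)"

text \<open>
  \<open>X\<close> is the space of both the values of \<open>u\<close> and the test functions: the weak problem is the
  case \<open>X = V_space\<close>, the semi-discrete problem the case where \<open>X\<close> is the finite element space.
  Time derivatives are determined only almost everywhere; \<open>u\<close> and \<open>u'\<close> are the continuous
  representatives, for which the initial conditions make sense. The condition on \<open>u' t\<close> and
  \<open>u'' t\<close> says that the terms of the equation are defined.
\<close>

definition beam_solution ::
  "real \<Rightarrow> real \<Rightarrow> real \<Rightarrow> real \<Rightarrow> (real \<Rightarrow> real) \<Rightarrow> (real \<Rightarrow> real) \<Rightarrow> (real \<Rightarrow> real) \<Rightarrow>
   ('a::euclidean_space \<Rightarrow> real) set \<Rightarrow> ('a \<Rightarrow> real) \<Rightarrow> ('a \<Rightarrow> real) \<Rightarrow>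
   (real \<Rightarrow> 'a \<Rightarrow> real) \<Rightarrow> (real \<Rightarrow> 'a \<Rightarrow> real) \<Rightarrow> (real \<Rightarrow> 'a \<Rightarrow> real) \<Rightarrow> bool" where
  "beam_solution T \<nu> \<zeta>0 \<zeta>1 K K' K'' X u0 u1 u u' u'' \<longleftrightarrow>
     (\<forall>t\<in>{0..<T}. u t \<in> X) \<and>
     L2_continuous T u \<and> L2_continuous T u' \<and>
     has_time_deriv T u u' \<and> has_time_deriv T u' u'' \<and>
     (\<forall>t\<in>{0<..<T}. u' t \<in> sobolev_space unit_cube 1 \<and> u'' t \<in> L2_space unit_cube) \<and>
     (\<forall>t\<in>{0<..<T}. \<forall>w\<in>X. beam_form \<nu> \<zeta>0 \<zeta>1 K K' K'' t (u t) (u' t) (u'' t) w = 0) \<and>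
     (AE y in lebesgue_on unit_cube. u 0 y = u0 y) \<and>
     (AE y in lebesgue_on unit_cube. u' 0 y = u1 y)"

definition ritz_form ::
  "real \<Rightarrow> real \<Rightarrow> (real \<Rightarrow> real) \<Rightarrow> (real \<Rightarrow> real) \<Rightarrow> (real \<Rightarrow> 'a::euclidean_space \<Rightarrow> real) \<Rightarrow> real \<Rightarrow>
   ('a \<Rightarrow> real) \<Rightarrow> ('a \<Rightarrow> real) \<Rightarrow> real" where
  "ritz_form \<zeta>0 \<zeta>1 K K' \<theta> t \<phi> w =
     (\<Sum>i\<in>Basis. ip (\<lambda>y. coeff_a1 \<zeta>0 K K' i y t * wd [i] \<phi> y) (wd [i] w))
     + coeff_b1 \<zeta>1 K t * (grad_norm (\<theta> t))\<^sup>2 * grad_inner \<phi> w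
     + coeff_b2 K t * ip (laplacian \<phi>) (laplacian w)"

definition ritz_projection ::
  "real \<Rightarrow> real \<Rightarrow> (real \<Rightarrow> real) \<Rightarrow> (real \<Rightarrow> real) \<Rightarrow> (real \<Rightarrow> 'a::euclidean_space \<Rightarrow> real) \<Rightarrow> real \<Rightarrow>
   ('a \<Rightarrow> real) set \<Rightarrow> ('a \<Rightarrow> real) \<Rightarrow> 'a \<Rightarrow> real" where
  "ritz_projection \<zeta>0 \<zeta>1 K K' \<theta> t Vh \<phi> =
     (SOME r. r \<in> Vh \<and> (\<forall>w\<in>Vh. ritz_form \<zeta>0 \<zeta>1 K K' \<theta> t (\<phi> - r) w = 0))"


section \<open>Finite element spaces\<close>

definition polytopal_partition :: "'a::euclidean_space set set \<Rightarrow> bool" where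
  "polytopal_partition \<T> \<longleftrightarrow>
     finite \<T> \<and> (\<forall>E\<in>\<T>. polytope E \<and> interior E \<noteq> {}) \<and>
     pairwise (\<lambda>E F. interior E \<inter> interior F = {}) \<T> \<and> \<Union>\<T> = closure unit_cube"

definition mesh_size :: "'a::euclidean_space set set \<Rightarrow> real" where
  "mesh_size \<T> = Max (diameter ` \<T>)"

text \<open>
  The angles of an element are those between two edges with a common vertex; in the plane
  these are the interior angles of the polygon.
\<close>

definition angles_ge :: "real \<Rightarrow> 'a::euclidean_space set \<Rightarrow> bool" where
  "angles_ge \<theta> E \<longleftrightarrow>
     (\<forall>x y z. closed_segment x y edge_of E \<and> closed_segment x z edge_of E \<and> y \<noteq> z \<longrightarrow>
        \<theta> \<le> arccos (((y - x) \<bullet> (z - x)) / (norm (y - x) * norm (z - x))))"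

definition min_angle_condition :: "'a::euclidean_space set set set \<Rightarrow> bool" where
  "min_angle_condition \<FF> \<longleftrightarrow> (\<exists>\<theta>>0. \<forall>\<T>\<in>\<FF>. \<forall>E\<in>\<T>. angles_ge \<theta> E)"

text \<open>Polynomial functions of total degree at most \<open>l\<close>.\<close>

definition polynomials_le :: "nat \<Rightarrow> ('a::euclidean_space \<Rightarrow> real) set" where
  "polynomials_le l =
     {p. \<exists>c. p = (\<lambda>y. \<Sum>\<alpha> | (\<forall>i. i \<notin> Basis \<longrightarrow> \<alpha> i = 0) \<and> sum \<alpha> Basis \<le> l.
                   c \<alpha> * (\<Prod>i\<in>Basis. (y \<bullet> i) ^ \<alpha> i))}"

definition C1_on :: "'a::euclidean_space set \<Rightarrow> ('a \<Rightarrow> real) \<Rightarrow> bool" where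
  "C1_on S f \<longleftrightarrow> (\<forall>x\<in>S. f differentiable (at x)) \<and>
     (\<forall>i\<in>Basis. continuous_on S (\<lambda>x. frechet_derivative f (at x) i))"

definition fe_space :: "'a::euclidean_space set set \<Rightarrow> ('a \<Rightarrow> real) set" where
  "fe_space \<T> = {w \<in> V_space. C1_on unit_cube w \<and>
     (\<forall>E\<in>\<T>. \<exists>p\<in>polynomials_le 3. \<forall>y\<in>E \<inter> unit_cube. w y = p y)}"

definition broken_seminorm :: "'a::euclidean_space set set \<Rightarrow> nat \<Rightarrow> ('a \<Rightarrow> real) \<Rightarrow> real" where
  "broken_seminorm \<T> m u = sqrt (\<Sum>E\<in>\<T>. (sobolev_seminorm (interior E) m u)\<^sup>2)"

text \<open>\<open>\<T> h\<close> is the partition of mesh size \<open>h\<close>, where \<open>h\<close> ranges over the index set \<open>H\<close>.\<close>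

definition approximation_property ::
  "real \<Rightarrow> real set \<Rightarrow> (real \<Rightarrow> 'a::euclidean_space set set) \<Rightarrow> bool" where
  "approximation_property T H \<T> \<longleftrightarrow>
     (\<exists>C1. \<forall>h\<in>H. \<forall>w :: real \<Rightarrow> 'a \<Rightarrow> real.
        (\<forall>t\<in>{0<..<T}. w t \<in> sobolev_space unit_cube 4 \<inter> V_space) \<longrightarrow>
        (\<exists>wh :: real \<Rightarrow> 'a \<Rightarrow> real. \<forall>t\<in>{0<..<T}. wh t \<in> fe_space (\<T> h) \<and>
           (\<forall>m\<le>2. sobolev_seminorm unit_cube m (w t - wh t)
                     \<le> C1 * h ^ (4 - m) * sobolev_seminorm unit_cube 4 (w t)) \<and>
           broken_seminorm (\<T> h) 3 (w t - wh t)
             \<le> C1 * h * sobolev_seminorm unit_cube 4 (w t)))"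

end

theory Submission
  imports Defs
begin

text \<open>
  The error is split by the projection \<open>P\<close> onto \<open>V\<^sub>h\<close> that is orthogonal for the form
  \<open>(\<Delta>u, \<Delta>w)\<close>, rather than by the Ritz projection: \<open>P\<close> does not depend on time, so it commutes
  with time derivatives, and \<open>\<Delta>(v - Pv)\<close> is of order \<open>h\<^sup>2\<close> together with its time derivatives.
  The rest \<open>\<theta> = Pv - v\<^sub>h\<close> lies in \<open>V\<^sub>h\<close> and may be used as a test function; the energy
  \<open>\<bar>\<theta>'\<bar>\<^sup>2/2 + b\<^sub>2 \<bar>\<Delta>\<theta>\<bar>\<^sup>2/2\<close> satisfies a Gronwall inequality with a right-hand side of order \<open>h\<^sup>4\<close>.
  In it the damping term, the term with \<open>b\<^sub>2'\<close> and the term with \<open>\<nabla>v'\<close> have a favourable sign,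
  up to the contribution of \<open>v - Pv\<close>, since \<open>K' > 0\<close>. All terms of second order in \<open>v\<close> other than the biharmonic one are
  integrated by parts onto \<open>v\<close> and bounded by \<open>\<bar>\<Delta>v\<bar>\<close>. The nonlocal term is Lipschitz on bounded
  sets, and \<open>\<Delta>v\<^sub>h\<close> is bounded uniformly in \<open>h\<close> by the energy estimate for \<open>v\<^sub>h\<close>, whose energy
  contains \<open>b\<^sub>1 \<bar>\<nabla>v\<^sub>h\<bar>\<^sup>4/4\<close>. The Ritz projection enters through the initial data only, where
  Cea's lemma compares it with the interpolant.

  Derivatives in time are never taken strongly: \<open>v'\<close> is paired with fixed elements of \<open>L\<^sup>2\<close>, which
  gives absolutely continuous functions, and the estimates are integral inequalities.
\<close>

section \<open>Square integrable functions modulo null sets\<close>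

text \<open>The data place \<open>v'\<close> and \<open>v''\<close> in H^4 for almost every time but
  do not state their boundary values. To project them, \<open>v' t\<close> must lie in V; this is
  extracted from the difference quotients of \<open>v\<close>, which do lie in V
  (\<open>x'_in_VV\<close>), and then once more for \<open>v''\<close>. As the result holds for
  almost all times only, the energy uses a continuous representative of the projected
  \<open>v'\<close>, built as an integral. The constants rest on two identities, valid in every
  dimension: (y_i d_i x, x) = -|x|^2/2 for x in V, which yields a Poincare inequality with factor 2
  and the sign of the term with \<open>a4\<close>, and the equality of the norms of Hessian and
  Laplacian, which bounds each second derivative by \<open>lap\<close>. Everything is measured in
  units of h^2: approximation of H^4 functions gives h^2 for the Laplacian, and the order h^4 of the
  initial velocity is reduced to h^2 by the boundedness of the mesh size. The condition linking
  \<open>K'\<close> and \<open>\<zeta>0\<close> makes the Ritz form coercive at time 0.\<close>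

abbreviation cube_measure :: "'a::euclidean_space measure" where
  "cube_measure \<equiv> lebesgue_on unit_cube"

lemma finite_measure_cube: "finite_measure (cube_measure :: 'a::euclidean_space measure)"
  by (rule finite_measure_lebesgue_on) (simp add: lmeasurable_box)

lemma L2_spaceD:
  assumes "f \<in> L2_space S"
  shows "f \<in> borel_measurable (lebesgue_on S)" "integrable (lebesgue_on S) (\<lambda>x. (f x)\<^sup>2)"
  using assms by (auto simp: L2_space_def)

lemma L2_mult_integrable:
  assumes "f \<in> L2_space S" "g \<in> L2_space S"
  shows "integrable (lebesgue_on S) (\<lambda>x. f x * g x)"
proof (rule Bochner_Integration.integrable_bound[where f="\<lambda>x. (f x)\<^sup>2 + (g x)\<^sup>2"])
  note [measurable] = L2_spaceD(1)[OF assms(1)] L2_spaceD(1)[OF assms(2)]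
  show "integrable (lebesgue_on S) (\<lambda>x. (f x)\<^sup>2 + (g x)\<^sup>2)"
    using assms by (simp add: L2_spaceD)
  show "(\<lambda>x. f x * g x) \<in> borel_measurable (lebesgue_on S)" by measurable
  have "\<bar>a * b\<bar> \<le> a\<^sup>2 + b\<^sup>2" for a b :: real
  proof -
    have "0 \<le> \<bar>a\<bar> * \<bar>b\<bar>" by simp
    then show ?thesis using sum_squares_bound[of "\<bar>a\<bar>" "\<bar>b\<bar>"]
      unfolding abs_mult power2_abs by linarith
  qed
  then show "AE x in lebesgue_on S. norm (f x * g x) \<le> norm ((f x)\<^sup>2 + (g x)\<^sup>2)"
    by (simp add: abs_of_nonneg)
qed

lemma L2_space_zero: "(\<lambda>x. 0) \<in> L2_space S"
  by (simp add: L2_space_def)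

lemma L2_space_add:
  assumes "f \<in> L2_space S" "g \<in> L2_space S"
  shows "(\<lambda>x. f x + g x) \<in> L2_space S"
proof -
  note [measurable] = L2_spaceD(1)[OF assms(1)] L2_spaceD(1)[OF assms(2)]
  have "integrable (lebesgue_on S) (\<lambda>x. (f x)\<^sup>2 + 2 * (f x * g x) + (g x)\<^sup>2)"
    using assms by (simp add: L2_spaceD L2_mult_integrable)
  then show ?thesis
    by (simp add: L2_space_def power2_sum algebra_simps)
qed

lemma L2_space_mult_bounded:
  assumes "f \<in> L2_space S" and [measurable]: "a \<in> borel_measurable (lebesgue_on S)"
    and a: "\<And>x. x \<in> S \<Longrightarrow> \<bar>a x\<bar> \<le> B" and S: "S \<in> sets lebesgue"
  shows "(\<lambda>x. a x * f x) \<in> L2_space S"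
proof -
  note [measurable] = L2_spaceD(1)[OF assms(1)]
  have "integrable (lebesgue_on S) (\<lambda>x. (a x * f x)\<^sup>2)"
  proof (rule Bochner_Integration.integrable_bound[where f="\<lambda>x. B\<^sup>2 * (f x)\<^sup>2"])
    show "integrable (lebesgue_on S) (\<lambda>x. B\<^sup>2 * (f x)\<^sup>2)" using assms by (simp add: L2_spaceD)
    have "(a x)\<^sup>2 \<le> B\<^sup>2" if "x \<in> S" for x
      using a[OF that] by (metis abs_ge_zero order_trans power2_abs power_mono)
    then show "AE x in lebesgue_on S. norm ((a x * f x)\<^sup>2) \<le> norm (B\<^sup>2 * (f x)\<^sup>2)"
      using S by (intro AE_I2) (auto simp: power_mult_distrib intro!: mult_right_mono)
  qed measurable
  then show ?thesis by (simp add: L2_space_def)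
qed

lemma L2_space_scale:
  assumes "f \<in> L2_space S" shows "(\<lambda>x. c * f x) \<in> L2_space S"
  using assms by (auto simp: L2_space_def power_mult_distrib)

lemma L2_space_diff:
  assumes "f \<in> L2_space S" "g \<in> L2_space S"
  shows "(\<lambda>x. f x - g x) \<in> L2_space S"
  using L2_space_add[OF assms(1) L2_space_scale[OF assms(2), of "-1"]] by simp

lemma L2_space_sum:
  assumes "\<And>i. i \<in> I \<Longrightarrow> f i \<in> L2_space S"
  shows "(\<lambda>x. \<Sum>i\<in>I. f i x) \<in> L2_space S"
  using assms by (induction I rule: infinite_finite_induct) (auto intro: L2_space_zero L2_space_add)

text \<open>Reflexive exactly on the square integrable functions, so the quotient consists of
  classes modulo null sets, on which the inner product is definite. For \<open>f\<close> outside
  \<open>L2_space\<close> the value \<open>cls f\<close> carries no information, hence the many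
  membership conditions below.\<close>

definition l2rel :: "('a::euclidean_space \<Rightarrow> real) \<Rightarrow> ('a \<Rightarrow> real) \<Rightarrow> bool" where
  "l2rel f g \<longleftrightarrow> f \<in> L2_space unit_cube \<and> g \<in> L2_space unit_cube \<and>
     (AE x in cube_measure. f x = g x)"

quotient_type (overloaded) 'a l2 = "'a::euclidean_space \<Rightarrow> real" / partial: l2rel
proof (rule part_equivpI)
  show "\<exists>x. l2rel x (x :: 'a \<Rightarrow> real)"
    by (rule exI[of _ "\<lambda>_. 0"]) (simp add: l2rel_def L2_space_zero)
  show "symp (l2rel :: ('a \<Rightarrow> real) \<Rightarrow> _)"
    by (auto intro!: sympI simp: l2rel_def eq_commute)
  show "transp (l2rel :: ('a \<Rightarrow> real) \<Rightarrow> _)"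
  proof (rule transpI)
    fix f g h :: "'a \<Rightarrow> real" assume "l2rel f g" "l2rel g h"
    then show "l2rel f h" unfolding l2rel_def by (auto elim: AE_mp)
  qed
qed

lemma ip_cong_AE:
  assumes "l2rel f f'" "l2rel g g'" shows "ip f g = ip f' g'"
proof -
  note [measurable] = assms[unfolded l2rel_def, THEN conjunct1, THEN L2_spaceD(1)]
    assms[unfolded l2rel_def, THEN conjunct2, THEN conjunct1, THEN L2_spaceD(1)]
  have "AE x in cube_measure. f x * g x = f' x * g' x"
    using assms unfolding l2rel_def by auto
  then show ?thesis unfolding L2_inner_def
    by (intro integral_cong_AE) measurable
qed

instantiation l2 :: (euclidean_space) real_vector
begin

lift_definition zero_l2 :: "'a l2" is "\<lambda>x. 0"
  by (simp add: l2rel_def L2_space_zero)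

lift_definition plus_l2 :: "'a l2 \<Rightarrow> 'a l2 \<Rightarrow> 'a l2" is "\<lambda>f g x. f x + g x"
  by (auto simp: l2rel_def L2_space_add)

lift_definition scaleR_l2 :: "real \<Rightarrow> 'a l2 \<Rightarrow> 'a l2" is "\<lambda>c f x. c * f x"
  by (auto simp: l2rel_def L2_space_scale)

lift_definition minus_l2 :: "'a l2 \<Rightarrow> 'a l2 \<Rightarrow> 'a l2" is "\<lambda>f g x. f x - g x"
  by (auto simp: l2rel_def L2_space_diff)

lift_definition uminus_l2 :: "'a l2 \<Rightarrow> 'a l2" is "\<lambda>f x. - f x"
  by (auto simp: l2rel_def dest: L2_space_scale[of _ _ "-1"])

instance
proof
  fix x y z :: "'a l2" and a b :: real
  show "x + y + z = x + (y + z)"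
    by transfer (auto simp: l2rel_def add.assoc intro!: L2_space_add)
  show "x + y = y + x"
    by transfer (auto simp: l2rel_def add.commute intro!: L2_space_add)
  show "0 + x = x"
    by transfer (auto simp: l2rel_def)
  show "- x + x = 0"
    by transfer (auto simp: l2rel_def L2_space_zero)
  show "x - y = x + - y"
    by transfer (auto simp: l2rel_def intro!: L2_space_diff)
  show "a *\<^sub>R (x + y) = a *\<^sub>R x + a *\<^sub>R y"
    by transfer (auto simp: l2rel_def algebra_simps intro!: L2_space_add L2_space_scale)
  show "(a + b) *\<^sub>R x = a *\<^sub>R x + b *\<^sub>R x"
    by transfer (auto simp: l2rel_def algebra_simps intro!: L2_space_add L2_space_scale)
  show "a *\<^sub>R b *\<^sub>R x = (a * b) *\<^sub>R x"
    by transfer (auto simp: l2rel_def mult.assoc intro!: L2_space_scale)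
  show "1 *\<^sub>R x = x"
    by transfer (auto simp: l2rel_def)
qed

end

instantiation l2 :: (euclidean_space) real_inner
begin

lift_definition inner_l2 :: "'a l2 \<Rightarrow> 'a l2 \<Rightarrow> real" is ip
  by (rule ip_cong_AE)

definition norm_l2 :: "'a l2 \<Rightarrow> real" where "norm_l2 x = sqrt (inner x x)"
definition dist_l2 :: "'a l2 \<Rightarrow> 'a l2 \<Rightarrow> real" where "dist_l2 x y = norm (x - y)"
definition sgn_l2 :: "'a l2 \<Rightarrow> 'a l2" where "sgn_l2 x = x /\<^sub>R norm x"
definition uniformity_l2 :: "('a l2 \<times> 'a l2) filter" where
  "uniformity_l2 = (INF e\<in>{0<..}. principal {(x, y). dist x y < e})"
definition open_l2 :: "'a l2 set \<Rightarrow> bool" where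
  "open_l2 U = (\<forall>x\<in>U. eventually (\<lambda>(x', y). x' = x \<longrightarrow> y \<in> U) uniformity)"

instance
proof
  fix x y z :: "'a l2" and a b :: real
  show "dist x y = norm (x - y)" by (rule dist_l2_def)
  show "sgn x = x /\<^sub>R norm x" by (rule sgn_l2_def)
  show "uniformity = (INF e\<in>{0<..}. principal {(x :: 'a l2, y). dist x y < e})"
    by (rule uniformity_l2_def)
  show "open U = (\<forall>x\<in>U. eventually (\<lambda>(x', y). x' = x \<longrightarrow> y \<in> U) uniformity)" for U :: "'a l2 set"
    by (rule open_l2_def)
  show "inner x y = inner y x"
    by transfer (simp add: L2_inner_def mult.commute)
  show "inner (x + y) z = inner x z + inner y z"
    by transfer (auto simp: l2rel_def L2_inner_def algebra_simps L2_mult_integrable)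
  show "inner (a *\<^sub>R x) y = a * inner x y"
    by transfer (auto simp: l2rel_def L2_inner_def algebra_simps)
  show "0 \<le> inner x x"
    by transfer (auto simp: L2_inner_def)
  show "(inner x x = 0) = (x = 0)"
  proof transfer
    fix f :: "'a \<Rightarrow> real" assume "l2rel f f"
    then have f: "f \<in> L2_space unit_cube" by (simp add: l2rel_def)
    have "ip f f = 0 \<longleftrightarrow> (AE x in cube_measure. f x * f x = 0)"
      unfolding L2_inner_def by (rule integral_nonneg_eq_0_iff_AE) (auto simp: L2_mult_integrable f)
    then show "(ip f f = 0) = l2rel f (\<lambda>x. 0)"
      by (auto simp: l2rel_def f L2_space_zero)
  qed
  show "norm x = sqrt (inner x x)" by (rule norm_l2_def)
qed

end

abbreviation "cls \<equiv> abs_l2"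

lemma rep_l2_mem: "rep_l2 x \<in> L2_space unit_cube"
  using Quotient_rep_reflp[OF Quotient_l2, of x] by (simp add: l2rel_def)

lemma cls_rep: "cls (rep_l2 x) = x"
  using Quotient_l2 by (rule Quotient_abs_rep)

lemma cls_eq_iff:
  assumes "f \<in> L2_space unit_cube" "g \<in> L2_space unit_cube"
  shows "cls f = cls g \<longleftrightarrow> (AE x in cube_measure. f x = g x)"
  using assms Quotient3_rel[OF Quotient3_l2, of f g] by (simp add: l2rel_def)

lemma inner_cls:
  assumes "f \<in> L2_space unit_cube" "g \<in> L2_space unit_cube"
  shows "inner (cls f) (cls g) = ip f g"
  using assms by (subst inner_l2.abs_eq) (auto simp: l2rel_def)

lemma cls_add:
  assumes "f \<in> L2_space unit_cube" "g \<in> L2_space unit_cube"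
  shows "cls (\<lambda>x. f x + g x) = cls f + cls g"
  using assms by (subst plus_l2.abs_eq) (auto simp: l2rel_def)

lemma cls_diff:
  assumes "f \<in> L2_space unit_cube" "g \<in> L2_space unit_cube"
  shows "cls (\<lambda>x. f x - g x) = cls f - cls g"
  using assms by (subst minus_l2.abs_eq) (auto simp: l2rel_def)

lemma cls_scale:
  assumes "f \<in> L2_space unit_cube"
  shows "cls (\<lambda>x. c * f x) = c *\<^sub>R cls f"
  using assms by (subst scaleR_l2.abs_eq) (auto simp: l2rel_def)

lemma cls_zero: "cls (\<lambda>x. 0) = 0"
  by (simp add: zero_l2.abs_eq)

lemma cls_sum:
  assumes "\<And>i. i \<in> I \<Longrightarrow> f i \<in> L2_space unit_cube"
  shows "cls (\<lambda>x. \<Sum>i\<in>I. f i x) = (\<Sum>i\<in>I. cls (f i))"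
  using assms
  by (induction I rule: infinite_finite_induct) (auto simp: cls_zero cls_add L2_space_sum)

lemma norm_cls: "f \<in> L2_space unit_cube \<Longrightarrow> norm (cls f) = L2_norm unit_cube f"
  by (simp add: norm_eq_sqrt_inner inner_cls L2_norm_def)

text \<open>At a fixed time the coefficients of the equation are polynomials in the coordinates, so
  this bounded self-adjoint operator together with \<open>dx\<close> suffices to write every term on
  classes.\<close>

definition coord_mult :: "'a::euclidean_space \<Rightarrow> 'a l2 \<Rightarrow> 'a l2" where
  "coord_mult i x = cls (\<lambda>y. (y \<bullet> i) * rep_l2 x y)"

lemma cube_coord_bounds:
  assumes "y \<in> unit_cube" "i \<in> Basis" shows "0 < y \<bullet> i" "y \<bullet> i < 1"
  using assms by (auto simp: mem_box)

lemma L2_space_coord_mult: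
  assumes "i \<in> Basis" "f \<in> L2_space unit_cube"
  shows "(\<lambda>y. (y \<bullet> i) * f y) \<in> L2_space unit_cube"
proof (rule L2_space_mult_bounded[OF assms(2), where B=1])
  show "(\<lambda>y. y \<bullet> i) \<in> borel_measurable (lebesgue_on unit_cube)"
    by (intro continuous_imp_measurable_on_sets_lebesgue continuous_intros) auto
  fix y :: 'a assume "y \<in> unit_cube"
  then show "\<bar>y \<bullet> i\<bar> \<le> 1"
    using cube_coord_bounds[of y i] assms(1) by auto
qed auto

lemma coord_mult_cls:
  assumes "i \<in> Basis" "f \<in> L2_space unit_cube"
  shows "coord_mult i (cls f) = cls (\<lambda>y. (y \<bullet> i) * f y)"
proof -
  have "AE x in cube_measure. rep_l2 (cls f) x = f x"
    using cls_eq_iff[OF rep_l2_mem assms(2), of "cls f"] cls_rep by auto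
  then show ?thesis unfolding coord_mult_def
    by (subst cls_eq_iff) (auto intro!: L2_space_coord_mult assms rep_l2_mem)
qed

lemma l2_cases: obtains f where "f \<in> L2_space unit_cube" "x = cls f"
  by (metis cls_rep rep_l2_mem)

lemma coord_mult_add: "i \<in> Basis \<Longrightarrow> coord_mult i (x + y) = coord_mult i x + coord_mult i y"
proof -
  assume i: "i \<in> Basis"
  obtain f g where f: "f \<in> L2_space unit_cube" "x = cls f" and g: "g \<in> L2_space unit_cube" "y = cls g"
    by (metis l2_cases)
  show ?thesis unfolding f g
    by (simp add: f g i coord_mult_cls L2_space_add L2_space_coord_mult distrib_left flip: cls_add)
qed

lemma coord_mult_scale: "i \<in> Basis \<Longrightarrow> coord_mult i (c *\<^sub>R x) = c *\<^sub>R coord_mult i x"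
proof -
  assume i: "i \<in> Basis"
  obtain f where f: "f \<in> L2_space unit_cube" "x = cls f" by (metis l2_cases)
  show ?thesis unfolding f
    by (simp add: f i coord_mult_cls L2_space_scale L2_space_coord_mult mult.left_commute flip: cls_scale)
qed

lemma norm_coord_mult:
  assumes i: "i \<in> Basis" shows "norm (coord_mult i x) \<le> norm x"
proof -
  obtain f where f: "f \<in> L2_space unit_cube" "x = cls f" by (metis l2_cases)
  have "ip (\<lambda>y. (y \<bullet> i) * f y) (\<lambda>y. (y \<bullet> i) * f y) \<le> ip f f"
    unfolding L2_inner_def
  proof (rule integral_mono)
    fix y :: 'a assume "y \<in> space cube_measure"
    then have y: "y \<in> unit_cube" by simp
    have "(y \<bullet> i) * (y \<bullet> i) \<le> 1 * 1"
      by (intro mult_mono) (use cube_coord_bounds[OF y i] in auto)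
    then have "(y \<bullet> i) * (y \<bullet> i) * (f y * f y) \<le> 1 * (f y * f y)"
      by (intro mult_right_mono) auto
    then show "(y \<bullet> i) * f y * ((y \<bullet> i) * f y) \<le> f y * f y"
      by (simp add: algebra_simps)
  qed (auto intro!: L2_mult_integrable L2_space_coord_mult f i)
  then show ?thesis unfolding f(2)
    by (simp add: coord_mult_cls f i norm_eq_sqrt_inner inner_cls L2_space_coord_mult)
qed

lemma bounded_linear_coord_mult: "i \<in> Basis \<Longrightarrow> bounded_linear (coord_mult i)"
  by (intro bounded_linear_intro[where K=1])
     (auto simp: coord_mult_add coord_mult_scale norm_coord_mult)

lemma inner_coord_mult:
  assumes i: "i \<in> Basis" shows "inner (coord_mult i x) y = inner x (coord_mult i y)"
proof -
  obtain f g where f: "f \<in> L2_space unit_cube" "x = cls f" and g: "g \<in> L2_space unit_cube" "y = cls g"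
    by (metis l2_cases)
  show ?thesis unfolding f g
    by (simp add: f g i coord_mult_cls inner_cls L2_space_coord_mult) (simp add: L2_inner_def algebra_simps)
qed

section \<open>Smooth functions and integration by parts\<close>

abbreviation partial :: "'a::euclidean_space \<Rightarrow> ('a \<Rightarrow> real) \<Rightarrow> 'a \<Rightarrow> real" where
  "partial i f \<equiv> (\<lambda>x. frechet_derivative f (at x) i)"

lemma iter_partial_Nil [simp]: "iter_partial [] f = f"
  and iter_partial_Cons [simp]: "iter_partial (i # \<alpha>) f = partial i (iter_partial \<alpha> f)"
  and iter_partial_append: "iter_partial (\<alpha> @ \<beta>) f = iter_partial \<alpha> (iter_partial \<beta> f)"
  by (simp_all add: iter_partial_def)

text \<open>A class of differentiable functions that is closed under partial derivatives contains
  all iterated partials of its members. Smoothness is thus shown by finding a closed class, without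
  a formula for higher derivatives.\<close>

lemma smooth_fun_coinduct:
  assumes "f \<in> F"
    and "\<And>g x. g \<in> F \<Longrightarrow> g differentiable (at x)"
    and "\<And>g i. g \<in> F \<Longrightarrow> i \<in> Basis \<Longrightarrow> partial i g \<in> F"
  shows "smooth_fun f"
proof -
  have "iter_partial \<alpha> f \<in> F" if "set \<alpha> \<subseteq> Basis" for \<alpha>
    using that by (induction \<alpha>) (auto simp: assms)
  then show ?thesis
    using assms(2) by (auto simp: smooth_fun_def multi_indices_def)
qed

lemma smooth_fun_differentiable: "smooth_fun f \<Longrightarrow> f differentiable (at x)"
  unfolding smooth_fun_def multi_indices_def
  by (drule spec[of _ 0]) auto

lemma smooth_fun_partial:
  assumes "smooth_fun f" "i \<in> Basis" shows "smooth_fun (partial i f)"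
  unfolding smooth_fun_def
proof (intro allI ballI)
  fix m x and \<alpha> :: "'a list" assume "\<alpha> \<in> multi_indices m"
  then have "\<alpha> @ [i] \<in> multi_indices (Suc m)"
    using assms by (auto simp: multi_indices_def)
  then have "iter_partial (\<alpha> @ [i]) f differentiable (at x)"
    using assms unfolding smooth_fun_def by blast
  then show "iter_partial \<alpha> (partial i f) differentiable (at x)"
    by (simp add: iter_partial_append)
qed

lemma smooth_fun_iter_partial:
  assumes "smooth_fun f" "set \<alpha> \<subseteq> Basis" shows "smooth_fun (iter_partial \<alpha> f)"
  using assms by (induction \<alpha>) (auto simp: smooth_fun_partial)

lemma smooth_fun_continuous_on: "smooth_fun f \<Longrightarrow> continuous_on A f"
  by (meson continuous_at_imp_continuous_on differentiable_imp_continuous_within smooth_fun_differentiable)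

lemma partial_eq:
  "(f has_derivative D) (at x) \<Longrightarrow> partial i f x = D i"
  using frechet_derivative_at by metis

lemma partial_add:
  assumes "f differentiable (at x)" "g differentiable (at x)"
  shows "partial i (\<lambda>y. f y + g y) x = partial i f x + partial i g x"
  using assms by (intro partial_eq) (auto intro!: derivative_eq_intros simp: frechet_derivative_works)

lemma partial_mult:
  assumes "f differentiable (at x)" "g differentiable (at x)"
  shows "partial i (\<lambda>y. f y * g y) x = f x * partial i g x + partial i f x * g x"
  using assms by (intro partial_eq) (auto intro!: derivative_eq_intros simp: frechet_derivative_works)

text \<open>By the sum and Leibniz rules the algebra generated by the smooth functions is closed
  under partial derivatives, which is what \<open>smooth_fun_coinduct\<close> asks for.\<close>

inductive_set smooth_closure :: "('a::euclidean_space \<Rightarrow> real) set" where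
  base: "smooth_fun f \<Longrightarrow> f \<in> smooth_closure"
| add: "f \<in> smooth_closure \<Longrightarrow> g \<in> smooth_closure \<Longrightarrow> (\<lambda>x. f x + g x) \<in> smooth_closure"
| mult: "f \<in> smooth_closure \<Longrightarrow> g \<in> smooth_closure \<Longrightarrow> (\<lambda>x. f x * g x) \<in> smooth_closure"

lemma smooth_closure_smooth:
  assumes "f \<in> smooth_closure" shows "smooth_fun f"
proof (rule smooth_fun_coinduct[OF assms])
  show diff: "g differentiable (at x)" if "g \<in> smooth_closure" for g :: "'a \<Rightarrow> real" and x
    using that by (induction g) (auto intro: smooth_fun_differentiable)
  show "partial i g \<in> smooth_closure" if "g \<in> smooth_closure" "i \<in> Basis" for g :: "'a \<Rightarrow> real" and i
    using that
  proof (induction g)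
    case (base f)
    then show ?case by (auto intro: smooth_closure.base smooth_fun_partial)
  next
    case (add f g)
    then show ?case
      by (subst partial_add) (auto intro: diff smooth_closure.intros)
  next
    case (mult f g)
    then show ?case
      by (subst partial_mult) (auto intro: diff smooth_closure.intros)
  qed
qed

lemma smooth_fun_add: "smooth_fun f \<Longrightarrow> smooth_fun g \<Longrightarrow> smooth_fun (\<lambda>x. f x + g x)"
  and smooth_fun_mult: "smooth_fun f \<Longrightarrow> smooth_fun g \<Longrightarrow> smooth_fun (\<lambda>x. f x * g x)"
  by (auto intro!: smooth_closure_smooth intro: smooth_closure.intros)

lemma smooth_fun_const: "smooth_fun (\<lambda>x. c)"
  by (rule smooth_fun_coinduct[where F="range (\<lambda>c x. c)"]) auto

lemma smooth_fun_prod: "(\<And>i. i \<in> I \<Longrightarrow> smooth_fun (f i)) \<Longrightarrow> smooth_fun (\<lambda>x. \<Prod>i\<in>I. f i x)"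
  by (induction I rule: infinite_finite_induct) (auto intro: smooth_fun_const smooth_fun_mult)

text \<open>The functions \<open>p(1/x) exp(-1/x)\<close>, extended by zero, are closed under differentiation.\<close>

definition flat :: "real poly \<Rightarrow> real \<Rightarrow> real" where
  "flat p x = (if x > 0 then poly p (1 / x) * exp (- (1 / x)) else 0)"

lemma tendsto_poly_exp_0: "((\<lambda>y::real. poly p y * exp (- y)) \<longlongrightarrow> 0) at_top"
proof -
  have "((\<lambda>y::real. \<Sum>i\<le>degree p. coeff p i * (y ^ i / exp y)) \<longlongrightarrow> (\<Sum>i\<le>degree p. coeff p i * 0)) at_top"
    by (intro tendsto_intros tendsto_power_div_exp_0)
  moreover have "(\<lambda>y::real. \<Sum>i\<le>degree p. coeff p i * (y ^ i / exp y)) = (\<lambda>y. poly p y * exp (- y))"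
    by (simp add: poly_altdef exp_minus sum_distrib_right divide_inverse mult.assoc)
  ultimately show ?thesis by simp
qed

text \<open>With u = 1/x the derivative of p(u) exp(-u) is u^2 (p - p')(u) exp(-u), and
  \<open>[:0, 0, 1:]\<close> is the polynomial u^2. At 0 the two one-sided difference quotients tend
  to 0, on the right because the exponential beats every polynomial.\<close>

lemma flat_has_real_derivative:
  "(flat p has_real_derivative flat ([:0, 0, 1:] * (p - pderiv p)) x) (at x)"
proof -
  consider "x > 0" | "x < 0" | "x = 0" by linarith
  then show ?thesis
  proof cases
    case 1
    have "((\<lambda>x. poly p (1 / x) * exp (- (1 / x))) has_real_derivative
        flat ([:0, 0, 1:] * (p - pderiv p)) x) (at x)"
      using 1 by (auto intro!: derivative_eq_intros poly_DERIV[THEN DERIV_chain2]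
          simp: flat_def power2_eq_square field_simps)
    then show ?thesis
      by (rule has_field_derivative_transform_within_open[where S="{0<..}"]) (use 1 in \<open>auto simp: flat_def\<close>)
  next
    case 2
    have "((\<lambda>x. 0) has_real_derivative flat ([:0, 0, 1:] * (p - pderiv p)) x) (at x)"
      using 2 by (auto simp: flat_def)
    then show ?thesis
      by (rule has_field_derivative_transform_within_open[where S="{..<0}"]) (use 2 in \<open>auto simp: flat_def\<close>)
  next
    case 3
    \<comment> \<open>Dividing by h multiplies the polynomial in 1/h by 1/h, which is
      \<open>pCons 0 p\<close>.\<close>
    have "((\<lambda>y. poly (pCons 0 p) y * exp (- y)) \<longlongrightarrow> 0) at_top"
      by (rule tendsto_poly_exp_0)
    then have "((\<lambda>h. poly (pCons 0 p) (inverse h) * exp (- inverse h)) \<longlongrightarrow> 0) (at_right (0::real))"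
      by (rule filterlim_compose) (rule filterlim_inverse_at_top_right)
    then have "((\<lambda>h. flat p h / h) \<longlongrightarrow> 0) (at_right 0)"
      by (rule Lim_transform_eventually)
         (auto simp: eventually_at_right_field flat_def field_simps intro: exI[of _ 1])
    moreover have "((\<lambda>h. flat p h / h) \<longlongrightarrow> 0) (at_left 0)"
      by (rule tendsto_eventually) (auto simp: eventually_at_left_field flat_def intro: exI[of _ "-1"])
    ultimately have "((\<lambda>h. flat p h / h) \<longlongrightarrow> 0) (at 0)"
      by (simp add: filterlim_at_split)
    then show ?thesis
      using 3 by (simp add: has_field_derivative_iff flat_def)
  qed
qed

lemma smooth_fun_flat:
  fixes i :: "'a::euclidean_space"
  shows "smooth_fun (\<lambda>y. flat p (c * (y \<bullet> i) + d))"
proof (rule smooth_fun_coinduct[where F="{\<lambda>y. k * flat q (c * (y \<bullet> i) + d) | k q. True}"])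
  show "(\<lambda>y. flat p (c * (y \<bullet> i) + d)) \<in> {\<lambda>y. k * flat q (c * (y \<bullet> i) + d) | k q. True}"
    by (rule CollectI, rule exI[of _ 1], rule exI[of _ p]) simp
  have *: "((\<lambda>y. k * flat q (c * (y \<bullet> i) + d)) has_derivative
      (\<lambda>h. k * (flat ([:0, 0, 1:] * (q - pderiv q)) (c * (x \<bullet> i) + d) * (c * (h \<bullet> i))))) (at x)" for k q x
  proof -
    have "((\<lambda>y. flat q (c * (y \<bullet> i) + d)) has_derivative
      (\<lambda>h. flat ([:0, 0, 1:] * (q - pderiv q)) (c * (x \<bullet> i) + d) * (c * (h \<bullet> i)))) (at x)"
    proof -
      have "((\<lambda>y. c * (y \<bullet> i) + d) has_derivative (\<lambda>h. c * (h \<bullet> i))) (at x)"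
        by (auto intro!: derivative_eq_intros)
      from diff_chain_at[OF this flat_has_real_derivative[of q "c * (x \<bullet> i) + d", unfolded has_field_derivative_def]]
      show ?thesis by (simp only: o_def)
    qed
    then show ?thesis by (rule has_derivative_mult_right)
  qed
  show "g differentiable (at x)" if "g \<in> {\<lambda>y. k * flat q (c * (y \<bullet> i) + d) | k q. True}" for g x
    using that * unfolding differentiable_def by blast
  show "partial j g \<in> {\<lambda>y. k * flat q (c * (y \<bullet> i) + d) | k q. True}"
    if g: "g \<in> {\<lambda>y. k * flat q (c * (y \<bullet> i) + d) | k q. True}" for g and j :: 'a
  proof -
    obtain k q where g: "g = (\<lambda>y. k * flat q (c * (y \<bullet> i) + d))" using g by blast
    \<comment> \<open>The chain rule produces a constant factor; this is why the family carries
      \<open>k\<close>.\<close>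
    have "partial j g = (\<lambda>y. (k * c * (j \<bullet> i)) * flat ([:0, 0, 1:] * (q - pderiv q)) (c * (y \<bullet> i) + d))"
      unfolding g by (rule ext, subst partial_eq[OF *]) (simp add: algebra_simps)
    then show ?thesis by blast
  qed
qed

text \<open>The product vanishes off the open box. Inside, the growing scale \<open>Suc n\<close>
  drives each factor exp(-1/(n+1)c) to 1, so the bumps increase to the indicator of the box while
  staying in [0, 1].\<close>

definition bump :: "'a::euclidean_space \<Rightarrow> 'a \<Rightarrow> nat \<Rightarrow> 'a \<Rightarrow> real" where
  "bump a b n y = (\<Prod>i\<in>Basis. flat 1 (Suc n * (y \<bullet> i - a \<bullet> i)) * flat 1 (Suc n * (b \<bullet> i - y \<bullet> i)))"

lemma flat_1_bounds: "0 \<le> flat 1 x" "flat 1 x \<le> 1"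
  by (auto simp: flat_def)

lemma bump_bounds: "0 \<le> bump a b n y" "bump a b n y \<le> 1"
  unfolding bump_def
  by (auto intro!: prod_nonneg prod_le_1 mult_nonneg_nonneg mult_le_one flat_1_bounds)

lemma bump_eq_0: "y \<notin> box a b \<Longrightarrow> bump a b n y = 0"
  unfolding bump_def
  by (rule prod_zero) (force simp: mem_box flat_def zero_less_mult_iff)+

lemma smooth_fun_bump: "smooth_fun (bump a b n)"
proof -
  have "smooth_fun (\<lambda>y::'a. flat 1 (Suc n * (y \<bullet> i - a \<bullet> i)))" for i
    using smooth_fun_flat[of 1 "Suc n" i "- Suc n * (a \<bullet> i)"] by (simp add: algebra_simps)
  moreover have "smooth_fun (\<lambda>y::'a. flat 1 (Suc n * (b \<bullet> i - y \<bullet> i)))" for i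
    using smooth_fun_flat[of 1 "- Suc n" i "Suc n * (b \<bullet> i)"] by (simp add: algebra_simps)
  ultimately show ?thesis unfolding bump_def
    by (intro smooth_fun_prod smooth_fun_mult)
qed

section \<open>Closure properties of test functions\<close>

lemma test_functionsI:
  assumes "smooth_fun f" "\<And>x. x \<notin> C \<Longrightarrow> f x = 0" "compact C" "C \<subseteq> S"
  shows "f \<in> test_functions S"
proof -
  have "closure {x. f x \<noteq> 0} \<subseteq> C"
    by (rule closure_minimal) (use assms in \<open>auto intro: compact_imp_closed\<close>)
  moreover have "compact (closure {x. f x \<noteq> 0})"
    using calculation assms(3) by (meson bounded_subset closed_closure compact_eq_bounded_closed)
  ultimately show ?thesis using assms by (auto simp: test_functions_def)
qed

lemma test_functionsD:
  assumes "f \<in> test_functions S"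
  obtains C where "smooth_fun f" "\<And>x. x \<notin> C \<Longrightarrow> f x = 0" "compact C" "C \<subseteq> S"
proof
  show "f x = 0" if "x \<notin> closure {x. f x \<noteq> 0}" for x
    using that closure_subset[of "{x. f x \<noteq> 0}"] by auto
qed (use assms in \<open>auto simp: test_functions_def\<close>)

lemma bump_test: "cbox a b \<subseteq> S \<Longrightarrow> bump a b n \<in> test_functions S"
  by (rule test_functionsI[of _ "cbox a b"])
     (auto simp: smooth_fun_bump intro!: bump_eq_0 dest: box_subset_cbox[THEN subsetD])

lemma bump_tendsto: "(\<lambda>n. bump a b n y) \<longlonglongrightarrow> indicator (box a b) y"
proof (cases "y \<in> box a b")
  case True
  have 1: "(\<lambda>n. flat 1 (Suc n * c)) \<longlonglongrightarrow> 1" if "c > 0" for c :: real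
  proof -
    have "(\<lambda>n. exp (- (inverse (real (Suc n)) * (1 / c)))) \<longlonglongrightarrow> exp (- (0 * (1 / c)))"
      by (intro tendsto_intros LIMSEQ_inverse_real_of_nat)
    moreover have "flat 1 (Suc n * c) = exp (- (inverse (real (Suc n)) * (1 / c)))" for n
      using that by (simp add: flat_def zero_less_mult_iff inverse_eq_divide)
    ultimately show ?thesis by simp
  qed
  have "(\<lambda>n. bump a b n y) \<longlonglongrightarrow> (\<Prod>i\<in>(Basis::'a set). 1 * 1)"
    unfolding bump_def using True by (intro tendsto_prod tendsto_mult 1) (auto simp: mem_box)
  then show ?thesis using True by simp
qed (simp add: bump_eq_0)

lemma test_functions_partial:
  assumes "f \<in> test_functions S" "i \<in> Basis" shows "partial i f \<in> test_functions S"
proof -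
  obtain C where C: "smooth_fun f" "\<And>x. x \<notin> C \<Longrightarrow> f x = 0" "compact C" "C \<subseteq> S"
    by (rule test_functionsD[OF assms(1)]) blast
  show ?thesis
  proof (rule test_functionsI[of _ C])
    show "partial i f x = 0" if "x \<notin> C" for x
    proof -
      have "((\<lambda>x. 0) has_derivative (\<lambda>h. 0)) (at x)" by simp
      then have "(f has_derivative (\<lambda>h. 0)) (at x)"
        by (rule has_derivative_transform_within_open[of _ _ _ _ "- C"])
           (use C that in \<open>auto intro: compact_imp_closed\<close>)
      then show ?thesis by (simp add: partial_eq)
    qed
  qed (use C assms in \<open>auto intro: smooth_fun_partial\<close>)
qed

lemma test_functions_iter_partial:
  "f \<in> test_functions S \<Longrightarrow> set \<alpha> \<subseteq> Basis \<Longrightarrow> iter_partial \<alpha> f \<in> test_functions S"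
  by (induction \<alpha>) (auto simp: test_functions_partial)

lemma test_functions_add:
  assumes "f \<in> test_functions S" "g \<in> test_functions S"
  shows "(\<lambda>x. f x + g x) \<in> test_functions S"
proof -
  obtain C where C: "smooth_fun f" "\<And>x. x \<notin> C \<Longrightarrow> f x = 0" "compact C" "C \<subseteq> S"
    by (rule test_functionsD[OF assms(1)]) blast
  obtain D where D: "smooth_fun g" "\<And>x. x \<notin> D \<Longrightarrow> g x = 0" "compact D" "D \<subseteq> S"
    by (rule test_functionsD[OF assms(2)]) blast
  show ?thesis
    by (rule test_functionsI[of _ "C \<union> D"]) (use C D in \<open>auto intro: smooth_fun_add\<close>)
qed

lemma test_functions_mult_smooth:
  assumes "smooth_fun f" "g \<in> test_functions S"
  shows "(\<lambda>x. f x * g x) \<in> test_functions S"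
proof -
  obtain D where D: "smooth_fun g" "\<And>x. x \<notin> D \<Longrightarrow> g x = 0" "compact D" "D \<subseteq> S"
    by (rule test_functionsD[OF assms(2)]) blast
  show ?thesis
    by (rule test_functionsI[of _ D]) (use D assms in \<open>auto intro: smooth_fun_mult\<close>)
qed

lemma test_functions_scale: "g \<in> test_functions S \<Longrightarrow> (\<lambda>x. c * g x) \<in> test_functions S"
  by (rule test_functions_mult_smooth[OF smooth_fun_const])

lemma test_functions_zero: "(\<lambda>x. 0) \<in> test_functions S"
  by (rule test_functionsI[of _ "{}"]) (auto simp: smooth_fun_const)

section \<open>Symmetry of mixed partial derivatives\<close>

lemma partial_line_derivative:
  assumes "f differentiable (at (p + r *\<^sub>R i))"
  shows "((\<lambda>r. f (p + r *\<^sub>R i)) has_real_derivative partial i f (p + r *\<^sub>R i)) (at r)"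
proof -
  have *: "((\<lambda>r. p + r *\<^sub>R i) has_derivative (\<lambda>h. h *\<^sub>R i)) (at r)"
    by (auto intro!: derivative_eq_intros)
  have "(f has_derivative frechet_derivative f (at (p + r *\<^sub>R i))) (at (p + r *\<^sub>R i))"
    using assms by (simp add: frechet_derivative_works)
  from diff_chain_at[OF * this] linear_frechet_derivative[OF assms]
  show ?thesis
    by (simp add: has_field_derivative_def o_def linear_scale mult_commute_abs)
qed

text \<open>The mean value theorem is used twice: in direction \<open>i\<close> for the difference
  of \<open>f\<close> on two parallel lines, then in direction \<open>j\<close> for
  \<open>partial i f\<close>.\<close>

lemma second_difference_mvt:
  assumes f: "smooth_fun f" and i: "i \<in> Basis" and s: "s > 0"
  obtains \<sigma> \<tau> where "0 < \<sigma>" "\<sigma> < s" "0 < \<tau>" "\<tau> < s"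
    "f (x + s *\<^sub>R i + s *\<^sub>R j) - f (x + s *\<^sub>R i) - f (x + s *\<^sub>R j) + f x
      = s * s * partial j (partial i f) (x + \<sigma> *\<^sub>R i + \<tau> *\<^sub>R j)"
proof -
  define G where "G = (\<lambda>r. f ((x + s *\<^sub>R j) + r *\<^sub>R i) - f (x + r *\<^sub>R i))"
  have "(G has_real_derivative partial i f ((x + s *\<^sub>R j) + r *\<^sub>R i) - partial i f (x + r *\<^sub>R i)) (at r)" for r
    unfolding G_def by (intro DERIV_diff partial_line_derivative smooth_fun_differentiable f)
  then obtain \<sigma> where \<sigma>: "0 < \<sigma>" "\<sigma> < s"
    "G s - G 0 = (s - 0) * (partial i f ((x + s *\<^sub>R j) + \<sigma> *\<^sub>R i) - partial i f (x + \<sigma> *\<^sub>R i))"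
    using MVT2[OF s, of G "\<lambda>r. partial i f ((x + s *\<^sub>R j) + r *\<^sub>R i) - partial i f (x + r *\<^sub>R i)"] by blast
  have "((\<lambda>r. partial i f ((x + \<sigma> *\<^sub>R i) + r *\<^sub>R j)) has_real_derivative
      partial j (partial i f) ((x + \<sigma> *\<^sub>R i) + r *\<^sub>R j)) (at r)" for r
    by (intro partial_line_derivative smooth_fun_differentiable smooth_fun_partial f i)
  then obtain \<tau> where \<tau>: "0 < \<tau>" "\<tau> < s"
    "partial i f ((x + \<sigma> *\<^sub>R i) + s *\<^sub>R j) - partial i f ((x + \<sigma> *\<^sub>R i) + 0 *\<^sub>R j)
      = (s - 0) * partial j (partial i f) ((x + \<sigma> *\<^sub>R i) + \<tau> *\<^sub>R j)"
    using MVT2[OF s, of "\<lambda>r. partial i f ((x + \<sigma> *\<^sub>R i) + r *\<^sub>R j)"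
        "\<lambda>r. partial j (partial i f) ((x + \<sigma> *\<^sub>R i) + r *\<^sub>R j)"] by blast
  have "G s - G 0 = s * (s * partial j (partial i f) (x + \<sigma> *\<^sub>R i + \<tau> *\<^sub>R j))"
    using \<sigma>(3) \<tau>(3) by (simp add: add_ac)
  then show ?thesis
    using that[OF \<sigma>(1,2) \<tau>(1,2)] by (simp add: G_def algebra_simps)
qed

text \<open>The second difference is symmetric in the two directions. Dividing by the squared step
  gives both mixed partials at points that converge to \<open>x\<close>, and both are continuous
  there.\<close>

lemma partial_commute:
  assumes f: "smooth_fun f" and ij: "i \<in> Basis" "j \<in> Basis"
  shows "partial i (partial j f) x = partial j (partial i f) x"
proof -
  define s :: "nat \<Rightarrow> real" where "s n = inverse (real (Suc n))" for n
  have s: "s n > 0" for n by (simp add: s_def)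
  have s0: "s \<longlonglongrightarrow> 0" unfolding s_def by (rule LIMSEQ_inverse_real_of_nat)
  have "\<exists>\<sigma> \<tau> \<sigma>' \<tau>'. 0 < \<sigma> \<and> \<sigma> < s n \<and> 0 < \<tau> \<and> \<tau> < s n \<and> 0 < \<sigma>' \<and> \<sigma>' < s n \<and> 0 < \<tau>' \<and> \<tau>' < s n \<and>
    partial j (partial i f) (x + \<sigma> *\<^sub>R i + \<tau> *\<^sub>R j) = partial i (partial j f) (x + \<sigma>' *\<^sub>R j + \<tau>' *\<^sub>R i)" for n
  proof -
    obtain \<sigma> \<tau> where 1: "0 < \<sigma>" "\<sigma> < s n" "0 < \<tau>" "\<tau> < s n"
     "f (x + s n *\<^sub>R i + s n *\<^sub>R j) - f (x + s n *\<^sub>R i) - f (x + s n *\<^sub>R j) + f x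
      = s n * s n * partial j (partial i f) (x + \<sigma> *\<^sub>R i + \<tau> *\<^sub>R j)"
      using second_difference_mvt[OF f ij(1) s] by blast
    obtain \<sigma>' \<tau>' where 2: "0 < \<sigma>'" "\<sigma>' < s n" "0 < \<tau>'" "\<tau>' < s n"
     "f (x + s n *\<^sub>R j + s n *\<^sub>R i) - f (x + s n *\<^sub>R j) - f (x + s n *\<^sub>R i) + f x
      = s n * s n * partial i (partial j f) (x + \<sigma>' *\<^sub>R j + \<tau>' *\<^sub>R i)"
      using second_difference_mvt[OF f ij(2) s] by blast
    have "s n * s n * partial j (partial i f) (x + \<sigma> *\<^sub>R i + \<tau> *\<^sub>R j)
      = s n * s n * partial i (partial j f) (x + \<sigma>' *\<^sub>R j + \<tau>' *\<^sub>R i)"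
      unfolding 1(5)[symmetric] 2(5)[symmetric] by (simp add: add_ac)
    then have "partial j (partial i f) (x + \<sigma> *\<^sub>R i + \<tau> *\<^sub>R j)
      = partial i (partial j f) (x + \<sigma>' *\<^sub>R j + \<tau>' *\<^sub>R i)"
      using s[of n] by simp
    with 1 2 show ?thesis by blast
  qed
  then obtain \<sigma> \<tau> \<sigma>' \<tau>' where st: "\<And>n. 0 < \<sigma> n \<and> \<sigma> n < s n \<and> 0 < \<tau> n \<and> \<tau> n < s n \<and>
      0 < \<sigma>' n \<and> \<sigma>' n < s n \<and> 0 < \<tau>' n \<and> \<tau>' n < s n"
    and eq: "\<And>n. partial j (partial i f) (x + \<sigma> n *\<^sub>R i + \<tau> n *\<^sub>R j)
      = partial i (partial j f) (x + \<sigma>' n *\<^sub>R j + \<tau>' n *\<^sub>R i)"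
    by metis
  have 0: "\<sigma> \<longlonglongrightarrow> 0" "\<tau> \<longlonglongrightarrow> 0" "\<sigma>' \<longlonglongrightarrow> 0" "\<tau>' \<longlonglongrightarrow> 0"
    using st by (auto intro!: tendsto_sandwich[OF _ _ tendsto_const s0] always_eventually less_imp_le)
  have cont: "isCont (partial k (partial l f)) x" if "k \<in> Basis" "l \<in> Basis" for k l
    using that f by (intro differentiable_imp_continuous_within smooth_fun_differentiable smooth_fun_partial)
  have "(\<lambda>n. partial j (partial i f) (x + \<sigma> n *\<^sub>R i + \<tau> n *\<^sub>R j)) \<longlonglongrightarrow> partial j (partial i f) x"
    by (rule isCont_tendsto_compose[OF cont]) (use ij in \<open>auto intro!: tendsto_eq_intros 0\<close>)
  moreover have "(\<lambda>n. partial i (partial j f) (x + \<sigma>' n *\<^sub>R j + \<tau>' n *\<^sub>R i)) \<longlonglongrightarrow> partial i (partial j f) x"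
    by (rule isCont_tendsto_compose[OF cont]) (use ij in \<open>auto intro!: tendsto_eq_intros 0\<close>)
  ultimately show ?thesis
    unfolding eq by (meson LIMSEQ_unique)
qed

text \<open>Translation invariance of Lebesgue measure makes the integral of every difference
  quotient vanish; this replaces Fubini's theorem in the proof of the divergence theorem.\<close>

lemma integral_partial_eq_0:
  assumes f: "\<And>x. f differentiable (at x)" and cont: "continuous_on UNIV (partial i f)"
    and C: "compact C" "\<And>x. x \<notin> C \<Longrightarrow> f x = 0" and i: "i \<in> Basis"
  shows "(\<integral>x. partial i f x \<partial>lborel) = (0::real)"
proof -
  obtain R where R: "C \<subseteq> cball 0 R"
    using compact_imp_bounded[OF C(1)] unfolding bounded_iff by (metis mem_cball_0 subsetI)
  have fR: "f x = 0" if "norm x > R" for x using that R by (intro C(2)) auto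
  have fcont: "continuous_on A f" for A
    by (meson continuous_at_imp_continuous_on differentiable_imp_continuous_within f)
  have [measurable]: "f \<in> borel_measurable borel" using fcont by (rule borel_measurable_continuous_onI)
  \<comment> \<open>Steps have length at most 1: the difference quotients vanish outside radius R +
    1, and inside it the mean value theorem evaluates the partial derivative within radius R +
    2.\<close>
  obtain B where B: "\<And>x. norm x \<le> R + 2 \<Longrightarrow> \<bar>partial i f x\<bar> \<le> B"
  proof -
    have "bounded (partial i f ` cball 0 (R + 2))"
      by (intro compact_imp_bounded compact_continuous_image continuous_on_subset[OF cont]) auto
    then show ?thesis using that unfolding bounded_iff by fastforce
  qed
  have intf: "integrable lborel f"
  proof -
    have "integrable lborel (\<lambda>x. indicator (cball 0 R) x *\<^sub>R f x)"
      by (intro borel_integrable_compact fcont) auto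
    also have "(\<lambda>x. indicator (cball 0 R) x *\<^sub>R f x) = f"
      by (rule ext) (use fR in \<open>auto simp: indicator_def not_le\<close>)
    finally show ?thesis .
  qed
  define s :: "nat \<Rightarrow> real" where "s n = inverse (real (Suc n))" for n
  have s: "s n > 0" "s n \<le> 1" for n by (auto simp: s_def field_simps)
  have s0: "s \<longlonglongrightarrow> 0" unfolding s_def by (rule LIMSEQ_inverse_real_of_nat)
  define g where "g n x = (f (x + s n *\<^sub>R i) - f x) / s n" for n x
  have [measurable]: "g n \<in> borel_measurable borel" for n unfolding g_def by measurable
  have "(\<lambda>n. \<integral>x. g n x \<partial>lborel) \<longlonglongrightarrow> (\<integral>x. partial i f x \<partial>lborel)"
  proof (rule integral_dominated_convergence[where w="\<lambda>x. B * indicator (cball 0 (R + 1)) x"])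
    show "partial i f \<in> borel_measurable lborel"
      using cont by (simp add: borel_measurable_continuous_onI)
    show "integrable lborel (\<lambda>x. B * indicator (cball 0 (R + 1)) x)"
      by (intro integrable_mult_right integrable_real_indicator emeasure_bounded_finite) auto
    show "AE x in lborel. (\<lambda>n. g n x) \<longlonglongrightarrow> partial i f x"
    proof (rule AE_I2)
      fix x
      have "((\<lambda>r. f (x + r *\<^sub>R i)) has_real_derivative partial i f (x + 0 *\<^sub>R i)) (at 0)"
        by (intro partial_line_derivative f)
      then have "((\<lambda>r. (f (x + r *\<^sub>R i) - f x) / r) \<longlongrightarrow> partial i f x) (at 0)"
        by (simp add: has_field_derivative_iff)
      moreover have "filterlim s (at 0) sequentially"
        using s0 s(1) by (auto simp: filterlim_at less_imp_neq[symmetric] intro!: always_eventually)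
      ultimately show "(\<lambda>n. g n x) \<longlonglongrightarrow> partial i f x"
        unfolding g_def by (rule filterlim_compose)
    qed
    show "AE x in lborel. norm (g n x) \<le> B * indicator (cball 0 (R + 1)) x" for n
    proof (rule AE_I2)
      fix x
      show "norm (g n x) \<le> B * indicator (cball 0 (R + 1)) x"
      proof (cases "norm x \<le> R + 1")
        case True
        have "((\<lambda>r. f (x + r *\<^sub>R i)) has_real_derivative partial i f (x + r *\<^sub>R i)) (at r)" for r
          by (intro partial_line_derivative f)
        then obtain z where z: "0 < z" "z < s n"
          "f (x + s n *\<^sub>R i) - f (x + 0 *\<^sub>R i) = (s n - 0) * partial i f (x + z *\<^sub>R i)"
          using MVT2[OF s(1)[of n], of "\<lambda>r. f (x + r *\<^sub>R i)" "\<lambda>r. partial i f (x + r *\<^sub>R i)"] by blast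
        then have "g n x = partial i f (x + z *\<^sub>R i)" using s(1)[of n] by (simp add: g_def)
        moreover have "norm (x + z *\<^sub>R i) \<le> R + 2"
          using norm_triangle_ineq[of x "z *\<^sub>R i"] z s(2)[of n] i True by simp
        ultimately show ?thesis using B True by simp
      next
        case False
        have "norm x \<le> norm (x + s n *\<^sub>R i) + norm (s n *\<^sub>R i)"
          using norm_triangle_ineq4[of "x + s n *\<^sub>R i" "s n *\<^sub>R i"] by simp
        then have "norm (x + s n *\<^sub>R i) > R" using False s[of n] i by simp
        then show ?thesis using False fR by (simp add: g_def)
      qed
    qed
  qed measurable
  moreover have "(\<integral>x. g n x \<partial>lborel) = 0" for n
  proof -
    have eq: "(\<integral>x. f (x + s n *\<^sub>R i) \<partial>lborel) = (\<integral>x. f x \<partial>lborel)"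
      by (subst lborel_distr_plus[of "s n *\<^sub>R i", symmetric], subst integral_distr) (auto simp: add.commute)
    have "integrable lborel (\<lambda>x. f (x + s n *\<^sub>R i))"
      using intf by (subst (asm) lborel_distr_plus[of "s n *\<^sub>R i", symmetric], subst (asm) integrable_distr_eq)
        (auto simp: add.commute)
    then show ?thesis unfolding g_def using intf eq by simp
  qed
  ultimately show ?thesis by (simp add: LIMSEQ_const_iff)
qed

section \<open>Absolutely continuous functions of time\<close>

abbreviation LI :: "real \<Rightarrow> real \<Rightarrow> (real \<Rightarrow> real) \<Rightarrow> real" where
  "LI a b f \<equiv> integral\<^sup>L (lebesgue_on {a..b}) f"

lemma LI_eq_integral: "integrable (lebesgue_on {a..b}) f \<Longrightarrow> LI a b f = integral {a..b} f"
  by (simp add: lebesgue_integral_eq_integral)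

lemma integrable_continuous_lebesgue_on:
  fixes f :: "real \<Rightarrow> real"
  assumes "continuous_on {a..b} f" shows "integrable (lebesgue_on {a..b}) f"
  using assms by (intro absolutely_integrable_imp_integrable absolutely_integrable_continuous_real) auto

lemma LI_mono_AE:
  assumes "integrable (lebesgue_on {a..b}) f" "integrable (lebesgue_on {a..b}) g"
    "AE t in lebesgue_on {a..b}. f t \<le> g t"
  shows "LI a b f \<le> LI a b g"
  using assms by (rule integral_mono_AE)

lemma LI_abs_le:
  assumes "integrable (lebesgue_on {a..b}) f" "integrable (lebesgue_on {a..b}) g"
    "AE t in lebesgue_on {a..b}. \<bar>f t\<bar> \<le> g t"
  shows "\<bar>LI a b f\<bar> \<le> LI a b g"
  by (rule order_trans[OF integral_abs_bound integral_mono_AE[OF integrable_abs[OF assms(1)] assms(2,3)]])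

lemma integrable_continuous_mult:
  fixes f g :: "real \<Rightarrow> real"
  assumes f: "continuous_on {a..b} f" and g: "integrable (lebesgue_on {a..b}) g"
  shows "integrable (lebesgue_on {a..b}) (\<lambda>t. f t * g t)"
proof -
  obtain B where B: "\<And>t. t \<in> {a..b} \<Longrightarrow> \<bar>f t\<bar> \<le> B"
    using compact_imp_bounded[OF compact_continuous_image[OF f]] unfolding bounded_iff by fastforce
  have [measurable]: "f \<in> borel_measurable (lebesgue_on {a..b})" "g \<in> borel_measurable (lebesgue_on {a..b})"
    using f g by (auto intro!: continuous_imp_measurable_on_sets_lebesgue)
  show ?thesis
  proof (rule Bochner_Integration.integrable_bound)
    show "integrable (lebesgue_on {a..b}) (\<lambda>t. B * \<bar>g t\<bar>)" using g by auto
    show "AE t in lebesgue_on {a..b}. norm (f t * g t) \<le> norm (B * \<bar>g t\<bar>)"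
      by (rule AE_I2) (auto simp: abs_mult intro!: mult_right_mono order_trans[OF B])
  qed measurable
qed

text \<open>Absolute continuity is encoded as the fundamental theorem of calculus with a prescribed
  density, which is therefore fixed up to null sets only. \<open>I\<close> need not be an interval:
  below it is also a set of almost all times, while the integrals still run over whole
  intervals.\<close>

definition AC_on :: "real set \<Rightarrow> (real \<Rightarrow> real) \<Rightarrow> (real \<Rightarrow> real) \<Rightarrow> bool" where
  "AC_on I f f' \<longleftrightarrow> (\<forall>s\<in>I. \<forall>t\<in>I. s \<le> t \<longrightarrow>
     integrable (lebesgue_on {s..t}) f' \<and> LI s t f' = f t - f s)"

lemma AC_onD:
  assumes "AC_on I f f'" "s \<in> I" "t \<in> I" "s \<le> t"
  shows "integrable (lebesgue_on {s..t}) f'" "LI s t f' = f t - f s"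
  using assms by (auto simp: AC_on_def)

lemma AC_on_subset: "AC_on I f f' \<Longrightarrow> J \<subseteq> I \<Longrightarrow> AC_on J f f'"
  by (auto simp: AC_on_def)

lemma AC_on_continuous:
  assumes f: "AC_on I f f'" and st: "s \<in> I" "t \<in> I"
    and I: "is_interval I"
  shows "continuous_on {s..t} f"
proof (cases "s \<le> t")
  case True
  have "continuous_on {s..t} (\<lambda>x. f s + integral {s..x} f')"
    by (intro continuous_intros indefinite_integral_continuous_1 integrable_on_lebesgue_on)
       (use AC_onD(1)[OF f st True] in auto)
  then show ?thesis
  proof (rule continuous_on_eq)
    fix x assume x: "x \<in> {s..t}"
    then have "x \<in> I" using I st unfolding is_interval_1 by (meson atLeastAtMost_iff)
    with AC_onD[OF f st(1) this] x show "f s + integral {s..x} f' = f x"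
      by (simp add: LI_eq_integral)
  qed
qed auto

lemma AC_on_add:
  assumes "AC_on I f f'" "AC_on I g g'"
  shows "AC_on I (\<lambda>t. f t + g t) (\<lambda>t. f' t + g' t)"
  using assms by (auto simp: AC_on_def)

lemma AC_on_scale:
  assumes "AC_on I f f'" shows "AC_on I (\<lambda>t. c * f t) (\<lambda>t. c * f' t)"
  using assms by (auto simp: AC_on_def right_diff_distrib)

lemma AC_on_diff:
  assumes "AC_on I f f'" "AC_on I g g'"
  shows "AC_on I (\<lambda>t. f t - g t) (\<lambda>t. f' t - g' t)"
  using assms by (auto simp: AC_on_def)

lemma AC_on_sum:
  assumes "\<And>k. k \<in> A \<Longrightarrow> AC_on I (f k) (f' k)"
  shows "AC_on I (\<lambda>t. \<Sum>k\<in>A. f k t) (\<lambda>t. \<Sum>k\<in>A. f' k t)"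
  using assms
proof (induction A rule: infinite_finite_induct)
  case (insert x A)
  then show ?case by (auto intro!: AC_on_add)
qed (auto simp: AC_on_def)

lemma AC_on_C1:
  assumes I: "is_interval I"
    and f: "\<And>t. t \<in> I \<Longrightarrow> (f has_real_derivative f' t) (at t within I)"
    and f': "continuous_on I f'"
  shows "AC_on I f f'"
  unfolding AC_on_def
proof (intro ballI impI)
  fix s t assume st: "s \<in> I" "t \<in> I" "s \<le> t"
  have sub: "{s..t} \<subseteq> I" using I st by (meson atLeastAtMost_iff mem_is_interval_1_I subsetI)
  have int: "integrable (lebesgue_on {s..t}) f'"
    by (intro integrable_continuous_lebesgue_on continuous_on_subset[OF f' sub])
  have "(f' has_integral (f t - f s)) {s..t}"
  proof (rule fundamental_theorem_of_calculus[OF st(3)])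
    fix x assume "x \<in> {s..t}"
    then have "(f has_real_derivative f' x) (at x within {s..t})"
      using f sub DERIV_subset by blast
    then show "(f has_vector_derivative f' x) (at x within {s..t})"
      by (simp add: has_real_derivative_iff_has_vector_derivative)
  qed
  then show "integrable (lebesgue_on {s..t}) f' \<and> LI s t f' = f t - f s"
    using int by (simp add: LI_eq_integral integral_unique)
qed

lemma LI_refl: "LI a a f = 0"
proof (cases "integrable (lebesgue_on {a..a}) f")
  case True
  then show ?thesis by (subst LI_eq_integral) auto
qed (rule not_integrable_integral_eq)

lemma LI_singleton [simp]: "integral\<^sup>L (lebesgue_on {a}) f = 0" for a :: real and f :: "real \<Rightarrow> real"
  using LI_refl[of a f] by simp

text \<open>The product rule for absolutely continuous functions, without differentiating them:
  on a short interval \<open>[u, w]\<close> one has \<open>f(w)\<^sup>2 - f(u)\<^sup>2 = (f(w) + f(u)) \<integral> f'\<close>, and the average of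
  the end values differs from \<open>f\<close> by at most the oscillation.\<close>

lemma AC_on_square:
  assumes f: "AC_on I f f'" and I: "is_interval I"
  shows "AC_on I (\<lambda>t. (f t)\<^sup>2) (\<lambda>t. 2 * (f t * f' t))"
  unfolding AC_on_def
proof (intro ballI impI)
  fix s t assume st: "s \<in> I" "t \<in> I" "s \<le> t"
  have sub: "{s..t} \<subseteq> I" using I st by (meson atLeastAtMost_iff mem_is_interval_1_I subsetI)
  have cont: "continuous_on {s..t} f" by (rule AC_on_continuous[OF f st(1,2) I])
  have if': "integrable (lebesgue_on {u..w}) f'" if "s \<le> u" "w \<le> t" for u w
    by (rule integrable_subinterval[OF AC_onD(1)[OF f st]]) (use that in auto)
  have iff': "integrable (lebesgue_on {u..w}) (\<lambda>t. f t * f' t)" if "s \<le> u" "w \<le> t" for u w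
    by (intro integrable_continuous_mult continuous_on_subset[OF cont] if' that) (use that in auto)
  define G where "G u w = (f w)\<^sup>2 - (f u)\<^sup>2 - LI u w (\<lambda>t. 2 * (f t * f' t))" for u w
  have "G s t = 0"
  proof (rule ccontr)
    assume "G s t \<noteq> 0"
    define M where "M = LI s t (\<lambda>t. \<bar>f' t\<bar>)"
    have M: "M \<ge> 0" unfolding M_def by simp
    \<comment> \<open>Makes the accumulated defect 2 e M at most half of the assumed discrepancy; M
      + 1 keeps the denominator positive.\<close>
    define e where "e = \<bar>G s t\<bar> / (4 * (M + 1))"
    have e: "e > 0" using M \<open>G s t \<noteq> 0\<close> by (simp add: e_def)
    have "uniformly_continuous_on {s..t} f"
      using cont by (rule compact_uniformly_continuous) simp
    then obtain d where d: "d > 0" "\<And>x y. x \<in> {s..t} \<Longrightarrow> y \<in> {s..t} \<Longrightarrow> \<bar>x - y\<bar> \<le> d \<Longrightarrow> \<bar>f x - f y\<bar> \<le> e"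
    proof -
      obtain d' where d': "d' > 0" "\<And>x y. x \<in> {s..t} \<Longrightarrow> y \<in> {s..t} \<Longrightarrow> dist y x < d' \<Longrightarrow> dist (f y) (f x) < e"
        using \<open>uniformly_continuous_on {s..t} f\<close> e unfolding uniformly_continuous_on_def by metis
      show ?thesis
      proof (rule that[of "d' / 2"])
        show "\<bar>f x - f y\<bar> \<le> e" if "x \<in> {s..t}" "y \<in> {s..t}" "\<bar>x - y\<bar> \<le> d' / 2" for x y
          using d'(2)[OF that(2,1)] that d'(1) by (auto simp: dist_real_def)
      qed (use d'(1) in auto)
    qed
    have short: "\<bar>G u w\<bar> \<le> 2 * e * LI u w (\<lambda>t. \<bar>f' t\<bar>)"
      if uw: "s \<le> u" "u \<le> w" "w \<le> t" "w - u \<le> d" for u w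
    proof -
      have "(f w)\<^sup>2 - (f u)\<^sup>2 = (f w + f u) * LI u w f'"
      proof -
        have "u \<in> I" "w \<in> I" using sub uw by auto
        then have "LI u w f' = f w - f u" using AC_onD(2)[OF f _ _ uw(2)] by blast
        then show ?thesis by (simp only:) (simp add: power2_eq_square algebra_simps)
      qed
      then have "G u w = LI u w (\<lambda>\<tau>. (f w + f u - 2 * f \<tau>) * f' \<tau>)"
        unfolding G_def using if'[OF uw(1,3)] iff'[OF uw(1,3)] by (simp add: left_diff_distrib mult.assoc)
      moreover have "\<bar>LI u w (\<lambda>\<tau>. (f w + f u - 2 * f \<tau>) * f' \<tau>)\<bar> \<le> LI u w (\<lambda>t. 2 * e * \<bar>f' t\<bar>)"
      proof (rule LI_abs_le)
        show "integrable (lebesgue_on {u..w}) (\<lambda>\<tau>. (f w + f u - 2 * f \<tau>) * f' \<tau>)"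
          using if'[OF uw(1,3)] iff'[OF uw(1,3)] by (simp add: left_diff_distrib mult.assoc)
        show "integrable (lebesgue_on {u..w}) (\<lambda>t. 2 * e * \<bar>f' t\<bar>)"
          using if'[OF uw(1,3)] by simp
        show "AE \<tau> in lebesgue_on {u..w}. \<bar>(f w + f u - 2 * f \<tau>) * f' \<tau>\<bar> \<le> 2 * e * \<bar>f' \<tau>\<bar>"
        proof (rule AE_I2)
          fix \<tau> assume "\<tau> \<in> space (lebesgue_on {u..w})"
          then have \<tau>: "u \<le> \<tau>" "\<tau> \<le> w" by auto
          have "\<bar>f w - f \<tau>\<bar> \<le> e" "\<bar>f u - f \<tau>\<bar> \<le> e" using uw \<tau> by (auto intro!: d(2))
          then have "\<bar>f w + f u - 2 * f \<tau>\<bar> \<le> 2 * e" by linarith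
          then show "\<bar>(f w + f u - 2 * f \<tau>) * f' \<tau>\<bar> \<le> 2 * e * \<bar>f' \<tau>\<bar>"
            by (simp add: abs_mult mult_right_mono)
        qed
      qed
      ultimately show ?thesis by simp
    qed
    \<comment> \<open>Both sides are additive over adjacent intervals, so the estimate passes from
      length d to any length by splitting off pieces of length d.\<close>
    have "\<bar>G u w\<bar> \<le> 2 * e * LI u w (\<lambda>t. \<bar>f' t\<bar>)"
      if uw: "s \<le> u" "u \<le> w" "w \<le> t" "w - u \<le> real n * d" for u w n
      using that
    proof (induction n arbitrary: u)
      case 0
      then have "u = w" by auto
      then show ?case by (simp add: G_def)
    next
      case (Suc n)
      show ?case
      proof (cases "w - u \<le> d")
        case True
        then show ?thesis using short Suc.prems by blast
      next
        case False
        then have v: "s \<le> u + d" "u + d \<le> w" using Suc.prems d(1) by auto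
        have "\<bar>G (u + d) w\<bar> \<le> 2 * e * LI (u + d) w (\<lambda>t. \<bar>f' t\<bar>)"
          by (rule Suc.IH) (use v Suc.prems in \<open>auto simp: algebra_simps\<close>)
        moreover have "\<bar>G u (u + d)\<bar> \<le> 2 * e * LI u (u + d) (\<lambda>t. \<bar>f' t\<bar>)"
          by (rule short) (use v Suc.prems d in auto)
        moreover have "G u w = G u (u + d) + G (u + d) w"
          unfolding G_def
          using integral_combine[of u w "\<lambda>t. 2 * (f t * f' t)" "u + d"] iff'[of u w] Suc.prems v d(1) by auto
        moreover have "LI u w (\<lambda>t. \<bar>f' t\<bar>) = LI u (u + d) (\<lambda>t. \<bar>f' t\<bar>) + LI (u + d) w (\<lambda>t. \<bar>f' t\<bar>)"
          using integral_combine[of u w "\<lambda>t. \<bar>f' t\<bar>" "u + d"] if'[of u w] Suc.prems v d(1) by auto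
        ultimately show ?thesis by (simp add: algebra_simps)
      qed
    qed
    moreover obtain n where "(t - s) / d \<le> real n" using real_arch_simple by blast
    ultimately have "\<bar>G s t\<bar> \<le> 2 * e * M"
      unfolding M_def using st(3) d(1) by (auto simp: field_simps)
    also have "\<dots> \<le> 2 * e * (M + 1)" using e by simp
    also have "\<dots> = \<bar>G s t\<bar> / 2" using M by (simp add: e_def field_simps)
    finally show False using \<open>G s t \<noteq> 0\<close> by simp
  qed
  then show "integrable (lebesgue_on {s..t}) (\<lambda>t. 2 * (f t * f' t)) \<and>
      LI s t (\<lambda>t. 2 * (f t * f' t)) = (f t)\<^sup>2 - (f s)\<^sup>2"
    using iff'[of s t] by (simp add: G_def)
qed

text \<open>The majorant G(x) = C + A times the integral of \<open>E\<close> over [0, x] has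
  derivative A E, at most A G, so G(x) exp(-A x) is decreasing.\<close>

lemma Gronwall:
  assumes E: "continuous_on {0..<T} E" and A: "A \<ge> 0"
    and le: "\<And>t. 0 \<le> t \<Longrightarrow> t < T \<Longrightarrow> E t \<le> C + A * LI 0 t E"
    and t: "0 \<le> t" "t < T"
  shows "E t \<le> C * exp (A * t)"
proof -
  have cont: "continuous_on {0..t} E" by (rule continuous_on_subset[OF E]) (use t in auto)
  define G where "G x = C + A * integral {0..x} E" for x
  have EG: "E x \<le> G x" if "0 \<le> x" "x \<le> t" for x
    using le[of x] that t LI_eq_integral[OF integrable_continuous_lebesgue_on[OF continuous_on_subset[OF cont]], of 0 x]
    by (simp add: G_def)
  have "G t * exp (- A * t) \<le> G 0 * exp (- A * 0)"
  proof (rule DERIV_nonpos_imp_decreasing_open[OF t(1)])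
    fix x assume x: "0 < x" "x < t"
    have "((\<lambda>x. integral {0..x} E) has_real_derivative E x) (at x within {0..t})"
      by (rule integral_has_real_derivative[OF cont]) (use x in auto)
    then have "((\<lambda>x. integral {0..x} E) has_real_derivative E x) (at x)"
      using x by (metis at_within_interior interior_atLeastAtMost_real greaterThanLessThan_iff)
    then have "((\<lambda>x. G x * exp (- A * x)) has_real_derivative (A * E x * exp (- A * x) - A * G x * exp (- A * x))) (at x)"
      unfolding G_def by (auto intro!: derivative_eq_intros simp: algebra_simps)
    moreover have "A * E x * exp (- A * x) - A * G x * exp (- A * x) \<le> 0"
      using mult_right_mono[OF mult_left_mono[OF EG[of x] A], of "exp (- A * x)"] x by simp
    ultimately show "\<exists>y. ((\<lambda>x. G x * exp (- A * x)) has_real_derivative y) (at x) \<and> y \<le> 0" by blast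
  next
    show "continuous_on {0..t} (\<lambda>x. G x * exp (- A * x))"
      unfolding G_def
      by (intro continuous_intros indefinite_integral_continuous_1 integrable_continuous_real cont)
  qed
  then have "G t \<le> C * exp (A * t)"
    by (simp add: G_def exp_minus field_simps)
  with EG[of t] t show ?thesis by simp
qed

text \<open>The weights \<open>\<psi>'\<close> are nonnegative, and the mass
  \<open>\<psi> n c\<close> that they put on [a, c] tends to 1 for every c > a. They form a
  one-sided approximate identity at the left end point.\<close>

lemma LI_monotone_weight_tendsto:
  fixes \<psi> \<psi>' :: "nat \<Rightarrow> real \<Rightarrow> real"
  assumes ab: "a < b" and f: "continuous_on {a..b} f"
    and d: "\<And>n y. y \<in> {a..b} \<Longrightarrow> (\<psi> n has_real_derivative \<psi>' n y) (at y within {a..b})"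
    and c: "\<And>n. continuous_on {a..b} (\<psi>' n)"
    and nn: "\<And>n y. y \<in> {a..b} \<Longrightarrow> \<psi>' n y \<ge> 0"
    and a0: "\<And>n. \<psi> n a = 0" and le1: "\<And>n y. \<psi> n y \<le> 1"
    and lim: "\<And>y. a < y \<Longrightarrow> y \<le> b \<Longrightarrow> (\<lambda>n. \<psi> n y) \<longlonglongrightarrow> 1"
  shows "(\<lambda>n. LI a b (\<lambda>y. \<psi>' n y * f y)) \<longlonglongrightarrow> f a"
proof -
  have AC: "AC_on {a..b} (\<psi> n) (\<psi>' n)" for n
    by (rule AC_on_C1[OF is_interval_cc d c])
  have int: "integrable (lebesgue_on {u..w}) (\<psi>' n)" if "{u..w} \<subseteq> {a..b}" for u w n
    by (intro integrable_continuous_lebesgue_on continuous_on_subset[OF c that])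
  obtain B where B: "\<And>t. t \<in> {a..b} \<Longrightarrow> \<bar>f t\<bar> \<le> B"
    using compact_imp_bounded[OF compact_continuous_image[OF f]] unfolding bounded_iff by fastforce
  have B0: "B \<ge> 0" using B[of a] ab by force
  define h where "h n = LI a b (\<lambda>y. \<psi>' n y * (f y - f a))" for n
  have intf: "integrable (lebesgue_on {u..w}) (\<lambda>y. \<psi>' n y * (f y - f a))" if "{u..w} \<subseteq> {a..b}" for u w n
    by (intro integrable_continuous_lebesgue_on continuous_intros continuous_on_subset[OF c that]
        continuous_on_subset[OF f that])
  have "h \<longlonglongrightarrow> 0"
  proof (rule LIMSEQ_I)
    fix r :: real assume r: "r > 0"
    have "isCont (\<lambda>x. x) (0::real)" by simp
    obtain \<eta> where \<eta>: "\<eta> > 0" "\<And>y. y \<in> {a..b} \<Longrightarrow> \<bar>y - a\<bar> \<le> \<eta> \<Longrightarrow> \<bar>f y - f a\<bar> \<le> r / 2"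
    proof -
      obtain d where "d > 0" "\<And>y. y \<in> {a..b} \<Longrightarrow> dist y a < d \<Longrightarrow> dist (f y) (f a) < r / 2"
        using f[unfolded continuous_on_iff, rule_format, of a "r / 2"] ab r by auto
      then show ?thesis by (intro that[of "d / 2"]) (auto simp: dist_real_def intro: less_imp_le)
    qed
    define c where "c = min (a + \<eta>) b"
    have c: "a < c" "c \<le> b" "c - a \<le> \<eta>" using \<eta>(1) ab by (auto simp: c_def)
    \<comment> \<open>On [a, c] the mass is at most 1 and \<open>f\<close> is within r/2 of
      \<open>f a\<close>; on [c, b] the remaining mass 1 - \<open>\<psi> n c\<close> meets a
      deviation of at most 2 B.\<close>
    have bound: "\<bar>h n\<bar> \<le> r / 2 + 2 * B * (1 - \<psi> n c)" for n
    proof -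
      have "h n = LI a c (\<lambda>y. \<psi>' n y * (f y - f a)) + LI c b (\<lambda>y. \<psi>' n y * (f y - f a))"
        unfolding h_def by (rule integral_combine) (use intf c in auto)
      moreover have "\<bar>LI a c (\<lambda>y. \<psi>' n y * (f y - f a))\<bar> \<le> LI a c (\<lambda>y. r / 2 * \<psi>' n y)"
      proof (rule LI_abs_le)
        show "AE y in lebesgue_on {a..c}. \<bar>\<psi>' n y * (f y - f a)\<bar> \<le> r / 2 * \<psi>' n y"
        proof (rule AE_I2)
          fix y assume "y \<in> space (lebesgue_on {a..c})"
          then show "\<bar>\<psi>' n y * (f y - f a)\<bar> \<le> r / 2 * \<psi>' n y"
            using \<eta>(2)[of y] nn[of y n] c mult_left_mono[of "\<bar>f y - f a\<bar>" "r / 2" "\<psi>' n y"]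
            by (auto simp: abs_mult mult.commute)
        qed
      qed (use intf int c in auto)
      moreover have "\<bar>LI c b (\<lambda>y. \<psi>' n y * (f y - f a))\<bar> \<le> LI c b (\<lambda>y. 2 * B * \<psi>' n y)"
      proof (rule LI_abs_le)
        show "AE y in lebesgue_on {c..b}. \<bar>\<psi>' n y * (f y - f a)\<bar> \<le> 2 * B * \<psi>' n y"
        proof (rule AE_I2)
          fix y assume y: "y \<in> space (lebesgue_on {c..b})"
          then have "\<bar>f y - f a\<bar> \<le> 2 * B" using B[of y] B[of a] c by auto
          then show "\<bar>\<psi>' n y * (f y - f a)\<bar> \<le> 2 * B * \<psi>' n y"
            using y nn[of y n] c mult_left_mono[of "\<bar>f y - f a\<bar>" "2 * B" "\<psi>' n y"]
            by (auto simp: abs_mult mult.commute)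
        qed
      qed (use intf int c in auto)
      moreover have "LI a c (\<lambda>y. r / 2 * \<psi>' n y) = r / 2 * \<psi> n c"
        using AC_onD[OF AC, of a c n] c a0 by simp
      moreover have "r / 2 * \<psi> n c \<le> r / 2 * 1" using r le1 by (intro mult_left_mono) auto
      moreover have "LI c b (\<lambda>y. 2 * B * \<psi>' n y) = 2 * B * (\<psi> n b - \<psi> n c)"
        using AC_onD[OF AC, of c b n] c a0 by simp
      moreover have "2 * B * (\<psi> n b - \<psi> n c) \<le> 2 * B * (1 - \<psi> n c)"
        using B0 le1 by (intro mult_left_mono) auto
      ultimately show ?thesis by linarith
    qed
    have "(\<lambda>n. r / 2 + 2 * B * (1 - \<psi> n c)) \<longlonglongrightarrow> r / 2 + 2 * B * (1 - 1)"
      by (intro tendsto_intros lim c)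
    then have "eventually (\<lambda>n. r / 2 + 2 * B * (1 - \<psi> n c) < r) sequentially"
      by (rule order_tendstoD) (use r in auto)
    then show "\<exists>no. \<forall>n\<ge>no. norm (h n - 0) < r"
      using bound unfolding eventually_sequentially by (metis diff_zero order_le_less_trans real_norm_def)
  qed
  moreover have "h n + f a * \<psi> n b = LI a b (\<lambda>y. \<psi>' n y * f y)" for n
  proof -
    have "LI a b (\<lambda>y. \<psi>' n y * f y) = LI a b (\<lambda>y. \<psi>' n y * (f y - f a) + f a * \<psi>' n y)"
      by (intro Bochner_Integration.integral_cong) (auto simp: algebra_simps)
    also have "\<dots> = h n + f a * \<psi> n b"
      unfolding h_def using intf[of a b n] int[of a b n] AC_onD(2)[OF AC, of a b n] a0 ab by simp
    finally show ?thesis by simp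
  qed
  moreover have "(\<lambda>n. f a * \<psi> n b) \<longlonglongrightarrow> f a * 1"
    using ab by (intro tendsto_intros lim) auto
  ultimately show ?thesis
    using tendsto_add[of h 0 sequentially "\<lambda>n. f a * \<psi> n b" "f a * 1"] by simp
qed

lemma integral_lebesgue_on_eq_LI:
  fixes h :: "real \<Rightarrow> real"
  assumes "{s..t} \<subseteq> S" "S \<in> sets lebesgue" "\<And>y. y \<notin> {s..t} \<Longrightarrow> h y = 0"
  shows "integral\<^sup>L (lebesgue_on S) h = LI s t h"
proof -
  have "(\<lambda>x. indicator S x *\<^sub>R h x) = (\<lambda>x. indicator {s..t} x *\<^sub>R h x)"
    using assms by (auto simp: indicator_def fun_eq_iff)
  then show ?thesis
    using assms by (simp add: integral_restrict_space)
qed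

text \<open>Testing with \<open>exp(-(1/(y - s) + 1/(t - y))/n)\<close>, which increases up to the midpoint of
  \<open>[s, t]\<close>, decreases from there on, and converges to the indicator function of \<open>(s, t)\<close>.\<close>

lemma AC_on_of_weak_derivative:
  assumes f: "continuous_on {0<..<T} f"
    and g: "\<And>a b. 0 < a \<Longrightarrow> b < T \<Longrightarrow> integrable (lebesgue_on {a..b}) g"
    and weak: "\<And>\<phi>. \<phi> \<in> test_functions {0<..<T} \<Longrightarrow>
      (\<integral>t. deriv \<phi> t * f t \<partial>(lebesgue_on {0<..<T})) = - (\<integral>t. \<phi> t * g t \<partial>(lebesgue_on {0<..<T}))"
  shows "AC_on {0<..<T} f g"
  unfolding AC_on_def
proof (intro ballI impI conjI)
  fix s t assume st: "s \<in> {0<..<T}" "t \<in> {0<..<T}" "s \<le> t"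
  show gi: "integrable (lebesgue_on {s..t}) g" using g st by auto
  show "LI s t g = f t - f s"
  proof (cases "s = t")
    case True
    then show ?thesis by (simp only: LI_refl diff_self)
  next
    case False
    then have lt: "s < t" using st by simp
    define m where "m = (s + t) / 2"
    have m: "s < m" "m < t" "m - s = t - m" using lt by (auto simp: m_def field_simps)
    have fst: "continuous_on {s..t} f" by (rule continuous_on_subset[OF f]) (use st in auto)
    define \<phi> where "\<phi> n = bump s t n" for n
    define \<phi>' where "\<phi>' n = partial 1 (\<phi> n)" for n
    have \<phi>eq: "\<phi> n y = flat 1 (Suc n * (y - s)) * flat 1 (Suc n * (t - y))" for n y
      by (simp add: \<phi>_def bump_def)
    have smooth: "smooth_fun (\<phi> n)" for n unfolding \<phi>_def by (rule smooth_fun_bump)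
    have d: "(\<phi> n has_real_derivative \<phi>' n y) (at y)" for n y
      using partial_line_derivative[of "\<phi> n" 0 y 1] smooth_fun_differentiable[OF smooth]
      by (simp add: \<phi>'_def)
    have c: "continuous_on A (\<phi>' n)" for n A
      unfolding \<phi>'_def by (intro smooth_fun_continuous_on smooth_fun_partial smooth) simp
    have out: "\<phi> n y = 0" if "y \<notin> {s<..<t}" for n y
      using that bump_eq_0[of y s t n] by (simp add: \<phi>_def box_real)
    \<comment> \<open>The sign of the derivative is decided by which end point is nearer, so it
      changes at the midpoint.\<close>
    have sgn: "\<phi>' n y = \<phi> n y / Suc n * (1 / (y - s)\<^sup>2 - 1 / (t - y)\<^sup>2)" if y: "y \<in> {s<..<t}" for n y
    proof -
      have eq: "flat 1 (Suc n * (x - s)) * flat 1 (Suc n * (t - x))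
          = exp (- (1 / (Suc n * (x - s)))) * exp (- (1 / (Suc n * (t - x))))" if "x \<in> {s<..<t}" for x
        using that by (auto simp: flat_def zero_less_mult_iff)
      have "((\<lambda>x. exp (- (1 / (Suc n * (x - s)))) * exp (- (1 / (Suc n * (t - x))))) has_real_derivative
          exp (- (1 / (Suc n * (y - s)))) * exp (- (1 / (Suc n * (t - y)))) / Suc n * (1 / (y - s)\<^sup>2 - 1 / (t - y)\<^sup>2)) (at y)"
        using y by (auto intro!: derivative_eq_intros simp: power2_eq_square divide_simps) (simp add: algebra_simps)
      then have "(\<phi> n has_real_derivative
          exp (- (1 / (Suc n * (y - s)))) * exp (- (1 / (Suc n * (t - y)))) / Suc n * (1 / (y - s)\<^sup>2 - 1 / (t - y)\<^sup>2)) (at y)"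
        by (rule has_field_derivative_transform_within_open[where S="{s<..<t}"]) (use y eq in \<open>auto simp: \<phi>eq\<close>)
      then show ?thesis
        using DERIV_unique[OF d] y eq by (simp add: \<phi>eq)
    qed
    \<comment> \<open>Where the nonnegative function vanishes it has a minimum; this covers the two
      end points as well.\<close>
    have d0: "\<phi>' n y = 0" if "y \<notin> {s<..<t}" for n y
    proof (rule DERIV_local_min[OF d])
      show "\<forall>z. \<bar>y - z\<bar> < 1 \<longrightarrow> \<phi> n y \<le> \<phi> n z"
        using out[OF that] bump_bounds[of s t n] by (simp add: \<phi>_def)
    qed simp
    have pos: "\<phi>' n y \<ge> 0" if "y \<in> {s..m}" for n y
    proof (cases "y = s")
      case True then show ?thesis using d0[of s] by simp
    next
      case False
      then have y: "y \<in> {s<..<t}" using that m by auto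
      have "(y - s)\<^sup>2 \<le> (t - y)\<^sup>2" using that m by (intro power_mono) auto
      then have "1 / (t - y)\<^sup>2 \<le> 1 / (y - s)\<^sup>2" using y by (intro divide_left_mono) auto
      then show ?thesis using sgn[OF y] bump_bounds[of s t n y] by (simp add: \<phi>_def)
    qed
    have neg: "\<phi>' n y \<le> 0" if "y \<in> {m..t}" for n y
    proof (cases "y = t")
      case True then show ?thesis using d0[of t] by simp
    next
      case False
      then have y: "y \<in> {s<..<t}" using that m by auto
      have "(t - y)\<^sup>2 \<le> (y - s)\<^sup>2" using that m by (intro power_mono) auto
      then have "1 / (y - s)\<^sup>2 \<le> 1 / (t - y)\<^sup>2" using y by (intro divide_left_mono) auto
      then show ?thesis using sgn[OF y] bump_bounds[of s t n y] by (simp add: \<phi>_def mult_nonneg_nonpos divide_nonpos_nonneg)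
    qed
    have lim: "(\<lambda>n. \<phi> n y) \<longlonglongrightarrow> 1" if "y \<in> {s<..<t}" for y
      using bump_tendsto[of s t y] that by (simp add: \<phi>_def box_real)
    have L1: "(\<lambda>n. LI s m (\<lambda>y. \<phi>' n y * f y)) \<longlonglongrightarrow> f s"
    proof (rule LI_monotone_weight_tendsto[where \<psi>=\<phi>])
      show "continuous_on {s..m} f" by (rule continuous_on_subset[OF fst]) (use m in auto)
      show "\<phi> n y \<le> 1" for n y using bump_bounds by (simp add: \<phi>_def)
    qed (use m pos lim out c d in \<open>auto intro: has_field_derivative_at_within\<close>)
    \<comment> \<open>Reflection turns the decreasing half into an increasing weight that starts at
      \<open>- t\<close>.\<close>
    have L2: "(\<lambda>n. LI (- t) (- m) (\<lambda>y. - \<phi>' n (- y) * f (- y))) \<longlonglongrightarrow> f (- (- t))"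
    proof (rule LI_monotone_weight_tendsto[where \<psi>="\<lambda>n y. \<phi> n (- y)"])
      show "continuous_on {- t..- m} (\<lambda>y. f (- y))"
        by (rule continuous_on_compose2[OF fst]) (use m in \<open>auto intro!: continuous_intros\<close>)
      show "((\<lambda>y. \<phi> n (- y)) has_real_derivative - \<phi>' n (- y)) (at y within {- t..- m})" for n y
      proof -
        have "((\<lambda>y. - y) has_real_derivative - 1) (at y within {- t..- m})"
          by (auto intro!: derivative_eq_intros)
        from DERIV_chain2[OF d this, of n] show ?thesis by simp
      qed
      show "continuous_on {- t..- m} (\<lambda>y. - \<phi>' n (- y))" for n
        by (intro continuous_intros continuous_on_compose2[OF c[of UNIV]]) auto
      show "- \<phi>' n (- y) \<ge> 0" if "y \<in> {- t..- m}" for n y using neg[of "- y" n] that by auto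
      show "\<phi> n (- y) \<le> 1" for n y using bump_bounds by (simp add: \<phi>_def)
      show "\<phi> n (- (- t)) = 0" for n using out[of t] by simp
      show "(\<lambda>n. \<phi> n (- y)) \<longlonglongrightarrow> 1" if "- t < y" "y \<le> - m" for y using lim[of "- y"] that m by auto
    qed (use m in auto)
    have L2': "(\<lambda>n. - LI m t (\<lambda>y. \<phi>' n y * f y)) \<longlonglongrightarrow> f t"
      using L2 Equivalence_Lebesgue_Henstock_Integration.integral_reflect_real[of t m "\<lambda>y. - (\<phi>' n y * f y)" for n] by simp
    have dec: "LI s t (\<lambda>y. \<phi>' n y * f y) = LI s m (\<lambda>y. \<phi>' n y * f y) + LI m t (\<lambda>y. \<phi>' n y * f y)" for n
      using m by (intro integral_combine integrable_continuous_lebesgue_on continuous_on_mult c fst) auto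
    have A: "(\<lambda>n. LI s t (\<lambda>y. \<phi>' n y * f y)) \<longlonglongrightarrow> f s - f t"
      unfolding dec using tendsto_diff[OF L1 L2'] by simp
    have Bt: "(\<lambda>n. LI s t (\<lambda>y. \<phi> n y * g y)) \<longlonglongrightarrow> LI s t g"
    proof (rule integral_dominated_convergence[where w="\<lambda>y. \<bar>g y\<bar>"])
      have [measurable]: "g \<in> borel_measurable (lebesgue_on {s..t})" using gi by auto
      show "g \<in> borel_measurable (lebesgue_on {s..t})" by measurable
      have [measurable]: "\<phi> n \<in> borel_measurable (lebesgue_on {s..t})" for n
        by (rule continuous_imp_measurable_on_sets_lebesgue) (auto intro: smooth_fun_continuous_on smooth)
      show "(\<lambda>y. \<phi> n y * g y) \<in> borel_measurable (lebesgue_on {s..t})" for n by measurable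
      show "integrable (lebesgue_on {s..t}) (\<lambda>y. \<bar>g y\<bar>)" using gi by simp
      have "negligible {s, t}" by simp
      then have "{s, t} \<in> null_sets lebesgue" by (simp add: negligible_iff_null_sets)
      then have "AE y in lebesgue. y \<notin> {s, t}" by (rule AE_not_in)
      then have "AE y in lebesgue_on {s..t}. y \<notin> {s, t}"
        by (subst AE_restrict_space_iff) auto
      then show "AE y in lebesgue_on {s..t}. (\<lambda>n. \<phi> n y * g y) \<longlonglongrightarrow> g y"
      proof (rule AE_mp, intro AE_I2 impI)
        fix y assume "y \<in> space (lebesgue_on {s..t})" "y \<notin> {s, t}"
        then have "(\<lambda>n. \<phi> n y * g y) \<longlonglongrightarrow> 1 * g y" by (intro tendsto_intros lim) auto
        then show "(\<lambda>n. \<phi> n y * g y) \<longlonglongrightarrow> g y" by simp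
      qed
      show "AE y in lebesgue_on {s..t}. norm (\<phi> n y * g y) \<le> \<bar>g y\<bar>" for n
        using bump_bounds[of s t n] by (auto simp: \<phi>_def abs_mult intro!: AE_I2 mult_left_le_one_le)
    qed
    have "LI s t (\<lambda>y. \<phi>' n y * f y) = - LI s t (\<lambda>y. \<phi> n y * g y)" for n
    proof -
      have "\<phi> n \<in> test_functions {0<..<T}"
        unfolding \<phi>_def by (rule bump_test) (use st in \<open>auto simp: cbox_interval\<close>)
      moreover have "deriv (\<phi> n) = \<phi>' n" using d DERIV_imp_deriv by blast
      moreover have sub: "{s..t} \<subseteq> {0<..<T}" using st by auto
      moreover have "(\<integral>y. \<phi>' n y * f y \<partial>(lebesgue_on {0<..<T})) = LI s t (\<lambda>y. \<phi>' n y * f y)"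
        using d0[of _ n] by (intro integral_lebesgue_on_eq_LI sub) auto
      moreover have "(\<integral>y. \<phi> n y * g y \<partial>(lebesgue_on {0<..<T})) = LI s t (\<lambda>y. \<phi> n y * g y)"
        using out[of _ n] by (intro integral_lebesgue_on_eq_LI sub) auto
      ultimately show ?thesis using weak[of "\<phi> n"] by simp
    qed
    then have "(\<lambda>n. LI s t (\<lambda>y. \<phi>' n y * f y)) \<longlonglongrightarrow> - LI s t g"
      using tendsto_minus[OF Bt] by simp
    with A have "f s - f t = - LI s t g" by (rule LIMSEQ_unique)
    then show ?thesis by simp
  qed
qed

section \<open>Test functions on the cube and integration by parts for them\<close>

abbreviation tests :: "('a::euclidean_space \<Rightarrow> real) set" where
  "tests \<equiv> test_functions unit_cube"

lemma test_L2: "\<phi> \<in> tests \<Longrightarrow> \<phi> \<in> L2_space unit_cube"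
proof -
  assume "\<phi> \<in> tests"
  then obtain C where C: "smooth_fun \<phi>" "\<And>x. x \<notin> C \<Longrightarrow> \<phi> x = 0" "compact C" "C \<subseteq> unit_cube"
    by (rule test_functionsD) blast
  obtain B where B: "\<And>x. x \<in> C \<Longrightarrow> \<bar>\<phi> x\<bar> \<le> B"
    using compact_imp_bounded[OF compact_continuous_image[OF smooth_fun_continuous_on[OF C(1)] C(3)]]
    unfolding bounded_iff by fastforce
  have meas: "\<phi> \<in> borel_measurable cube_measure"
    by (intro continuous_imp_measurable_on_sets_lebesgue smooth_fun_continuous_on C) auto
  have one: "(\<lambda>x. 1) \<in> L2_space (unit_cube :: 'a set)"
    by (simp add: L2_space_def finite_measure.integrable_const finite_measure_cube)
  have "\<bar>\<phi> x\<bar> \<le> max B 0" for x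
    using B[of x] C(2)[of x] by (cases "x \<in> C") auto
  then have "(\<lambda>x. \<phi> x * 1) \<in> L2_space unit_cube"
    by (intro L2_space_mult_bounded[OF one meas, where B="max B 0"]) auto
  then show ?thesis by simp
qed

lemma integral_cube_eq_lborel:
  fixes h :: "'a::euclidean_space \<Rightarrow> real"
  assumes "\<And>x. x \<notin> unit_cube \<Longrightarrow> h x = 0" and [measurable]: "h \<in> borel_measurable borel"
  shows "integral\<^sup>L cube_measure h = (\<integral>x. h x \<partial>lborel)"
proof -
  have "(\<lambda>x. indicator unit_cube x *\<^sub>R h x) = h"
    using assms by (auto simp: indicator_def fun_eq_iff)
  then show ?thesis by (simp add: integral_restrict_space integral_completion)
qed

text \<open>The product is again a test function, and the integral of each of its partial
  derivatives vanishes.\<close>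

lemma integration_by_parts_test:
  assumes \<phi>: "\<phi> \<in> tests" and \<psi>: "\<psi> \<in> tests" and i: "i \<in> Basis"
  shows "ip (partial i \<phi>) \<psi> = - ip \<phi> (partial i \<psi>)"
proof -
  obtain C where C: "smooth_fun \<phi>" "\<And>x. x \<notin> C \<Longrightarrow> \<phi> x = 0" "compact C" "C \<subseteq> unit_cube"
    by (rule test_functionsD[OF \<phi>]) blast
  obtain D where D: "smooth_fun \<psi>" "\<And>x. x \<notin> D \<Longrightarrow> \<psi> x = 0" "compact D" "D \<subseteq> unit_cube"
    by (rule test_functionsD[OF \<psi>]) blast
  have sm: "smooth_fun (\<lambda>x. \<phi> x * \<psi> x)" using C D by (intro smooth_fun_mult)
  have eq: "partial i (\<lambda>x. \<phi> x * \<psi> x) = (\<lambda>x. \<phi> x * partial i \<psi> x + partial i \<phi> x * \<psi> x)"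
    using C(1) D(1) by (intro ext partial_mult smooth_fun_differentiable)
  have 0: "(\<integral>x. partial i (\<lambda>x. \<phi> x * \<psi> x) x \<partial>lborel) = (0::real)"
    by (rule integral_partial_eq_0[where C=C])
       (use C i sm in \<open>auto intro: smooth_fun_differentiable smooth_fun_continuous_on smooth_fun_partial\<close>)
  have "partial i (\<lambda>x. \<phi> x * \<psi> x) \<in> tests"
    by (intro test_functions_partial test_functions_mult_smooth C \<psi> i)
  then obtain E where E: "smooth_fun (partial i (\<lambda>x. \<phi> x * \<psi> x))"
      "\<And>x. x \<notin> E \<Longrightarrow> partial i (\<lambda>x. \<phi> x * \<psi> x) x = 0" "compact E" "E \<subseteq> unit_cube"
    by (rule test_functionsD) blast
  have "integral\<^sup>L cube_measure (partial i (\<lambda>x. \<phi> x * \<psi> x)) = 0"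
    unfolding 0[symmetric]
    by (rule integral_cube_eq_lborel) (use E in \<open>auto intro!: borel_measurable_continuous_onI smooth_fun_continuous_on\<close>)
  then have "ip \<phi> (partial i \<psi>) + ip (partial i \<phi>) \<psi> = 0"
    unfolding eq L2_inner_def
    using L2_mult_integrable[OF test_L2[OF \<phi>] test_L2[OF test_functions_partial[OF \<psi> i]]]
      L2_mult_integrable[OF test_L2[OF test_functions_partial[OF \<phi> i]] test_L2[OF \<psi>]] by simp
  then show ?thesis by simp
qed

lemma iter_partial_commute:
  assumes "smooth_fun \<phi>" "set \<alpha> \<subseteq> Basis" "i \<in> Basis"
  shows "partial i (iter_partial \<alpha> \<phi>) = iter_partial \<alpha> (partial i \<phi>)"
  using assms(2)
proof (induction \<alpha>)
  case (Cons j \<alpha>)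
  have "partial i (partial j (iter_partial \<alpha> \<phi>)) = partial j (partial i (iter_partial \<alpha> \<phi>))"
    by (rule ext, rule partial_commute) (use assms Cons in \<open>auto intro: smooth_fun_iter_partial\<close>)
  with Cons show ?case by simp
qed simp

lemma test_smooth: "\<phi> \<in> test_functions S \<Longrightarrow> smooth_fun \<phi>"
  by (simp add: test_functions_def)

text \<open>Each step peels off the outermost direction and applies it innermost on the other
  factor; symmetry of mixed partials restores the order.\<close>

lemma ip_iter_partial:
  assumes "\<phi> \<in> tests" "\<psi> \<in> tests" "set \<alpha> \<subseteq> Basis"
  shows "ip \<phi> (iter_partial \<alpha> \<psi>) = (-1) ^ length \<alpha> * ip (iter_partial \<alpha> \<phi>) \<psi>"
  using assms(1,3)
proof (induction \<alpha> arbitrary: \<phi>)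
  case (Cons i \<alpha>)
  have "ip \<phi> (iter_partial (i # \<alpha>) \<psi>) = - ip (partial i \<phi>) (iter_partial \<alpha> \<psi>)"
    using integration_by_parts_test[of \<phi> "iter_partial \<alpha> \<psi>" i] Cons.prems assms(2)
    by (simp add: test_functions_iter_partial)
  also have "ip (partial i \<phi>) (iter_partial \<alpha> \<psi>) = (-1) ^ length \<alpha> * ip (iter_partial \<alpha> (partial i \<phi>)) \<psi>"
    using Cons by (simp add: test_functions_partial)
  also have "iter_partial \<alpha> (partial i \<phi>) = iter_partial (i # \<alpha>) \<phi>"
    using Cons.prems by (simp add: iter_partial_commute test_smooth)
  finally show ?case by simp
qed simp

section \<open>Density of test functions\<close>

lemma cls_tendsto_dominated:
  fixes f :: "nat \<Rightarrow> 'a::euclidean_space \<Rightarrow> real"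
  assumes f: "\<And>n. f n \<in> L2_space unit_cube" and g: "g \<in> L2_space unit_cube"
    and lim: "AE x in cube_measure. (\<lambda>n. f n x) \<longlonglongrightarrow> g x"
    and w: "integrable cube_measure w" "\<And>n. AE x in cube_measure. (f n x - g x)\<^sup>2 \<le> w x"
  shows "(\<lambda>n. cls (f n)) \<longlonglongrightarrow> cls g"
proof -
  have "(\<lambda>n. integral\<^sup>L cube_measure (\<lambda>x. (f n x - g x)\<^sup>2)) \<longlonglongrightarrow> integral\<^sup>L cube_measure (\<lambda>x::'a. 0)"
  proof (rule integral_dominated_convergence[where w=w])
    show "(\<lambda>x. (f n x - g x)\<^sup>2) \<in> borel_measurable cube_measure" for n
      using L2_spaceD(1)[OF f[of n]] L2_spaceD(1)[OF g] by measurable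
    show "AE x in cube_measure. (\<lambda>n. (f n x - g x)\<^sup>2) \<longlonglongrightarrow> 0"
      using lim
    proof (rule AE_mp, intro AE_I2 impI)
      fix x assume "(\<lambda>n. f n x) \<longlonglongrightarrow> g x"
      then have "(\<lambda>n. (f n x - g x)\<^sup>2) \<longlonglongrightarrow> (g x - g x)\<^sup>2" by (intro tendsto_intros)
      then show "(\<lambda>n. (f n x - g x)\<^sup>2) \<longlonglongrightarrow> 0" by simp
    qed
  qed (use w in auto)
  moreover have "integral\<^sup>L cube_measure (\<lambda>x. (f n x - g x)\<^sup>2) = (norm (cls (f n) - cls g))\<^sup>2" for n
  proof -
    have "(norm (cls (f n) - cls g))\<^sup>2 = ip (\<lambda>x. f n x - g x) (\<lambda>x. f n x - g x)"
      using f[of n] g by (simp add: cls_diff[symmetric] power2_norm_eq_inner inner_cls L2_space_diff)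
    then show ?thesis by (simp add: L2_inner_def power2_eq_square)
  qed
  ultimately have "(\<lambda>n. (norm (cls (f n) - cls g))\<^sup>2) \<longlonglongrightarrow> 0" by simp
  then have "(\<lambda>n. sqrt ((norm (cls (f n) - cls g))\<^sup>2)) \<longlonglongrightarrow> sqrt 0" by (intro tendsto_intros)
  then have "(\<lambda>n. norm (cls (f n) - cls g)) \<longlonglongrightarrow> 0" by simp
  then show ?thesis
    by (simp add: LIM_zero_iff tendsto_norm_zero_iff)
qed

lemma subspace_closure:
  fixes S :: "'v::real_normed_vector set"
  assumes "subspace S" shows "subspace (closure S)"
  unfolding subspace_def
proof (intro conjI ballI allI)
  show "0 \<in> closure S" using assms subspace_0 closure_subset by blast
  fix x y :: 'v and c :: real assume x: "x \<in> closure S"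
  obtain f where f: "\<And>n. f n \<in> S" "f \<longlonglongrightarrow> x" using x unfolding closure_sequential by blast
  show "c *\<^sub>R x \<in> closure S" unfolding closure_sequential
    using f assms by (intro exI[of _ "\<lambda>n. c *\<^sub>R f n"]) (auto intro!: tendsto_intros subspace_scale)
  assume y: "y \<in> closure S"
  obtain g where g: "\<And>n. g n \<in> S" "g \<longlonglongrightarrow> y" using y unfolding closure_sequential by blast
  show "x + y \<in> closure S" unfolding closure_sequential
    using f g assms by (intro exI[of _ "\<lambda>n. f n + g n"]) (auto intro!: tendsto_intros subspace_add)
qed

lemma closure_tendsto: "(\<And>n. f n \<in> closure S) \<Longrightarrow> f \<longlonglongrightarrow> x \<Longrightarrow> x \<in> closure S"
  for S :: "'v::metric_space set"
  by (metis closed_closure closed_sequentially)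

lemma subspace_tests: "subspace (cls ` (tests :: ('a::euclidean_space \<Rightarrow> real) set))"
  unfolding subspace_def
proof (intro conjI ballI allI)
  show "0 \<in> cls ` (tests :: ('a \<Rightarrow> real) set)"
    using test_functions_zero cls_zero by (metis image_eqI)
  fix x y :: "'a l2" and c :: real
  assume "x \<in> cls ` tests"
  then obtain f where f: "f \<in> tests" "x = cls f" by auto
  show "c *\<^sub>R x \<in> cls ` tests"
    using f test_functions_scale[OF f(1), of c] by (metis cls_scale test_L2 image_eqI)
  assume "y \<in> cls ` tests"
  then obtain g where g: "g \<in> tests" "y = cls g" by auto
  show "x + y \<in> cls ` tests"
  proof (rule image_eqI)
    show "x + y = cls (\<lambda>z. f z + g z)" using f g by (simp add: cls_add test_L2)
  qed (rule test_functions_add[OF f(1) g(1)])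
qed

abbreviation "test_closure \<equiv> closure (cls ` tests)"

lemma subspace_test_closure: "subspace test_closure"
  by (rule subspace_closure[OF subspace_tests])

lemma L2_bounded:
  fixes f :: "'a::euclidean_space \<Rightarrow> real"
  assumes [measurable]: "f \<in> borel_measurable cube_measure"
    and "\<And>x. x \<in> unit_cube \<Longrightarrow> \<bar>f x\<bar> \<le> B"
  shows "f \<in> L2_space unit_cube"
proof -
  have "(\<lambda>x. 1) \<in> L2_space (unit_cube :: 'a set)"
    by (simp add: L2_space_def finite_measure.integrable_const finite_measure_cube)
  then have "(\<lambda>x. f x * 1) \<in> L2_space unit_cube"
    by (rule L2_space_mult_bounded) (use assms in auto)
  then show ?thesis by simp
qed

lemma L2_indicator: "A \<in> sets lebesgue \<Longrightarrow> (indicator A :: 'a::euclidean_space \<Rightarrow> real) \<in> L2_space unit_cube"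
  by (rule L2_bounded[where B=1])
     (auto intro!: borel_measurable_indicator measurable_restrict_space1 simp: indicator_def)

lemma cls_tendsto_bounded:
  fixes f :: "nat \<Rightarrow> 'a::euclidean_space \<Rightarrow> real"
  assumes f: "\<And>n. f n \<in> L2_space unit_cube" and g: "g \<in> L2_space unit_cube"
    and lim: "\<And>x. x \<in> unit_cube \<Longrightarrow> (\<lambda>n. f n x) \<longlonglongrightarrow> g x"
    and 01: "\<And>n x. x \<in> unit_cube \<Longrightarrow> 0 \<le> f n x \<and> f n x \<le> 1" "\<And>x. x \<in> unit_cube \<Longrightarrow> 0 \<le> g x \<and> g x \<le> 1"
  shows "(\<lambda>n. cls (f n)) \<longlonglongrightarrow> cls g"
proof (rule cls_tendsto_dominated[OF f g, where w="\<lambda>_. 1"])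
  show "integrable (cube_measure :: 'a measure) (\<lambda>_. 1 :: real)"
    by (simp add: finite_measure.integrable_const finite_measure_cube)
  have "(f n x - g x)\<^sup>2 \<le> 1" if "x \<in> unit_cube" for n x
    using 01(1)[OF that, of n] 01(2)[OF that] by (simp add: abs_square_le_1 abs_le_iff)
  then show "AE x in cube_measure. (f n x - g x)\<^sup>2 \<le> 1" for n
    by (intro AE_I2) auto
qed (use lim in auto)

text \<open>A bump is a test function only if its closed box lies inside the open cube. The box is
  therefore first shrunk by \<open>s n\<close> on all sides, bumps exhaust the shrunken box, and
  then \<open>s n\<close> tends to 0.\<close>

lemma indicator_box_in_test_closure:
  fixes a b :: "'a::euclidean_space"
  shows "cls (indicator (box a b \<inter> unit_cube)) \<in> test_closure"
proof -
  obtain e f :: 'a where ef: "box a b \<inter> unit_cube = box e f"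
    using box_Int_box[of a b 0 One] by blast
  define s :: "nat \<Rightarrow> real" where "s n = inverse (real (Suc n))" for n
  have s: "s n > 0" for n by (simp add: s_def)
  have s0: "s \<longlonglongrightarrow> 0" unfolding s_def by (rule LIMSEQ_inverse_real_of_nat)
  let ?E = "\<lambda>n. box (e + s n *\<^sub>R One) (f - s n *\<^sub>R One)"
  have in': "cls (indicator (?E n)) \<in> test_closure" for n
  proof (rule closure_tendsto)
    have "cbox (e + s n *\<^sub>R One) (f - s n *\<^sub>R One) \<subseteq> box e f"
      using s[of n] by (auto simp: mem_box inner_add_left inner_diff_left) (smt (verit) s)+
    then have bt: "bump (e + s n *\<^sub>R One) (f - s n *\<^sub>R One) k \<in> tests" for k
      using ef by (intro bump_test) auto
    then show "cls (bump (e + s n *\<^sub>R One) (f - s n *\<^sub>R One) k) \<in> test_closure" for k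
      using closure_subset by blast
    show "(\<lambda>k. cls (bump (e + s n *\<^sub>R One) (f - s n *\<^sub>R One) k)) \<longlonglongrightarrow> cls (indicator (?E n))"
      by (rule cls_tendsto_bounded) (use bt test_L2 bump_bounds bump_tendsto in \<open>auto intro!: L2_indicator\<close>)
  qed
  have lim: "(\<lambda>n. cls (indicator (?E n))) \<longlonglongrightarrow> cls (indicator (box e f))"
  proof (rule cls_tendsto_bounded)
    fix x :: 'a
    show "(\<lambda>n. indicator (?E n) x :: real) \<longlonglongrightarrow> indicator (box e f) x"
    proof (cases "x \<in> box e f")
      case True
      have "\<forall>\<^sub>F n in sequentially. \<forall>i\<in>Basis. s n < x \<bullet> i - e \<bullet> i \<and> s n < f \<bullet> i - x \<bullet> i"
        using True by (intro eventually_ball_finite ballI eventually_conj order_tendstoD[OF s0]) (auto simp: mem_box)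
      then have "\<forall>\<^sub>F n in sequentially. indicator (?E n) x = (1::real)"
        by eventually_elim (auto simp: indicator_def mem_box inner_add_left inner_diff_left algebra_simps)
      then show ?thesis using True by (simp add: tendsto_eventually)
    next
      case False
      then have "x \<notin> ?E n" for n
        using s[of n] by (auto simp: mem_box inner_add_left inner_diff_left) (smt (verit))+
      then show ?thesis using False by simp
    qed
  qed (auto intro!: L2_indicator simp: indicator_def)
  show ?thesis unfolding ef by (rule closure_tendsto[OF in' lim])
qed

text \<open>Dynkin's argument: boxes are stable under intersection and generate the Borel sets, and
  the sets in question are closed under complements within the cube and under disjoint
  unions.\<close>

lemma indicator_in_test_closure:
  fixes A :: "'a::euclidean_space set"
  assumes "A \<in> sets borel"
  shows "cls (indicator (A \<inter> unit_cube)) \<in> test_closure"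
proof -
  let ?G = "range (\<lambda>(a, b). box a b :: 'a set)"
  have A: "A \<in> sigma_sets UNIV ?G" using assms by (simp add: borel_eq_box)
  have Int: "Int_stable ?G"
  proof (rule Int_stableI)
    fix A B assume "A \<in> ?G" "B \<in> ?G"
    then obtain a b c d where "A = box a b" "B = box c d" by auto
    then show "A \<inter> B \<in> ?G" by (auto simp: box_Int_box)
  qed
  have bor: "B \<in> sets borel" if "B \<in> sigma_sets UNIV ?G" for B using that by (simp add: borel_eq_box)
  show ?thesis
    using Int _ A
  proof (rule sigma_sets_induct_disjoint)
    show "?G \<subseteq> Pow UNIV" by simp
    show "cls (indicator (B \<inter> unit_cube)) \<in> test_closure" if "B \<in> ?G" for B
      using that indicator_box_in_test_closure by auto
    have "(indicator ({} \<inter> unit_cube) :: 'a \<Rightarrow> real) = (\<lambda>x. 0)" by auto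
    then show "cls (indicator ({} \<inter> unit_cube) :: 'a \<Rightarrow> real) \<in> test_closure"
      using subspace_0[OF subspace_test_closure] by (simp only: cls_zero)
    show "cls (indicator ((UNIV - B) \<inter> unit_cube)) \<in> test_closure"
      if B: "B \<in> sigma_sets UNIV ?G" "cls (indicator (B \<inter> unit_cube)) \<in> test_closure" for B
    proof -
      have "(indicator ((UNIV - B) \<inter> unit_cube) :: 'a \<Rightarrow> real) =
          (\<lambda>x. indicator (box 0 One \<inter> unit_cube) x - indicator (B \<inter> unit_cube) x)"
        by (auto simp: indicator_def fun_eq_iff)
      then have "cls (indicator ((UNIV - B) \<inter> unit_cube) :: 'a \<Rightarrow> real) =
          cls (indicator (box 0 One \<inter> unit_cube)) - cls (indicator (B \<inter> unit_cube))"
        using bor[OF B(1)] by (simp only:) (intro cls_diff L2_indicator; auto)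
      then show ?thesis
        using subspace_diff[OF subspace_test_closure indicator_box_in_test_closure[of 0 One] B(2)] by simp
    qed
    fix B :: "nat \<Rightarrow> 'a set"
    assume dis: "disjoint_family B" and B: "range B \<subseteq> sigma_sets UNIV ?G"
      and IH: "\<And>i. cls (indicator (B i \<inter> unit_cube)) \<in> test_closure"
    have Bb: "B i \<in> sets borel" for i using B bor by auto
    let ?S = "\<lambda>n x. \<Sum>i<n. indicator (B i \<inter> unit_cube) x :: real"
    \<comment> \<open>Disjointness turns the partial sums into indicators; they stay in [0, 1],
      which is the domination needed for the limit.\<close>
    have eq: "?S n x = indicator ((\<Union>i<n. B i) \<inter> unit_cube) x" for n x
    proof -
      have "(\<Union>i<n. B i) \<inter> unit_cube = (\<Union>i\<in>{..<n}. B i \<inter> unit_cube)" by auto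
      moreover have "disjoint_family_on (\<lambda>i. B i \<inter> unit_cube) {..<n}"
        using dis by (auto simp: disjoint_family_on_def)
      ultimately show ?thesis by (simp only: indicator_UN_disjoint finite_lessThan)
    qed
    have lim: "(\<lambda>n. cls (?S n)) \<longlonglongrightarrow> cls (indicator ((\<Union>i. B i) \<inter> unit_cube))"
    proof (rule cls_tendsto_bounded)
      show "?S n \<in> L2_space unit_cube" for n
        using Bb by (intro L2_space_sum L2_indicator) auto
      show "indicator ((\<Union>i. B i) \<inter> unit_cube) \<in> L2_space unit_cube"
        using Bb by (intro L2_indicator) auto
      show "(\<lambda>n. ?S n x) \<longlonglongrightarrow> indicator ((\<Union>i. B i) \<inter> unit_cube) x" for x
      proof (cases "x \<in> (\<Union>i. B i) \<inter> unit_cube")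
        case True
        then obtain k where k: "x \<in> B k" by auto
        have "\<forall>\<^sub>F n in sequentially. ?S n x = 1"
          using eventually_gt_at_top[of k] by eventually_elim (subst eq, use k True in \<open>auto simp: indicator_def\<close>)
        then show ?thesis using True by (simp add: tendsto_eventually)
      next
        case False
        then have "?S n x = 0" for n unfolding eq by (auto simp: indicator_def)
        then show ?thesis using False by simp
      qed
    next
      show "0 \<le> ?S n x \<and> ?S n x \<le> 1" for n x unfolding eq by simp
    qed simp
    have "cls (?S n) \<in> test_closure" for n
    proof -
      have "cls (?S n) = (\<Sum>i<n. cls (indicator (B i \<inter> unit_cube)))"
        using Bb by (intro cls_sum L2_indicator) auto
      then show ?thesis using IH by (simp add: subspace_sum subspace_test_closure)
    qed
    then show "cls (indicator ((\<Union>i. B i) \<inter> unit_cube)) \<in> test_closure"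
      by (rule closure_tendsto[OF _ lim])
  qed
qed

lemma simple_in_test_closure:
  fixes f :: "'a::euclidean_space \<Rightarrow> real"
  assumes "simple_function borel f"
  shows "cls (\<lambda>x. indicator unit_cube x * f x) \<in> test_closure" (is "?A")
    and "(\<lambda>x. indicator unit_cube x * f x) \<in> L2_space unit_cube" (is "?B")
proof -
  have fin: "finite (range f)" and sets: "\<And>y. f -` {y} \<in> sets borel"
    using simple_functionD[OF assms] by auto
  have eq: "(\<lambda>x. indicator unit_cube x * f x) = (\<lambda>x. \<Sum>y\<in>range f. y * indicator (f -` {y} \<inter> unit_cube) x)"
  proof
    fix x
    have "(\<Sum>y\<in>range f. y * indicator (f -` {y} \<inter> unit_cube) x) = (\<Sum>y\<in>range f. if y = f x then y * indicator unit_cube x else 0)"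
      by (intro sum.cong) (auto simp: indicator_def)
    then show "indicator unit_cube x * f x = (\<Sum>y\<in>range f. y * indicator (f -` {y} \<inter> unit_cube) x)"
      using fin by (simp add: mult.commute)
  qed
  have L: "(indicator (f -` {y} \<inter> unit_cube) :: 'a \<Rightarrow> real) \<in> L2_space unit_cube" for y
    using sets by (intro L2_indicator) auto
  show ?B unfolding eq by (intro L2_space_sum L2_space_scale L)
  have "cls (\<lambda>x. indicator unit_cube x * f x) = (\<Sum>y\<in>range f. y *\<^sub>R cls (indicator (f -` {y} \<inter> unit_cube)))"
    unfolding eq by (subst cls_sum) (auto intro!: L2_space_scale L sum.cong cls_scale)
  then show ?A
    using sets by (auto intro!: subspace_sum subspace_scale subspace_test_closure indicator_in_test_closure)
qed

text \<open>After a square integrable function is replaced by a Borel representative, it is a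
  dominated limit of simple functions, each of which is a combination of indicators of Borel
  sets.\<close>

theorem tests_dense: "x \<in> test_closure" for x :: "'a::euclidean_space l2"
proof -
  obtain f where f: "f \<in> L2_space unit_cube" "x = cls f" by (rule l2_cases)
  have "(\<lambda>x. if x \<in> unit_cube then f x else 0) \<in> borel_measurable lebesgue"
    using L2_spaceD(1)[OF f(1)] by (simp add: borel_measurable_if)
  then obtain g where g: "g \<in> borel_measurable lborel"
      "AE x in lborel. (if x \<in> unit_cube then f x else 0) = g x"
    using completion_ex_borel_measurable_real by blast
  have "AE x in lebesgue. (if x \<in> unit_cube then f x else 0) = g x"
    using g(2) by (rule AE_completion)
  then have fg: "AE x in cube_measure. f x = g x"
    by (subst AE_restrict_space_iff) (auto elim: AE_mp)
  have gL: "g \<in> L2_space unit_cube"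
  proof -
    have [measurable]: "g \<in> borel_measurable cube_measure"
      using g(1) by (intro measurable_restrict_space1 measurable_completion) simp
    have [measurable]: "f \<in> borel_measurable cube_measure" by (rule L2_spaceD(1)[OF f(1)])
    have "integrable cube_measure (\<lambda>x. (g x)\<^sup>2)"
      using L2_spaceD(2)[OF f(1)] by (rule integrable_cong_AE_imp) (use fg in \<open>auto elim: AE_mp\<close>)
    then show ?thesis by (simp add: L2_space_def)
  qed
  have x: "x = cls g" unfolding f(2) by (subst cls_eq_iff[OF f(1) gL]) (rule fg)
  have "g \<in> borel_measurable borel" using g(1) by simp
  from borel_measurable_implies_sequence_metric[OF this, of 0]
  obtain F where F: "\<And>i. simple_function borel (F i)" "\<And>x. (\<lambda>i. F i x) \<longlonglongrightarrow> g x"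
    "\<And>i x. \<bar>F i x\<bar> \<le> 2 * \<bar>g x\<bar>"
    by (auto simp: dist_real_def)
  \<comment> \<open>The simple functions satisfy |F| at most 2 |g|, hence |F - g| is at most 3 |g|;
    this is the 9 in the dominating function.\<close>
  have lim: "(\<lambda>i. cls (\<lambda>x. indicator unit_cube x * F i x)) \<longlonglongrightarrow> cls g"
  proof (rule cls_tendsto_dominated[where w="\<lambda>x. 9 * (g x)\<^sup>2"])
    show "AE x in cube_measure. (\<lambda>n. indicator unit_cube x * F n x) \<longlonglongrightarrow> g x"
      by (rule AE_I2) (use F(2) in auto)
    show "AE x in cube_measure. (indicator unit_cube x * F n x - g x)\<^sup>2 \<le> 9 * (g x)\<^sup>2" for n
    proof (rule AE_I2)
      fix x :: 'a assume "x \<in> space cube_measure"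
      moreover have "\<bar>F n x - g x\<bar> \<le> 3 * \<bar>g x\<bar>" using F(3)[of n x] by linarith
      then have "(F n x - g x)\<^sup>2 \<le> (3 * \<bar>g x\<bar>)\<^sup>2" by (metis abs_ge_zero power2_abs power_mono)
      ultimately show "(indicator unit_cube x * F n x - g x)\<^sup>2 \<le> 9 * (g x)\<^sup>2"
        by (simp add: power_mult_distrib)
    qed
  qed (use gL simple_in_test_closure(2)[OF F(1)] L2_spaceD(2)[OF gL] in auto)
  show ?thesis unfolding x
    by (rule closure_tendsto[OF _ lim]) (rule simple_in_test_closure(1)[OF F(1)])
qed

lemma tests_dense_seq:
  obtains \<phi> where "\<And>n. \<phi> n \<in> tests" "(\<lambda>n. cls (\<phi> n)) \<longlonglongrightarrow> x"
proof -
  obtain y where y: "\<And>n. y n \<in> cls ` tests" "y \<longlonglongrightarrow> x"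
    using tests_dense[of x] unfolding closure_sequential by blast
  have "\<exists>\<phi>\<in>tests. y n = cls \<phi>" for n using y(1)[of n] by auto
  then obtain \<phi> where \<phi>: "\<And>n. \<phi> n \<in> tests" "\<And>n. y n = cls (\<phi> n)" by metis
  then have "y = (\<lambda>n. cls (\<phi> n))" by auto
  with y(2) \<phi>(1) show thesis by (auto intro: that)
qed

text \<open>By density the bound extends to the pairing of \<open>x\<close> with itself.\<close>

lemma norm_le_by_tests:
  assumes "\<And>\<phi>. \<phi> \<in> tests \<Longrightarrow> \<bar>inner x (cls \<phi>)\<bar> \<le> M * norm (cls \<phi>)" "M \<ge> 0"
  shows "norm x \<le> M"
proof -
  obtain \<phi> where \<phi>: "\<And>n. \<phi> n \<in> tests" "(\<lambda>n. cls (\<phi> n)) \<longlonglongrightarrow> x"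
    by (rule tests_dense_seq[of x]) blast
  have "\<bar>inner x x\<bar> \<le> M * norm x"
  proof (rule LIMSEQ_le)
    show "(\<lambda>n. \<bar>inner x (cls (\<phi> n))\<bar>) \<longlonglongrightarrow> \<bar>inner x x\<bar>" by (intro tendsto_intros \<phi>)
    show "(\<lambda>n. M * norm (cls (\<phi> n))) \<longlonglongrightarrow> M * norm x" by (intro tendsto_intros \<phi>)
  qed (use assms \<phi> in auto)
  then have "norm x * norm x \<le> M * norm x" by (simp add: power2_norm_eq_inner[symmetric] power2_eq_square)
  then show ?thesis using assms(2) by (cases "norm x = 0") (auto simp: mult_le_cancel_right)
qed

lemma eq_0_by_tests:
  assumes "\<And>\<phi>. \<phi> \<in> tests \<Longrightarrow> inner x (cls \<phi>) = 0" shows "x = 0"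
  using norm_le_by_tests[of x 0] assms by auto

section \<open>Weak derivatives and Sobolev norms on classes\<close>

definition has_d :: "'a::euclidean_space list \<Rightarrow> 'a l2 \<Rightarrow> 'a l2 \<Rightarrow> bool" where
  "has_d \<alpha> x g \<longleftrightarrow>
     (\<forall>\<phi>\<in>tests. inner x (cls (iter_partial \<alpha> \<phi>)) = (-1) ^ length \<alpha> * inner g (cls \<phi>))"

text \<open>The choice hidden in \<open>weak_deriv\<close> is harmless: test functions are dense, so
  the class of a weak derivative is unique. Where no derivative exists the value is unspecified,
  which is why linearity of \<open>dx\<close> holds on \<open>sob m\<close> only.\<close>

definition dx :: "'a::euclidean_space list \<Rightarrow> 'a l2 \<Rightarrow> 'a l2" where
  "dx \<alpha> x = cls (wd \<alpha> (rep_l2 x))"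

definition indices :: "nat \<Rightarrow> 'a::euclidean_space list set" where
  "indices m = {\<alpha>. set \<alpha> \<subseteq> Basis \<and> length \<alpha> \<le> m}"

definition sob :: "nat \<Rightarrow> 'a::euclidean_space l2 set" where
  "sob m = {x. \<forall>\<alpha>\<in>indices m. \<exists>g. has_d \<alpha> x g}"

lemma finite_indices: "finite (indices m)"
  using finite_lists_length_le[OF finite_Basis, of m] by (simp add: indices_def)

lemma indices_basis: "\<alpha> \<in> indices m \<Longrightarrow> set \<alpha> \<subseteq> Basis"
  by (simp add: indices_def)

lemma iter_partial_test_L2:
  "\<phi> \<in> tests \<Longrightarrow> set \<alpha> \<subseteq> Basis \<Longrightarrow> iter_partial \<alpha> \<phi> \<in> L2_space unit_cube"
  by (intro test_L2 test_functions_iter_partial)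

lemma is_weak_deriv_iff:
  assumes "u \<in> L2_space unit_cube" "g \<in> L2_space unit_cube" "set \<alpha> \<subseteq> Basis"
  shows "is_weak_deriv unit_cube \<alpha> u g \<longleftrightarrow> has_d \<alpha> (cls u) (cls g)"
  using assms by (auto simp: is_weak_deriv_def has_d_def inner_cls iter_partial_test_L2 test_L2)

lemma has_d_unique:
  assumes "has_d \<alpha> x g" "has_d \<alpha> x h" shows "g = h"
proof -
  have "inner (g - h) (cls \<phi>) = 0" if "\<phi> \<in> tests" for \<phi>
    using assms that unfolding has_d_def by (fastforce simp: inner_diff_left)
  then have "g - h = 0" by (rule eq_0_by_tests)
  then show ?thesis by simp
qed

lemma weak_deriv_cls:
  assumes "u \<in> L2_space unit_cube" "set \<alpha> \<subseteq> Basis" "has_d \<alpha> (cls u) g"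
  shows "wd \<alpha> u \<in> L2_space unit_cube" "cls (wd \<alpha> u) = g"
proof -
  have "\<exists>h. h \<in> L2_space unit_cube \<and> is_weak_deriv unit_cube \<alpha> u h"
    using assms is_weak_deriv_iff[OF assms(1) rep_l2_mem[of g] assms(2)]
    by (intro exI[of _ "rep_l2 g"]) (auto simp: rep_l2_mem cls_rep)
  then have *: "wd \<alpha> u \<in> L2_space unit_cube \<and> is_weak_deriv unit_cube \<alpha> u (wd \<alpha> u)"
    unfolding weak_deriv_def by (rule someI_ex)
  then show "wd \<alpha> u \<in> L2_space unit_cube" by simp
  have "has_d \<alpha> (cls u) (cls (wd \<alpha> u))"
    using * is_weak_deriv_iff[OF assms(1) _ assms(2)] by blast
  then show "cls (wd \<alpha> u) = g" by (rule has_d_unique) (rule assms(3))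
qed

lemma dx_eqI: "has_d \<alpha> x g \<Longrightarrow> set \<alpha> \<subseteq> Basis \<Longrightarrow> dx \<alpha> x = g"
  using weak_deriv_cls(2)[of "rep_l2 x" \<alpha> g] by (simp add: dx_def rep_l2_mem cls_rep)

lemma sob_has_d: "x \<in> sob m \<Longrightarrow> \<alpha> \<in> indices m \<Longrightarrow> has_d \<alpha> x (dx \<alpha> x)"
  unfolding sob_def using dx_eqI indices_basis by blast

lemma multi_indices_indices: "\<alpha> \<in> multi_indices k \<Longrightarrow> k \<le> m \<Longrightarrow> \<alpha> \<in> indices m"
  by (auto simp: multi_indices_def indices_def)

lemma sobolev_space_iff:
  assumes "u \<in> L2_space unit_cube"
  shows "u \<in> sobolev_space unit_cube m \<longleftrightarrow> cls u \<in> sob m"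
proof
  assume u: "u \<in> sobolev_space unit_cube m"
  show "cls u \<in> sob m" unfolding sob_def
  proof (intro CollectI ballI)
    fix \<alpha> :: "'a list" assume \<alpha>: "\<alpha> \<in> indices m"
    then have "\<alpha> \<in> multi_indices (length \<alpha>)" "length \<alpha> \<le> m"
      by (auto simp: indices_def multi_indices_def)
    with u obtain g where "g \<in> L2_space unit_cube" "is_weak_deriv unit_cube \<alpha> u g"
      unfolding sobolev_space_def by blast
    then show "\<exists>g. has_d \<alpha> (cls u) g"
      using is_weak_deriv_iff assms indices_basis[OF \<alpha>] by blast
  qed
next
  assume u: "cls u \<in> sob m"
  show "u \<in> sobolev_space unit_cube m" unfolding sobolev_space_def
  proof (intro CollectI conjI allI impI ballI assms)
    fix k \<alpha> assume "k \<le> m" "\<alpha> \<in> (multi_indices k :: 'a list set)"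
    then have \<alpha>: "\<alpha> \<in> indices m" by (auto intro: multi_indices_indices)
    with u obtain g where "has_d \<alpha> (cls u) g" unfolding sob_def by blast
    then show "\<exists>g\<in>L2_space unit_cube. is_weak_deriv unit_cube \<alpha> u g"
      by (intro bexI[of _ "rep_l2 g"]) (auto simp: is_weak_deriv_iff assms rep_l2_mem cls_rep indices_basis[OF \<alpha>])
  qed
qed

lemma sobolev_space_L2: "u \<in> sobolev_space S m \<Longrightarrow> u \<in> L2_space S"
  by (simp add: sobolev_space_def)

lemma sobolev_space_sob: "u \<in> sobolev_space unit_cube m \<Longrightarrow> cls u \<in> sob m"
  using sobolev_space_iff sobolev_space_L2 by blast

lemma sobolev_wd:
  assumes "u \<in> sobolev_space unit_cube m" "\<alpha> \<in> indices m"
  shows "wd \<alpha> u \<in> L2_space unit_cube" "cls (wd \<alpha> u) = dx \<alpha> (cls u)"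
  using weak_deriv_cls[OF sobolev_space_L2[OF assms(1)] indices_basis[OF assms(2)]
      sob_has_d[OF sobolev_space_sob[OF assms(1)] assms(2)]] by auto

lemma has_d_add: "has_d \<alpha> x g \<Longrightarrow> has_d \<alpha> y h \<Longrightarrow> has_d \<alpha> (x + y) (g + h)"
  by (auto simp: has_d_def inner_add_left algebra_simps)

lemma has_d_scale: "has_d \<alpha> x g \<Longrightarrow> has_d \<alpha> (c *\<^sub>R x) (c *\<^sub>R g)"
  by (auto simp: has_d_def)

lemma has_d_zero: "has_d \<alpha> 0 0" by (simp add: has_d_def)

lemma subspace_sob: "subspace (sob m)"
  unfolding subspace_def
proof (intro conjI ballI allI)
  show "0 \<in> sob m" using has_d_zero by (auto simp: sob_def)
  show "x + y \<in> sob m" if "x \<in> sob m" "y \<in> sob m" for x y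
    using that has_d_add unfolding sob_def by blast
  show "c *\<^sub>R x \<in> sob m" if "x \<in> sob m" for c x
    using that has_d_scale unfolding sob_def by blast
qed

lemma dx_add: "x \<in> sob m \<Longrightarrow> y \<in> sob m \<Longrightarrow> \<alpha> \<in> indices m \<Longrightarrow> dx \<alpha> (x + y) = dx \<alpha> x + dx \<alpha> y"
  by (intro dx_eqI has_d_add sob_has_d) (auto simp: indices_basis)

lemma dx_scale: "x \<in> sob m \<Longrightarrow> \<alpha> \<in> indices m \<Longrightarrow> dx \<alpha> (c *\<^sub>R x) = c *\<^sub>R dx \<alpha> x"
  by (intro dx_eqI has_d_scale sob_has_d) (auto simp: indices_basis)

lemma dx_diff:
  assumes "x \<in> sob m" "y \<in> sob m" "\<alpha> \<in> indices m"
  shows "dx \<alpha> (x - y) = dx \<alpha> x - dx \<alpha> y"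
  using dx_add[of x m "(-1) *\<^sub>R y" \<alpha>] dx_scale[of y m \<alpha> "-1"] assms
    subspace_scale[OF subspace_sob, of y m "-1"] by simp

lemma sob_mono: "m \<le> n \<Longrightarrow> sob n \<subseteq> sob m"
  by (auto simp: sob_def indices_def)

lemma dx_Nil: "dx [] x = x"
  by (rule dx_eqI) (auto simp: has_d_def)

definition snorm :: "nat \<Rightarrow> 'a::euclidean_space l2 \<Rightarrow> real" where
  "snorm k x = sqrt (\<Sum>\<alpha>\<in>multi_indices k. (norm (dx \<alpha> x))\<^sup>2)"

text \<open>Written as an \<open>L2_set\<close> so that the triangle inequality is Minkowski's
  inequality for finite sums.\<close>

definition hnorm :: "nat \<Rightarrow> 'a::euclidean_space l2 \<Rightarrow> real" where
  "hnorm m x = L2_set (\<lambda>\<alpha>. norm (dx \<alpha> x)) (indices m)"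

lemma sobolev_seminorm_eq:
  assumes "u \<in> sobolev_space unit_cube m" "k \<le> m"
  shows "sobolev_seminorm unit_cube k u = snorm k (cls u)"
proof -
  have "L2_norm unit_cube (wd \<alpha> u) = norm (dx \<alpha> (cls u))" if "\<alpha> \<in> multi_indices k" for \<alpha>
    using sobolev_wd[OF assms(1) multi_indices_indices[OF that assms(2)]] by (simp add: norm_cls[symmetric])
  then show ?thesis by (simp add: sobolev_seminorm_def snorm_def)
qed

lemma multi_indices_finite: "finite (multi_indices k)"
  using finite_lists_length_eq[OF finite_Basis, of k] by (simp add: multi_indices_def)

lemma indices_UN: "indices m = (\<Union>k\<le>m. multi_indices k)"
  by (auto simp: indices_def multi_indices_def)

lemma hnorm_eq: "hnorm m x = sqrt (\<Sum>k\<le>m. (snorm k x)\<^sup>2)"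
proof -
  have "(\<Sum>\<alpha>\<in>indices m. (norm (dx \<alpha> x))\<^sup>2) = (\<Sum>k\<le>m. \<Sum>\<alpha>\<in>multi_indices k. (norm (dx \<alpha> x))\<^sup>2)"
    unfolding indices_UN
    by (rule sum.UNION_disjoint) (auto simp: multi_indices_finite, auto simp: multi_indices_def)
  then show ?thesis by (simp add: hnorm_def L2_set_def snorm_def sum_nonneg)
qed

lemma sobolev_norm_eq:
  assumes "u \<in> sobolev_space unit_cube m"
  shows "sobolev_norm unit_cube m u = hnorm m (cls u)"
  unfolding hnorm_eq sobolev_norm_def using sobolev_seminorm_eq[OF assms] by simp

lemma hnorm_nonneg: "0 \<le> hnorm m x" by (simp add: hnorm_def)

lemma norm_dx_le_hnorm: "\<alpha> \<in> indices m \<Longrightarrow> norm (dx \<alpha> x) \<le> hnorm m x"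
  unfolding hnorm_def by (rule member_le_L2_set[OF finite_indices])

lemma hnorm_triangle:
  assumes "x \<in> sob m" "y \<in> sob m"
  shows "hnorm m (x + y) \<le> hnorm m x + hnorm m y"
proof -
  have "hnorm m (x + y) \<le> L2_set (\<lambda>\<alpha>. norm (dx \<alpha> x) + norm (dx \<alpha> y)) (indices m)"
    unfolding hnorm_def by (rule L2_set_mono) (auto simp: dx_add[OF assms] norm_triangle_ineq)
  also have "\<dots> \<le> hnorm m x + hnorm m y"
    unfolding hnorm_def by (rule L2_set_triangle_ineq)
  finally show ?thesis .
qed

lemma hnorm_minus: "x \<in> sob m \<Longrightarrow> y \<in> sob m \<Longrightarrow> hnorm m (x - y) = hnorm m (y - x)"
  unfolding hnorm_def by (rule L2_set_cong) (auto simp: dx_diff norm_minus_commute)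

lemma snorm_le_hnorm: "k \<le> m \<Longrightarrow> snorm k x \<le> hnorm m x"
  unfolding hnorm_eq by (rule real_le_rsqrt) (auto intro!: member_le_sum[of k "{..m}" "\<lambda>k. (snorm k x)\<^sup>2"])

lemma snorm_nonneg: "0 \<le> snorm k x"
  by (simp add: snorm_def sum_nonneg)

section \<open>The energy space\<close>

text \<open>This is \<open>V_space\<close> on classes. Convergence in H^2 is spelled out derivative
  by derivative, because the identities below pass to the limit in single derivatives.\<close>

definition VV :: "'a::euclidean_space l2 set" where
  "VV = {x \<in> sob 2. \<exists>\<phi>. (\<forall>k. \<phi> k \<in> tests) \<and>
     (\<forall>\<alpha>\<in>indices 2. (\<lambda>k. cls (iter_partial \<alpha> (\<phi> k))) \<longlonglongrightarrow> dx \<alpha> x)}"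

lemma has_d_test:
  assumes "\<phi> \<in> tests" "set \<alpha> \<subseteq> Basis" shows "has_d \<alpha> (cls \<phi>) (cls (iter_partial \<alpha> \<phi>))"
  unfolding has_d_def using assms
  by (auto simp: inner_cls iter_partial_test_L2 test_L2 ip_iter_partial)

lemma dx_test: "\<phi> \<in> tests \<Longrightarrow> set \<alpha> \<subseteq> Basis \<Longrightarrow> dx \<alpha> (cls \<phi>) = cls (iter_partial \<alpha> \<phi>)"
  by (rule dx_eqI[OF has_d_test])

lemma test_sob: "\<phi> \<in> tests \<Longrightarrow> cls \<phi> \<in> sob m"
  unfolding sob_def using has_d_test indices_basis by blast

lemma VV_sob: "x \<in> VV \<Longrightarrow> x \<in> sob 2" by (simp add: VV_def)

lemma VVE:
  assumes "x \<in> VV"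
  obtains \<phi> where "\<And>k. \<phi> k \<in> tests" "\<And>\<alpha>. \<alpha> \<in> indices 2 \<Longrightarrow> (\<lambda>k. dx \<alpha> (cls (\<phi> k))) \<longlonglongrightarrow> dx \<alpha> x"
proof -
  obtain \<phi> where "\<And>k. \<phi> k \<in> tests"
      "\<And>\<alpha>. \<alpha> \<in> indices 2 \<Longrightarrow> (\<lambda>k. cls (iter_partial \<alpha> (\<phi> k))) \<longlonglongrightarrow> dx \<alpha> x"
    using assms unfolding VV_def by blast
  then show ?thesis by (intro that[of \<phi>]) (auto simp: dx_test indices_basis)
qed

lemma VVI:
  assumes "x \<in> sob 2" "\<And>k. \<phi> k \<in> tests"
    "\<And>\<alpha>. \<alpha> \<in> indices 2 \<Longrightarrow> (\<lambda>k. dx \<alpha> (cls (\<phi> k))) \<longlonglongrightarrow> dx \<alpha> x"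
  shows "x \<in> VV"
  unfolding VV_def using assms
  by (intro CollectI conjI exI[of _ \<phi>]) (auto simp: dx_test[symmetric] indices_basis)

lemma hnorm_tendsto_0_iff:
  assumes "\<And>k. x k \<in> sob m" "y \<in> sob m"
  shows "(\<lambda>k. hnorm m (y - x k)) \<longlonglongrightarrow> 0 \<longleftrightarrow>
    (\<forall>\<alpha>\<in>indices m. (\<lambda>k. dx \<alpha> (x k)) \<longlonglongrightarrow> dx \<alpha> y)"
proof
  assume h: "(\<lambda>k. hnorm m (y - x k)) \<longlonglongrightarrow> 0"
  show "\<forall>\<alpha>\<in>indices m. (\<lambda>k. dx \<alpha> (x k)) \<longlonglongrightarrow> dx \<alpha> y"
  proof
    fix \<alpha> :: "'a list" assume \<alpha>: "\<alpha> \<in> indices m"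
    have "(\<lambda>k. norm (dx \<alpha> (y - x k))) \<longlonglongrightarrow> 0"
      by (rule tendsto_sandwich[OF _ _ tendsto_const h]) (auto simp: norm_dx_le_hnorm[OF \<alpha>])
    moreover have "norm (dx \<alpha> (y - x k)) = norm (dx \<alpha> (x k) - dx \<alpha> y)" for k
      unfolding dx_diff[OF assms(2,1) \<alpha>] by (rule norm_minus_commute)
    ultimately show "(\<lambda>k. dx \<alpha> (x k)) \<longlonglongrightarrow> dx \<alpha> y"
      by (simp add: LIM_zero_iff tendsto_norm_zero_iff)
  qed
next
  assume *: "\<forall>\<alpha>\<in>indices m. (\<lambda>k. dx \<alpha> (x k)) \<longlonglongrightarrow> dx \<alpha> y"
  have "(\<lambda>k. L2_set (\<lambda>\<alpha>. norm (dx \<alpha> y - dx \<alpha> (x k))) (indices m)) \<longlonglongrightarrow> L2_set (\<lambda>\<alpha>. norm (dx \<alpha> y - dx \<alpha> y)) (indices m)"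
    unfolding L2_set_def using * by (intro tendsto_intros) auto
  moreover have "hnorm m (y - x k) = L2_set (\<lambda>\<alpha>. norm (dx \<alpha> y - dx \<alpha> (x k))) (indices m)" for k
    unfolding hnorm_def by (rule L2_set_cong) (auto simp: dx_diff[OF assms(2,1)])
  ultimately show "(\<lambda>k. hnorm m (y - x k)) \<longlonglongrightarrow> 0" by (simp add: L2_set_0')
qed

lemma V_space_iff:
  fixes u :: "'a::euclidean_space \<Rightarrow> real"
  assumes u: "u \<in> L2_space unit_cube"
  shows "u \<in> V_space \<longleftrightarrow> cls u \<in> VV"
proof -
  have *: "(\<lambda>k. sobolev_norm unit_cube 2 (u - \<phi> k)) \<longlonglongrightarrow> 0 \<longleftrightarrow>
      (\<forall>\<alpha>\<in>indices 2. (\<lambda>k. dx \<alpha> (cls (\<phi> k))) \<longlonglongrightarrow> dx \<alpha> (cls u))"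
    if "cls u \<in> sob 2" "\<And>k. \<phi> k \<in> tests" for \<phi> :: "nat \<Rightarrow> 'a \<Rightarrow> real"
  proof -
    have L: "(\<lambda>y. u y - \<phi> k y) \<in> L2_space unit_cube" for k
      using u test_L2[OF that(2)] by (rule L2_space_diff)
    have c: "cls (\<lambda>y. u y - \<phi> k y) = cls u - cls (\<phi> k)" for k
      using u test_L2[OF that(2)] by (rule cls_diff)
    have "sobolev_norm unit_cube 2 (u - \<phi> k) = hnorm 2 (cls u - cls (\<phi> k))" for k
      using sobolev_norm_eq[of "u - \<phi> k" 2] sobolev_space_iff[OF L[of k], of 2] c[of k]
        subspace_diff[OF subspace_sob that(1) test_sob[OF that(2)[of k]]]
      by (simp add: fun_diff_def)
    then show ?thesis
      using hnorm_tendsto_0_iff[OF test_sob[OF that(2)] that(1)] by simp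
  qed
  show ?thesis
  proof
    assume "u \<in> V_space"
    then obtain \<phi> where \<phi>: "u \<in> sobolev_space unit_cube 2" "\<And>k. \<phi> k \<in> tests"
        "(\<lambda>k. sobolev_norm unit_cube 2 (u - \<phi> k)) \<longlonglongrightarrow> 0"
      unfolding sobolev_space0_def by blast
    then show "cls u \<in> VV"
      using *[of \<phi>] sobolev_space_sob by (intro VVI[where \<phi>=\<phi>]) auto
  next
    assume V: "cls u \<in> VV"
    obtain \<phi> where \<phi>: "\<And>k. \<phi> k \<in> tests" "\<And>\<alpha>. \<alpha> \<in> indices 2 \<Longrightarrow> (\<lambda>k. dx \<alpha> (cls (\<phi> k))) \<longlonglongrightarrow> dx \<alpha> (cls u)"
      using VVE[OF V] by blast
    show "u \<in> V_space"
      unfolding sobolev_space0_def mem_Collect_eq sobolev_space_iff[OF u]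
      using *[of \<phi>] VV_sob[OF V] \<phi> by blast
  qed
qed

lemma V_space_L2: "u \<in> V_space \<Longrightarrow> u \<in> L2_space unit_cube"
  by (auto simp: sobolev_space0_def sobolev_space_def)

lemma V_space_VV: "u \<in> V_space \<Longrightarrow> cls u \<in> VV"
  using V_space_iff V_space_L2 by blast

lemma subspace_VV: "subspace VV"
  unfolding subspace_def
proof (intro conjI ballI allI)
  show "0 \<in> VV"
  proof (rule VVI[where \<phi>="\<lambda>k x. 0"])
    show "0 \<in> sob 2" by (rule subspace_0[OF subspace_sob])
  qed (auto simp: test_functions_zero cls_zero)
  fix x y :: "'a l2" and c :: real assume x: "x \<in> VV"
  obtain \<phi> where \<phi>: "\<And>k. \<phi> k \<in> tests" "\<And>\<alpha>. \<alpha> \<in> indices 2 \<Longrightarrow> (\<lambda>k. dx \<alpha> (cls (\<phi> k))) \<longlonglongrightarrow> dx \<alpha> x"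
    using VVE[OF x] by blast
  show "c *\<^sub>R x \<in> VV"
  proof (rule VVI[where \<phi>="\<lambda>k y. c * \<phi> k y"])
    show "c *\<^sub>R x \<in> sob 2" by (intro subspace_scale subspace_sob VV_sob x)
    show "(\<lambda>y. c * \<phi> k y) \<in> tests" for k by (rule test_functions_scale[OF \<phi>(1)])
    show "(\<lambda>k. dx \<alpha> (cls (\<lambda>y. c * \<phi> k y))) \<longlonglongrightarrow> dx \<alpha> (c *\<^sub>R x)" if "\<alpha> \<in> indices 2" for \<alpha>
      using tendsto_scaleR[OF tendsto_const \<phi>(2)[OF that], of c] that
      by (simp add: cls_scale test_L2 \<phi>(1) dx_scale[OF test_sob[OF \<phi>(1)]] dx_scale[OF VV_sob[OF x]])
  qed
  assume y: "y \<in> VV"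
  obtain \<psi> where \<psi>: "\<And>k. \<psi> k \<in> tests" "\<And>\<alpha>. \<alpha> \<in> indices 2 \<Longrightarrow> (\<lambda>k. dx \<alpha> (cls (\<psi> k))) \<longlonglongrightarrow> dx \<alpha> y"
    using VVE[OF y] by blast
  show "x + y \<in> VV"
  proof (rule VVI[where \<phi>="\<lambda>k z. \<phi> k z + \<psi> k z"])
    show "x + y \<in> sob 2" by (intro subspace_add subspace_sob VV_sob x y)
    show "(\<lambda>z. \<phi> k z + \<psi> k z) \<in> tests" for k by (rule test_functions_add[OF \<phi>(1) \<psi>(1)])
    show "(\<lambda>k. dx \<alpha> (cls (\<lambda>z. \<phi> k z + \<psi> k z))) \<longlonglongrightarrow> dx \<alpha> (x + y)" if "\<alpha> \<in> indices 2" for \<alpha>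
      using tendsto_add[OF \<phi>(2)[OF that] \<psi>(2)[OF that]] that
      by (simp add: cls_add test_L2 \<phi>(1) \<psi>(1) dx_add[OF test_sob[OF \<phi>(1)] test_sob[OF \<psi>(1)]] dx_add[OF VV_sob[OF x] VV_sob[OF y]])
  qed
qed

text \<open>The form in which closedness is used in \<open>x'_in_VV\<close>. A test function near
  the approximant is near \<open>x\<close>; tolerances 1/(n+1) produce the required
  sequence.\<close>

lemma VV_closed:
  assumes x: "x \<in> sob 2" and approx: "\<And>e. e > 0 \<Longrightarrow> \<exists>y\<in>VV. \<forall>\<alpha>\<in>indices 2. norm (dx \<alpha> (x - y)) < e"
  shows "x \<in> VV"
proof -
  have "\<exists>\<phi>\<in>tests. \<forall>\<alpha>\<in>indices 2. norm (dx \<alpha> x - dx \<alpha> (cls \<phi>)) < e" if e: "e > 0" for e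
  proof -
    obtain y where y: "y \<in> VV" "\<forall>\<alpha>\<in>indices 2. norm (dx \<alpha> (x - y)) < e / 2"
      using approx[of "e / 2"] e by auto
    obtain \<phi> where \<phi>: "\<And>k. \<phi> k \<in> tests" "\<And>\<alpha>. \<alpha> \<in> indices 2 \<Longrightarrow> (\<lambda>k. dx \<alpha> (cls (\<phi> k))) \<longlonglongrightarrow> dx \<alpha> y"
      using VVE[OF y(1)] by blast
    have "\<forall>\<^sub>F k in sequentially. \<forall>\<alpha>\<in>indices 2. norm (dx \<alpha> (cls (\<phi> k)) - dx \<alpha> y) < e / 2"
    proof (intro eventually_ball_finite[OF finite_indices] ballI)
      fix \<alpha> :: "'a list" assume "\<alpha> \<in> indices 2"
      from tendstoD[OF \<phi>(2)[OF this], of "e / 2"] e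
      show "\<forall>\<^sub>F k in sequentially. norm (dx \<alpha> (cls (\<phi> k)) - dx \<alpha> y) < e / 2"
        by (simp add: dist_norm)
    qed
    then obtain k where k: "\<And>\<alpha>. \<alpha> \<in> indices 2 \<Longrightarrow> norm (dx \<alpha> (cls (\<phi> k)) - dx \<alpha> y) < e / 2"
      unfolding eventually_sequentially by blast
    have "norm (dx \<alpha> x - dx \<alpha> (cls (\<phi> k))) < e" if \<alpha>: "\<alpha> \<in> indices 2" for \<alpha>
    proof -
      have "norm (dx \<alpha> x - dx \<alpha> y) < e / 2" using y(2) \<alpha> dx_diff[OF x VV_sob[OF y(1)] \<alpha>] by auto
      with norm_triangle_lt[of "dx \<alpha> x - dx \<alpha> y" "dx \<alpha> y - dx \<alpha> (cls (\<phi> k))" e] k[OF \<alpha>]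
      show ?thesis by (simp add: norm_minus_commute)
    qed
    then show ?thesis using \<phi>(1) by blast
  qed
  then have "\<exists>\<phi>. \<phi> \<in> tests \<and> (\<forall>\<alpha>\<in>indices 2. norm (dx \<alpha> x - dx \<alpha> (cls \<phi>)) < inverse (real (Suc n)))" for n
    by (metis inverse_positive_iff_positive of_nat_0_less_iff zero_less_Suc)
  then obtain \<phi> where \<phi>: "\<And>n. \<phi> n \<in> tests"
      "\<And>n \<alpha>. \<alpha> \<in> indices 2 \<Longrightarrow> norm (dx \<alpha> x - dx \<alpha> (cls (\<phi> n))) < inverse (real (Suc n))"
    by metis
  show ?thesis
  proof (rule VVI[OF x \<phi>(1)])
    fix \<alpha> :: "'a list" assume \<alpha>: "\<alpha> \<in> indices 2"
    have "(\<lambda>n. norm (dx \<alpha> (cls (\<phi> n)) - dx \<alpha> x)) \<longlonglongrightarrow> 0"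
      by (rule tendsto_sandwich[OF _ _ tendsto_const LIMSEQ_inverse_real_of_nat])
        (use \<phi>(2)[OF \<alpha>] in \<open>auto simp: norm_minus_commute intro!: always_eventually less_imp_le\<close>)
    then show "(\<lambda>n. dx \<alpha> (cls (\<phi> n))) \<longlonglongrightarrow> dx \<alpha> x"
      by (simp add: LIM_zero_iff tendsto_norm_zero_iff)
  qed
qed

section \<open>The Laplacian and integration by parts in the energy space\<close>

definition lap :: "'a::euclidean_space l2 \<Rightarrow> 'a l2" where
  "lap x = (\<Sum>i\<in>Basis. dx [i, i] x)"

lemma indices_2 [simp]:
  "[] \<in> indices m" "i \<in> Basis \<Longrightarrow> [i] \<in> indices 2" "i \<in> Basis \<Longrightarrow> j \<in> Basis \<Longrightarrow> [i, j] \<in> indices 2"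
  "i \<in> Basis \<Longrightarrow> [i] \<in> indices 1" "i \<in> Basis \<Longrightarrow> [i] \<in> indices (Suc 0)"
  by (auto simp: indices_def)

lemma lap_add: "x \<in> sob 2 \<Longrightarrow> y \<in> sob 2 \<Longrightarrow> lap (x + y) = lap x + lap y"
  by (simp add: lap_def dx_add[where m=2] sum.distrib)

lemma lap_scale: "x \<in> sob 2 \<Longrightarrow> lap (c *\<^sub>R x) = c *\<^sub>R lap x"
  by (simp add: lap_def dx_scale[where m=2] scaleR_sum_right)

lemma lap_diff: "x \<in> sob 2 \<Longrightarrow> y \<in> sob 2 \<Longrightarrow> lap (x - y) = lap x - lap y"
  by (simp add: lap_def dx_diff[where m=2] sum_subtractf)

lemma laplacian_cls:
  assumes "u \<in> sobolev_space unit_cube 2"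
  shows "laplacian u \<in> L2_space unit_cube" "cls (laplacian u) = lap (cls u)"
proof -
  have "wd [i, i] u \<in> L2_space unit_cube" "cls (wd [i, i] u) = dx [i, i] (cls u)" if "i \<in> Basis" for i
    using sobolev_wd[OF assms, of "[i, i]"] that by auto
  then show "laplacian u \<in> L2_space unit_cube" "cls (laplacian u) = lap (cls u)"
    unfolding laplacian_def lap_def by (auto intro!: L2_space_sum simp: cls_sum)
qed

lemma smooth_fun_coord: "smooth_fun (\<lambda>y. y \<bullet> i)" for i :: "'a::euclidean_space"
proof (rule smooth_fun_coinduct[where F="{\<lambda>y. c * (y \<bullet> i) + d | c d. True}"])
  have *: "((\<lambda>y. c * (y \<bullet> i) + d) has_derivative (\<lambda>h. c * (h \<bullet> i))) (at x)" for c d x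
    by (auto intro!: derivative_eq_intros)
  show "(\<lambda>y. y \<bullet> i) \<in> {\<lambda>y. c * (y \<bullet> i) + d | c d. True}"
    by (rule CollectI, rule exI[of _ 1], rule exI[of _ 0]) simp
  show "g differentiable (at x)" if "g \<in> {\<lambda>y. c * (y \<bullet> i) + d | c d. True}" for g x
    using that * unfolding differentiable_def by blast
  show "partial j g \<in> {\<lambda>y. c * (y \<bullet> i) + d | c d. True}"
    if g: "g \<in> {\<lambda>y. c * (y \<bullet> i) + d | c d. True}" for g and j :: 'a
  proof -
    obtain c d where g: "g = (\<lambda>y. c * (y \<bullet> i) + d)" using g by blast
    have "partial j g = (\<lambda>y. 0 * (y \<bullet> i) + c * (j \<bullet> i))"
      unfolding g by (rule ext, subst partial_eq[OF *]) simp
    then show ?thesis by blast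
  qed
qed

lemma partial_coord: "i \<in> Basis \<Longrightarrow> partial i (\<lambda>y. y \<bullet> i) x = 1"
  by (subst partial_eq[of _ "\<lambda>h. h \<bullet> i"]) (auto intro!: derivative_eq_intros)

lemma test_dx:
  assumes "\<phi> \<in> tests" "i \<in> Basis"
  shows "dx [i] (cls \<phi>) = cls (partial i \<phi>)" "partial i \<phi> \<in> tests"
  using assms dx_test[of \<phi> "[i]"] by (auto intro: test_functions_partial)

lemma test_ibp:
  assumes "\<phi> \<in> tests" "\<psi> \<in> tests" "i \<in> Basis"
  shows "inner (dx [i] (cls \<phi>)) (cls \<psi>) = - inner (cls \<phi>) (dx [i] (cls \<psi>))"
  using assms by (simp add: test_dx inner_cls test_L2 integration_by_parts_test)

lemma test_dx_coord_mult:
  assumes \<phi>: "\<phi> \<in> tests" and i: "i \<in> Basis"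
  shows "(\<lambda>y. (y \<bullet> i) * \<phi> y) \<in> tests" "coord_mult i (cls \<phi>) = cls (\<lambda>y. (y \<bullet> i) * \<phi> y)"
    "dx [i] (coord_mult i (cls \<phi>)) = coord_mult i (dx [i] (cls \<phi>)) + cls \<phi>"
proof -
  show t: "(\<lambda>y. (y \<bullet> i) * \<phi> y) \<in> tests"
    by (rule test_functions_mult_smooth[OF smooth_fun_coord \<phi>])
  show c: "coord_mult i (cls \<phi>) = cls (\<lambda>y. (y \<bullet> i) * \<phi> y)"
    using i test_L2[OF \<phi>] by (rule coord_mult_cls)
  have "partial i (\<lambda>y. (y \<bullet> i) * \<phi> y) = (\<lambda>y. (y \<bullet> i) * partial i \<phi> y + \<phi> y)"
    by (rule ext, subst partial_mult)
       (use i partial_coord smooth_fun_differentiable smooth_fun_coord test_smooth[OF \<phi>] in auto)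
  then show "dx [i] (coord_mult i (cls \<phi>)) = coord_mult i (dx [i] (cls \<phi>)) + cls \<phi>"
    using test_dx[OF \<phi> i] test_dx(1)[OF t i] i \<phi>
    by (simp add: c coord_mult_cls test_L2 cls_add[symmetric] L2_space_coord_mult)
qed

lemma test_dx_dx:
  assumes "\<phi> \<in> tests" "i \<in> Basis" "j \<in> Basis"
  shows "dx [i] (dx [j] (cls \<phi>)) = dx [i, j] (cls \<phi>)"
  using assms test_dx(1)[of "partial j \<phi>" i] dx_test[of \<phi> "[i, j]"] by (simp add: test_dx)

lemma tendsto_coord_mult [tendsto_intros]:
  "i \<in> Basis \<Longrightarrow> (f \<longlongrightarrow> x) F \<Longrightarrow> ((\<lambda>k. coord_mult i (f k)) \<longlongrightarrow> coord_mult i x) F"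
  by (rule bounded_linear.tendsto[OF bounded_linear_coord_mult])

lemma VV_inner_dx:
  assumes x: "x \<in> VV" and y: "y \<in> VV" and i: "i \<in> Basis"
  shows "inner (dx [i] x) (dx [i] y) = - inner (dx [i, i] x) y"
proof -
  obtain \<phi> where \<phi>: "\<And>k. \<phi> k \<in> tests" "\<And>\<alpha>. \<alpha> \<in> indices 2 \<Longrightarrow> (\<lambda>k. dx \<alpha> (cls (\<phi> k))) \<longlonglongrightarrow> dx \<alpha> x"
    using VVE[OF x] by blast
  obtain \<psi> where \<psi>: "\<And>k. \<psi> k \<in> tests" "\<And>\<alpha>. \<alpha> \<in> indices 2 \<Longrightarrow> (\<lambda>k. dx \<alpha> (cls (\<psi> k))) \<longlonglongrightarrow> dx \<alpha> y"
    using VVE[OF y] by blast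
  have "inner (dx [i] (cls (\<phi> k))) (dx [i] (cls (\<psi> k))) = - inner (dx [i, i] (cls (\<phi> k))) (cls (\<psi> k))" for k
    using test_ibp[OF test_dx(2)[OF \<phi>(1)[of k] i] \<psi>(1)[of k] i] \<phi>(1) i
    by (simp add: test_dx_dx[symmetric] test_dx)
  moreover have "(\<lambda>k. inner (dx [i] (cls (\<phi> k))) (dx [i] (cls (\<psi> k)))) \<longlonglongrightarrow> inner (dx [i] x) (dx [i] y)"
    using i by (intro tendsto_intros \<phi> \<psi>) auto
  moreover have "(\<lambda>k. - inner (dx [i, i] (cls (\<phi> k))) (cls (\<psi> k))) \<longlonglongrightarrow> - inner (dx [i, i] x) y"
    using i \<psi>(2)[of "[]"] by (intro tendsto_intros \<phi>) (auto simp: dx_Nil)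
  ultimately show ?thesis by (simp add: LIMSEQ_unique)
qed

text \<open>Differentiating y_i x gives x + y_i d_i x, so integration by parts expresses the pairing
  by minus itself and minus the squared norm. Source of both the Poincare inequality and the sign of
  the first order term in the time derivative.\<close>

lemma VV_inner_coord_dx:
  assumes x: "x \<in> VV" and i: "i \<in> Basis"
  shows "inner (coord_mult i (dx [i] x)) x = - (norm x)\<^sup>2 / 2"
proof -
  obtain \<phi> where \<phi>: "\<And>k. \<phi> k \<in> tests" "\<And>\<alpha>. \<alpha> \<in> indices 2 \<Longrightarrow> (\<lambda>k. dx \<alpha> (cls (\<phi> k))) \<longlonglongrightarrow> dx \<alpha> x"
    using VVE[OF x] by blast
  have "inner (coord_mult i (dx [i] (cls (\<phi> k)))) (cls (\<phi> k)) = - (norm (cls (\<phi> k)))\<^sup>2 / 2" for k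
    using test_ibp[OF test_dx_coord_mult(1)[OF \<phi>(1)[of k] i] \<phi>(1)[of k] i] test_dx_coord_mult[OF \<phi>(1)[of k] i]
      inner_coord_mult[OF i, of "cls (\<phi> k)" "dx [i] (cls (\<phi> k))"]
    by (simp add: inner_add_left inner_add_right power2_norm_eq_inner inner_commute)
  moreover have "(\<lambda>k. inner (coord_mult i (dx [i] (cls (\<phi> k)))) (cls (\<phi> k))) \<longlonglongrightarrow> inner (coord_mult i (dx [i] x)) x"
    using i \<phi>(2)[of "[]"] by (intro tendsto_intros \<phi>) (auto simp: dx_Nil)
  moreover have "(\<lambda>k. - (norm (cls (\<phi> k)))\<^sup>2 / 2) \<longlonglongrightarrow> - (norm x)\<^sup>2 / 2"
    using \<phi>(2)[of "[]"] by (intro tendsto_intros) (auto simp: dx_Nil)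
  ultimately show ?thesis by (simp add: LIMSEQ_unique)
qed

text \<open>For the part of \<open>coeff_a1\<close> with y_i^2: the derivative is moved off the
  second factor, so that in the error equation the test function is controlled in L^2 alone.\<close>

lemma VV_inner_coord_coord_dx:
  assumes x: "x \<in> VV" and y: "y \<in> VV" and i: "i \<in> Basis"
  shows "inner (coord_mult i (coord_mult i (dx [i] x))) (dx [i] y)
    = - inner (2 *\<^sub>R coord_mult i (dx [i] x) + coord_mult i (coord_mult i (dx [i, i] x))) y"
proof -
  obtain \<phi> where \<phi>: "\<And>k. \<phi> k \<in> tests" "\<And>\<alpha>. \<alpha> \<in> indices 2 \<Longrightarrow> (\<lambda>k. dx \<alpha> (cls (\<phi> k))) \<longlonglongrightarrow> dx \<alpha> x"
    using VVE[OF x] by blast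
  obtain \<psi> where \<psi>: "\<And>k. \<psi> k \<in> tests" "\<And>\<alpha>. \<alpha> \<in> indices 2 \<Longrightarrow> (\<lambda>k. dx \<alpha> (cls (\<psi> k))) \<longlonglongrightarrow> dx \<alpha> y"
    using VVE[OF y] by blast
  have "inner (coord_mult i (coord_mult i (dx [i] (cls (\<phi> k))))) (dx [i] (cls (\<psi> k)))
    = - inner (2 *\<^sub>R coord_mult i (dx [i] (cls (\<phi> k))) + coord_mult i (coord_mult i (dx [i, i] (cls (\<phi> k))))) (cls (\<psi> k))" for k
  proof -
    let ?f = "partial i (\<phi> k)"
    have f: "?f \<in> tests" "dx [i] (cls (\<phi> k)) = cls ?f" using test_dx[OF \<phi>(1)[of k] i] by auto
    note g = test_dx_coord_mult[OF f(1) i]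
    note h = test_dx_coord_mult[OF g(1) i]
    have ff: "dx [i, i] (cls (\<phi> k)) = dx [i] (cls ?f)" using test_dx_dx[OF \<phi>(1)[of k] i i] f by simp
    have "dx [i] (coord_mult i (coord_mult i (cls ?f))) =
        2 *\<^sub>R coord_mult i (cls ?f) + coord_mult i (coord_mult i (dx [i] (cls ?f)))"
      using g h i by (simp add: coord_mult_add scaleR_2)
    then show ?thesis
      using test_ibp[OF h(1) \<psi>(1)[of k] i] g h unfolding f(2) ff by simp
  qed
  moreover have "(\<lambda>k. inner (coord_mult i (coord_mult i (dx [i] (cls (\<phi> k))))) (dx [i] (cls (\<psi> k))))
      \<longlonglongrightarrow> inner (coord_mult i (coord_mult i (dx [i] x))) (dx [i] y)"
    using i by (intro tendsto_intros \<phi> \<psi>) auto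
  moreover have "(\<lambda>k. - inner (2 *\<^sub>R coord_mult i (dx [i] (cls (\<phi> k))) + coord_mult i (coord_mult i (dx [i, i] (cls (\<phi> k))))) (cls (\<psi> k)))
      \<longlonglongrightarrow> - inner (2 *\<^sub>R coord_mult i (dx [i] x) + coord_mult i (coord_mult i (dx [i, i] x))) y"
    using i \<psi>(2)[of "[]"] by (intro tendsto_intros \<phi>) (auto simp: dx_Nil)
  ultimately show ?thesis by (simp add: LIMSEQ_unique)
qed

text \<open>Two integrations by parts exchange one derivative of each direction. The third
  derivatives that occur on the way exist for test functions only, hence the detour through an
  approximating sequence.\<close>

lemma VV_norm_dx2:
  assumes x: "x \<in> VV" and i: "i \<in> Basis" and j: "j \<in> Basis"
  shows "(norm (dx [i, j] x))\<^sup>2 = inner (dx [i, i] x) (dx [j, j] x)"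
proof -
  obtain \<phi> where \<phi>: "\<And>k. \<phi> k \<in> tests" "\<And>\<alpha>. \<alpha> \<in> indices 2 \<Longrightarrow> (\<lambda>k. dx \<alpha> (cls (\<phi> k))) \<longlonglongrightarrow> dx \<alpha> x"
    using VVE[OF x] by blast
  have "(norm (dx [i, j] (cls (\<phi> k))))\<^sup>2 = inner (dx [i, i] (cls (\<phi> k))) (dx [j, j] (cls (\<phi> k)))" for k
  proof -
    let ?f = "\<phi> k"
    note t = \<phi>(1)[of k]
    have sm: "smooth_fun ?f" by (rule test_smooth[OF t])
    have ti: "partial i ?f \<in> tests" "partial j ?f \<in> tests" using test_dx[OF t] i j by auto
    have tij: "partial i (partial j ?f) \<in> tests" "partial i (partial i ?f) \<in> tests" "partial j (partial j ?f) \<in> tests"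
      using test_dx(2)[OF ti(1)] test_dx(2)[OF ti(2)] i j by auto
    have comm: "partial i (partial i (partial j ?f)) = partial j (partial i (partial i ?f))"
      using iter_partial_commute[OF sm, of "[i, i]" j] i j by simp
    have eq: "dx [k, l] (cls ?f) = cls (partial k (partial l ?f))" if "k \<in> Basis" "l \<in> Basis" for k l
      using dx_test[OF t, of "[k, l]"] that by simp
    have "ip (partial i (partial j ?f)) (partial i (partial j ?f)) = - ip (partial j ?f) (partial i (partial i (partial j ?f)))"
      by (rule integration_by_parts_test[OF ti(2) tij(1) i])
    also have "\<dots> = ip (partial j (partial j ?f)) (partial i (partial i ?f))"
      unfolding comm using integration_by_parts_test[OF ti(2) tij(2) j] by simp
    finally show ?thesis
      using i j tij by (simp add: eq power2_norm_eq_inner inner_cls test_L2 L2_inner_def mult.commute)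
  qed
  moreover have "(\<lambda>k. (norm (dx [i, j] (cls (\<phi> k))))\<^sup>2) \<longlonglongrightarrow> (norm (dx [i, j] x))\<^sup>2"
    using i j by (intro tendsto_intros \<phi>) auto
  moreover have "(\<lambda>k. inner (dx [i, i] (cls (\<phi> k))) (dx [j, j] (cls (\<phi> k)))) \<longlonglongrightarrow> inner (dx [i, i] x) (dx [j, j] x)"
    using i j by (intro tendsto_intros \<phi>) auto
  ultimately show ?thesis by (simp add: LIMSEQ_unique)
qed

text \<open>Summed over all pairs of directions, \<open>VV_norm_dx2\<close> says that the Laplacian
  has the same norm as the full Hessian.\<close>

lemma VV_norm_dx2_le_lap:
  assumes x: "x \<in> VV" and i: "i \<in> Basis" and j: "j \<in> Basis"
  shows "norm (dx [i, j] x) \<le> norm (lap x)"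
proof -
  have "(norm (lap x))\<^sup>2 = (\<Sum>i\<in>Basis. \<Sum>j\<in>Basis. (norm (dx [i, j] x))\<^sup>2)"
    unfolding lap_def power2_norm_eq_inner inner_sum_left inner_sum_right
    using VV_norm_dx2[OF x] by (intro sum.cong) (auto simp: power2_norm_eq_inner intro: inner_commute)
  also have "\<dots> \<ge> (\<Sum>j\<in>Basis. (norm (dx [i, j] x))\<^sup>2)"
    by (rule member_le_sum[OF i]) (auto intro: sum_nonneg)
  finally have "(\<Sum>j\<in>Basis. (norm (dx [i, j] x))\<^sup>2) \<le> (norm (lap x))\<^sup>2" .
  moreover have "(norm (dx [i, j] x))\<^sup>2 \<le> (\<Sum>j\<in>Basis. (norm (dx [i, j] x))\<^sup>2)"
    by (rule member_le_sum[OF j]) auto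
  ultimately show ?thesis by (meson norm_ge_zero order_trans power2_le_imp_le)
qed

text \<open>The squared norm is -2 (y_i d_i x, x), and y_i is at most 1 on the cube.\<close>

lemma VV_poincare:
  assumes x: "x \<in> VV" and i: "i \<in> Basis" shows "norm x \<le> 2 * norm (dx [i] x)"
proof -
  have "(norm x)\<^sup>2 = - 2 * inner (coord_mult i (dx [i] x)) x"
    using VV_inner_coord_dx[OF x i] by simp
  also have "\<dots> \<le> 2 * (norm (coord_mult i (dx [i] x)) * norm x)"
    using Cauchy_Schwarz_ineq2[of "coord_mult i (dx [i] x)" x] by linarith
  also have "\<dots> \<le> 2 * (norm (dx [i] x) * norm x)"
    using norm_coord_mult[OF i] by (intro mult_left_mono mult_right_mono) auto
  finally show ?thesis
    by (cases "norm x = 0") (auto simp: power2_eq_square mult_le_cancel_right)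
qed

text \<open>The squared gradient is -(lap x, x); the Poincare inequality bounds |x| by the same
  first derivative, of which one power then cancels.\<close>

lemma VV_norm_dx1_le_lap:
  assumes x: "x \<in> VV" and i: "i \<in> Basis" shows "norm (dx [i] x) \<le> 2 * norm (lap x)"
proof -
  have "(norm (dx [i] x))\<^sup>2 \<le> (\<Sum>i\<in>Basis. (norm (dx [i] x))\<^sup>2)"
    by (rule member_le_sum[OF i]) auto
  also have "\<dots> = - inner (lap x) x"
    unfolding lap_def inner_sum_left power2_norm_eq_inner using VV_inner_dx[OF x x]
    by (simp add: sum_negf)
  also have "\<dots> \<le> norm (lap x) * norm x"
    using Cauchy_Schwarz_ineq2[of "lap x" x] by linarith
  also have "\<dots> \<le> norm (lap x) * (2 * norm (dx [i] x))"
    using VV_poincare[OF x i] by (intro mult_left_mono) auto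
  finally show ?thesis
    by (cases "norm (dx [i] x) = 0") (auto simp: power2_eq_square mult_le_cancel_right)
qed

lemma VV_norm_le_lap: "x \<in> VV \<Longrightarrow> norm x \<le> 4 * norm (lap x)" for x :: "'a::euclidean_space l2"
proof -
  assume x: "x \<in> VV"
  obtain i :: 'a where i: "i \<in> Basis" using nonempty_Basis by blast
  show ?thesis using VV_poincare[OF x i] VV_norm_dx1_le_lap[OF x i] by linarith
qed

lemma VV_norm_dx_le_lap:
  assumes x: "x \<in> VV" and \<alpha>: "\<alpha> \<in> indices 2" shows "norm (dx \<alpha> x) \<le> 4 * norm (lap x)"
proof -
  consider "\<alpha> = []" | i where "\<alpha> = [i]" "i \<in> Basis" | i j where "\<alpha> = [i, j]" "i \<in> Basis" "j \<in> Basis"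
    using \<alpha> by (auto simp: indices_def le_Suc_eq numeral_2_eq_2 length_Suc_conv)
  then show ?thesis
  proof cases
    case 1 then show ?thesis using VV_norm_le_lap[OF x] by (simp add: dx_Nil)
  next
    case 2
    show ?thesis unfolding 2(1) using VV_norm_dx1_le_lap[OF x 2(2)] norm_ge_zero[of "lap x"] by linarith
  next
    case 3
    show ?thesis unfolding 3(1) using VV_norm_dx2_le_lap[OF x 3(2,3)] norm_ge_zero[of "lap x"] by linarith
  qed
qed

lemma VV_hnorm_le_lap:
  fixes x :: "'a::euclidean_space l2"
  assumes x: "x \<in> VV"
  shows "hnorm 2 x \<le> 4 * real (card (indices 2 :: 'a list set)) * norm (lap x)"
proof -
  have "hnorm 2 x \<le> (\<Sum>\<alpha>\<in>indices 2. \<bar>norm (dx \<alpha> x)\<bar>)"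
    unfolding hnorm_def by (rule L2_set_le_sum_abs)
  also have "\<dots> \<le> (\<Sum>\<alpha>\<in>(indices 2 :: 'a list set). 4 * norm (lap x))"
    by (rule sum_mono) (simp add: VV_norm_dx_le_lap[OF x])
  finally show ?thesis by (simp add: mult_ac)
qed

lemma norm_lap_le_snorm:
  fixes x :: "'a::euclidean_space l2"
  shows "norm (lap x) \<le> real DIM('a) * snorm 2 x"
proof -
  have "norm (lap x) \<le> (\<Sum>i\<in>(Basis :: 'a set). norm (dx [i, i] x))"
    unfolding lap_def by (rule norm_sum)
  also have "\<dots> \<le> (\<Sum>i\<in>(Basis :: 'a set). snorm 2 x)"
  proof (rule sum_mono)
    fix i :: 'a assume i: "i \<in> Basis"
    show "norm (dx [i, i] x) \<le> snorm 2 x"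
      unfolding snorm_def
      by (rule real_le_rsqrt)
        (use i in \<open>auto intro!: member_le_sum[of "[i, i]" _ "\<lambda>\<alpha>. (norm (dx \<alpha> x))\<^sup>2"] simp: multi_indices_finite, auto simp: multi_indices_def\<close>)
  qed
  finally show ?thesis by simp
qed

section \<open>Pointwise signs from the signs of integrals over intervals\<close>

lemma integrable_lebesgue_on_indicator_mult:
  fixes h :: "'a::euclidean_space \<Rightarrow> real"
  assumes "integrable (lebesgue_on S) h" "U \<in> sets lebesgue"
  shows "integrable (lebesgue_on S) (\<lambda>x. indicator U x * h x)"
proof -
  have U: "U \<inter> S \<in> sets (lebesgue_on S)"
    using assms(2) by (auto simp: sets_restrict_space)
  have "integrable (lebesgue_on S) (\<lambda>x. indicator (U \<inter> S) x * h x)"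
    using integrable_mult_indicator[OF U assms(1)] by simp
  then show ?thesis
    by (rule Bochner_Integration.integrable_cong[THEN iffD1, rotated -1]) (auto simp: indicator_def)
qed

lemma AE_lebesgue_on_not_in_countable:
  fixes E :: "real set"
  assumes "countable E" "S \<in> sets lebesgue" shows "AE x in lebesgue_on S. x \<notin> E"
proof -
  have "E \<in> null_sets lebesgue"
    using countable_imp_null_set_lborel[OF assms(1)] by (rule null_sets_completionI)
  then have "AE x in lebesgue. x \<notin> E" by (rule AE_not_in)
  then show ?thesis using assms(2) by (subst AE_restrict_space_iff) auto
qed

lemma integral_indicator_interval:
  fixes h :: "real \<Rightarrow> real"
  assumes h: "integrable (lebesgue_on {a..b}) h" and sub: "{c..d} \<subseteq> {a..b}"
  shows "(\<integral>x. indicator {c<..<d} x * h x \<partial>(lebesgue_on {a..b})) = LI c d h"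
proof -
  have "(\<integral>x. indicator {c<..<d} x * h x \<partial>(lebesgue_on {a..b}))
      = (\<integral>x. indicator {c..d} x * h x \<partial>(lebesgue_on {a..b}))"
  proof (rule integral_cong_AE)
    show "AE x in lebesgue_on {a..b}. indicator {c<..<d} x * h x = indicator {c..d} x * h x"
    proof (rule AE_mp[OF AE_lebesgue_on_not_in_countable[of "{c, d}" "{a..b}"]], simp, simp, intro AE_I2 impI)
      fix x assume "x \<notin> {c, d}"
      then show "indicator {c<..<d} x * h x = indicator {c..d} x * h x" by (auto simp: indicator_def)
    qed
  qed (intro borel_measurable_integrable integrable_lebesgue_on_indicator_mult h; simp)+
  also have "\<dots> = (\<integral>x. indicator {a..b} x * (indicator {c..d} x * h x) \<partial>lebesgue)"
    by (simp add: integral_restrict_space)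
  also have "(\<lambda>x. indicator {a..b} x * (indicator {c..d} x * h x)) = (\<lambda>x. indicator {c..d} x * h x)"
    using sub by (auto simp: indicator_def fun_eq_iff)
  also have "(\<integral>x. indicator {c..d} x * h x \<partial>lebesgue) = LI c d h"
    by (simp add: integral_restrict_space)
  finally show ?thesis .
qed

text \<open>The intervals meet in end points only, which form a countable set; the integrals over
  their disjoint interiors are added up by dominated convergence.\<close>

lemma integral_nonneg_Union_intervals:
  fixes h :: "real \<Rightarrow> real"
  assumes h: "integrable (lebesgue_on {a..b}) h"
    and nn: "\<And>c d. a \<le> c \<Longrightarrow> c \<le> d \<Longrightarrow> d \<le> b \<Longrightarrow> 0 \<le> LI c d h"
    and D: "countable \<D>" "\<And>K. K \<in> \<D> \<Longrightarrow> K \<subseteq> {a..b} \<and> K \<noteq> {} \<and> (\<exists>c d. K = {c..d})"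
      "pairwise (\<lambda>A B. interior A \<inter> interior B = {}) \<D>"
  shows "0 \<le> (\<integral>x. indicator (\<Union>\<D>) x * h x \<partial>(lebesgue_on {a..b}))"
proof -
  \<comment> \<open>The interior of the interval with number i, and empty if no interval has that
    number.\<close>
  define A where "A i = (\<Union>K\<in>{K\<in>\<D>. to_nat_on \<D> K = i}. interior K)" for i
  have Acases: "A i = {} \<or> (\<exists>K\<in>\<D>. to_nat_on \<D> K = i \<and> A i = interior K)" for i
    unfolding A_def using inj_on_to_nat_on[OF D(1)] by (fastforce simp: inj_on_def)
  have disj: "disjoint_family_on A I" for I
    unfolding disjoint_family_on_def
  proof (intro ballI impI)
    fix i j :: nat assume ij: "i \<noteq> j"
    show "A i \<inter> A j = {}"
    proof (cases "A i = {} \<or> A j = {}")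
      case False
      then obtain K L where "K \<in> \<D>" "to_nat_on \<D> K = i" "A i = interior K"
          "L \<in> \<D>" "to_nat_on \<D> L = j" "A j = interior L"
        using Acases[of i] Acases[of j] by auto
      then show ?thesis using ij pairwiseD[OF D(3), of K L] by auto
    qed auto
  qed
  have Aset: "A i \<in> sets lebesgue" for i
    using Acases[of i] by auto
  have J0: "0 \<le> (\<integral>x. indicator (A i) x * h x \<partial>(lebesgue_on {a..b}))" for i
  proof (cases "A i = {}")
    case False
    then obtain K where K: "K \<in> \<D>" "A i = interior K" using Acases[of i] by auto
    then obtain c d where cd: "K = {c..d}" "{c..d} \<subseteq> {a..b}" "c \<le> d" using D(2)[OF K(1)] by force
    then have "A i = {c<..<d}" using K by (simp add: interior_atLeastAtMost_real)
    then show ?thesis using integral_indicator_interval[OF h cd(2)] nn[of c d] cd by auto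
  qed simp
  define E where "E = (\<Union>K\<in>\<D>. K - interior K)"
  have cE: "countable E" unfolding E_def
  proof (intro countable_UN D(1))
    fix K assume "K \<in> \<D>"
    then obtain c d where "K = {c..d}" using D(2) by blast
    then have "K - interior K \<subseteq> {c, d}" by (auto simp: interior_atLeastAtMost_real)
    then show "countable (K - interior K)" by (rule countable_subset) auto
  qed
  let ?f = "\<lambda>n x. \<Sum>i<n. indicator (A i) x * h x"
  have eq: "?f n x = indicator (\<Union>i<n. A i) x * h x" for n x
  proof -
    have "indicator (\<Union>i<n. A i) x = (\<Sum>i<n. indicator (A i) x :: real)"
      by (intro indicator_UN_disjoint disj) simp
    then show ?thesis by (simp add: sum_distrib_right)
  qed
  have US: "\<Union>\<D> \<in> sets lebesgue"
  proof (rule sets.countable_Union[OF D(1)])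
    show "\<D> \<subseteq> sets lebesgue"
    proof
      fix K assume "K \<in> \<D>"
      then obtain c d where "K = {c..d}" using D(2) by blast
      then show "K \<in> sets lebesgue" by simp
    qed
  qed
  have "(\<lambda>n. \<integral>x. ?f n x \<partial>(lebesgue_on {a..b})) \<longlonglongrightarrow> (\<integral>x. indicator (\<Union>\<D>) x * h x \<partial>(lebesgue_on {a..b}))"
  proof (rule integral_dominated_convergence[where w="\<lambda>x. \<bar>h x\<bar>"])
    show "AE x in lebesgue_on {a..b}. (\<lambda>n. ?f n x) \<longlonglongrightarrow> indicator (\<Union>\<D>) x * h x"
    proof (rule AE_mp[OF AE_lebesgue_on_not_in_countable[OF cE]], simp, intro AE_I2 impI)
      fix x assume x: "x \<notin> E"
      show "(\<lambda>n. ?f n x) \<longlonglongrightarrow> indicator (\<Union>\<D>) x * h x"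
      proof (cases "x \<in> \<Union>\<D>")
        case True
        then obtain K where K: "K \<in> \<D>" "x \<in> interior K" using x by (auto simp: E_def)
        then have "x \<in> A (to_nat_on \<D> K)" by (auto simp: A_def)
        have "\<forall>\<^sub>F n in sequentially. ?f n x = indicator (\<Union>\<D>) x * h x"
          using eventually_gt_at_top[of "to_nat_on \<D> K"]
        proof eventually_elim
          case (elim n)
          then have "x \<in> (\<Union>i<n. A i)" using \<open>x \<in> A (to_nat_on \<D> K)\<close> by auto
          then show ?case unfolding eq using True by (simp add: indicator_def)
        qed
        then show ?thesis by (rule tendsto_eventually)
      next
        case False
        then have "x \<notin> A i" for i using interior_subset by (auto simp: A_def)
        then show ?thesis using False by simp
      qed
    qed
    show "AE x in lebesgue_on {a..b}. norm (?f n x) \<le> \<bar>h x\<bar>" for n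
      unfolding eq by (auto intro!: AE_I2 simp: indicator_def)
    show "?f n \<in> borel_measurable (lebesgue_on {a..b})" for n
      using integrable_lebesgue_on_indicator_mult[OF h Aset] by (intro borel_measurable_sum) auto
  qed (use h integrable_lebesgue_on_indicator_mult[OF h US] in auto)
  moreover have "0 \<le> (\<integral>x. ?f n x \<partial>(lebesgue_on {a..b}))" for n
    using integrable_lebesgue_on_indicator_mult[OF h Aset] J0
    by (subst Bochner_Integration.integral_sum) (auto intro: sum_nonneg)
  ultimately show ?thesis by (intro LIMSEQ_le_const) auto
qed

text \<open>A one-sided substitute for Lebesgue's differentiation theorem.\<close>

lemma AE_nonneg_of_intervals:
  fixes h :: "real \<Rightarrow> real"
  assumes h: "integrable (lebesgue_on {a..b}) h"
    and nn: "\<And>c d. a \<le> c \<Longrightarrow> c \<le> d \<Longrightarrow> d \<le> b \<Longrightarrow> 0 \<le> LI c d h"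
  shows "AE t in lebesgue_on {a..b}. 0 \<le> h t"
proof -
  interpret finite_measure "lebesgue_on {a..b}" by (rule finite_measure_lebesgue_on) simp
  show ?thesis
  proof (rule density_nonneg[OF h])
  fix A assume "A \<in> sets (lebesgue_on {a..b})"
  then have A: "A \<subseteq> {a..b}" "A \<in> sets lebesgue" by (auto simp: sets_restrict_space)
  have Al: "A \<in> lmeasurable"
    by (rule bounded_set_imp_lmeasurable[OF bounded_subset[OF _ A(1)] A(2)]) simp
  \<comment> \<open>The part of |h| above level N. Its integral tends to 0, so over a set of measure
    at most \<open>\<delta>\<close> the function \<open>h\<close> contributes at most N
    \<open>\<delta>\<close> plus a small tail.\<close>
  define k where "k N t = max (\<bar>h t\<bar> - real N) 0" for N t
  have hm: "h \<in> borel_measurable (lebesgue_on {a..b})" using h by auto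
  have km: "k N \<in> borel_measurable (lebesgue_on {a..b})" for N
    unfolding k_def using hm by measurable
  have ki: "integrable (lebesgue_on {a..b}) (k N)" for N
    by (rule Bochner_Integration.integrable_bound[OF h km]) (auto simp: k_def)
  have "(\<lambda>N. LI a b (k N)) \<longlonglongrightarrow> LI a b (\<lambda>t. 0)"
  proof (rule integral_dominated_convergence[where w="\<lambda>t. \<bar>h t\<bar>"])
    show "AE t in lebesgue_on {a..b}. (\<lambda>N. k N t) \<longlonglongrightarrow> 0"
    proof (rule AE_I2)
      fix t
      obtain N0 :: nat where N0: "\<bar>h t\<bar> \<le> N0" using real_arch_simple by blast
      have "\<forall>\<^sub>F N in sequentially. k N t = 0"
        by (rule eventually_mono[OF eventually_ge_at_top[of N0]]) (use N0 in \<open>auto simp: k_def max_def\<close>)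
      then show "(\<lambda>N. k N t) \<longlonglongrightarrow> 0" by (rule tendsto_eventually)
    qed
  qed (use h km in \<open>auto simp: k_def\<close>)
  then have k0: "(\<lambda>N. LI a b (k N)) \<longlonglongrightarrow> 0" by simp
  have eps: "- e \<le> (\<integral>x. indicator A x * h x \<partial>(lebesgue_on {a..b}))" if e: "e > 0" for e
  proof -
    have "\<forall>\<^sub>F N in sequentially. LI a b (k N) < e / 2"
      using k0 by (rule order_tendstoD) (use e in simp)
    then obtain N where N: "LI a b (k N) < e / 2" by (meson eventually_happens sequentially_bot)
    define \<delta> where "\<delta> = e / (2 * (real N + 1))"
    have \<delta>: "\<delta> > 0" using e by (simp add: \<delta>_def)
    \<comment> \<open>Outer regularity: \<open>A\<close> is covered by intervals with excess measure
      at most \<open>\<delta>\<close>, and on the covering the sign of the integral is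
      known.\<close>
    obtain \<D> where D: "countable \<D>" "\<And>K. K \<in> \<D> \<Longrightarrow> K \<subseteq> {a..b} \<and> K \<noteq> {} \<and> (\<exists>c d. K = {c..d})"
      "pairwise (\<lambda>A B. interior A \<inter> interior B = {}) \<D>"
      "A \<subseteq> \<Union>\<D>" "\<Union>\<D> \<in> lmeasurable" "measure lebesgue (\<Union>\<D>) \<le> measure lebesgue A + \<delta>"
      using measurable_outer_intervals_bounded[OF Al _ \<delta>, of a b] A(1) unfolding cbox_interval by metis
    let ?U = "\<Union>\<D>"
    have Ui: "integrable (lebesgue_on {a..b}) (\<lambda>x. indicator S x * h x)" if "S \<in> sets lebesgue" for S
      by (rule integrable_lebesgue_on_indicator_mult[OF h that])
    have UA: "?U - A \<in> sets lebesgue" "?U - A \<subseteq> {a..b}" using D(2,5) A(2) by auto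
    have mUA: "measure lebesgue (?U - A) \<le> \<delta>"
      using D(4,5,6) Al by (simp add: measurable_measure_Diff)
    have "(\<integral>x. indicator ?U x * h x \<partial>(lebesgue_on {a..b})) =
        (\<integral>x. indicator A x * h x \<partial>(lebesgue_on {a..b})) + (\<integral>x. indicator (?U - A) x * h x \<partial>(lebesgue_on {a..b}))"
    proof -
      have "(\<lambda>x. indicator ?U x * h x) = (\<lambda>x. indicator A x * h x + indicator (?U - A) x * h x)"
        using D(4) by (auto simp: indicator_def fun_eq_iff)
      then show ?thesis
        by (simp only: Bochner_Integration.integral_add[OF Ui[OF A(2)] Ui[OF UA(1)]])
    qed
    moreover have "0 \<le> (\<integral>x. indicator ?U x * h x \<partial>(lebesgue_on {a..b}))"
      by (rule integral_nonneg_Union_intervals[OF h nn D(1-3)])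
    moreover have "(\<integral>x. indicator (?U - A) x * h x \<partial>(lebesgue_on {a..b})) \<le> e"
    proof -
      have i1: "integrable (lebesgue_on {a..b}) (\<lambda>x. indicator (?U - A) x * 1 :: real)"
        by (rule integrable_lebesgue_on_indicator_mult[OF _ UA(1)])
           (simp add: finite_measure.integrable_const finite_measure_lebesgue_on)
      have "(\<integral>x. indicator (?U - A) x * h x \<partial>(lebesgue_on {a..b}))
          \<le> (\<integral>x. real N * (indicator (?U - A) x * 1) + k N x \<partial>(lebesgue_on {a..b}))"
      proof (rule integral_mono)
        show "integrable (lebesgue_on {a..b}) (\<lambda>x. real N * (indicator (?U - A) x * 1) + k N x)"
          using i1 ki by auto
        show "indicator (?U - A) x * h x \<le> real N * (indicator (?U - A) x * 1) + k N x" for x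
          by (auto simp: indicator_def k_def)
      qed (rule Ui[OF UA(1)])
      also have "\<dots> = real N * (\<integral>x. indicator (?U - A) x * 1 \<partial>(lebesgue_on {a..b})) + LI a b (k N)"
        using i1 ki by simp
      also have "(\<integral>x. indicator (?U - A) x * 1 \<partial>(lebesgue_on {a..b})) = measure lebesgue (?U - A)"
      proof -
        have "(\<integral>x. indicator (?U - A) x * (1::real) \<partial>(lebesgue_on {a..b})) = (\<integral>x. indicator {a..b} x * indicator (?U - A) x \<partial>lebesgue)"
          by (subst integral_restrict_space, simp, simp only: real_scaleR_def mult_1_right)
        also have "(\<lambda>x. indicator {a..b} x * indicator (?U - A) x :: real) = indicator (?U - A)"
          using UA(2) by (auto simp: indicator_def fun_eq_iff)
        finally show ?thesis using UA(1) by simp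
      qed
      also have "real N * measure lebesgue (?U - A) \<le> real N * \<delta>"
        using mUA by (intro mult_left_mono) auto
      also have "real N * \<delta> \<le> e / 2" using e by (simp add: \<delta>_def field_simps)
      finally show ?thesis using N by simp
    qed
    ultimately show ?thesis by simp
  qed
  have "0 \<le> (\<integral>x. indicator A x * h x \<partial>(lebesgue_on {a..b}))"
  proof (rule field_le_epsilon)
    fix e :: real assume "0 < e"
    then show "0 \<le> (\<integral>x. indicator A x * h x \<partial>(lebesgue_on {a..b})) + e"
      using eps[of e] by linarith
  qed
  then show "0 \<le> set_lebesgue_integral (lebesgue_on {a..b}) A h"
    by (simp add: set_lebesgue_integral_def)
  qed
qed

lemma AE_lebesgue_on_dense:
  fixes T :: real
  assumes "AE t in lebesgue_on {0<..<T}. t \<in> G" "0 \<le> p" "p < q" "q \<le> T"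
  obtains r where "p < r" "r < q" "r \<in> G"
proof -
  have "\<exists>r. p < r \<and> r < q \<and> r \<in> G"
  proof (rule ccontr)
    assume no: "\<not> (\<exists>r. p < r \<and> r < q \<and> r \<in> G)"
    have "AE t in lebesgue. t \<in> {0<..<T} \<longrightarrow> t \<in> G"
      using assms(1) by (subst (asm) AE_restrict_space_iff) auto
    then have "AE t in lebesgue. t \<notin> {p<..<q}"
      by (rule AE_mp) (use no assms in \<open>auto intro!: AE_I2\<close>)
    then have "{p<..<q} \<in> null_sets lebesgue"
      by (subst AE_iff_null_sets) auto
    then have "negligible {p<..<q}" by (simp add: negligible_iff_null_sets)
    then show False using open_not_negligible[of "{p<..<q}"] assms by auto
  qed
  then show ?thesis using that by blast
qed

lemma AE_open_to_closed:
  fixes T :: real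
  assumes "AE t in lebesgue_on {0<..<T}. P t" "0 \<le> a" "b < T"
  shows "AE t in lebesgue_on {a..b}. P t"
proof -
  have 1: "AE t in lebesgue. t \<in> {0<..<T} \<longrightarrow> P t"
    using assms(1) by (subst (asm) AE_restrict_space_iff) auto
  have 2: "AE t in lebesgue_on {a..b}. t \<notin> {0}"
    by (rule AE_lebesgue_on_not_in_countable) auto
  then have 2: "AE t in lebesgue. t \<in> {a..b} \<longrightarrow> t \<notin> {0}"
    by (subst (asm) AE_restrict_space_iff) auto
  have "AE t in lebesgue. t \<in> {a..b} \<longrightarrow> P t"
    using 1 2 by eventually_elim (use assms in auto)
  then show ?thesis by (subst AE_restrict_space_iff) auto
qed

lemma AE_closed_to_open:
  fixes T :: real
  assumes "\<And>b. b < T \<Longrightarrow> AE t in lebesgue_on {0..b}. P t"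
  shows "AE t in lebesgue_on {0<..<T}. P t"
proof -
  have "AE t in lebesgue. \<forall>n. t \<in> {0..T - 1 / real (Suc n)} \<longrightarrow> P t"
  proof (subst AE_all_countable, rule allI)
    fix n :: nat
    have "AE t in lebesgue_on {0..T - 1 / real (Suc n)}. P t" by (rule assms) simp
    then show "AE t in lebesgue. t \<in> {0..T - 1 / real (Suc n)} \<longrightarrow> P t"
      by (subst (asm) AE_restrict_space_iff) auto
  qed
  then have "AE t in lebesgue. t \<in> {0<..<T} \<longrightarrow> P t"
  proof (rule AE_mp, intro AE_I2 impI)
    fix t assume *: "\<forall>n. t \<in> {0..T - 1 / real (Suc n)} \<longrightarrow> P t" and t: "t \<in> {0<..<T}"
    have "0 < T - t" using t by simp
    then obtain n where "inverse (real (Suc n)) < T - t" using reals_Archimedean by blast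
    then have "t \<in> {0..T - 1 / real (Suc n)}" using t by (auto simp: inverse_eq_divide)
    then show "P t" using * by blast
  qed
  then show ?thesis by (subst AE_restrict_space_iff) auto
qed

lemma integrable_open_to_closed:
  fixes h :: "real \<Rightarrow> real"
  assumes "integrable (lebesgue_on {0<..<T}) h" "0 \<le> a" "b < T"
  shows "integrable (lebesgue_on {a..b}) h"
proof -
  have "h absolutely_integrable_on {0<..<T}"
    using assms(1) by (simp add: set_integrable_def integrable_restrict_space)
  then have "h absolutely_integrable_on ({a..b} \<inter> {0<..<T})"
    by (rule set_integrable_subset) auto
  moreover have "negligible {x \<in> ({a..b} \<inter> {0<..<T}) - {a..b}. h x \<noteq> 0}"
    by (rule negligible_subset[of "{}"]) auto
  moreover have "negligible {x \<in> {a..b} - ({a..b} \<inter> {0<..<T}). h x \<noteq> 0}"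
    by (rule negligible_subset[of "{0}"]) (use assms in auto)
  ultimately have "h absolutely_integrable_on {a..b}"
    by (rule absolutely_integrable_spike_set)
  then show ?thesis by (intro absolutely_integrable_imp_integrable) auto
qed

lemma LI_le_total:
  fixes h :: "real \<Rightarrow> real"
  assumes h: "integrable (lebesgue_on {0<..<T}) h" and ab: "0 \<le> a" "b < T" and nn: "\<And>t. 0 \<le> h t"
  shows "LI a b h \<le> integral\<^sup>L (lebesgue_on {0<..<T}) h"
proof -
  have "integral\<^sup>L lebesgue (\<lambda>x. indicator {a..b} x *\<^sub>R h x) \<le> integral\<^sup>L lebesgue (\<lambda>x. indicator {0<..<T} x *\<^sub>R h x)"
  proof (rule integral_mono_AE)
    show "integrable lebesgue (\<lambda>x. indicator {a..b} x *\<^sub>R h x)"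
      using integrable_open_to_closed[OF h ab] by (subst integrable_restrict_space[symmetric]) auto
    show "integrable lebesgue (\<lambda>x. indicator {0<..<T} x *\<^sub>R h x)"
      using h by (subst integrable_restrict_space[symmetric]) auto
    have "AE x in lebesgue_on UNIV. x \<notin> {0::real}" by (rule AE_lebesgue_on_not_in_countable) auto
    then have "AE x in lebesgue. x \<notin> {0::real}" by (subst (asm) AE_restrict_space_iff) auto
    then show "AE x in lebesgue. indicator {a..b} x *\<^sub>R h x \<le> indicator {0<..<T} x *\<^sub>R h x"
      by eventually_elim (use ab nn in \<open>auto simp: indicator_def\<close>)
  qed
  then show ?thesis by (simp add: integral_restrict_space)
qed

lemma integrable_const_Icc: "integrable (lebesgue_on {a..b}) (\<lambda>t. c)" for a b c :: real
  by (simp add: finite_measure.integrable_const finite_measure_lebesgue_on)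

lemma measure_lebesgue_on_Icc [simp]: "a \<le> b \<Longrightarrow> measure (lebesgue_on {a..b}) {a..b} = b - a" for a b :: real
  by (simp add: measure_restrict_space)

text \<open>Distributional derivatives on (0, T) see only times bounded away from 0. Integrability
  up to 0 lets the lower end of the identity tend to 0, where \<open>f\<close> is
  continuous.\<close>

lemma AC_on_extend0:
  assumes f: "continuous_on {0..<T} f" and AC: "AC_on {0<..<T} f g"
    and g: "\<And>b. 0 \<le> b \<Longrightarrow> b < T \<Longrightarrow> integrable (lebesgue_on {0..b}) g"
  shows "AC_on {0..<T} f g"
  unfolding AC_on_def
proof (intro ballI impI conjI)
  fix s t assume st: "s \<in> {0..<T}" "t \<in> {0..<T}" "s \<le> t"
  show i: "integrable (lebesgue_on {s..t}) g"
    by (rule integrable_subinterval[OF g[of t]]) (use st in auto)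
  show "LI s t g = f t - f s"
  proof (cases "s = 0 \<and> t > 0")
    case False
    then show ?thesis
    proof (cases "s = t")
      case True
      then show ?thesis by (simp only: LI_refl diff_self)
    next
      case False
      with \<open>\<not> (s = 0 \<and> t > 0)\<close> show ?thesis using AC_onD(2)[OF AC, of s t] st by auto
    qed
  next
    case True
    then have s: "s = 0" and t: "t > 0" "t < T" using st by auto
    define r :: "nat \<Rightarrow> real" where "r n = t * inverse (real (Suc n))" for n
    have r: "0 < r n" "r n \<le> t" for n using t by (auto simp: r_def field_simps)
    have r0: "r \<longlonglongrightarrow> 0" unfolding r_def
      using tendsto_mult[OF tendsto_const LIMSEQ_inverse_real_of_nat, of t] by simp
    have hk: "g integrable_on {0..t}" using i s by (auto intro: integrable_on_lebesgue_on)
    have c1: "continuous_on {0..t} (\<lambda>x. integral {x..t} g)"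
      by (rule indefinite_integral_continuous_1'[OF hk])
    have r': "r n \<in> {0..<T}" for n using r[of n] t by auto
    have "(\<lambda>n. integral {r n..t} g) \<longlonglongrightarrow> integral {0..t} g"
      by (intro continuous_on_tendsto_compose[OF c1 r0] always_eventually allI)
         (use r t in \<open>auto intro: less_imp_le\<close>)
    moreover have "integral {r n..t} g = f t - f (r n)" for n
    proof -
      have "LI (r n) t g = f t - f (r n)" using AC_onD(2)[OF AC, of "r n" t] r[of n] t by auto
      moreover have "integrable (lebesgue_on {r n..t}) g"
        using AC_onD(1)[OF AC, of "r n" t] r[of n] t by auto
      ultimately show ?thesis by (simp add: LI_eq_integral)
    qed
    moreover have "(\<lambda>n. f t - f (r n)) \<longlonglongrightarrow> f t - f 0"
      by (intro tendsto_intros continuous_on_tendsto_compose[OF f r0] always_eventually allI r')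
        (use t in auto)
    ultimately have "integral {0..t} g = f t - f 0" by (simp add: LIMSEQ_unique)
    then show ?thesis using i s by (simp add: LI_eq_integral)
  qed
qed

section \<open>Time dependent elements of \<open>L\<^sup>2\<close>\<close>

text \<open>Order m = 0 covers L^2 itself: \<open>sob 0\<close> is everything and
  \<open>hnorm 0\<close> is the norm.\<close>

definition smeas :: "real \<Rightarrow> nat \<Rightarrow> (real \<Rightarrow> 'a::euclidean_space l2) \<Rightarrow> bool" where
  "smeas T m x \<longleftrightarrow> (AE t in lebesgue_on {0<..<T}. x t \<in> sob m) \<and>
     (\<exists>s. (\<forall>k. simple_function (lebesgue_on {0<..<T}) (s k) \<and> s k ` {0<..<T} \<subseteq> sob m) \<and>
          (AE t in lebesgue_on {0<..<T}. (\<lambda>k. hnorm m (x t - s k t)) \<longlonglongrightarrow> 0))"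

lemma sob_0: "sob 0 = UNIV"
  by (auto simp: sob_def indices_def has_d_def)

lemma hnorm_0: "hnorm 0 x = norm x"
proof -
  have "indices 0 = {[] :: 'a list}" by (auto simp: indices_def)
  then show ?thesis by (simp add: hnorm_def dx_Nil L2_set_def)
qed

lemma AE_lebesgue_on_mem: "S \<in> sets lebesgue \<Longrightarrow> AE t in lebesgue_on S. t \<in> S"
  by (rule AE_I2) simp

lemma strongly_measurable_smeas:
  fixes u :: "real \<Rightarrow> 'a::euclidean_space \<Rightarrow> real"
  assumes "strongly_measurable T (sobolev_space unit_cube m) (sobolev_norm unit_cube m) u"
  shows "smeas T m (\<lambda>t. cls (u t))"
proof -
  obtain s where s: "AE t in lebesgue_on {0<..<T}. u t \<in> sobolev_space unit_cube m"
    "\<And>k. simple_function (lebesgue_on {0<..<T}) (s k)" "\<And>k t. t \<in> {0<..<T} \<Longrightarrow> s k t \<in> sobolev_space unit_cube m"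
    "AE t in lebesgue_on {0<..<T}. (\<lambda>k. sobolev_norm unit_cube m (u t - s k t)) \<longlonglongrightarrow> 0"
    using assms unfolding strongly_measurable_def by blast
  have mem: "AE t in lebesgue_on {0<..<T}. t \<in> {0<..<T}" by (rule AE_lebesgue_on_mem) simp
  have "AE t in lebesgue_on {0<..<T}. (\<lambda>k. hnorm m (cls (u t) - cls (s k t))) \<longlonglongrightarrow> 0"
    using s(1,4) mem
  proof eventually_elim
    case (elim t)
    have "sobolev_norm unit_cube m (u t - s k t) = hnorm m (cls (u t) - cls (s k t))" for k
    proof -
      have L: "u t \<in> L2_space unit_cube" "s k t \<in> L2_space unit_cube"
        using elim s(3) sobolev_space_L2 by blast+
      have c: "cls (\<lambda>y. u t y - s k t y) = cls (u t) - cls (s k t)"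
        by (rule cls_diff[OF L])
      have "cls (u t) - cls (s k t) \<in> sob m"
        using elim s(3) by (intro subspace_diff subspace_sob sobolev_space_sob) auto
      then have "(\<lambda>y. u t y - s k t y) \<in> sobolev_space unit_cube m"
        using sobolev_space_iff[OF L2_space_diff[OF L]] c by simp
      from sobolev_norm_eq[OF this] show ?thesis by (simp add: fun_diff_def c)
    qed
    then show ?case using elim by simp
  qed
  moreover have "AE t in lebesgue_on {0<..<T}. cls (u t) \<in> sob m"
    using s(1) by eventually_elim (rule sobolev_space_sob)
  ultimately show ?thesis
    unfolding smeas_def using simple_function_compose1[OF s(2), where g=cls] sobolev_space_sob[OF s(3)]
    by (intro conjI exI[of _ "\<lambda>k t. cls (s k t)"]) auto
qed

lemma strongly_measurable_L2_smeas:
  fixes u :: "real \<Rightarrow> 'a::euclidean_space \<Rightarrow> real"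
  assumes "strongly_measurable T (L2_space unit_cube) (L2_norm unit_cube) u"
  shows "smeas T 0 (\<lambda>t. cls (u t))"
proof -
  obtain s where s: "AE t in lebesgue_on {0<..<T}. u t \<in> L2_space unit_cube"
    "\<And>k. simple_function (lebesgue_on {0<..<T}) (s k)" "\<And>k t. t \<in> {0<..<T} \<Longrightarrow> s k t \<in> L2_space unit_cube"
    "AE t in lebesgue_on {0<..<T}. (\<lambda>k. L2_norm unit_cube (u t - s k t)) \<longlonglongrightarrow> 0"
    using assms unfolding strongly_measurable_def by blast
  have mem: "AE t in lebesgue_on {0<..<T}. t \<in> {0<..<T}" by (rule AE_lebesgue_on_mem) simp
  have "AE t in lebesgue_on {0<..<T}. (\<lambda>k. hnorm 0 (cls (u t) - cls (s k t))) \<longlonglongrightarrow> 0"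
    using s(1,4) mem
  proof eventually_elim
    case (elim t)
    have "L2_norm unit_cube (u t - s k t) = hnorm 0 (cls (u t) - cls (s k t))" for k
      using elim s(3)[of t k] L2_space_diff[of "u t" unit_cube "s k t"]
      by (simp add: hnorm_0 cls_diff[symmetric] norm_cls fun_diff_def)
    then show ?case using elim by simp
  qed
  then show ?thesis
    unfolding smeas_def using simple_function_compose1[OF s(2), where g=cls]
    by (intro conjI exI[of _ "\<lambda>k t. cls (s k t)"]) (auto simp: sob_0)
qed

lemma borel_measurable_lebesgue_on_AE:
  fixes f g :: "real \<Rightarrow> real"
  assumes "f \<in> borel_measurable (lebesgue_on S)" "S \<in> sets lebesgue"
    and "AE t in lebesgue_on S. f t = g t"
  shows "g \<in> borel_measurable (lebesgue_on S)"
proof -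
  have 1: "(\<lambda>x. if x \<in> S then f x else 0) \<in> borel_measurable lebesgue"
    using assms by (simp add: borel_measurable_if)
  have "AE t in lebesgue. t \<in> S \<longrightarrow> f t = g t"
    using assms(3) by (subst (asm) AE_restrict_space_iff) (use assms(2) in auto)
  then have "AE t in lebesgue. (if t \<in> S then f t else 0) = (if t \<in> S then g t else 0)"
    by eventually_elim auto
  from borel_measurable_AE[OF 1 this] show ?thesis
    using assms by (simp add: borel_measurable_if)
qed

lemma borel_measurable_AE_LIMSEQ:
  fixes f :: "nat \<Rightarrow> real \<Rightarrow> real"
  assumes "\<And>k. f k \<in> borel_measurable (lebesgue_on S)" "S \<in> sets lebesgue"
    and "AE t in lebesgue_on S. (\<lambda>k. f k t) \<longlonglongrightarrow> g t"
  shows "g \<in> borel_measurable (lebesgue_on S)"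
proof (rule borel_measurable_lebesgue_on_AE[OF _ assms(2)])
  show "(\<lambda>t. lim (\<lambda>k. f k t)) \<in> borel_measurable (lebesgue_on S)"
    by (rule borel_measurable_lim_metric[OF assms(1)])
  show "AE t in lebesgue_on S. lim (\<lambda>k. f k t) = g t"
    using assms(3) by eventually_elim (rule limI)
qed

lemma simple_function_borel_compose:
  fixes F :: "'b \<Rightarrow> real"
  shows "simple_function M s \<Longrightarrow> (\<lambda>t. F (s t)) \<in> borel_measurable M"
  by (rule borel_measurable_simple_function[OF simple_function_compose1])

lemma smeas_hnorm_measurable:
  assumes x: "smeas T m x" and y: "y \<in> sob m"
  shows "(\<lambda>t. hnorm m (x t - y)) \<in> borel_measurable (lebesgue_on {0<..<T})"
proof -
  obtain s where s: "AE t in lebesgue_on {0<..<T}. x t \<in> sob m"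
    "\<And>k. simple_function (lebesgue_on {0<..<T}) (s k)" "\<And>k t. t \<in> {0<..<T} \<Longrightarrow> s k t \<in> sob m"
    "AE t in lebesgue_on {0<..<T}. (\<lambda>k. hnorm m (x t - s k t)) \<longlonglongrightarrow> 0"
    using x unfolding smeas_def by blast
  have mem: "AE t in lebesgue_on {0<..<T}. t \<in> {0<..<T}" by (rule AE_lebesgue_on_mem) simp
  show ?thesis
  proof (rule borel_measurable_AE_LIMSEQ)
    show "(\<lambda>t. hnorm m (s k t - y)) \<in> borel_measurable (lebesgue_on {0<..<T})" for k
      by (rule simple_function_borel_compose[OF s(2)])
    show "AE t in lebesgue_on {0<..<T}. (\<lambda>k. hnorm m (s k t - y)) \<longlonglongrightarrow> hnorm m (x t - y)"
      using s(1,4) mem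
    proof eventually_elim
      case (elim t)
      have "\<bar>hnorm m (s k t - y) - hnorm m (x t - y)\<bar> \<le> hnorm m (x t - s k t)" for k
      proof -
        note sk = s(3)[OF elim(3), of k]
        have sd: "x t - y \<in> sob m" "s k t - y \<in> sob m" "x t - s k t \<in> sob m" "s k t - x t \<in> sob m"
          using elim(1) sk y by (auto intro: subspace_diff subspace_sob)
        have "hnorm m (x t - y) \<le> hnorm m (x t - s k t) + hnorm m (s k t - y)"
          using hnorm_triangle[OF sd(3,2)] by simp
        moreover have "hnorm m (s k t - y) \<le> hnorm m (s k t - x t) + hnorm m (x t - y)"
          using hnorm_triangle[OF sd(4,1)] by simp
        ultimately show ?thesis using hnorm_minus[OF sk elim(1)] by linarith
      qed
      then have "(\<lambda>k. hnorm m (s k t - y) - hnorm m (x t - y)) \<longlonglongrightarrow> 0"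
        by (intro Lim_null_comparison[OF _ elim(2)]) auto
      then show ?case by (simp add: LIM_zero_iff)
    qed
  qed simp
qed

lemma smeas_inner_measurable:
  assumes x: "smeas T m x" and \<alpha>: "\<alpha> \<in> indices m"
  shows "(\<lambda>t. inner (dx \<alpha> (x t)) \<psi>) \<in> borel_measurable (lebesgue_on {0<..<T})"
proof -
  obtain s where s: "AE t in lebesgue_on {0<..<T}. x t \<in> sob m"
    "\<And>k. simple_function (lebesgue_on {0<..<T}) (s k)" "\<And>k t. t \<in> {0<..<T} \<Longrightarrow> s k t \<in> sob m"
    "AE t in lebesgue_on {0<..<T}. (\<lambda>k. hnorm m (x t - s k t)) \<longlonglongrightarrow> 0"
    using x unfolding smeas_def by blast
  have mem: "AE t in lebesgue_on {0<..<T}. t \<in> {0<..<T}" by (rule AE_lebesgue_on_mem) simp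
  show ?thesis
  proof (rule borel_measurable_AE_LIMSEQ)
    show "(\<lambda>t. inner (dx \<alpha> (s k t)) \<psi>) \<in> borel_measurable (lebesgue_on {0<..<T})" for k
      by (rule simple_function_borel_compose[OF s(2)])
    show "AE t in lebesgue_on {0<..<T}. (\<lambda>k. inner (dx \<alpha> (s k t)) \<psi>) \<longlonglongrightarrow> inner (dx \<alpha> (x t)) \<psi>"
      using s(1,4) mem
    proof eventually_elim
      case (elim t)
      have "(\<lambda>k. dx \<alpha> (s k t)) \<longlonglongrightarrow> dx \<alpha> (x t)"
        using hnorm_tendsto_0_iff[of "\<lambda>k. s k t" m "x t"] s(3)[OF elim(3)] elim \<alpha> by auto
      then show ?case by (intro tendsto_intros)
    qed
  qed simp
qed

text \<open>The values of the approximating simple functions form a countable set. Its countability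
  is what allows exceptional null sets to be collected in \<open>x'_in_VV\<close>.\<close>

lemma smeas_separable:
  assumes x: "smeas T m x"
  obtains Q where "countable Q" "Q \<subseteq> sob m"
    "AE t in lebesgue_on {0<..<T}. \<forall>e>0. \<exists>q\<in>Q. hnorm m (x t - q) < e"
proof -
  obtain s where s: "AE t in lebesgue_on {0<..<T}. x t \<in> sob m"
    "\<And>k. simple_function (lebesgue_on {0<..<T}) (s k)" "\<And>k. s k ` {0<..<T} \<subseteq> sob m"
    "AE t in lebesgue_on {0<..<T}. (\<lambda>k. hnorm m (x t - s k t)) \<longlonglongrightarrow> 0"
    using x unfolding smeas_def by blast
  have mem: "AE t in lebesgue_on {0<..<T}. t \<in> {0<..<T}" by (rule AE_lebesgue_on_mem) simp
  let ?Q = "\<Union>k. s k ` {0<..<T}"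
  show ?thesis
  proof (rule that[of ?Q])
    have "finite (s k ` {0<..<T})" for k using simple_functionD(1)[OF s(2)[of k]] by simp
    then show "countable ?Q" by (auto intro: countable_finite)
    show "?Q \<subseteq> sob m" using s(3) by auto
    show "AE t in lebesgue_on {0<..<T}. \<forall>e>0. \<exists>q\<in>?Q. hnorm m (x t - q) < e"
      using s(4) mem
    proof eventually_elim
      case (elim t)
      show ?case
      proof (intro allI impI)
        fix e :: real assume "e > 0"
        then have "\<forall>\<^sub>F k in sequentially. hnorm m (x t - s k t) < e"
          using elim(1) by (rule order_tendstoD(2)[rotated])
        then obtain k where "hnorm m (x t - s k t) < e" by (meson eventually_happens sequentially_bot)
        then show "\<exists>q\<in>?Q. hnorm m (x t - q) < e" using elim(2) by blast
      qed
    qed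
  qed
qed

text \<open>Used for the pairs (v, v') and (v', v''). Absolute continuity includes time 0, where the
  initial data enter. No regularity in space is imposed on \<open>x\<close> itself; only its
  derivative is in H^4, at almost all times.\<close>

locale l2_evolution =
  fixes T :: real and x x' :: "real \<Rightarrow> 'a::euclidean_space l2"
  assumes T: "T > 0"
    and AC: "\<And>\<psi>. AC_on {0..<T} (\<lambda>t. inner (x t) \<psi>) (\<lambda>t. inner (x' t) \<psi>)"
    and meas: "smeas T 4 x'"
    and hint: "integrable (lebesgue_on {0<..<T}) (\<lambda>t. hnorm 4 (x' t))"
begin

lemma x'_sob: "AE t in lebesgue_on {0<..<T}. x' t \<in> sob 4"
  using meas by (simp add: smeas_def)

lemma x'_sob_closed: "0 \<le> a \<Longrightarrow> b < T \<Longrightarrow> AE t in lebesgue_on {a..b}. x' t \<in> sob 4"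
  by (rule AE_open_to_closed[OF x'_sob])

lemma hnorm_integrable: "0 \<le> a \<Longrightarrow> b < T \<Longrightarrow> integrable (lebesgue_on {a..b}) (\<lambda>t. hnorm 4 (x' t))"
  by (rule integrable_open_to_closed[OF hint])

lemma hnorm_diff_integrable_open:
  assumes g: "g \<in> sob 4"
  shows "integrable (lebesgue_on {0<..<T}) (\<lambda>t. hnorm 4 (x' t - g))"
proof (rule Bochner_Integration.integrable_bound[where f="\<lambda>t. hnorm 4 (x' t) + hnorm 4 g"])
  show "integrable (lebesgue_on {0<..<T}) (\<lambda>t. hnorm 4 (x' t) + hnorm 4 g)"
    using hint by (auto simp: finite_measure.integrable_const finite_measure_lebesgue_on)
  show "(\<lambda>t. hnorm 4 (x' t - g)) \<in> borel_measurable (lebesgue_on {0<..<T})"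
    by (rule smeas_hnorm_measurable[OF meas g])
  show "AE t in lebesgue_on {0<..<T}. norm (hnorm 4 (x' t - g)) \<le> norm (hnorm 4 (x' t) + hnorm 4 g)"
    using x'_sob
  proof eventually_elim
    case (elim t)
    have g': "- g \<in> sob 4" using subspace_neg[OF subspace_sob g] .
    have "hnorm 4 (x' t + - g) \<le> hnorm 4 (x' t) + hnorm 4 (- g)"
      by (rule hnorm_triangle[OF elim g'])
    moreover have "hnorm 4 (- g) = hnorm 4 g"
      using hnorm_minus[OF subspace_0[OF subspace_sob] g] by simp
    ultimately show ?case by (simp add: hnorm_nonneg)
  qed
qed

lemma dx_pair_le:
  assumes "x' t \<in> sob 4" "\<alpha> \<in> indices 2"
  shows "\<bar>inner (dx \<alpha> (x' t)) \<psi>\<bar> \<le> hnorm 4 (x' t) * norm \<psi>"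
proof -
  have "\<alpha> \<in> indices 4" using assms(2) by (auto simp: indices_def)
  then show ?thesis
    by (intro order_trans[OF Cauchy_Schwarz_ineq2] mult_right_mono norm_dx_le_hnorm) auto
qed

lemma indices_2_4: "\<alpha> \<in> indices 2 \<Longrightarrow> \<alpha> \<in> indices 4"
  by (auto simp: indices_def)

lemma dx_pair_integrable:
  assumes "0 \<le> a" "b < T" "\<alpha> \<in> indices 2"
  shows "integrable (lebesgue_on {a..b}) (\<lambda>t. inner (dx \<alpha> (x' t)) \<psi>)"
proof (rule integrable_open_to_closed[OF _ assms(1,2)])
  show "integrable (lebesgue_on {0<..<T}) (\<lambda>t. inner (dx \<alpha> (x' t)) \<psi>)"
  proof (rule Bochner_Integration.integrable_bound[where f="\<lambda>t. hnorm 4 (x' t) * norm \<psi>"])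
    show "AE t in lebesgue_on {0<..<T}. norm (inner (dx \<alpha> (x' t)) \<psi>) \<le> norm (hnorm 4 (x' t) * norm \<psi>)"
      using x'_sob by eventually_elim (use dx_pair_le assms(3) in \<open>auto simp: hnorm_nonneg\<close>)
  qed (use hint smeas_inner_measurable[OF meas indices_2_4[OF assms(3)]] in auto)
qed

text \<open>The space derivatives are moved onto the test function, where absolute continuity of
  pairings with a fixed class applies, and are moved back under the integral. The two signs
  cancel.\<close>

lemma test_increment:
  assumes \<phi>: "\<phi> \<in> tests" and \<alpha>: "\<alpha> \<in> indices 2" and ab: "0 \<le> a" "a \<le> b" "b < T"
    and s: "x b - x a \<in> sob 2"
  shows "inner (dx \<alpha> (x b - x a)) (cls \<phi>) = LI a b (\<lambda>t. inner (dx \<alpha> (x' t)) (cls \<phi>))"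
proof -
  let ?\<psi> = "cls (iter_partial \<alpha> \<phi>)"
  have sg: "(-1::real) ^ length \<alpha> * (-1) ^ length \<alpha> = 1" by (simp add: power_add[symmetric])
  have e: "inner (dx \<alpha> z) (cls \<phi>) = (-1) ^ length \<alpha> * inner z ?\<psi>" if "z \<in> sob m" "\<alpha> \<in> indices m" for z m
  proof -
    have h: "inner z ?\<psi> = (-1) ^ length \<alpha> * inner (dx \<alpha> z) (cls \<phi>)"
      using sob_has_d[OF that] \<phi> unfolding has_d_def by blast
    show ?thesis unfolding h mult.assoc[symmetric] sg by simp
  qed
  have "inner (dx \<alpha> (x b - x a)) (cls \<phi>) = (-1) ^ length \<alpha> * (inner (x b) ?\<psi> - inner (x a) ?\<psi>)"
    using e[OF s \<alpha>] by (simp add: inner_diff_left)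
  also have "\<dots> = (-1) ^ length \<alpha> * LI a b (\<lambda>t. inner (x' t) ?\<psi>)"
    using AC_onD(2)[OF AC, of a b ?\<psi>] ab by simp
  also have "\<dots> = LI a b (\<lambda>t. (-1) ^ length \<alpha> * inner (x' t) ?\<psi>)"
    by simp
  also have "\<dots> = LI a b (\<lambda>t. inner (dx \<alpha> (x' t)) (cls \<phi>))"
  proof (rule integral_cong_AE)
    show "AE t in lebesgue_on {a..b}. (-1) ^ length \<alpha> * inner (x' t) ?\<psi> = inner (dx \<alpha> (x' t)) (cls \<phi>)"
      using x'_sob_closed[OF ab(1,3)] by eventually_elim (use e indices_2_4[OF \<alpha>] in auto)
    show "(\<lambda>t. (-1) ^ length \<alpha> * inner (x' t) ?\<psi>) \<in> borel_measurable (lebesgue_on {a..b})"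
      using AC_onD(1)[OF AC, of a b ?\<psi>] ab by auto
    show "(\<lambda>t. inner (dx \<alpha> (x' t)) (cls \<phi>)) \<in> borel_measurable (lebesgue_on {a..b})"
      using dx_pair_integrable[OF ab(1,3) \<alpha>] by auto
  qed
  finally show ?thesis .
qed

lemma pair_increment:
  assumes \<alpha>: "\<alpha> \<in> indices 2" and ab: "0 \<le> a" "a \<le> b" "b < T" and s: "x b - x a \<in> sob 2"
  shows "inner (dx \<alpha> (x b - x a)) \<psi> = LI a b (\<lambda>t. inner (dx \<alpha> (x' t)) \<psi>)"
proof -
  obtain \<phi> where \<phi>: "\<And>n. \<phi> n \<in> tests" "(\<lambda>n. cls (\<phi> n)) \<longlonglongrightarrow> \<psi>"
    using tests_dense_seq[of \<psi>] by blast
  have "Bseq (\<lambda>n. cls (\<phi> n))" using \<phi>(2) by (intro convergent_imp_Bseq) (auto simp: convergent_def)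
  then obtain B where B: "\<And>n. norm (cls (\<phi> n)) \<le> B" unfolding Bseq_def by blast
  have "(\<lambda>n. LI a b (\<lambda>t. inner (dx \<alpha> (x' t)) (cls (\<phi> n)))) \<longlonglongrightarrow> LI a b (\<lambda>t. inner (dx \<alpha> (x' t)) \<psi>)"
  proof (rule integral_dominated_convergence[where w="\<lambda>t. hnorm 4 (x' t) * B"])
    show "AE t in lebesgue_on {a..b}. (\<lambda>n. inner (dx \<alpha> (x' t)) (cls (\<phi> n))) \<longlonglongrightarrow> inner (dx \<alpha> (x' t)) \<psi>"
      by (intro AE_I2 tendsto_intros \<phi>)
    show "AE t in lebesgue_on {a..b}. norm (inner (dx \<alpha> (x' t)) (cls (\<phi> n))) \<le> hnorm 4 (x' t) * B" for n
      using x'_sob_closed[OF ab(1,3)]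
      by eventually_elim (auto intro!: order_trans[OF dx_pair_le[OF _ \<alpha>]] mult_left_mono B hnorm_nonneg)
  qed (use dx_pair_integrable[OF ab(1,3) \<alpha>] hnorm_integrable[OF ab(1,3)] in auto)
  moreover have "(\<lambda>n. inner (dx \<alpha> (x b - x a)) (cls (\<phi> n))) \<longlonglongrightarrow> inner (dx \<alpha> (x b - x a)) \<psi>"
    by (intro tendsto_intros \<phi>)
  ultimately show ?thesis
    using test_increment[OF \<phi>(1) \<alpha> ab s] by (simp add: LIMSEQ_unique)
qed

text \<open>Minkowski's integral inequality, obtained by pairing with the increment itself and
  dividing by its norm. The constant \<open>g\<close> is subtracted to compare a difference quotient
  with a fixed element.\<close>

lemma dx_increment_le:
  assumes \<alpha>: "\<alpha> \<in> indices 2" and ab: "0 \<le> a" "a \<le> b" "b < T" and s: "x b - x a \<in> sob 2"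
    and g: "g \<in> sob 4"
  shows "norm (dx \<alpha> (x b - x a - (b - a) *\<^sub>R g)) \<le> LI a b (\<lambda>t. hnorm 4 (x' t - g))"
proof -
  have g2: "g \<in> sob 2" using g sob_mono[of 2 4] by auto
  let ?z = "x b - x a - (b - a) *\<^sub>R g"
  have z: "dx \<alpha> ?z = dx \<alpha> (x b - x a) - (b - a) *\<^sub>R dx \<alpha> g"
    using \<alpha> s g2 by (simp add: dx_diff[where m=2] dx_scale[where m=2] subspace_scale[OF subspace_sob])
  have int: "integrable (lebesgue_on {a..b}) (\<lambda>t. hnorm 4 (x' t - g))"
    by (rule integrable_open_to_closed[OF hnorm_diff_integrable_open[OF g] ab(1,3)])
  let ?\<psi> = "dx \<alpha> ?z"
  have c: "integrable (lebesgue_on {a..b}) (\<lambda>t. inner (dx \<alpha> g) ?\<psi>)"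
    by (simp add: finite_measure.integrable_const finite_measure_lebesgue_on)
  have "(norm ?\<psi>)\<^sup>2 = LI a b (\<lambda>t. inner (dx \<alpha> (x' t)) ?\<psi> - inner (dx \<alpha> g) ?\<psi>)"
    using pair_increment[OF \<alpha> ab s, of ?\<psi>] dx_pair_integrable[OF ab(1,3) \<alpha>, of ?\<psi>] c
    using ab by (simp add: power2_norm_eq_inner z inner_diff_left)
  also have "\<dots> \<le> LI a b (\<lambda>t. hnorm 4 (x' t - g) * norm ?\<psi>)"
  proof (rule LI_mono_AE)
    show "AE t in lebesgue_on {a..b}. inner (dx \<alpha> (x' t)) ?\<psi> - inner (dx \<alpha> g) ?\<psi> \<le> hnorm 4 (x' t - g) * norm ?\<psi>"
      using x'_sob_closed[OF ab(1,3)]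
    proof eventually_elim
      case (elim t)
      have "inner (dx \<alpha> (x' t)) ?\<psi> - inner (dx \<alpha> g) ?\<psi> = inner (dx \<alpha> (x' t - g)) ?\<psi>"
        using dx_diff[OF elim g indices_2_4[OF \<alpha>]] by (simp add: inner_diff_left)
      also have "\<dots> \<le> norm (dx \<alpha> (x' t - g)) * norm ?\<psi>" by (rule norm_cauchy_schwarz)
      also have "\<dots> \<le> hnorm 4 (x' t - g) * norm ?\<psi>"
        by (intro mult_right_mono norm_dx_le_hnorm indices_2_4[OF \<alpha>]) auto
      finally show ?case .
    qed
  qed (use int c dx_pair_integrable[OF ab(1,3) \<alpha>] in auto)
  also have "\<dots> = LI a b (\<lambda>t. hnorm 4 (x' t - g)) * norm ?\<psi>"
    using int by simp
  finally show ?thesis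
    using integral_nonneg_AE[of "\<lambda>t. hnorm 4 (x' t - g)" "lebesgue_on {a..b}"] hnorm_nonneg
    by (cases "norm ?\<psi> = 0") (auto simp: power2_eq_square mult_le_cancel_right)
qed

text \<open>Difference quotients of \<open>x\<close> between times in \<open>G\<close> lie in
  \<open>VV\<close>. If \<open>q\<close> stays at distance c from \<open>VV\<close>, then it also
  stays at distance c from these quotients, so the mean of \<open>hnorm 4 (x' t - q)\<close> over
  every interval is at least c, and hence the function itself almost everywhere. With countably many
  \<open>q\<close> that come close to \<open>x' t\<close>, this forces \<open>x' t\<close> into the
  closure of \<open>VV\<close>. A general \<open>G\<close> of full measure is allowed because
  \<open>v'\<close> lies in V at almost all times only.\<close>

lemma x'_in_VV:
  assumes G: "AE t in lebesgue_on {0<..<T}. t \<in> G" "G \<subseteq> {0..<T}" "\<And>t. t \<in> G \<Longrightarrow> x t \<in> VV"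
  shows "AE t in lebesgue_on {0<..<T}. x' t \<in> VV"
proof -
  obtain Q where Q: "countable Q" "Q \<subseteq> sob 4"
    "AE t in lebesgue_on {0<..<T}. \<forall>e>0. \<exists>q\<in>Q. hnorm 4 (x' t - q) < e"
    using smeas_separable[OF meas] .
  \<comment> \<open>Distance from \<open>VV\<close> is measured by the largest of the derivatives up
    to order two, so c is a lower bound for at least one of them.\<close>
  have far: "AE t in lebesgue_on {0<..<T}. c \<le> hnorm 4 (x' t - q)"
    if q: "q \<in> sob 4" and f: "\<And>y. y \<in> VV \<Longrightarrow> \<exists>\<alpha>\<in>indices 2. c \<le> norm (dx \<alpha> (q - y))" for q c
  proof (rule AE_closed_to_open)
    fix b0 assume b0: "b0 < T"
    let ?h = "\<lambda>t. hnorm 4 (x' t - q) - c"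
    have hi: "integrable (lebesgue_on {a..b}) ?h" if "0 \<le> a" "b < T" for a b
      using integrable_open_to_closed[OF hnorm_diff_integrable_open[OF q] that]
      by (auto simp: finite_measure.integrable_const finite_measure_lebesgue_on)
    have q2: "q \<in> sob 2" using q sob_mono[of 2 4] by auto
    \<comment> \<open>The increment minus (b - a) q is -(b - a) times the difference of q and the
      difference quotient, whose distance from q is at least c.\<close>
    have goodLI: "0 \<le> LI a b ?h" if ab: "a \<in> G" "b \<in> G" "a < b" for a b
    proof -
      have ab': "0 \<le> a" "a \<le> b" "b < T" using ab G(2) by auto
      have d: "x b - x a \<in> VV" using G(3) ab by (intro subspace_diff subspace_VV) auto
      have "(1 / (b - a)) *\<^sub>R (x b - x a) \<in> VV" by (intro subspace_scale subspace_VV d)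
      from f[OF this] obtain \<alpha> where \<alpha>: "\<alpha> \<in> indices 2"
          "c \<le> norm (dx \<alpha> (q - (1 / (b - a)) *\<^sub>R (x b - x a)))" by blast
      let ?y = "(1 / (b - a)) *\<^sub>R (x b - x a)"
      have "x b - x a - (b - a) *\<^sub>R q = (- (b - a)) *\<^sub>R (q - ?y)"
      proof -
        have "(b - a) *\<^sub>R ?y = x b - x a" using ab(3) by simp
        then show ?thesis
          by (simp only: scaleR_minus_left scaleR_diff_right) simp
      qed
      moreover have "q - ?y \<in> sob 2"
        by (rule subspace_diff[OF subspace_sob q2 subspace_scale[OF subspace_sob VV_sob[OF d]]])
      ultimately have "dx \<alpha> (x b - x a - (b - a) *\<^sub>R q) = (- (b - a)) *\<^sub>R dx \<alpha> (q - ?y)"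
        using \<alpha>(1) by (simp only: dx_scale)
      then have "norm (dx \<alpha> (x b - x a - (b - a) *\<^sub>R q)) = (b - a) * norm (dx \<alpha> (q - (1 / (b - a)) *\<^sub>R (x b - x a)))"
        using ab(3) by simp
      moreover have "(b - a) * c \<le> (b - a) * norm (dx \<alpha> (q - (1 / (b - a)) *\<^sub>R (x b - x a)))"
        using \<alpha>(2) ab(3) by (intro mult_left_mono) auto
      ultimately have "(b - a) * c \<le> LI a b (\<lambda>t. hnorm 4 (x' t - q))"
        using dx_increment_le[OF \<alpha>(1) ab' VV_sob[OF d] q] by linarith
      then show ?thesis
        using integrable_open_to_closed[OF hnorm_diff_integrable_open[OF q] ab'(1,3)]
          integrable_const_Icc[of a b c] ab' by simp
    qed
    have "AE t in lebesgue_on {0..b0}. 0 \<le> ?h t"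
    proof (rule AE_nonneg_of_intervals[OF hi[OF order_refl b0]])
      fix c' d assume cd: "0 \<le> c'" "c' \<le> d" "d \<le> b0"
      show "0 \<le> LI c' d ?h"
      proof (cases "c' = d")
        case True then show ?thesis by (simp only: LI_refl order_refl)
      next
        case False
        then have lt: "c' < d" using cd by simp
        \<comment> \<open>End points outside \<open>G\<close> are approached from inside the
          interval by times in \<open>G\<close>; the midpoint keeps the two sequences apart.\<close>
        define m where "m = (c' + d) / 2"
        have m: "c' < m" "m < d" using lt by (auto simp: m_def)
        have "\<exists>r. c' < r \<and> r < min m (c' + inverse (real (Suc n))) \<and> r \<in> G" for n
        proof -
          have *: "c' < min m (c' + inverse (real (Suc n)))" "min m (c' + inverse (real (Suc n))) \<le> T"
            using m cd b0 by auto
          show ?thesis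
            by (rule AE_lebesgue_on_dense[OF G(1) cd(1) *]) blast
        qed
        then obtain r where r: "\<And>n. c' < r n \<and> r n < min m (c' + inverse (real (Suc n))) \<and> r n \<in> G" by metis
        have "\<exists>s. max m (d - inverse (real (Suc n))) < s \<and> s < d \<and> s \<in> G" for n
        proof -
          have *: "0 \<le> max m (d - inverse (real (Suc n)))" "max m (d - inverse (real (Suc n))) < d" "d \<le> T"
            using m cd b0 by auto
          show ?thesis
            by (rule AE_lebesgue_on_dense[OF G(1) *]) blast
        qed
        then obtain s where s: "\<And>n. max m (d - inverse (real (Suc n))) < s n \<and> s n < d \<and> s n \<in> G" by metis
        have r0: "r \<longlonglongrightarrow> c'"
        proof (rule tendsto_sandwich[OF _ _ tendsto_const])
          show "(\<lambda>n. c' + inverse (real (Suc n))) \<longlonglongrightarrow> c'"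
            using tendsto_add[OF tendsto_const LIMSEQ_inverse_real_of_nat, of c'] by simp
        qed (use r in \<open>auto intro!: always_eventually less_imp_le\<close>)
        have s0: "s \<longlonglongrightarrow> d"
        proof (rule tendsto_sandwich[OF _ _ _ tendsto_const])
          show "(\<lambda>n. d - inverse (real (Suc n))) \<longlonglongrightarrow> d"
            using tendsto_diff[OF tendsto_const LIMSEQ_inverse_real_of_nat, of d] by simp
        qed (use s in \<open>auto intro!: always_eventually less_imp_le\<close>)
        have hk: "?h integrable_on {c'..d}"
          using hi[of c' d] cd b0 by (auto intro: integrable_on_lebesgue_on)
        have F: "continuous_on {c'..d} (\<lambda>t. integral {c'..t} ?h)"
          by (rule indefinite_integral_continuous_1[OF hk])
        have rs: "c' \<le> r n" "r n < s n" "s n \<le> d" for n using r[of n] s[of n] by auto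
        have rs': "c' \<le> s n" "r n \<le> d" for n using rs[of n] by auto
        have "(\<lambda>n. integral {c'..s n} ?h - integral {c'..r n} ?h) \<longlonglongrightarrow> integral {c'..d} ?h - integral {c'..c'} ?h"
          using rs rs' lt by (intro tendsto_diff continuous_on_tendsto_compose[OF F s0] continuous_on_tendsto_compose[OF F r0])
            (auto intro!: always_eventually)
        moreover have "0 \<le> integral {c'..s n} ?h - integral {c'..r n} ?h" for n
        proof -
          have "integral {c'..r n} ?h + integral {r n..s n} ?h = integral {c'..s n} ?h"
            by (rule Henstock_Kurzweil_Integration.integral_combine)
              (use rs[of n] integrable_on_subinterval[OF hk] in auto)
          moreover have "integrable (lebesgue_on {r n..s n}) ?h" using rs[of n] cd b0 by (intro hi) auto
          ultimately show ?thesis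
            using goodLI[of "r n" "s n"] r[of n] s[of n] rs(2)[of n] by (simp add: LI_eq_integral)
        qed
        ultimately have "0 \<le> integral {c'..d} ?h - integral {c'..c'} ?h"
          by (intro tendsto_lowerbound) auto
        then show ?thesis using hi[of c' d] cd b0 by (simp add: LI_eq_integral)
      qed
    qed
    then show "AE t in lebesgue_on {0..b0}. c \<le> hnorm 4 (x' t - q)" by simp
  qed
  \<comment> \<open>Distances are restricted to rationals so that only countably many exceptional
    sets arise.\<close>
  have "AE t in lebesgue_on {0<..<T}. \<forall>q\<in>Q. \<forall>c\<in>\<rat>.
      (\<forall>y\<in>VV. \<exists>\<alpha>\<in>indices 2. c \<le> norm (dx \<alpha> (q - y))) \<longrightarrow> c \<le> hnorm 4 (x' t - q)"
  proof (subst AE_ball_countable[OF Q(1)], rule ballI, subst AE_ball_countable[OF countable_rat], rule ballI)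
    fix q and c :: real assume "q \<in> Q" "c \<in> \<rat>"
    then show "AE t in lebesgue_on {0<..<T}. (\<forall>y\<in>VV. \<exists>\<alpha>\<in>indices 2. c \<le> norm (dx \<alpha> (q - y))) \<longrightarrow> c \<le> hnorm 4 (x' t - q)"
      using far[of q c] Q(2) by (cases "\<forall>y\<in>VV. \<exists>\<alpha>\<in>indices 2. c \<le> norm (dx \<alpha> (q - y))") auto
  qed
  then show ?thesis
    using Q(3) x'_sob
  proof eventually_elim
    case (elim t)
    have s2: "x' t \<in> sob 2" using elim(3) sob_mono[of 2 4] by auto
    show ?case
    proof (rule VV_closed[OF s2])
      fix e :: real assume "e > 0"
      then obtain c where c: "c \<in> \<rat>" "0 < c" "c < e / 2" using Rats_dense_in_real[of 0 "e / 2"] by auto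
      obtain q where q: "q \<in> Q" "hnorm 4 (x' t - q) < c" using elim(2) c(2) by blast
      have q4: "q \<in> sob 4" using q Q(2) by auto
      then have q2: "q \<in> sob 2" using sob_mono[of 2 4] by auto
      \<comment> \<open>Since q is closer than c to \<open>x' t\<close>, it cannot have distance c
        from \<open>VV\<close>.\<close>
      have "\<not> (\<forall>y\<in>VV. \<exists>\<alpha>\<in>indices 2. c \<le> norm (dx \<alpha> (q - y)))"
        using elim(1) q c(1) by (metis not_le)
      then obtain y where y: "y \<in> VV" "\<And>\<alpha>. \<alpha> \<in> indices 2 \<Longrightarrow> norm (dx \<alpha> (q - y)) < c"
        by (auto simp: not_le)
      have "norm (dx \<alpha> (x' t - y)) < e" if \<alpha>: "\<alpha> \<in> indices 2" for \<alpha>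
      proof -
        have "dx \<alpha> (x' t - y) = dx \<alpha> (x' t - q) + dx \<alpha> (q - y)"
          using dx_diff[OF s2 q2 \<alpha>] dx_diff[OF q2 VV_sob[OF y(1)] \<alpha>] dx_diff[OF s2 VV_sob[OF y(1)] \<alpha>] by simp
        moreover have "norm (dx \<alpha> (x' t - q)) < c"
          using norm_dx_le_hnorm[OF indices_2_4[OF \<alpha>], of "x' t - q"] q(2) by simp
        ultimately show ?thesis
          using norm_triangle_ineq[of "dx \<alpha> (x' t - q)" "dx \<alpha> (q - y)"] y(2)[OF \<alpha>] c(3) by simp
      qed
      then show "\<exists>y\<in>VV. \<forall>\<alpha>\<in>indices 2. norm (dx \<alpha> (x' t - y)) < e" using y(1) by blast
    qed
  qed
qed

lemma dx_AC:
  assumes G: "G \<subseteq> {0..<T}" "\<And>t. t \<in> G \<Longrightarrow> x t \<in> sob 2" and \<alpha>: "\<alpha> \<in> indices 2"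
  shows "AC_on G (\<lambda>t. inner (dx \<alpha> (x t)) \<psi>) (\<lambda>t. inner (dx \<alpha> (x' t)) \<psi>)"
  unfolding AC_on_def
proof (intro ballI impI conjI)
  fix s t assume st: "s \<in> G" "t \<in> G" "s \<le> t"
  then have st': "0 \<le> s" "t < T" using G(1) by auto
  show "integrable (lebesgue_on {s..t}) (\<lambda>t. inner (dx \<alpha> (x' t)) \<psi>)"
    by (rule dx_pair_integrable[OF st' \<alpha>])
  have "x t - x s \<in> sob 2" using G(2) st by (intro subspace_diff subspace_sob) auto
  from pair_increment[OF \<alpha> st'(1) st(3) st'(2) this, of \<psi>]
  show "LI s t (\<lambda>t. inner (dx \<alpha> (x' t)) \<psi>) = inner (dx \<alpha> (x t)) \<psi> - inner (dx \<alpha> (x s)) \<psi>"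
    using dx_diff[OF G(2)[OF st(2)] G(2)[OF st(1)] \<alpha>] by (simp add: inner_diff_left)
qed

lemma lap_AC:
  assumes G: "G \<subseteq> {0..<T}" "\<And>t. t \<in> G \<Longrightarrow> x t \<in> sob 2"
  shows "AC_on G (\<lambda>t. inner (lap (x t)) \<psi>) (\<lambda>t. inner (lap (x' t)) \<psi>)"
  unfolding lap_def inner_sum_left by (intro AC_on_sum dx_AC G) auto

end

section \<open>Orthonormal bases of finite-dimensional subspaces\<close>

text \<open>The form is constrained on \<open>W\<close> only, because \<open>lap\<close> is linear
  and definite just on \<open>VV\<close>. One Gram-Schmidt construction then serves three forms: the
  L^2 inner product, the Laplacian form and the Ritz form.\<close>

locale pos_form =
  fixes W :: "'v::real_vector set" and B :: "'v \<Rightarrow> 'v \<Rightarrow> real"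
  assumes W: "subspace W"
    and add: "\<And>x y z. x \<in> W \<Longrightarrow> y \<in> W \<Longrightarrow> z \<in> W \<Longrightarrow> B (x + y) z = B x z + B y z"
    and scale: "\<And>c x z. x \<in> W \<Longrightarrow> z \<in> W \<Longrightarrow> B (c *\<^sub>R x) z = c * B x z"
    and sym: "\<And>x y. x \<in> W \<Longrightarrow> y \<in> W \<Longrightarrow> B x y = B y x"
    and pos: "\<And>x. x \<in> W \<Longrightarrow> x \<noteq> 0 \<Longrightarrow> 0 < B x x"
begin

definition onb :: "'v set \<Rightarrow> bool" where
  "onb Q \<longleftrightarrow> finite Q \<and> Q \<subseteq> W \<and> (\<forall>p\<in>Q. \<forall>q\<in>Q. B p q = (if p = q then 1 else 0))"

lemma zero: "x \<in> W \<Longrightarrow> B 0 x = 0"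
  using scale[of x x 0] by simp

lemma diff: "x \<in> W \<Longrightarrow> y \<in> W \<Longrightarrow> z \<in> W \<Longrightarrow> B (x - y) z = B x z - B y z"
  using add[of x "(-1) *\<^sub>R y" z] scale[of y z "-1"] subspace_scale[OF W, of y "-1"] by simp

lemma sum:
  "(\<And>i. i \<in> I \<Longrightarrow> f i \<in> W) \<Longrightarrow> z \<in> W \<Longrightarrow> B (\<Sum>i\<in>I. f i) z = (\<Sum>i\<in>I. B (f i) z)"
  by (induction I rule: infinite_finite_induct) (auto simp: zero add subspace_sum[OF W])

definition proj :: "'v set \<Rightarrow> 'v \<Rightarrow> 'v" where
  "proj Q x = (\<Sum>q\<in>Q. B x q *\<^sub>R q)"

lemma proj_span: "proj Q x \<in> span Q"
  unfolding proj_def by (intro span_sum span_scale span_base)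

lemma onb_span_W: "onb Q \<Longrightarrow> span Q \<subseteq> W"
  unfolding onb_def by (intro span_minimal W) auto

lemma proj_orth:
  assumes Q: "onb Q" and x: "x \<in> W" and w: "w \<in> span Q"
  shows "B (x - proj Q x) w = 0"
proof -
  have P: "proj Q x \<in> W" using proj_span onb_span_W[OF Q] by blast
  have base: "B (x - proj Q x) q = 0" if q: "q \<in> Q" for q
  proof -
    have qW: "p \<in> W" if "p \<in> Q" for p using that Q by (auto simp: onb_def)
    have "B (proj Q x) q = (\<Sum>p\<in>Q. B x p * B p q)"
      unfolding proj_def by (subst sum) (auto simp: qW q subspace_scale[OF W] scale)
    also have "\<dots> = (\<Sum>p\<in>Q. if p = q then B x p else 0)"
      using Q q by (intro sum.cong) (auto simp: onb_def)
    also have "\<dots> = B x q" using Q q by (simp add: onb_def)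
    finally show ?thesis using diff[OF x P qW[OF q]] by simp
  qed
  have D: "x - proj Q x \<in> W" by (intro subspace_diff W x P)
  have QW: "Q \<subseteq> W" using Q by (simp add: onb_def)
  have sub: "subspace {w \<in> W. B (x - proj Q x) w = 0}"
    unfolding subspace_def
  proof (intro conjI ballI allI; clarsimp)
    show "0 \<in> W \<and> B (x - proj Q x) 0 = 0"
      using subspace_0[OF W] zero[OF D] sym[OF D subspace_0[OF W]] by simp
    fix u v c assume "u \<in> W" "B (x - proj Q x) u = 0"
    then show "c *\<^sub>R u \<in> W \<and> B (x - proj Q x) (c *\<^sub>R u) = 0"
      using sym[OF D] scale[OF _ D] subspace_scale[OF W] by simp
    assume "v \<in> W" "B (x - proj Q x) v = 0"
    with \<open>u \<in> W\<close> \<open>B (x - proj Q x) u = 0\<close>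
    show "u + v \<in> W \<and> B (x - proj Q x) (u + v) = 0"
      using sym[OF D] add[OF _ _ D] subspace_add[OF W] by simp
  qed
  have "span Q \<subseteq> {w \<in> W. B (x - proj Q x) w = 0}"
    by (rule span_minimal[OF _ sub]) (use base QW in auto)
  then show ?thesis using w by blast
qed

lemma proj_eq:
  assumes Q: "onb Q" and x: "x \<in> span Q" shows "proj Q x = x"
proof (rule ccontr)
  assume "proj Q x \<noteq> x"
  have xW: "x \<in> W" using x onb_span_W[OF Q] by blast
  have d: "x - proj Q x \<in> span Q" by (intro span_diff x proj_span)
  then have "x - proj Q x \<in> W" using onb_span_W[OF Q] by blast
  from pos[OF this] \<open>proj Q x \<noteq> x\<close> proj_orth[OF Q xW d] show False by simp
qed

text \<open>Gram-Schmidt: the new vector minus its projection is normalised, or discarded if it is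
  zero.\<close>

lemma onb_exists:
  assumes "finite S" "S \<subseteq> W"
  shows "\<exists>Q. onb Q \<and> span Q = span S"
  using assms
proof (induction S)
  case empty
  show ?case by (rule exI[of _ "{}"]) (simp add: onb_def)
next
  case (insert a S)
  then obtain Q where Q: "onb Q" "span Q = span S" by auto
  have aW: "a \<in> W" using insert by auto
  have QW: "Q \<subseteq> W" "finite Q" using Q by (auto simp: onb_def)
  let ?a = "a - proj Q a"
  have a'W: "?a \<in> W" using aW proj_span onb_span_W[OF Q(1)] by (intro subspace_diff W) blast+
  show ?case
  proof (cases "?a = 0")
    case True
    then have "a \<in> span S" using proj_span[of Q a] Q(2) by simp
    then have "span (insert a S) = span S" by (simp add: span_redundant)
    then show ?thesis using Q by auto
  next
    case False
    define n where "n = sqrt (B ?a ?a)"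
    have n: "n > 0" "n * n = B ?a ?a" using pos[OF a'W False] by (auto simp: n_def)
    define p where "p = (1 / n) *\<^sub>R ?a"
    have pW: "p \<in> W" unfolding p_def by (rule subspace_scale[OF W a'W])
    have pp: "B p p = 1"
      using scale[OF a'W pW, of "1 / n"] scale[OF a'W a'W, of "1 / n"] sym[OF a'W pW] n pos[OF a'W False]
      by (simp add: p_def[symmetric])
    have pq: "B p q = 0" "B q p = 0" if "q \<in> Q" for q
    proof -
      have qW: "q \<in> W" using that QW by auto
      show "B p q = 0" using proj_orth[OF Q(1) aW span_base[OF that]] scale[OF a'W qW, of "1 / n"] by (simp add: p_def)
      then show "B q p = 0" using sym[OF pW qW] by simp
    qed
    have pnQ: "p \<notin> Q" using pq(1) pp by force
    have "onb (insert p Q)"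
      using Q(1) pW pp pq pnQ unfolding onb_def by auto
    moreover have "span (insert p Q) = span (insert a S)"
    proof -
      have "a = n *\<^sub>R p + proj Q a" using n by (simp add: p_def)
      moreover have "n *\<^sub>R p + proj Q a \<in> span (insert p Q)"
        by (intro span_add span_scale) (auto intro: span_base span_mono[THEN subsetD, OF _ proj_span])
      ultimately have 1: "a \<in> span (insert p Q)" by simp
      have pa: "proj Q a \<in> span (insert a S)"
        using proj_span[of Q a] Q(2) span_mono[of S "insert a S"] by auto
      have 2: "p \<in> span (insert a S)" unfolding p_def
        by (intro span_scale span_diff pa) (auto intro: span_base)
      have 3: "S \<subseteq> span (insert p Q)"
        using span_superset[of S] Q(2) span_mono[of Q "insert p Q"] by auto
      have 4: "Q \<subseteq> span (insert a S)"
        using span_superset[of Q] Q(2) span_mono[of S "insert a S"] by auto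
      show ?thesis
        by (rule subset_antisym; rule span_minimal[OF _ subspace_span]) (use 1 2 3 4 in auto)
    qed
    ultimately show ?thesis by blast
  qed
qed

end

interpretation l2f: pos_form UNIV "inner :: 'v::real_inner \<Rightarrow> 'v \<Rightarrow> real"
  by standard (auto simp: inner_add_left subspace_UNIV intro: inner_commute)

lemma lap_eq_0: "x \<in> VV \<Longrightarrow> lap x = 0 \<Longrightarrow> x = 0"
  using VV_norm_le_lap[of x] by simp

interpretation lapf: pos_form VV "\<lambda>x y. inner (lap x) (lap y)"
proof
  show "0 < inner (lap x) (lap x)" if "x \<in> VV" "x \<noteq> 0" for x :: "'a l2"
    using lap_eq_0[OF that(1)] that(2) by auto
qed (auto simp: subspace_VV lap_add lap_scale VV_sob inner_add_left intro: inner_commute)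

lemma lap_sum:
  "(\<And>i. i \<in> I \<Longrightarrow> f i \<in> VV) \<Longrightarrow> lap (\<Sum>i\<in>I. f i) = (\<Sum>i\<in>I. lap (f i))"
proof (induction I rule: infinite_finite_induct)
  case (insert i I)
  have "(\<Sum>i\<in>I. f i) \<in> VV" using insert by (intro subspace_sum subspace_VV) auto
  then show ?case using insert by (simp add: lap_add VV_sob)
qed (use lap_scale[of 0 0] subspace_0[OF subspace_sob] in auto)

lemma dx_sum:
  "\<alpha> \<in> indices 2 \<Longrightarrow> (\<And>i. i \<in> I \<Longrightarrow> f i \<in> VV) \<Longrightarrow> dx \<alpha> (\<Sum>i\<in>I. f i) = (\<Sum>i\<in>I. dx \<alpha> (f i))"
proof (induction I rule: infinite_finite_induct)
  case (insert i I)
  have "(\<Sum>i\<in>I. f i) \<in> VV" using insert by (intro subspace_sum subspace_VV) auto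
  then show ?case using insert by (simp add: dx_add[where m=2] VV_sob)
qed (use dx_scale[of 0 2 \<alpha> 0] subspace_0[OF subspace_sob] in auto)

text \<open>Pythagoras: the projection error is orthogonal to \<open>span Q\<close> in the Laplacian
  form. The projection thus inherits the order of any interpolant.\<close>

lemma lap_best_approx:
  assumes Q: "lapf.onb Q" and x: "x \<in> VV" and w: "w \<in> span Q"
  shows "norm (lap (x - lapf.proj Q x)) \<le> norm (lap (x - w))"
proof -
  let ?P = "lapf.proj Q x"
  have P: "?P \<in> VV" "w \<in> VV" using lapf.proj_span lapf.onb_span_W[OF Q] w by auto
  have d: "?P - w \<in> span Q" by (intro span_diff lapf.proj_span w)
  have eq: "lap (x - w) = lap (x - ?P) + lap (?P - w)"
    using x P by (simp add: lap_diff VV_sob)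
  have "inner (lap (x - ?P)) (lap (?P - w)) = 0" by (rule lapf.proj_orth[OF Q x d])
  then have "(norm (lap (x - w)))\<^sup>2 = (norm (lap (x - ?P)))\<^sup>2 + (norm (lap (?P - w)))\<^sup>2"
    unfolding eq power2_norm_eq_inner by (simp add: inner_add_left inner_add_right inner_commute)
  then have "(norm (lap (x - ?P)))\<^sup>2 \<le> (norm (lap (x - w)))\<^sup>2" by simp
  then show ?thesis by (rule power2_le_imp_le) simp
qed

section \<open>Energy estimates\<close>

lemma AC_on_deriv:
  assumes f: "AC_on {0<..<T} f g" and g: "continuous_on {0<..<T} g" and t: "t \<in> {0<..<T}"
  shows "(f has_real_derivative g t) (at t)"
proof -
  define a b where "a = t / 2" and "b = (t + T) / 2"
  have ab: "0 < a" "a < t" "t < b" "b < T" using t by (auto simp: a_def b_def)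
  have gab: "continuous_on {a..b} g" by (rule continuous_on_subset[OF g]) (use ab in auto)
  have "((\<lambda>u. integral {a..u} g) has_real_derivative g t) (at t within {a..b})"
    by (rule integral_has_real_derivative[OF gab]) (use ab in auto)
  then have "((\<lambda>u. integral {a..u} g) has_real_derivative g t) (at t)"
    using ab by (metis at_within_interior interior_atLeastAtMost_real greaterThanLessThan_iff)
  then have "((\<lambda>u. f a + integral {a..u} g) has_real_derivative g t) (at t)"
    by (auto intro!: derivative_eq_intros)
  then show ?thesis
  proof (rule has_field_derivative_transform_within_open[where S="{a<..<b}"])
    fix u assume u: "u \<in> {a<..<b}"
    with AC_onD[OF f, of a u] ab show "f a + integral {a..u} g = f u"
      by (auto simp: LI_eq_integral)
  qed (use ab in auto)
qed

text \<open>The energy is absolutely continuous away from 0 only, so the inequality is integrated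
  from s > 0 and s tends to 0 by continuity of \<open>E\<close>. The source \<open>f\<close> enters
  through a uniform bound \<open>G\<close> of its integrals, which suits data that are merely square
  integrable in time.\<close>

lemma Gronwall_AC:
  assumes E: "continuous_on {0..<T} E" "\<And>t. 0 \<le> E t" and AC: "AC_on {0<..<T} E E'" and A: "A \<ge> 0"
    and f: "\<And>s t. 0 < s \<Longrightarrow> s \<le> t \<Longrightarrow> t < T \<Longrightarrow> integrable (lebesgue_on {s..t}) f \<and> LI s t f \<le> G"
    and le: "\<And>s t. 0 < s \<Longrightarrow> s \<le> t \<Longrightarrow> t < T \<Longrightarrow> AE \<tau> in lebesgue_on {s..t}. E' \<tau> \<le> A * E \<tau> + f \<tau>"
    and G: "G \<ge> 0" and t: "0 \<le> t" "t < T"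
  shows "E t \<le> (E 0 + G) * exp (A * T)"
proof -
  have Eint: "integrable (lebesgue_on {s..t}) E" if "0 \<le> s" "t < T" for s t
    by (intro integrable_continuous_lebesgue_on continuous_on_subset[OF E(1)]) (use that in auto)
  have "E t \<le> E 0 + G + A * LI 0 t E" if t: "0 \<le> t" "t < T" for t
  proof (cases "t = 0")
    case True
    have "LI 0 t E = 0" unfolding True by (rule LI_refl)
    then show ?thesis using True G by simp
  next
    case False
    then have t0: "0 < t" using t by simp
    have *: "E t \<le> E s + G + A * LI 0 t E" if s: "0 < s" "s \<le> t" for s
    proof -
      have "E t - E s = LI s t E'" using AC_onD(2)[OF AC, of s t] s t by auto
      also have "\<dots> \<le> LI s t (\<lambda>\<tau>. A * E \<tau> + f \<tau>)"
        using AC_onD(1)[OF AC, of s t] f[OF s t(2)] le[OF s t(2)] Eint[of s t] s t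
        by (intro LI_mono_AE) auto
      also have "\<dots> = A * LI s t E + LI s t f"
        using f[OF s t(2)] Eint[of s t] s t by simp
      also have "LI s t E \<le> LI 0 t E"
      proof -
        have "LI 0 t E = LI 0 s E + LI s t E"
          by (rule integral_combine) (use Eint[of 0 t] s t in auto)
        moreover have "0 \<le> LI 0 s E" by (rule integral_nonneg_AE) (simp add: E(2))
        ultimately show ?thesis by simp
      qed
      finally show ?thesis using f[OF s t(2)] A by (simp add: mult_left_mono)
    qed
    define r :: "nat \<Rightarrow> real" where "r n = t * inverse (real (Suc n))" for n
    have r: "0 < r n" "r n \<le> t" for n using t0 by (auto simp: r_def field_simps)
    have r0: "r \<longlonglongrightarrow> 0" unfolding r_def
      using tendsto_mult[OF tendsto_const LIMSEQ_inverse_real_of_nat, of t] by simp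
    have r': "r n \<in> {0..<T}" for n using r[of n] t by auto
    have "(\<lambda>n. E (r n)) \<longlonglongrightarrow> E 0"
      by (intro continuous_on_tendsto_compose[OF E(1) r0] always_eventually allI r') (use t in auto)
    then have "(\<lambda>n. E (r n) + G + A * LI 0 t E) \<longlonglongrightarrow> E 0 + G + A * LI 0 t E"
      by (intro tendsto_intros)
    then show ?thesis by (rule LIMSEQ_le_const) (use *[OF r] in auto)
  qed
  from Gronwall[OF E(1) A this t] have "E t \<le> (E 0 + G) * exp (A * t)" by simp
  also have "\<dots> \<le> (E 0 + G) * exp (A * T)"
    using t A G E(2)[of 0] by (intro mult_left_mono) (auto intro: mult_left_mono)
  finally show ?thesis .
qed

lemma l2_expand: "l2f.onb R \<Longrightarrow> z \<in> span R \<Longrightarrow> z = (\<Sum>r\<in>R. inner z r *\<^sub>R r)"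
  using l2f.proj_eq[of R z] by (simp add: l2f.proj_def)

lemma span_inner_expand:
  assumes "l2f.onb R" "z \<in> span R" shows "inner y z = (\<Sum>r\<in>R. inner y r * inner z r)"
proof -
  have "inner y z = inner y (\<Sum>r\<in>R. inner z r *\<^sub>R r)" using l2_expand[OF assms] by simp
  then show ?thesis by (simp add: inner_sum_right mult.commute)
qed

text \<open>\<open>lap\<close> and \<open>dx\<close> are unbounded in L^2, but on a
  finite-dimensional span any linear map is a combination of the continuous coordinate
  functionals.\<close>

lemma span_tendsto_linear:
  fixes \<Lambda> :: "'a::euclidean_space l2 \<Rightarrow> 'b::real_normed_vector"
  assumes R: "l2f.onb R" and z: "\<And>t. t \<in> I \<Longrightarrow> z t \<in> span R"
    and \<Lambda>: "\<And>c. \<Lambda> (\<Sum>r\<in>R. c r *\<^sub>R r) = (\<Sum>r\<in>R. c r *\<^sub>R \<Lambda> r)"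
    and cont: "continuous_on I z"
  shows "continuous_on I (\<lambda>t. \<Lambda> (z t))"
proof (rule continuous_on_eq)
  show "continuous_on I (\<lambda>t. \<Sum>r\<in>R. inner (z t) r *\<^sub>R \<Lambda> r)"
    by (intro continuous_intros cont)
  show "(\<Sum>r\<in>R. inner (z t) r *\<^sub>R \<Lambda> r) = \<Lambda> (z t)" if "t \<in> I" for t
    using \<Lambda>[of "inner (z t)"] l2_expand[OF R z[OF that]] by simp
qed

lemma span_derivative_linear:
  fixes \<Lambda> :: "'a::euclidean_space l2 \<Rightarrow> 'b::real_normed_vector"
  assumes R: "l2f.onb R" and I: "open I" "t \<in> I" and z: "\<And>t. t \<in> I \<Longrightarrow> z t \<in> span R" "z' \<in> span R"
    and \<Lambda>: "\<And>c. \<Lambda> (\<Sum>r\<in>R. c r *\<^sub>R r) = (\<Sum>r\<in>R. c r *\<^sub>R \<Lambda> r)"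
    and d: "\<And>r. r \<in> R \<Longrightarrow> ((\<lambda>t. inner (z t) r) has_real_derivative inner z' r) (at t)"
  shows "((\<lambda>t. \<Lambda> (z t)) has_vector_derivative \<Lambda> z') (at t)"
proof -
  have "((\<lambda>t. \<Sum>r\<in>R. inner (z t) r *\<^sub>R \<Lambda> r) has_vector_derivative (\<Sum>r\<in>R. inner z' r *\<^sub>R \<Lambda> r)) (at t)"
  proof (rule has_vector_derivative_sum)
    fix r assume "r \<in> R"
    from has_vector_derivative_scaleR[OF d[OF this] has_vector_derivative_const, of "\<Lambda> r"]
    show "((\<lambda>t. inner (z t) r *\<^sub>R \<Lambda> r) has_vector_derivative inner z' r *\<^sub>R \<Lambda> r) (at t)" by simp
  qed
  moreover have eq: "(\<Sum>r\<in>R. inner y r *\<^sub>R \<Lambda> r) = \<Lambda> y" if "y \<in> span R" for y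
    using \<Lambda>[of "inner y"] l2_expand[OF R that] by simp
  ultimately have "((\<lambda>t. \<Sum>r\<in>R. inner (z t) r *\<^sub>R \<Lambda> r) has_vector_derivative \<Lambda> z') (at t)"
    using z(2) by simp
  then show ?thesis
    by (rule has_vector_derivative_transform_within_open[OF _ I]) (use eq z in auto)
qed

lemma has_real_derivative_inner_self:
  assumes "(f has_vector_derivative f') (at t)"
  shows "((\<lambda>t. (norm (f t))\<^sup>2) has_real_derivative 2 * inner (f t) f') (at t)"
proof -
  have "(f has_derivative (\<lambda>h. h *\<^sub>R f')) (at t)"
    using assms by (simp add: has_vector_derivative_def)
  from has_derivative_inner[OF this this]
  show ?thesis
    by (simp add: has_field_derivative_def power2_norm_eq_inner inner_commute mult_ac fun_eq_iff)
      (simp add: mult_commute_abs)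
qed

lemma VV_linear_lap:
  assumes "R \<subseteq> VV" shows "lap (\<Sum>r\<in>R. c r *\<^sub>R r) = (\<Sum>r\<in>R. c r *\<^sub>R lap r)"
  using assms by (subst lap_sum) (auto intro!: subspace_scale subspace_VV sum.cong simp: lap_scale VV_sob subset_iff)

lemma VV_linear_dx:
  assumes "R \<subseteq> VV" "\<alpha> \<in> indices 2" shows "dx \<alpha> (\<Sum>r\<in>R. c r *\<^sub>R r) = (\<Sum>r\<in>R. c r *\<^sub>R dx \<alpha> r)"
  using assms by (subst dx_sum) (auto intro!: subspace_scale subspace_VV sum.cong simp: dx_scale[where m=2] VV_sob subset_iff)

text \<open>\<open>\<eta> r\<close> plays the role of the coefficient of \<open>z''\<close> along \<open>r\<close>.\<close>

lemma energy_AC: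
  fixes z z' :: "real \<Rightarrow> 'a::euclidean_space l2"
  assumes R: "l2f.onb R" "R \<subseteq> VV"
    and z: "\<And>t. t \<in> {0<..<T} \<Longrightarrow> z t \<in> span R" "\<And>t. t \<in> {0<..<T} \<Longrightarrow> z' t \<in> span R"
    and d: "\<And>r t. r \<in> R \<Longrightarrow> t \<in> {0<..<T} \<Longrightarrow> ((\<lambda>t. inner (z t) r) has_real_derivative inner (z' t) r) (at t)"
    and z'': "\<And>r. r \<in> R \<Longrightarrow> AC_on {0<..<T} (\<lambda>t. inner (z' t) r) (\<eta> r)"
    and cont: "continuous_on {0<..<T} z" "continuous_on {0<..<T} z'"
    and b: "\<And>t. t \<in> {0<..<T} \<Longrightarrow> (b has_real_derivative b' t) (at t)" "continuous_on {0<..<T} b'"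
  shows "AC_on {0<..<T} (\<lambda>t. (norm (z' t))\<^sup>2 / 2 + b t * (norm (lap (z t)))\<^sup>2 / 2)
     (\<lambda>t. (\<Sum>r\<in>R. \<eta> r t * inner (z' t) r) + (b t * inner (lap (z t)) (lap (z' t)) + b' t * (norm (lap (z t)))\<^sup>2 / 2))"
proof (rule AC_on_add)
  \<comment> \<open>The coordinates of \<open>z'\<close> are merely absolutely continuous, so the
    kinetic part is differentiated as a sum of squares of coordinates.\<close>
  have "AC_on {0<..<T} (\<lambda>t. (1 / 2) * (\<Sum>r\<in>R. (inner (z' t) r)\<^sup>2)) (\<lambda>t. (1 / 2) * (\<Sum>r\<in>R. 2 * (inner (z' t) r * \<eta> r t)))"
    by (intro AC_on_scale AC_on_sum AC_on_square z'' is_interval_oo)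
  moreover have "(1 / 2) * (\<Sum>r\<in>R. 2 * (inner (z' t) r * \<eta> r t)) = (\<Sum>r\<in>R. \<eta> r t * inner (z' t) r)" for t
    by (simp add: sum_distrib_left mult.commute)
  moreover have "(1 / 2) * (\<Sum>r\<in>R. (inner (z' t) r)\<^sup>2) = (norm (z' t))\<^sup>2 / 2" if "t \<in> {0<..<T}" for t
    using span_inner_expand[OF R(1) z(2)[OF that], of "z' t"] by (simp add: power2_norm_eq_inner) (simp add: power2_eq_square)
  ultimately show "AC_on {0<..<T} (\<lambda>t. (norm (z' t))\<^sup>2 / 2) (\<lambda>t. \<Sum>r\<in>R. \<eta> r t * inner (z' t) r)"
    unfolding AC_on_def by (simp add: diff_divide_distrib[symmetric] eq_divide_eq)
next
  have lapz: "continuous_on {0<..<T} (\<lambda>t. lap (z t))" "continuous_on {0<..<T} (\<lambda>t. lap (z' t))"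
    by (rule span_tendsto_linear[OF R(1) z(1) VV_linear_lap[OF R(2)] cont(1)], assumption)
       (rule span_tendsto_linear[OF R(1) z(2) VV_linear_lap[OF R(2)] cont(2)], assumption)
  have bc: "continuous_on {0<..<T} b"
    by (intro continuous_at_imp_continuous_on ballI DERIV_isCont[OF b(1)])
  show "AC_on {0<..<T} (\<lambda>t. b t * (norm (lap (z t)))\<^sup>2 / 2)
     (\<lambda>t. b t * inner (lap (z t)) (lap (z' t)) + b' t * (norm (lap (z t)))\<^sup>2 / 2)"
  \<comment> \<open>The coordinates of \<open>z\<close> are continuously differentiable, so the
    ordinary product rule suffices for this part.\<close>
  proof (rule AC_on_C1[OF is_interval_oo])
    fix t assume t: "t \<in> {0<..<T}"
    have "((\<lambda>t. lap (z t)) has_vector_derivative lap (z' t)) (at t)"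
      by (rule span_derivative_linear[OF R(1) _ t]) (use z t d VV_linear_lap[OF R(2)] in auto)
    note g = has_real_derivative_inner_self[OF this]
    have "((\<lambda>t. b t * (norm (lap (z t)))\<^sup>2 / 2) has_real_derivative
        b t * inner (lap (z t)) (lap (z' t)) + b' t * (norm (lap (z t)))\<^sup>2 / 2) (at t)"
      by (rule DERIV_cong[OF DERIV_cdivide[OF DERIV_mult[OF b(1)[OF t] g], of 2]])
        (simp add: algebra_simps add_divide_distrib)
    then show "((\<lambda>t. b t * (norm (lap (z t)))\<^sup>2 / 2) has_real_derivative
        b t * inner (lap (z t)) (lap (z' t)) + b' t * (norm (lap (z t)))\<^sup>2 / 2) (at t within {0<..<T})"
      by (rule has_field_derivative_at_within)
  qed (intro continuous_intros lapz bc b(2); simp)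
qed

section \<open>The equation on classes and the a priori bound for its discrete solutions\<close>

definition grad_sq :: "'a::euclidean_space l2 \<Rightarrow> real" where
  "grad_sq x = (\<Sum>i\<in>Basis. (norm (dx [i] x))\<^sup>2)"

lemma grad_sq_nonneg: "0 \<le> grad_sq x" by (simp add: grad_sq_def sum_nonneg)

lemma grad_sq_le:
  fixes x :: "'a::euclidean_space l2"
  assumes "x \<in> VV" shows "grad_sq x \<le> 4 * real DIM('a) * (norm (lap x))\<^sup>2"
proof -
  have "grad_sq x \<le> (\<Sum>i\<in>(Basis::'a set). (2 * norm (lap x))\<^sup>2)"
    unfolding grad_sq_def by (intro sum_mono power_mono VV_norm_dx1_le_lap assms) auto
  then show ?thesis by (simp add: power_mult_distrib mult_ac)
qed

lemma grad_sq_diff_le: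
  fixes x y :: "'a::euclidean_space l2"
  assumes "x \<in> VV" "y \<in> VV"
  shows "\<bar>grad_sq x - grad_sq y\<bar> \<le> 4 * real DIM('a) * norm (lap (x - y)) * (norm (lap x) + norm (lap y))"
proof -
  have "\<bar>grad_sq x - grad_sq y\<bar> \<le> (\<Sum>i\<in>(Basis::'a set). \<bar>(norm (dx [i] x))\<^sup>2 - (norm (dx [i] y))\<^sup>2\<bar>)"
    unfolding grad_sq_def sum_subtractf[symmetric] by (rule sum_abs)
  also have "\<dots> \<le> (\<Sum>i\<in>(Basis::'a set). 4 * (norm (lap (x - y)) * (norm (lap x) + norm (lap y))))"
  proof (rule sum_mono)
    fix i :: 'a assume i: "i \<in> Basis"
    have "dx [i] (x - y) = dx [i] x - dx [i] y"
      using i assms by (simp add: dx_diff[where m=2] VV_sob)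
    then have "\<bar>norm (dx [i] x) - norm (dx [i] y)\<bar> \<le> norm (dx [i] (x - y))"
      using norm_triangle_ineq3 by metis
    also have "\<dots> \<le> 2 * norm (lap (x - y))"
      by (intro VV_norm_dx1_le_lap subspace_diff subspace_VV assms i)
    finally have 1: "\<bar>norm (dx [i] x) - norm (dx [i] y)\<bar> \<le> 2 * norm (lap (x - y))" .
    have 2: "norm (dx [i] x) + norm (dx [i] y) \<le> 2 * (norm (lap x) + norm (lap y))"
      using add_mono[OF VV_norm_dx1_le_lap[OF assms(1) i] VV_norm_dx1_le_lap[OF assms(2) i]] by (simp add: distrib_left)
    have "\<bar>(norm (dx [i] x))\<^sup>2 - (norm (dx [i] y))\<^sup>2\<bar>
        = \<bar>norm (dx [i] x) - norm (dx [i] y)\<bar> * (norm (dx [i] x) + norm (dx [i] y))"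
      by (simp add: square_diff_square_factored power2_eq_square abs_mult mult.commute)
    also have "\<dots> \<le> (2 * norm (lap (x - y))) * (2 * (norm (lap x) + norm (lap y)))"
      using 1 2 by (intro mult_mono) auto
    finally show "\<bar>(norm (dx [i] x))\<^sup>2 - (norm (dx [i] y))\<^sup>2\<bar> \<le> 4 * (norm (lap (x - y)) * (norm (lap x) + norm (lap y)))"
      by (simp add: algebra_simps)
  qed
  finally show ?thesis by (simp add: mult_ac)
qed

text \<open>Here \<open>b\<close> stands for K^(-4), nonincreasing because K' > 0, and
  \<open>\<kappa>\<close> for 2 K'/K. \<open>LL\<close> gathers the remaining space terms; linearity
  in differences and the bound by \<open>lap\<close> are the properties through which it enters the
  estimates.\<close>

locale beam_coeffs =
  fixes T \<nu> \<zeta>1 :: real and b b' \<kappa> :: "real \<Rightarrow> real"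
    and LL :: "real \<Rightarrow> 'a::euclidean_space l2 \<Rightarrow> 'a l2" and CL \<beta> Bb \<kappa>1 :: real
  assumes T0: "T > 0" and \<nu>0: "\<nu> > 0" and \<zeta>1: "\<zeta>1 > 0"
    and b_deriv: "\<And>t. t \<in> {0<..<T} \<Longrightarrow> (b has_real_derivative b' t) (at t)"
    and b_cont: "continuous_on {0..<T} b" and b'_cont: "continuous_on {0<..<T} b'"
    and b'_le: "\<And>t. t \<in> {0<..<T} \<Longrightarrow> b' t \<le> 0"
    and b_bounds: "\<And>t. t \<in> {0..<T} \<Longrightarrow> \<beta> \<le> b t \<and> b t \<le> Bb" and \<beta>: "\<beta> > 0"
    and \<kappa>: "\<And>t. t \<in> {0<..<T} \<Longrightarrow> 0 \<le> \<kappa> t \<and> \<kappa> t \<le> \<kappa>1"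
    and LL_diff: "\<And>t x y. x \<in> VV \<Longrightarrow> y \<in> VV \<Longrightarrow> LL t (x - y) = LL t x - LL t y"
    and LL_le: "\<And>t x. t \<in> {0<..<T} \<Longrightarrow> x \<in> VV \<Longrightarrow> norm (LL t x) \<le> CL * norm (lap x)"
    and CL: "CL \<ge> 0"
begin

text \<open>The nonlocal term is integrated by parts, whence its minus sign, with
  \<open>\<zeta>1 * b\<close> as its coefficient; \<open>coeff_a4\<close> is
  -\<open>\<kappa>\<close> times the coordinate.\<close>

definition beam_eq :: "real \<Rightarrow> 'a l2 \<Rightarrow> 'a l2 \<Rightarrow> 'a l2 \<Rightarrow> 'a l2 \<Rightarrow> bool" where
  "beam_eq t x x' x'' w \<longleftrightarrow>
     inner x'' w + b t * inner (lap x) (lap w) + \<nu> * inner x' w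
     - \<kappa> t * (\<Sum>i\<in>Basis. inner (coord_mult i (dx [i] x')) w)
     + inner (LL t x) w - \<zeta>1 * b t * grad_sq x * inner (lap x) w = 0"

end

locale galerkin = beam_coeffs T \<nu> \<zeta>1 b b' \<kappa> LL CL \<beta> Bb \<kappa>1
  for T \<nu> \<zeta>1 :: real and b b' \<kappa> :: "real \<Rightarrow> real"
    and LL :: "real \<Rightarrow> 'a::euclidean_space l2 \<Rightarrow> 'a l2" and CL \<beta> Bb \<kappa>1 :: real +
  fixes Vh :: "'a l2 set" and y y' y'' :: "real \<Rightarrow> 'a l2"
  assumes Vh: "\<exists>S. finite S \<and> S \<subseteq> VV \<and> Vh = span S"
    and y_Vh: "\<And>t. t \<in> {0..<T} \<Longrightarrow> y t \<in> Vh"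
    and y_cont: "continuous_on {0..<T} y" and y'_cont: "continuous_on {0..<T} y'"
    and y_AC: "\<And>\<psi>. AC_on {0<..<T} (\<lambda>t. inner (y t) \<psi>) (\<lambda>t. inner (y' t) \<psi>)"
    and y'_AC: "\<And>\<psi>. AC_on {0<..<T} (\<lambda>t. inner (y' t) \<psi>) (\<lambda>t. inner (y'' t) \<psi>)"
    and y_eq: "\<And>t w. t \<in> {0<..<T} \<Longrightarrow> w \<in> Vh \<Longrightarrow> beam_eq t (y t) (y' t) (y'' t) w"
begin

lemma Vh_VV: "Vh \<subseteq> VV" using Vh by (auto intro: span_minimal[OF _ subspace_VV, THEN subsetD])

lemma Vh_subspace: "subspace Vh" using Vh by auto

lemma onb_l2: obtains R where "l2f.onb R" "R \<subseteq> VV" "span R = Vh"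
proof -
  obtain S where S: "finite S" "S \<subseteq> VV" "Vh = span S" using Vh by auto
  from l2f.onb_exists[OF S(1)] obtain R where "l2f.onb R" "span R = span S" by auto
  then show ?thesis using that S Vh_VV span_superset[of R] by auto
qed

lemma onb_lap: obtains Q where "lapf.onb Q" "span Q = Vh"
proof -
  obtain S where S: "finite S" "S \<subseteq> VV" "Vh = span S" using Vh by auto
  from lapf.onb_exists[OF S(1,2)] show ?thesis using that S(3) by auto
qed

lemma y_deriv:
  assumes "t \<in> {0<..<T}"
  shows "((\<lambda>t. inner (y t) \<psi>) has_real_derivative inner (y' t) \<psi>) (at t)"
  by (rule AC_on_deriv[OF y_AC _ assms])
    (intro continuous_intros continuous_on_subset[OF y'_cont]; auto)

text \<open>A vector orthogonal to \<open>Vh\<close> annihilates \<open>y\<close>, hence also its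
  derivative at positive times, and at time 0 by continuity. This is applied to the component of
  \<open>y' t\<close> orthogonal to \<open>Vh\<close>.\<close>

lemma y'_Vh: assumes t: "t \<in> {0..<T}" shows "y' t \<in> Vh"
proof -
  obtain R where R: "l2f.onb R" "R \<subseteq> VV" "span R = Vh" by (rule onb_l2)
  define z where "z = y' t - l2f.proj R (y' t)"
  have orth: "inner w z = 0" if "w \<in> Vh" for w
    using l2f.proj_orth[OF R(1), of "y' t" w] that R(3) by (simp add: z_def inner_commute)
  have 0: "inner (y' s) z = 0" if s: "s \<in> {0<..<T}" for s
  proof -
    have "((\<lambda>t. inner (y t) z) has_real_derivative 0) (at s)"
    proof (rule has_field_derivative_transform_within_open[where S="{0<..<T}" and f="\<lambda>_. 0"])
      show "0 = inner (y u) z" if "u \<in> {0<..<T}" for u using orth[OF y_Vh[of u]] that by auto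
    qed (use s in auto)
    then show ?thesis using DERIV_unique[OF y_deriv[OF s]] by blast
  qed
  have "inner (y' t) z = 0"
  proof (cases "t = 0")
    case False then show ?thesis using 0 t by auto
  next
    case True
    define r :: "nat \<Rightarrow> real" where "r n = (T / 2) * inverse (real (Suc n))" for n
    have r: "0 < r n" "r n < T" for n
    proof -
      have "inverse (real (Suc n)) \<le> 1" by (simp add: field_simps)
      then have "r n \<le> (T / 2) * 1" unfolding r_def using T0 by (intro mult_left_mono) auto
      then show "0 < r n" "r n < T" using T0 by (auto simp: r_def)
    qed
    have r0: "r \<longlonglongrightarrow> 0" unfolding r_def
      using tendsto_mult[OF tendsto_const LIMSEQ_inverse_real_of_nat, of "T / 2"] by simp
    have "(\<lambda>n. inner (y' (r n)) z) \<longlonglongrightarrow> inner (y' 0) z"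
      by (intro tendsto_intros continuous_on_tendsto_compose[OF y'_cont r0] always_eventually allI)
         (use r T0 in \<open>auto intro: less_imp_le\<close>)
    then show ?thesis using 0 r True by (simp add: LIMSEQ_const_iff)
  qed
  moreover have "inner (l2f.proj R (y' t)) z = 0" using orth l2f.proj_span[of R "y' t"] R(3) by auto
  ultimately have "inner z z = 0" by (simp add: z_def inner_diff_left)
  then have "y' t = l2f.proj R (y' t)" by (simp add: z_def)
  then show ?thesis using l2f.proj_span[of R "y' t"] R(3) by metis
qed

lemma coord_term_nonpos: "w \<in> VV \<Longrightarrow> (\<Sum>i\<in>Basis. inner (coord_mult i (dx [i] w)) w) \<le> 0"
  by (intro sum_nonpos) (simp add: VV_inner_coord_dx)

text \<open>The quartic term is the potential of the nonlocal force: its derivative along a solution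
  cancels that force in the equation tested with \<open>y'\<close>, up to the part with
  \<open>b'\<close>, which is nonpositive.\<close>

definition energy0 :: "real \<Rightarrow> real" where
  "energy0 t = ((norm (y' t))\<^sup>2 / 2 + b t * (norm (lap (y t)))\<^sup>2 / 2) + \<zeta>1 * b t * (grad_sq (y t))\<^sup>2 / 4"

lemma lap_cont:
  assumes "continuous_on I z" "\<And>t. t \<in> I \<Longrightarrow> z t \<in> Vh"
  shows "continuous_on I (\<lambda>t. lap (z t))"
proof -
  obtain R where R: "l2f.onb R" "R \<subseteq> VV" "span R = Vh" by (rule onb_l2)
  show ?thesis
    by (rule span_tendsto_linear[OF R(1)]) (use assms R VV_linear_lap[OF R(2)] in auto)
qed

lemma dx_cont:
  assumes "continuous_on I z" "\<And>t. t \<in> I \<Longrightarrow> z t \<in> Vh" "\<alpha> \<in> indices 2"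
  shows "continuous_on I (\<lambda>t. dx \<alpha> (z t))"
proof -
  obtain R where R: "l2f.onb R" "R \<subseteq> VV" "span R = Vh" by (rule onb_l2)
  show ?thesis
    by (rule span_tendsto_linear[OF R(1)]) (use assms R VV_linear_dx[OF R(2) assms(3)] in auto)
qed

text \<open>Testing with \<open>y'\<close> leaves only the pairing with \<open>LL\<close> without a
  sign. Young's inequality bounds it by CL/2 times the squares of \<open>y'\<close> and
  \<open>lap y\<close>, which are at most twice the energy and 2/\<open>\<beta>\<close> times the
  energy; this is the rate CL + CL/\<open>\<beta>\<close>.\<close>

lemma apriori:
  assumes t: "t \<in> {0..<T}"
  shows "\<beta> * (norm (lap (y t)))\<^sup>2 / 2 \<le> energy0 0 * exp ((CL + CL / \<beta>) * T)"
proof -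
  obtain R where R: "l2f.onb R" "R \<subseteq> VV" "span R = Vh" by (rule onb_l2)
  have finR: "finite R" using R(1) by (simp add: l2f.onb_def)
  let ?I = "{0<..<T}"
  have yI: "y t \<in> Vh" "y' t \<in> Vh" if "t \<in> ?I" for t using that y_Vh y'_Vh by auto
  have yc: "continuous_on ?I y" "continuous_on ?I y'"
    using y_cont y'_cont by (auto intro: continuous_on_subset)
  let ?E2 = "\<lambda>t. \<zeta>1 * b t * (grad_sq (y t))\<^sup>2 / 4"
  let ?E2' = "\<lambda>t. \<zeta>1 * b' t * (grad_sq (y t))\<^sup>2 / 4 + \<zeta>1 * b t * grad_sq (y t) * (\<Sum>i\<in>Basis. inner (dx [i] (y t)) (dx [i] (y' t)))"
  have dxc: "continuous_on ?I (\<lambda>t. dx [i] (y t))" "continuous_on ?I (\<lambda>t. dx [i] (y' t))" if "i \<in> Basis" for i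
    using that yc yI by (auto intro!: dx_cont)
  have AC2: "AC_on ?I ?E2 ?E2'"
  proof (rule AC_on_C1[OF is_interval_oo])
    fix t assume t: "t \<in> ?I"
    have "((\<lambda>t. dx [i] (y t)) has_vector_derivative dx [i] (y' t)) (at t)" if "i \<in> Basis" for i
      by (rule span_derivative_linear[OF R(1) _ t]) (use yI t y_deriv R VV_linear_dx[OF R(2)] that in auto)
    then have "((\<lambda>t. grad_sq (y t)) has_real_derivative (\<Sum>i\<in>Basis. 2 * inner (dx [i] (y t)) (dx [i] (y' t)))) (at t)"
      unfolding grad_sq_def by (intro DERIV_sum has_real_derivative_inner_self)
    then have g: "((\<lambda>t. grad_sq (y t)) has_real_derivative 2 * (\<Sum>i\<in>Basis. inner (dx [i] (y t)) (dx [i] (y' t)))) (at t)"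
      by (simp add: sum_distrib_left)
    have "(?E2 has_real_derivative ?E2' t) (at t)"
      using g b_deriv[OF t] by (auto intro!: derivative_eq_intros simp: field_simps power2_eq_square)
    then show "(?E2 has_real_derivative ?E2' t) (at t within ?I)"
      by (rule has_field_derivative_at_within)
  next
    have "continuous_on ?I b" by (rule continuous_on_subset[OF b_cont]) auto
    moreover have "continuous_on ?I (\<lambda>t. grad_sq (y t))"
      unfolding grad_sq_def by (intro continuous_intros dxc)
    ultimately show "continuous_on ?I ?E2'"
      by (intro continuous_intros dxc b'_cont) auto
  qed
  have AC1: "AC_on ?I (\<lambda>t. (norm (y' t))\<^sup>2 / 2 + b t * (norm (lap (y t)))\<^sup>2 / 2)
     (\<lambda>t. (\<Sum>r\<in>R. inner (y'' t) r * inner (y' t) r) + (b t * inner (lap (y t)) (lap (y' t)) + b' t * (norm (lap (y t)))\<^sup>2 / 2))"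
    by (rule energy_AC[OF R(1,2)]) (use yI R y_deriv y'_AC yc b_deriv b'_cont in auto)
  have AC: "AC_on ?I energy0 (\<lambda>t. ((\<Sum>r\<in>R. inner (y'' t) r * inner (y' t) r) +
      (b t * inner (lap (y t)) (lap (y' t)) + b' t * (norm (lap (y t)))\<^sup>2 / 2)) + ?E2' t)"
    unfolding energy0_def[abs_def] by (rule AC_on_add[OF AC1 AC2])
  have nn: "0 \<le> b t" if "t \<in> {0..<T}" for t using b_bounds[OF that] \<beta> by auto
  have E0: "0 \<le> energy0 t" if "t \<in> {0..<T}" for t
    unfolding energy0_def using nn[OF that] \<zeta>1 by (intro add_nonneg_nonneg) auto
  have Ec: "continuous_on {0..<T} energy0"
  proof -
    have "continuous_on {0..<T} (\<lambda>t. grad_sq (y t))"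
      unfolding grad_sq_def by (intro continuous_intros dx_cont y_cont y_Vh) auto
    then show ?thesis
      unfolding energy0_def[abs_def]
      by (intro continuous_intros b_cont y_cont y'_cont lap_cont y_Vh) auto
  qed
  have bound: "((\<Sum>r\<in>R. inner (y'' t) r * inner (y' t) r) +
      (b t * inner (lap (y t)) (lap (y' t)) + b' t * (norm (lap (y t)))\<^sup>2 / 2)) + ?E2' t \<le> (CL + CL / \<beta>) * energy0 t"
    if t: "t \<in> ?I" for t
  proof -
    have tt: "t \<in> {0..<T}" using t by auto
    have V: "y t \<in> VV" "y' t \<in> VV" using yI[OF t] Vh_VV by auto
    have s1: "(\<Sum>r\<in>R. inner (y'' t) r * inner (y' t) r) = inner (y'' t) (y' t)"
      using span_inner_expand[OF R(1), of "y' t" "y'' t"] yI[OF t] R(3) by simp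
    \<comment> \<open>Turns the derivative of the quartic energy into the nonlocal term of the
      equation, so that the two cancel.\<close>
    have s2: "(\<Sum>i\<in>Basis. inner (dx [i] (y t)) (dx [i] (y' t))) = - inner (lap (y t)) (y' t)"
      unfolding lap_def inner_sum_left using VV_inner_dx[OF V] by (simp add: sum_negf)
    have eq: "inner (y'' t) (y' t) + b t * inner (lap (y t)) (lap (y' t)) + \<nu> * inner (y' t) (y' t)
     - \<kappa> t * (\<Sum>i\<in>Basis. inner (coord_mult i (dx [i] (y' t))) (y' t))
     + inner (LL t (y t)) (y' t) - \<zeta>1 * b t * grad_sq (y t) * inner (lap (y t)) (y' t) = 0"
      using y_eq[OF t yI(2)[OF t]] by (simp add: beam_eq_def)
    have k: "\<kappa> t * (\<Sum>i\<in>Basis. inner (coord_mult i (dx [i] (y' t))) (y' t)) \<le> 0"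
      using \<kappa>[OF t] coord_term_nonpos[OF V(2)] by (simp add: mult_nonneg_nonpos)
    have n: "0 \<le> \<nu> * inner (y' t) (y' t)" using \<nu>0 by simp
    have b1: "b' t * (norm (lap (y t)))\<^sup>2 / 2 \<le> 0" "\<zeta>1 * b' t * (grad_sq (y t))\<^sup>2 / 4 \<le> 0"
      using b'_le[OF t] \<zeta>1 by (auto simp: mult_nonneg_nonpos mult_nonpos_nonneg)
    have "- inner (LL t (y t)) (y' t) \<le> norm (LL t (y t)) * norm (y' t)"
      using Cauchy_Schwarz_ineq2[of "LL t (y t)" "y' t"] by linarith
    also have "\<dots> \<le> CL * norm (lap (y t)) * norm (y' t)"
      by (intro mult_right_mono LL_le t V) auto
    also have "\<dots> \<le> CL * ((norm (lap (y t)))\<^sup>2 / 2 + (norm (y' t))\<^sup>2 / 2)"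
      using CL sum_squares_bound[of "norm (lap (y t))" "norm (y' t)"]
      by (auto simp: mult.assoc intro!: mult_left_mono)
    also have "\<dots> \<le> (CL + CL / \<beta>) * energy0 t"
    proof -
      have "CL * (norm (lap (y t)))\<^sup>2 / 2 = CL / \<beta> * (\<beta> * (norm (lap (y t)))\<^sup>2 / 2)" using \<beta> by simp
      also have "\<dots> \<le> CL / \<beta> * (b t * (norm (lap (y t)))\<^sup>2 / 2)"
        using CL \<beta> b_bounds[OF tt] by (intro mult_left_mono divide_right_mono mult_right_mono) auto
      also have "\<dots> \<le> CL / \<beta> * energy0 t"
        unfolding energy0_def using CL \<beta> \<zeta>1 nn[OF tt] by (intro mult_left_mono) auto
      finally have 1: "CL * (norm (lap (y t)))\<^sup>2 / 2 \<le> CL / \<beta> * energy0 t" .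
      have 2: "CL * ((norm (y' t))\<^sup>2 / 2) \<le> CL * energy0 t"
        unfolding energy0_def using CL \<beta> \<zeta>1 nn[OF tt] by (intro mult_left_mono) auto
      have "CL * ((norm (lap (y t)))\<^sup>2 / 2 + (norm (y' t))\<^sup>2 / 2) = CL * (norm (lap (y t)))\<^sup>2 / 2 + CL * ((norm (y' t))\<^sup>2 / 2)"
        by (simp add: algebra_simps)
      also have "\<dots> \<le> CL / \<beta> * energy0 t + CL * energy0 t" by (rule add_mono[OF 1 2])
      also have "\<dots> = (CL + CL / \<beta>) * energy0 t" by (simp add: algebra_simps)
      finally show ?thesis .
    qed
    finally have "- inner (LL t (y t)) (y' t) \<le> (CL + CL / \<beta>) * energy0 t" .
    moreover have e2: "?E2' t = \<zeta>1 * b' t * (grad_sq (y t))\<^sup>2 / 4 - \<zeta>1 * b t * grad_sq (y t) * inner (lap (y t)) (y' t)"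
      unfolding s2 by simp
    ultimately show ?thesis unfolding s1 e2 using eq k n b1 by linarith
  qed
  \<comment> \<open>Extended by zero because \<open>Gronwall_AC\<close> asks for nonnegativity at
    all real times.\<close>
  define E where "E t = (if t \<in> {0..<T} then energy0 t else 0)" for t
  have "E t \<le> (E 0 + 0) * exp ((CL + CL / \<beta>) * T)"
  proof (rule Gronwall_AC[where f="\<lambda>_. 0"])
    show "continuous_on {0..<T} E"
      using Ec by (rule continuous_on_eq) (simp add: E_def)
    show "0 \<le> E t" for t using E0 by (simp add: E_def)
    show "AC_on ?I E (\<lambda>t. ((\<Sum>r\<in>R. inner (y'' t) r * inner (y' t) r) +
      (b t * inner (lap (y t)) (lap (y' t)) + b' t * (norm (lap (y t)))\<^sup>2 / 2)) + ?E2' t)"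
      using AC unfolding AC_on_def by (simp add: E_def)
    show "AE \<tau> in lebesgue_on {s..t}. ((\<Sum>r\<in>R. inner (y'' \<tau>) r * inner (y' \<tau>) r) +
      (b \<tau> * inner (lap (y \<tau>)) (lap (y' \<tau>)) + b' \<tau> * (norm (lap (y \<tau>)))\<^sup>2 / 2)) + ?E2' \<tau> \<le> (CL + CL / \<beta>) * E \<tau> + 0"
      if "0 < s" "s \<le> t" "t < T" for s t
    proof (rule AE_I2)
      fix \<tau> assume "\<tau> \<in> space (lebesgue_on {s..t})"
      then have "\<tau> \<in> ?I" using that by auto
      from bound[OF this] this show "((\<Sum>r\<in>R. inner (y'' \<tau>) r * inner (y' \<tau>) r) +
      (b \<tau> * inner (lap (y \<tau>)) (lap (y' \<tau>)) + b' \<tau> * (norm (lap (y \<tau>)))\<^sup>2 / 2)) + ?E2' \<tau> \<le> (CL + CL / \<beta>) * E \<tau> + 0"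
        by (simp add: E_def)
    qed
  qed (use t CL \<beta> in auto)
  then have le: "energy0 t \<le> energy0 0 * exp ((CL + CL / \<beta>) * T)" using t T0 by (simp add: E_def)
  have "\<beta> * (norm (lap (y t)))\<^sup>2 / 2 \<le> b t * (norm (lap (y t)))\<^sup>2 / 2"
    using b_bounds[OF t] by (intro divide_right_mono mult_right_mono) auto
  also have "\<dots> \<le> energy0 t"
    unfolding energy0_def using \<zeta>1 nn[OF t] by auto
  finally show ?thesis using le by linarith
qed

end

section \<open>The error of the Galerkin approximation\<close>

lemma AC_on_indefinite:
  assumes g: "\<And>t. 0 \<le> t \<Longrightarrow> t < T \<Longrightarrow> integrable (lebesgue_on {0..t}) g"
  shows "AC_on {0..<T} (\<lambda>t. c + LI 0 t g) g"
  unfolding AC_on_def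
proof (intro ballI impI conjI)
  fix s t assume st: "s \<in> {0..<T}" "t \<in> {0..<T}" "s \<le> t"
  show "integrable (lebesgue_on {s..t}) g"
    by (rule integrable_subinterval[OF g[of t]]) (use st in auto)
  have "LI 0 t g = LI 0 s g + LI s t g"
    by (rule integral_combine[OF g]) (use st in auto)
  then show "LI s t g = c + LI 0 t g - (c + LI 0 s g)" by simp
qed

text \<open>Exchanges a density known almost everywhere for a continuous one, after which
  \<open>AC_on_deriv\<close> yields a true derivative.\<close>

lemma AC_on_cong_AE:
  assumes f: "AC_on {0..<T} f g" and h: "continuous_on {0..<T} h"
    and ae: "AE t in lebesgue_on {0<..<T}. g t = h t"
  shows "AC_on {0..<T} f h"
  unfolding AC_on_def
proof (intro ballI impI conjI)
  fix s t assume st: "s \<in> {0..<T}" "t \<in> {0..<T}" "s \<le> t"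
  show i: "integrable (lebesgue_on {s..t}) h"
    by (intro integrable_continuous_lebesgue_on continuous_on_subset[OF h]) (use st in auto)
  have "LI s t g = LI s t h"
  proof (rule integral_cong_AE)
    show "AE x in lebesgue_on {s..t}. g x = h x"
      by (rule AE_open_to_closed[OF ae]) (use st in auto)
  qed (use AC_onD(1)[OF f st] i in auto)
  then show "LI s t h = f t - f s" using AC_onD(2)[OF f st] by simp
qed

lemma AC_on_continuous_half_open:
  assumes f: "AC_on {0..<T} f g" shows "continuous_on {0..<T} f"
  unfolding continuous_on_eq_continuous_within
proof
  fix t assume t: "t \<in> {0..<T}"
  define c where "c = (t + T) / 2"
  have c: "t < c" "c < T" "0 \<le> c" using t by (auto simp: c_def)
  have "continuous_on {0..c} f"
    by (rule AC_on_continuous[OF f]) (use t c in \<open>auto simp: is_interval_co\<close>)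
  then have "continuous (at t within {0..c}) f"
    using t c by (auto simp: continuous_on_eq_continuous_within)
  moreover have "at t within {0..<T} = at t within {0..c}"
    by (rule at_within_nhd[of _ "{..<c}"]) (use t c in auto)
  ultimately show "continuous (at t within {0..<T}) f" by simp
qed

context l2_evolution
begin

abbreviation "hnorm_total \<equiv> integral\<^sup>L (lebesgue_on {0<..<T}) (\<lambda>t. hnorm 4 (x' t))"

lemma hnorm_LI_le: "0 \<le> a \<Longrightarrow> b < T \<Longrightarrow> LI a b (\<lambda>t. hnorm 4 (x' t)) \<le> hnorm_total"
  by (rule LI_le_total[OF hint]) (auto simp: hnorm_nonneg)

lemma hnorm_total_nonneg: "0 \<le> hnorm_total"
  by (rule integral_nonneg_AE) (simp add: hnorm_nonneg)

text \<open>To be used with \<open>w\<close> the increment of \<open>lap (x \<tau>)\<close>, or its component orthogonal to the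
  Laplacians of \<open>Vh\<close>: testing with \<open>w\<close> itself bounds the norm without Bochner integrals.\<close>

lemma lap_increment_le:
  assumes G: "G \<subseteq> {0..<T}" "\<And>t. t \<in> G \<Longrightarrow> x t \<in> sob 2" and t: "0 \<in> G" "t \<in> G"
    and w: "inner w w = inner (lap (x t) - lap (x 0)) w"
    and bound: "AE \<tau> in lebesgue_on {0<..<T}. inner (lap (x' \<tau>)) w \<le> c * hnorm 4 (x' \<tau>) * norm w"
    and c: "c \<ge> 0"
  shows "norm w \<le> c * hnorm_total"
proof -
  have t': "0 \<le> t" "t < T" using t(2) G(1) by auto
  have AC: "AC_on G (\<lambda>t. inner (lap (x t)) w) (\<lambda>t. inner (lap (x' t)) w)"
    by (rule lap_AC[OF G])
  have "(norm w)\<^sup>2 = LI 0 t (\<lambda>\<tau>. inner (lap (x' \<tau>)) w)"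
    using AC_onD(2)[OF AC t t'(1)] w by (simp add: power2_norm_eq_inner inner_diff_left)
  also have "\<dots> \<le> LI 0 t (\<lambda>\<tau>. (c * norm w) * hnorm 4 (x' \<tau>))"
  proof (rule LI_mono_AE)
    show "AE \<tau> in lebesgue_on {0..t}. inner (lap (x' \<tau>)) w \<le> (c * norm w) * hnorm 4 (x' \<tau>)"
      using AE_open_to_closed[OF bound order_refl t'(2)] by (simp add: mult_ac)
  qed (use AC_onD(1)[OF AC t t'(1)] hnorm_integrable[of 0 t] t' in auto)
  also have "\<dots> = (c * norm w) * LI 0 t (\<lambda>\<tau>. hnorm 4 (x' \<tau>))" by simp
  also have "\<dots> \<le> (c * norm w) * hnorm_total"
    using c t' by (intro mult_left_mono hnorm_LI_le) auto
  finally have "norm w * norm w \<le> (c * hnorm_total) * norm w" by (simp add: power2_eq_square mult_ac)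
  then show ?thesis using c hnorm_total_nonneg
    by (cases "norm w = 0") (auto simp: mult_le_cancel_right)
qed

end

lemma norm_lap_le_hnorm:
  fixes x :: "'a::euclidean_space l2"
  shows "norm (lap x) \<le> real DIM('a) * hnorm 4 x"
  by (rule order_trans[OF norm_lap_le_snorm mult_left_mono[OF snorm_le_hnorm]]) auto

text \<open>\<open>\<delta>\<close> is a multiple of h^2; \<open>a0\<close>, \<open>a1\<close> and
  \<open>M\<close> will be chosen independent of h, so that the final constants are too. The initial
  conditions quantify over all bases \<open>Q\<close> because a basis is picked only inside the
  proofs.\<close>

locale galerkin_error = galerkin T \<nu> \<zeta>1 b b' \<kappa> LL CL \<beta> Bb \<kappa>1 Vh y y' y''
    + ev1: l2_evolution T x x' + ev2: l2_evolution T x' x''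
  for T \<nu> \<zeta>1 :: real and b b' \<kappa> :: "real \<Rightarrow> real"
    and LL :: "real \<Rightarrow> 'a::euclidean_space l2 \<Rightarrow> 'a l2" and CL \<beta> Bb \<kappa>1 :: real
    and Vh and y y' y'' x x' x'' :: "real \<Rightarrow> 'a l2" +
  fixes \<delta> a0 a1 M :: real
  assumes x_VV: "\<And>t. t \<in> {0..<T} \<Longrightarrow> x t \<in> VV"
    and x0: "x 0 \<in> sob 4" and x'0: "x' 0 \<in> VV" "x' 0 \<in> sob 4"
    and x_eq: "\<And>t w. t \<in> {0<..<T} \<Longrightarrow> w \<in> VV \<Longrightarrow> beam_eq t (x t) (x' t) (x'' t) w"
    and sq1: "integrable (lebesgue_on {0<..<T}) (\<lambda>t. (hnorm 4 (x' t))\<^sup>2)"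
    and sq2: "integrable (lebesgue_on {0<..<T}) (\<lambda>t. (hnorm 4 (x'' t))\<^sup>2)"
    and approx: "\<And>z. z \<in> VV \<Longrightarrow> z \<in> sob 4 \<Longrightarrow> \<exists>w\<in>Vh. norm (lap (z - w)) \<le> \<delta> * hnorm 4 z"
    and \<delta>: "\<delta> \<ge> 0"
    and init1: "\<And>Q. lapf.onb Q \<Longrightarrow> span Q = Vh \<Longrightarrow> norm (lapf.proj Q (x' 0) - y' 0) \<le> \<delta> * a0"
    and init0: "\<And>Q. lapf.onb Q \<Longrightarrow> span Q = Vh \<Longrightarrow> norm (lap (lapf.proj Q (x 0) - y 0)) \<le> \<delta> * a1"
    and M: "\<And>t. t \<in> {0..<T} \<Longrightarrow> norm (lap (x t)) \<le> M" "\<And>t. t \<in> {0..<T} \<Longrightarrow> norm (lap (y t)) \<le> M"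
    and \<kappa>1: "\<kappa>1 \<ge> 0"
begin

text \<open>\<open>\<delta> * R0\<close> bounds the Laplacian of the projection error.
  \<open>C4\<close> is the Lipschitz constant of the lower order terms; its 12 is 4 + 8, from
  changing the Laplacian or the squared gradient in the nonlocal term. \<open>C3\<close> collects
  the coefficients of the projection errors: 4 from \<open>VV_norm_le_lap\<close>, 2 per direction
  from \<open>VV_norm_dx1_le_lap\<close>. \<open>\<Gamma>\<close> is Gronwall's bound for the energy
  divided by the square of \<open>\<delta>\<close>, with 3/2 from Young's inequality and the square
  of a sum of three terms.\<close>

definition "R0 = hnorm 4 (x 0) + ev1.hnorm_total"
definition "C4 = CL + \<zeta>1 * Bb * (12 * real DIM('a) * M\<^sup>2)"
definition "C3 = 4 + 4 * \<nu> + 2 * real DIM('a) * \<kappa>1 + C4"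
definition "J1 = integral\<^sup>L (lebesgue_on {0<..<T}) (\<lambda>t. (hnorm 4 (x' t))\<^sup>2)"
definition "J2 = integral\<^sup>L (lebesgue_on {0<..<T}) (\<lambda>t. (hnorm 4 (x'' t))\<^sup>2)"
definition "\<Gamma> = ((a0\<^sup>2 + Bb * a1\<^sup>2) / 2 + 3 / 2 * C3\<^sup>2 * (J1 + J2 + R0\<^sup>2 * T)) * exp ((1 + C4 + C4 / \<beta>) * T)"

lemma proj_approx:
  assumes Q: "lapf.onb Q" "span Q = Vh" and z: "z \<in> VV" "z \<in> sob 4"
  shows "norm (lap (z - lapf.proj Q z)) \<le> \<delta> * hnorm 4 z"
  using approx[OF z] lap_best_approx[OF Q(1) z(1)] Q(2) by (meson order_trans)

lemma x'_VV: "AE t in lebesgue_on {0<..<T}. x' t \<in> VV"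
  by (rule ev1.x'_in_VV[of "{0..<T}"]) (auto intro: x_VV AE_lebesgue_on_mem[THEN AE_mp] AE_I2)

text \<open>\<open>x'\<close> lies in \<open>VV\<close> on a set of full measure, and this set can
  serve as \<open>G\<close> for the pair of \<open>x'\<close> and \<open>x''\<close>.\<close>

lemma x''_VV: "AE t in lebesgue_on {0<..<T}. x'' t \<in> VV"
proof (rule ev2.x'_in_VV[of "{t \<in> {0..<T}. x' t \<in> VV}"])
  show "AE t in lebesgue_on {0<..<T}. t \<in> {t \<in> {0..<T}. x' t \<in> VV}"
    using x'_VV AE_lebesgue_on_mem[of "{0<..<T}"] by (auto elim: AE_mp)
qed auto

lemma proj_VV: "lapf.onb Q \<Longrightarrow> lapf.proj Q z \<in> VV"
  using lapf.proj_span lapf.onb_span_W by blast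

text \<open>At positive times \<open>x t\<close> is not given as an element of H^4, so the
  approximation property is applied to \<open>x 0\<close> and to \<open>x'\<close> under the time
  integral. The increment \<open>?w\<close> of the projection error has a Laplacian orthogonal to
  those of the discrete space; projections may therefore be dropped from, or inserted into, every
  pairing with it.\<close>

lemma rho_le:
  assumes Q: "lapf.onb Q" "span Q = Vh" and t: "t \<in> {0..<T}"
  shows "norm (lap (x t - lapf.proj Q (x t))) \<le> \<delta> * R0"
proof -
  let ?P = "lapf.proj Q"
  let ?w = "(x t - ?P (x t)) - (x 0 - ?P (x 0))"
  have z: "0 \<in> {0..<T}" using t by auto
  have V: "x t \<in> VV" "x 0 \<in> VV" using x_VV t z by auto
  have rV: "x t - ?P (x t) \<in> VV" "x 0 - ?P (x 0) \<in> VV"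
    by (intro subspace_diff subspace_VV V proj_VV Q)+
  have wV: "?w \<in> VV" by (rule subspace_diff[OF subspace_VV rV])
  have lw: "lap ?w = lap (x t - ?P (x t)) - lap (x 0 - ?P (x 0))"
    using rV by (simp add: lap_diff VV_sob)
  have orth: "inner (lap ?w) (lap q) = 0" if "q \<in> span Q" for q
    unfolding lw inner_diff_left using lapf.proj_orth[OF Q(1) V(1) that] lapf.proj_orth[OF Q(1) V(2) that] by simp
  have "norm (lap ?w) \<le> \<delta> * ev1.hnorm_total"
  proof (rule ev1.lap_increment_le[where G="{0..<T}"])
    have "lap ?w = (lap (x t) - lap (x 0)) - (lap (?P (x t)) - lap (?P (x 0)))"
      unfolding lw using V by (simp add: lap_diff VV_sob proj_VV Q)
    then have "inner (lap ?w) v = inner (lap (x t) - lap (x 0)) v - inner (lap (?P (x t)) - lap (?P (x 0))) v" for v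
      by (simp only: inner_diff_left)
    moreover have "inner (lap (?P (x t)) - lap (?P (x 0))) (lap ?w) = 0"
      using orth[OF lapf.proj_span, of "x t"] orth[OF lapf.proj_span, of "x 0"]
      by (simp add: inner_diff_left inner_commute)
    ultimately show "inner (lap ?w) (lap ?w) = inner (lap (x t) - lap (x 0)) (lap ?w)" by simp
    show "AE \<tau> in lebesgue_on {0<..<T}. inner (lap (x' \<tau>)) (lap ?w) \<le> \<delta> * hnorm 4 (x' \<tau>) * norm (lap ?w)"
      using x'_VV ev1.x'_sob
    proof eventually_elim
      case (elim \<tau>)
      have "inner (lap (x' \<tau>)) (lap ?w) = inner (lap (x' \<tau> - ?P (x' \<tau>))) (lap ?w)"
        using orth[OF lapf.proj_span, of "x' \<tau>"] elim Q
        by (simp add: lap_diff VV_sob proj_VV inner_diff_left inner_commute)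
      also have "\<dots> \<le> norm (lap (x' \<tau> - ?P (x' \<tau>))) * norm (lap ?w)" by (rule norm_cauchy_schwarz)
      also have "\<dots> \<le> \<delta> * hnorm 4 (x' \<tau>) * norm (lap ?w)"
        by (intro mult_right_mono proj_approx Q elim) auto
      finally show ?case .
    qed
  qed (use t z x_VV VV_sob \<delta> in auto)
  moreover have "norm (lap (x 0 - ?P (x 0))) \<le> \<delta> * hnorm 4 (x 0)"
    by (rule proj_approx[OF Q V(2) x0])
  moreover have "norm (lap (x t - ?P (x t))) \<le> norm (lap ?w) + norm (lap (x 0 - ?P (x 0)))"
    unfolding lw using norm_triangle_ineq[of "lap (x t - ?P (x t)) - lap (x 0 - ?P (x 0))" "lap (x 0 - ?P (x 0))"] by simp
  ultimately show ?thesis by (simp add: R0_def distrib_left)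
qed

text \<open>Energy estimate for \<open>\<theta>\<close>, followed by the triangle inequality with
  the projection errors of \<open>x\<close> and \<open>x'\<close>. Both bounds hold at every time,
  although the regularity of \<open>x'\<close> is known at almost all times only.\<close>

lemma error_bound:
  assumes t: "t \<in> {0..<T}"
  shows "norm (x' t - y' t) \<le> \<delta> * (4 * (hnorm 4 (x' 0) + ev2.hnorm_total) + sqrt (2 * \<Gamma>))"
    and "norm (lap (x t - y t)) \<le> \<delta> * (R0 + sqrt (2 * \<Gamma> / \<beta>))"
proof -
  obtain R where R: "l2f.onb R" "R \<subseteq> VV" "span R = Vh" by (rule onb_l2)
  obtain Q where Q: "lapf.onb Q" "span Q = Vh" by (rule onb_lap)
  have QV: "q \<in> VV" "q \<in> Vh" if "q \<in> Q" for q
    using Q that span_base[OF that] by (auto simp: lapf.onb_def)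
  let ?I = "{0<..<T}" and ?n = "real DIM('a)" and ?P = "lapf.proj Q"
  let ?N1 = "\<lambda>t. hnorm 4 (x' t)" and ?N2 = "\<lambda>t. hnorm 4 (x'' t)"
  have z: "0 \<in> {0..<T}" using T0 by auto
  let ?G = "{t \<in> {0..<T}. x' t \<in> VV}"
  have M0: "M \<ge> 0" using M(1)[OF z] norm_ge_zero order_trans by blast
  have Bb0: "Bb \<ge> 0" using b_bounds[OF z] \<beta> by auto
  have C4: "C4 \<ge> CL" "C4 \<ge> 0" unfolding C4_def using CL \<zeta>1 Bb0 by auto
  have C3: "C3 \<ge> 0" unfolding C3_def using C4 \<nu>0 \<kappa>1 by auto
  have R00: "R0 \<ge> 0" unfolding R0_def by (rule add_nonneg_nonneg[OF hnorm_nonneg ev1.hnorm_total_nonneg])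

  define \<gamma> where "\<gamma> q t = inner (lap (x t)) (lap q)" for q t
  define \<mu>' where "\<mu>' q t = inner (lap (x'' t)) (lap q)" for q t
  \<comment> \<open>The coordinates of the projected \<open>x'\<close> make sense only where
    \<open>x'\<close> lies in \<open>VV\<close>. Defined as an integral from time 0, they are
    continuous and agree with the true coordinates on \<open>?G\<close>.\<close>
  define \<mu> where "\<mu> q t = inner (lap (x' 0)) (lap q) + LI 0 t (\<mu>' q)" for q t
  have \<mu>'int: "integrable (lebesgue_on {0..t}) (\<mu>' q)" if "0 \<le> t" "t < T" for q t
    unfolding \<mu>'_def[abs_def] lap_def inner_sum_left
    using ev2.dx_pair_integrable[of 0 t] that by (intro Bochner_Integration.integrable_sum) auto
  have \<mu>_AC: "AC_on {0..<T} (\<mu> q) (\<mu>' q)" for q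
    unfolding \<mu>_def[abs_def] by (rule AC_on_indefinite[OF \<mu>'int])
  have \<mu>_cont: "continuous_on {0..<T} (\<mu> q)" for q
    by (rule AC_on_continuous_half_open[OF \<mu>_AC])
  have \<mu>_eq: "\<mu> q t = inner (lap (x' t)) (lap q)" if "t \<in> ?G" for q t
  proof -
    have "AC_on ?G (\<lambda>t. inner (lap (x' t)) (lap q)) (\<mu>' q)"
      unfolding \<mu>'_def[abs_def] by (rule ev2.lap_AC) (auto intro: VV_sob)
    from AC_onD(2)[OF this, of 0 t] that x'0 z show ?thesis by (auto simp: \<mu>_def)
  qed
  have AEG: "AE t in lebesgue_on ?I. t \<in> ?G"
    using x'_VV AE_lebesgue_on_mem[of ?I] by (auto elim: AE_mp)
  have \<gamma>_AC: "AC_on {0..<T} (\<gamma> q) (\<mu> q)" for q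
  proof (rule AC_on_cong_AE[OF _ \<mu>_cont])
    show "AC_on {0..<T} (\<gamma> q) (\<lambda>t. inner (lap (x' t)) (lap q))"
      unfolding \<gamma>_def[abs_def] by (rule ev1.lap_AC[OF subset_refl VV_sob[OF x_VV]])
    show "AE t in lebesgue_on ?I. inner (lap (x' t)) (lap q) = \<mu> q t"
      using AEG by eventually_elim (simp add: \<mu>_eq)
  qed
  have \<gamma>_cont: "continuous_on {0..<T} (\<gamma> q)" for q
    by (rule AC_on_continuous_half_open[OF \<gamma>_AC])
  have \<gamma>_deriv: "(\<gamma> q has_real_derivative \<mu> q t) (at t)" if "t \<in> ?I" for q t
    by (rule AC_on_deriv[OF AC_on_subset[OF \<gamma>_AC] continuous_on_subset[OF \<mu>_cont] that]) auto

  \<comment> \<open>Continuous representative of the projection of \<open>x'\<close>; it belongs to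
    the discrete space at every time.\<close>
  define P' where "P' t = (\<Sum>q\<in>Q. \<mu> q t *\<^sub>R q)" for t
  define \<theta> where "\<theta> t = ?P (x t) - y t" for t
  define \<theta>' where "\<theta>' t = P' t - y' t" for t
  have Px: "?P (x t) = (\<Sum>q\<in>Q. \<gamma> q t *\<^sub>R q)" for t by (simp add: lapf.proj_def \<gamma>_def)
  have P'eq: "P' t = ?P (x' t)" if "t \<in> ?G" for t
    using \<mu>_eq[OF that] by (simp add: P'_def lapf.proj_def)
  have PVh: "?P z \<in> Vh" for z using lapf.proj_span[of Q z] Q(2) by simp
  have P'Vh: "P' t \<in> Vh" for t
    unfolding P'_def by (intro subspace_sum Vh_subspace subspace_scale QV)
  have \<theta>Vh: "\<theta> t \<in> Vh" "\<theta>' t \<in> Vh" if "t \<in> {0..<T}" for t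
    unfolding \<theta>_def \<theta>'_def using y_Vh y'_Vh that by (intro subspace_diff Vh_subspace PVh P'Vh; auto)+
  have \<theta>c: "continuous_on {0..<T} \<theta>" "continuous_on {0..<T} \<theta>'"
    unfolding \<theta>_def[abs_def] \<theta>'_def[abs_def] Px P'_def
    by (intro continuous_intros y_cont y'_cont \<gamma>_cont \<mu>_cont)+
  \<comment> \<open>The L^2 coordinates of the second time derivative of \<open>\<theta>\<close>,
    which is used through its pairings only.\<close>
  define \<eta> where "\<eta> r t = (\<Sum>q\<in>Q. \<mu>' q t * inner q r) - inner (y'' t) r" for r t
  define E' where "E' t = (\<Sum>r\<in>R. \<eta> r t * inner (\<theta>' t) r) +
      (b t * inner (lap (\<theta> t)) (lap (\<theta>' t)) + b' t * (norm (lap (\<theta> t)))\<^sup>2 / 2)" for t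
  define E0 where "E0 t = (norm (\<theta>' t))\<^sup>2 / 2 + b t * (norm (lap (\<theta> t)))\<^sup>2 / 2" for t
  have AC: "AC_on ?I E0 E'"
    unfolding E0_def[abs_def] E'_def[abs_def]
  proof (rule energy_AC[OF R(1,2)])
    show "\<theta> t \<in> span R" "\<theta>' t \<in> span R" if "t \<in> ?I" for t using \<theta>Vh that R(3) by auto
    show "((\<lambda>t. inner (\<theta> t) r) has_real_derivative inner (\<theta>' t) r) (at t)" if "t \<in> ?I" for r t
      unfolding \<theta>_def \<theta>'_def P'_def Px inner_diff_left inner_sum_left inner_scaleR_left
      by (intro DERIV_diff y_deriv[OF that] DERIV_sum DERIV_cmult_right \<gamma>_deriv that)
    show "AC_on ?I (\<lambda>t. inner (\<theta>' t) r) (\<eta> r)" for r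
    proof -
      have "AC_on ?I (\<lambda>t. inner q r * \<mu> q t) (\<lambda>t. inner q r * \<mu>' q t)" for q
        by (rule AC_on_scale[OF AC_on_subset[OF \<mu>_AC]]) auto
      then have "AC_on ?I (\<lambda>t. (\<Sum>q\<in>Q. inner q r * \<mu> q t) - inner (y' t) r) (\<lambda>t. (\<Sum>q\<in>Q. inner q r * \<mu>' q t) - inner (y'' t) r)"
        by (intro AC_on_diff AC_on_sum y'_AC)
      then show ?thesis
        by (simp add: \<theta>'_def P'_def \<eta>_def[abs_def] inner_diff_left inner_sum_left mult.commute)
    qed
    show "continuous_on ?I \<theta>" "continuous_on ?I \<theta>'" using \<theta>c by (auto intro: continuous_on_subset)
  qed (use b_deriv b'_cont in auto)

  \<comment> \<open>The energy inequality at almost every time. The rate consists of 1 from Young's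
    inequality on the projection errors, and of \<open>C4\<close> and \<open>C4 / \<beta>\<close>
    from the Lipschitz terms, split between \<open>\<theta>'\<close> and the Laplacian of
    \<open>\<theta>\<close>.\<close>
  have bound: "E' \<tau> \<le> (1 + C4 + C4 / \<beta>) * E0 \<tau> + \<delta>\<^sup>2 * (3 / 2 * C3\<^sup>2) * ((?N1 \<tau>)\<^sup>2 + (?N2 \<tau>)\<^sup>2 + R0\<^sup>2)"
    if \<tau>: "\<tau> \<in> ?I" and V1: "x' \<tau> \<in> VV" "x' \<tau> \<in> sob 4" and V2: "x'' \<tau> \<in> VV" "x'' \<tau> \<in> sob 4" for \<tau>
  proof -
    have tt: "\<tau> \<in> {0..<T}" using \<tau> by auto
    let ?w = "\<theta>' \<tau>" and ?a = "norm (\<theta>' \<tau>)" and ?l = "norm (lap (\<theta> \<tau>))"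
    let ?r = "x \<tau> - ?P (x \<tau>)" and ?r1 = "x' \<tau> - ?P (x' \<tau>)" and ?r2 = "x'' \<tau> - ?P (x'' \<tau>)"
    have P'1: "P' \<tau> = ?P (x' \<tau>)" using P'eq tt V1 by auto
    have xV: "x \<tau> \<in> VV" and yV: "y \<tau> \<in> VV" "y' \<tau> \<in> VV" using x_VV y_Vh y'_Vh Vh_VV tt by auto
    have wVh: "?w \<in> Vh" and wV: "?w \<in> VV" and \<theta>V: "\<theta> \<tau> \<in> VV" using \<theta>Vh[OF tt] Vh_VV by auto
    have rV: "?r \<in> VV" "?r1 \<in> VV" "?r2 \<in> VV"
      by (intro subspace_diff subspace_VV xV V1 V2 proj_VV Q)+
    have e: "x \<tau> - y \<tau> = ?r + \<theta> \<tau>" "x' \<tau> - y' \<tau> = ?r1 + ?w" by (auto simp: \<theta>_def \<theta>'_def P'1)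
    have eV: "x \<tau> - y \<tau> \<in> VV" by (intro subspace_diff subspace_VV xV yV)
    have lape: "norm (lap (x \<tau> - y \<tau>)) \<le> \<delta> * R0 + ?l"
      unfolding e(1) lap_add[OF VV_sob[OF rV(1)] VV_sob[OF \<theta>V]]
      using norm_triangle_ineq[of "lap ?r" "lap (\<theta> \<tau>)"] rho_le[OF Q tt] by linarith
    have s1: "(\<Sum>r\<in>R. \<eta> r \<tau> * inner ?w r) = inner (?P (x'' \<tau>) - y'' \<tau>) ?w"
    proof -
      have "\<eta> r \<tau> = inner (?P (x'' \<tau>) - y'' \<tau>) r" for r
        by (simp add: \<eta>_def \<mu>'_def lapf.proj_def inner_diff_left inner_sum_left)
      then show ?thesis using span_inner_expand[OF R(1), of ?w] wVh R(3) by simp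
    qed
    \<comment> \<open>Without this cancellation the biharmonic term would pair with the Laplacian of
      \<open>\<theta>'\<close>, which the energy does not control.\<close>
    have orth: "inner (lap ?r) (lap ?w) = 0"
      using lapf.proj_orth[OF Q(1) xV, of ?w] wVh Q(2) by simp
    have eqx: "inner (x'' \<tau>) ?w + b \<tau> * inner (lap (x \<tau>)) (lap ?w) + \<nu> * inner (x' \<tau>) ?w
       - \<kappa> \<tau> * (\<Sum>i\<in>Basis. inner (coord_mult i (dx [i] (x' \<tau>))) ?w)
       + inner (LL \<tau> (x \<tau>)) ?w - \<zeta>1 * b \<tau> * grad_sq (x \<tau>) * inner (lap (x \<tau>)) ?w = 0"
      using x_eq[OF \<tau> wV] by (simp add: beam_eq_def)
    have eqy: "inner (y'' \<tau>) ?w + b \<tau> * inner (lap (y \<tau>)) (lap ?w) + \<nu> * inner (y' \<tau>) ?w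
       - \<kappa> \<tau> * (\<Sum>i\<in>Basis. inner (coord_mult i (dx [i] (y' \<tau>))) ?w)
       + inner (LL \<tau> (y \<tau>)) ?w - \<zeta>1 * b \<tau> * grad_sq (y \<tau>) * inner (lap (y \<tau>)) ?w = 0"
      using y_eq[OF \<tau> wVh] by (simp add: beam_eq_def)
    have d1: "inner (lap (x \<tau>)) (lap ?w) - inner (lap (y \<tau>)) (lap ?w) = inner (lap (\<theta> \<tau>)) (lap ?w)"
    proof -
      have "lap (x \<tau>) - lap (y \<tau>) = lap ?r + lap (\<theta> \<tau>)"
        using arg_cong[OF e(1), of lap] xV yV rV \<theta>V by (simp add: lap_diff lap_add VV_sob)
      then have "inner (lap (x \<tau>) - lap (y \<tau>)) (lap ?w) = inner (lap ?r + lap (\<theta> \<tau>)) (lap ?w)" by (simp only:)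
      then show ?thesis unfolding inner_diff_left inner_add_left orth by linarith
    qed
    have d2: "(\<Sum>i\<in>Basis. inner (coord_mult i (dx [i] (x' \<tau>))) ?w) - (\<Sum>i\<in>Basis. inner (coord_mult i (dx [i] (y' \<tau>))) ?w)
      = (\<Sum>i\<in>Basis. inner (coord_mult i (dx [i] ?r1)) ?w) + (\<Sum>i\<in>Basis. inner (coord_mult i (dx [i] ?w)) ?w)"
    proof -
      have "inner (coord_mult i (dx [i] (x' \<tau>))) ?w - inner (coord_mult i (dx [i] (y' \<tau>))) ?w
        = inner (coord_mult i (dx [i] ?r1)) ?w + inner (coord_mult i (dx [i] ?w)) ?w" if i: "i \<in> Basis" for i
      proof -
        have eq: "x' \<tau> = y' \<tau> + (?r1 + ?w)" using e(2) by (simp add: algebra_simps)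
        have sb: "y' \<tau> \<in> sob 2" "?r1 \<in> sob 2" "?w \<in> sob 2" using yV rV wV VV_sob by auto
        have "dx [i] (y' \<tau> + (?r1 + ?w)) = dx [i] (y' \<tau>) + dx [i] (?r1 + ?w)"
          by (rule dx_add[where m=2]) (use i sb subspace_add[OF subspace_sob sb(2,3)] in auto)
        moreover have "dx [i] (?r1 + ?w) = dx [i] ?r1 + dx [i] ?w"
          by (rule dx_add[where m=2, OF sb(2,3)]) (use i in auto)
        ultimately have "dx [i] (x' \<tau>) = dx [i] (y' \<tau>) + (dx [i] ?r1 + dx [i] ?w)"
          by (simp only: eq[symmetric])
        then show ?thesis using i by (simp add: coord_mult_add inner_add_left)
      qed
      then show ?thesis by (simp add: sum_subtractf[symmetric] sum.distrib[symmetric])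
    qed
    have d3: "inner (LL \<tau> (x \<tau>)) ?w - inner (LL \<tau> (y \<tau>)) ?w = inner (LL \<tau> (x \<tau> - y \<tau>)) ?w"
      using LL_diff[OF xV yV(1)] by (simp add: inner_diff_left)
    have d4: "inner (x' \<tau>) ?w - inner (y' \<tau>) ?w = inner ?r1 ?w + inner ?w ?w"
      by (simp only: inner_diff_left[symmetric] inner_add_left[symmetric] e(2))
    define D where "D = grad_sq (x \<tau>) *\<^sub>R lap (x \<tau>) - grad_sq (y \<tau>) *\<^sub>R lap (y \<tau>)"
    have d5: "grad_sq (x \<tau>) * inner (lap (x \<tau>)) ?w - grad_sq (y \<tau>) * inner (lap (y \<tau>)) ?w = inner D ?w"
      by (simp add: D_def inner_diff_left)
    define S1 where "S1 = (\<Sum>i\<in>Basis. inner (coord_mult i (dx [i] ?r1)) ?w)"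
    define S2 where "S2 = (\<Sum>i\<in>Basis. inner (coord_mult i (dx [i] ?w)) ?w)"
    \<comment> \<open>The difference of the two equations, both tested with
      \<open>\<theta>'\<close>, replaces the second derivatives and the biharmonic term.\<close>
    have main: "E' \<tau> = - inner ?r2 ?w - \<nu> * inner ?r1 ?w - \<nu> * inner ?w ?w + \<kappa> \<tau> * S1 + \<kappa> \<tau> * S2
        - inner (LL \<tau> (x \<tau> - y \<tau>)) ?w + \<zeta>1 * b \<tau> * inner D ?w + b' \<tau> * ?l\<^sup>2 / 2"
    proof -
      have p: "inner (?P (x'' \<tau>) - y'' \<tau>) ?w = - inner ?r2 ?w + (inner (x'' \<tau>) ?w - inner (y'' \<tau>) ?w)"
        by (simp add: inner_diff_left)
      have "inner (x'' \<tau>) ?w - inner (y'' \<tau>) ?w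
         + b \<tau> * (inner (lap (x \<tau>)) (lap ?w) - inner (lap (y \<tau>)) (lap ?w))
         + \<nu> * (inner (x' \<tau>) ?w - inner (y' \<tau>) ?w)
         - \<kappa> \<tau> * ((\<Sum>i\<in>Basis. inner (coord_mult i (dx [i] (x' \<tau>))) ?w) - (\<Sum>i\<in>Basis. inner (coord_mult i (dx [i] (y' \<tau>))) ?w))
         + (inner (LL \<tau> (x \<tau>)) ?w - inner (LL \<tau> (y \<tau>)) ?w)
         - \<zeta>1 * b \<tau> * (grad_sq (x \<tau>) * inner (lap (x \<tau>)) ?w - grad_sq (y \<tau>) * inner (lap (y \<tau>)) ?w) = 0"
        using eqx eqy by (simp add: algebra_simps)
      then show ?thesis
        unfolding E'_def s1 p d1 d2 d3 d4 d5 S1_def[symmetric] S2_def[symmetric]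
        by (simp add: algebra_simps)
    qed
    have t1: "- inner ?r2 ?w \<le> (4 * \<delta> * ?N2 \<tau>) * ?a"
    proof -
      have "norm ?r2 \<le> 4 * \<delta> * ?N2 \<tau>"
        using VV_norm_le_lap[OF rV(3)] proj_approx[OF Q V2] by linarith
      then have "norm ?r2 * ?a \<le> (4 * \<delta> * ?N2 \<tau>) * ?a" by (rule mult_right_mono) simp
      then show ?thesis using Cauchy_Schwarz_ineq2[of ?r2 ?w] by linarith
    qed
    have r1: "norm (lap ?r1) \<le> \<delta> * ?N1 \<tau>" by (rule proj_approx[OF Q V1])
    have t2: "- \<nu> * inner ?r1 ?w \<le> \<nu> * (4 * \<delta> * ?N1 \<tau>) * ?a"
    proof -
      have "norm ?r1 \<le> 4 * \<delta> * ?N1 \<tau>" using VV_norm_le_lap[OF rV(2)] r1 by linarith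
      then have "norm ?r1 * ?a \<le> (4 * \<delta> * ?N1 \<tau>) * ?a" by (rule mult_right_mono) simp
      then have "- inner ?r1 ?w \<le> (4 * \<delta> * ?N1 \<tau>) * ?a" using Cauchy_Schwarz_ineq2[of ?r1 ?w] by linarith
      from mult_left_mono[OF this, of \<nu>] \<nu>0 show ?thesis by (simp add: mult_ac)
    qed
    have t3: "\<kappa> \<tau> * S1 \<le> \<kappa>1 * (?n * (2 * \<delta> * ?N1 \<tau>)) * ?a"
    proof -
      have "S1 \<le> (\<Sum>i\<in>(Basis::'a set). (2 * \<delta> * ?N1 \<tau>) * ?a)"
        unfolding S1_def
      proof (rule sum_mono)
        fix i :: 'a assume i: "i \<in> Basis"
        have "norm (coord_mult i (dx [i] ?r1)) \<le> 2 * \<delta> * ?N1 \<tau>"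
          using norm_coord_mult[OF i, of "dx [i] ?r1"] VV_norm_dx1_le_lap[OF rV(2) i] r1 by linarith
        then have "norm (coord_mult i (dx [i] ?r1)) * ?a \<le> (2 * \<delta> * ?N1 \<tau>) * ?a" by (rule mult_right_mono) simp
        then show "inner (coord_mult i (dx [i] ?r1)) ?w \<le> (2 * \<delta> * ?N1 \<tau>) * ?a"
          using norm_cauchy_schwarz[of "coord_mult i (dx [i] ?r1)" ?w] by linarith
      qed
      then have S: "S1 \<le> ?n * (2 * \<delta> * ?N1 \<tau>) * ?a" by (simp add: mult_ac)
      have "\<kappa> \<tau> * S1 \<le> \<kappa> \<tau> * (?n * (2 * \<delta> * ?N1 \<tau>) * ?a)"
        using \<kappa>[OF \<tau>] S by (intro mult_left_mono) auto
      also have "\<dots> \<le> \<kappa>1 * (?n * (2 * \<delta> * ?N1 \<tau>) * ?a)"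
        using \<kappa>[OF \<tau>] \<delta> hnorm_nonneg[of 4 "x' \<tau>"] by (intro mult_right_mono mult_nonneg_nonneg) auto
      finally show ?thesis by (simp add: mult_ac)
    qed
    have t4: "\<kappa> \<tau> * S2 \<le> 0"
      using \<kappa>[OF \<tau>] coord_term_nonpos[OF wV] unfolding S2_def by (simp add: mult_nonneg_nonpos)
    have t5: "- inner (LL \<tau> (x \<tau> - y \<tau>)) ?w \<le> CL * (\<delta> * R0 + ?l) * ?a"
    proof -
      have "norm (LL \<tau> (x \<tau> - y \<tau>)) \<le> CL * (\<delta> * R0 + ?l)"
        using LL_le[OF \<tau> eV] mult_left_mono[OF lape CL] by linarith
      then have "norm (LL \<tau> (x \<tau> - y \<tau>)) * ?a \<le> CL * (\<delta> * R0 + ?l) * ?a" by (rule mult_right_mono) simp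
      then show ?thesis using Cauchy_Schwarz_ineq2[of "LL \<tau> (x \<tau> - y \<tau>)" ?w] by linarith
    qed
    have nD: "norm D \<le> 12 * ?n * M\<^sup>2 * (\<delta> * R0 + ?l)"
    proof -
      let ?e = "norm (lap (x \<tau> - y \<tau>))"
      \<comment> \<open>First the Laplacian is changed, then the squared gradient; these give 4 and
        8 times n M^2, together the factor 12.\<close>
      have "D = grad_sq (x \<tau>) *\<^sub>R lap (x \<tau> - y \<tau>) + (grad_sq (x \<tau>) - grad_sq (y \<tau>)) *\<^sub>R lap (y \<tau>)"
        unfolding D_def using xV yV by (simp add: lap_diff VV_sob algebra_simps)
      then have "norm D \<le> grad_sq (x \<tau>) * ?e + \<bar>grad_sq (x \<tau>) - grad_sq (y \<tau>)\<bar> * norm (lap (y \<tau>))"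
        using norm_triangle_ineq[of "grad_sq (x \<tau>) *\<^sub>R lap (x \<tau> - y \<tau>)" "(grad_sq (x \<tau>) - grad_sq (y \<tau>)) *\<^sub>R lap (y \<tau>)"]
        by (simp add: grad_sq_nonneg)
      also have "grad_sq (x \<tau>) * ?e \<le> (4 * ?n * M\<^sup>2) * ?e"
        using M(1)[OF tt] by (intro mult_right_mono order_trans[OF grad_sq_le[OF xV]] mult_left_mono power_mono) auto
      also have "\<bar>grad_sq (x \<tau>) - grad_sq (y \<tau>)\<bar> * norm (lap (y \<tau>)) \<le> (4 * ?n * ?e * (M + M)) * M"
        using M[OF tt] M0
        by (intro mult_mono order_trans[OF grad_sq_diff_le[OF xV yV(1)]] mult_left_mono add_mono) auto
      finally have "norm D \<le> 12 * ?n * M\<^sup>2 * ?e" by (simp add: power2_eq_square algebra_simps)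
      also have "\<dots> \<le> 12 * ?n * M\<^sup>2 * (\<delta> * R0 + ?l)" by (intro mult_left_mono lape) auto
      finally show ?thesis .
    qed
    have t6: "\<zeta>1 * b \<tau> * inner D ?w \<le> \<zeta>1 * Bb * (12 * ?n * M\<^sup>2) * (\<delta> * R0 + ?l) * ?a"
    proof -
      have "\<zeta>1 * b \<tau> * inner D ?w \<le> \<zeta>1 * b \<tau> * (norm D * ?a)"
        using \<zeta>1 b_bounds[OF tt] \<beta> by (intro mult_left_mono norm_cauchy_schwarz) auto
      also have "\<dots> \<le> \<zeta>1 * Bb * ((12 * ?n * M\<^sup>2 * (\<delta> * R0 + ?l)) * ?a)"
        using \<zeta>1 b_bounds[OF tt] \<beta> Bb0 order_trans[OF norm_ge_zero nD]
        by (intro mult_mono mult_right_mono nD mult_nonneg_nonneg[of _ ?a] mult_nonneg_nonneg[of \<zeta>1]) auto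
      finally show ?thesis by (simp add: mult_ac)
    qed
    have t7: "b' \<tau> * ?l\<^sup>2 / 2 \<le> 0" "- \<nu> * inner ?w ?w \<le> 0"
      using b'_le[OF \<tau>] \<nu>0 by (auto simp: mult_nonneg_nonpos mult_nonpos_nonneg)
    have "E' \<tau> \<le> (4 * \<delta> * ?N2 \<tau>) * ?a + \<nu> * (4 * \<delta> * ?N1 \<tau>) * ?a + \<kappa>1 * (?n * (2 * \<delta> * ?N1 \<tau>)) * ?a
        + CL * (\<delta> * R0 + ?l) * ?a + \<zeta>1 * Bb * (12 * ?n * M\<^sup>2) * (\<delta> * R0 + ?l) * ?a"
      unfolding main using t1 t2 t3 t4 t5 t6 t7 by linarith
    also have "\<dots> = (\<delta> * (4 * ?N2 \<tau> + (4 * \<nu> + 2 * ?n * \<kappa>1) * ?N1 \<tau> + C4 * R0)) * ?a + C4 * (?l * ?a)"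
      by (simp add: C4_def algebra_simps)
    also have "\<dots> \<le> (\<delta> * (C3 * (?N1 \<tau> + ?N2 \<tau> + R0))) * ?a + C4 * (?l * ?a)"
    proof -
      have "4 * ?N2 \<tau> \<le> C3 * ?N2 \<tau>" "(4 * \<nu> + 2 * ?n * \<kappa>1) * ?N1 \<tau> \<le> C3 * ?N1 \<tau>" "C4 * R0 \<le> C3 * R0"
        using C4 \<nu>0 \<kappa>1 R00 by (auto simp: C3_def hnorm_nonneg intro!: mult_right_mono)
      then have "4 * ?N2 \<tau> + (4 * \<nu> + 2 * ?n * \<kappa>1) * ?N1 \<tau> + C4 * R0 \<le> C3 * (?N1 \<tau> + ?N2 \<tau> + R0)"
        by (simp add: distrib_left)
      then show ?thesis using \<delta> by (intro add_mono mult_right_mono mult_left_mono) auto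
    qed
    also have "\<dots> \<le> ((\<delta> * (C3 * (?N1 \<tau> + ?N2 \<tau> + R0)))\<^sup>2 + ?a\<^sup>2) / 2 + C4 * ((?l\<^sup>2 + ?a\<^sup>2) / 2)"
    proof -
      have "p * q \<le> (p\<^sup>2 + q\<^sup>2) / 2" for p q :: real using sum_squares_bound[of p q] by simp
      then show ?thesis using C4 by (intro add_mono mult_left_mono)
    qed
    also have "(\<delta> * (C3 * (?N1 \<tau> + ?N2 \<tau> + R0)))\<^sup>2 \<le> \<delta>\<^sup>2 * C3\<^sup>2 * (3 * ((?N1 \<tau>)\<^sup>2 + (?N2 \<tau>)\<^sup>2 + R0\<^sup>2))"
    proof -
      have "(p + q + r)\<^sup>2 \<le> 3 * (p\<^sup>2 + q\<^sup>2 + r\<^sup>2)" for p q r :: real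
        using sum_squares_bound[of p q] sum_squares_bound[of p r] sum_squares_bound[of q r]
        by (simp add: power2_eq_square algebra_simps)
      then show ?thesis by (simp add: power_mult_distrib mult.assoc mult_left_mono)
    qed
    finally have le: "E' \<tau> \<le> \<delta>\<^sup>2 * (3 / 2 * C3\<^sup>2) * ((?N1 \<tau>)\<^sup>2 + (?N2 \<tau>)\<^sup>2 + R0\<^sup>2) + ?a\<^sup>2 / 2 + C4 * (?a\<^sup>2 / 2) + C4 * (?l\<^sup>2 / 2)"
      by (simp add: algebra_simps add_divide_distrib)
    have bl: "0 \<le> b \<tau> * ?l\<^sup>2 / 2" using b_bounds[OF tt] \<beta> by auto
    have a2: "?a\<^sup>2 / 2 \<le> E0 \<tau>" unfolding E0_def using bl by linarith
    moreover have "C4 * (?a\<^sup>2 / 2) \<le> C4 * E0 \<tau>" by (rule mult_left_mono[OF a2 C4(2)])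
    moreover have "C4 * (?l\<^sup>2 / 2) \<le> C4 / \<beta> * E0 \<tau>"
    proof -
      have "C4 * (?l\<^sup>2 / 2) = C4 / \<beta> * (\<beta> * ?l\<^sup>2 / 2)" using \<beta> by simp
      also have "\<dots> \<le> C4 / \<beta> * (b \<tau> * ?l\<^sup>2 / 2)"
        using C4 \<beta> b_bounds[OF tt] by (intro mult_left_mono divide_right_mono mult_right_mono) auto
      also have "\<dots> \<le> C4 / \<beta> * E0 \<tau>" unfolding E0_def using C4 \<beta> by (intro mult_left_mono) auto
      finally show ?thesis .
    qed
    ultimately show ?thesis using le unfolding distrib_right mult_1_left by linarith
  qed

  \<comment> \<open>Extended by zero, as in \<open>apriori\<close>, for the sake of nonnegativity at
    all times.\<close>
  define E where "E t = (if t \<in> {0..<T} then E0 t else 0)" for t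
  let ?f = "\<lambda>\<tau>. \<delta>\<^sup>2 * (3 / 2 * C3\<^sup>2) * ((?N1 \<tau>)\<^sup>2 + (?N2 \<tau>)\<^sup>2 + R0\<^sup>2)"
  let ?GG = "\<delta>\<^sup>2 * (3 / 2 * C3\<^sup>2) * (J1 + J2 + R0\<^sup>2 * T)"
  have E0nn: "0 \<le> E0 t" if "t \<in> {0..<T}" for t
    unfolding E0_def using b_bounds[OF that] \<beta> by (intro add_nonneg_nonneg) auto
  have J: "0 \<le> J1" "0 \<le> J2" unfolding J1_def J2_def by (auto intro: integral_nonneg_AE)
  have Ebd: "E t \<le> (E 0 + ?GG) * exp ((1 + C4 + C4 / \<beta>) * T)"
  proof (rule Gronwall_AC[where f="?f" and E'=E'])
    have "continuous_on {0..<T} E0"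
      unfolding E0_def[abs_def] by (intro continuous_intros b_cont \<theta>c lap_cont \<theta>Vh) auto
    then show "continuous_on {0..<T} E" by (rule continuous_on_eq) (simp add: E_def)
    show "0 \<le> E t" for t using E0nn by (simp add: E_def)
    show "AC_on ?I E E'" using AC unfolding AC_on_def by (simp add: E_def)
    show "AE \<tau> in lebesgue_on {s..t}. E' \<tau> \<le> (1 + C4 + C4 / \<beta>) * E \<tau> + ?f \<tau>"
      if st: "0 < s" "s \<le> t" "t < T" for s t
    proof -
      have "AE \<tau> in lebesgue_on {s..t}. \<tau> \<in> {s..t}" by (rule AE_lebesgue_on_mem) simp
      moreover have "AE \<tau> in lebesgue_on {s..t}. x' \<tau> \<in> VV" "AE \<tau> in lebesgue_on {s..t}. x'' \<tau> \<in> VV"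
        "AE \<tau> in lebesgue_on {s..t}. x' \<tau> \<in> sob 4" "AE \<tau> in lebesgue_on {s..t}. x'' \<tau> \<in> sob 4"
        using AE_open_to_closed[OF x'_VV, of s t] AE_open_to_closed[OF x''_VV, of s t]
          ev1.x'_sob_closed[of s t] ev2.x'_sob_closed[of s t] st by auto
      ultimately show ?thesis
      proof eventually_elim
        case (elim \<tau>)
        then have "\<tau> \<in> ?I" using st by auto
        from bound[OF this] elim this show ?case by (simp add: E_def)
      qed
    qed
    show "integrable (lebesgue_on {s..t}) ?f \<and> LI s t ?f \<le> ?GG" if st: "0 < s" "s \<le> t" "t < T" for s t
    proof
      have i: "integrable (lebesgue_on {s..t}) (\<lambda>t. (?N1 t)\<^sup>2)" "integrable (lebesgue_on {s..t}) (\<lambda>t. (?N2 t)\<^sup>2)"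
        using integrable_open_to_closed[OF sq1, of s t] integrable_open_to_closed[OF sq2, of s t] st by auto
      show "integrable (lebesgue_on {s..t}) ?f" using i integrable_const_Icc[of s t] by simp
      have "LI s t ?f = \<delta>\<^sup>2 * (3 / 2 * C3\<^sup>2) * (LI s t (\<lambda>t. (?N1 t)\<^sup>2) + LI s t (\<lambda>t. (?N2 t)\<^sup>2) + (t - s) * R0\<^sup>2)"
        using i integrable_const_Icc[of s t] st by (simp add: mult.commute)
      also have "\<dots> \<le> ?GG"
      proof (intro mult_left_mono add_mono)
        show "LI s t (\<lambda>t. (?N1 t)\<^sup>2) \<le> J1" unfolding J1_def by (rule LI_le_total[OF sq1]) (use st in auto)
        show "LI s t (\<lambda>t. (?N2 t)\<^sup>2) \<le> J2" unfolding J2_def by (rule LI_le_total[OF sq2]) (use st in auto)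
        show "(t - s) * R0\<^sup>2 \<le> R0\<^sup>2 * T" using st mult_right_mono[of "t - s" T "R0\<^sup>2"] by (simp add: mult.commute)
      qed auto
      finally show "LI s t ?f \<le> ?GG" .
    qed
    show "0 \<le> ?GG" using J T0 by auto
  qed (use t C4 \<beta> in auto)
  have "E 0 \<le> \<delta>\<^sup>2 * ((a0\<^sup>2 + Bb * a1\<^sup>2) / 2)"
  proof -
    have "P' 0 = ?P (x' 0)" using P'eq[of 0] x'0 z by auto
    then have "norm (\<theta>' 0) \<le> \<delta> * a0" using init1[OF Q] by (simp add: \<theta>'_def)
    then have 1: "(norm (\<theta>' 0))\<^sup>2 \<le> \<delta>\<^sup>2 * a0\<^sup>2" by (metis norm_ge_zero power_mono power_mult_distrib)
    have "norm (lap (\<theta> 0)) \<le> \<delta> * a1" using init0[OF Q] by (simp add: \<theta>_def)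
    then have 2: "(norm (lap (\<theta> 0)))\<^sup>2 \<le> \<delta>\<^sup>2 * a1\<^sup>2" by (metis norm_ge_zero power_mono power_mult_distrib)
    have "b 0 * (norm (lap (\<theta> 0)))\<^sup>2 \<le> Bb * (\<delta>\<^sup>2 * a1\<^sup>2)"
      using b_bounds[OF z] Bb0 2 by (intro mult_mono) auto
    with 1 show ?thesis using z by (simp add: E_def E0_def algebra_simps)
  qed
  then have "(E 0 + ?GG) * exp ((1 + C4 + C4 / \<beta>) * T)
      \<le> (\<delta>\<^sup>2 * ((a0\<^sup>2 + Bb * a1\<^sup>2) / 2) + ?GG) * exp ((1 + C4 + C4 / \<beta>) * T)"
    by (intro mult_right_mono) auto
  also have "\<dots> = \<delta>\<^sup>2 * \<Gamma>" by (simp add: \<Gamma>_def algebra_simps)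
  finally have EG: "E0 t \<le> \<delta>\<^sup>2 * \<Gamma>" using Ebd t by (simp add: E_def)
  have b\<theta>: "0 \<le> b t * (norm (lap (\<theta> t)))\<^sup>2 / 2" using b_bounds[OF t] \<beta> by auto
  have "(norm (\<theta>' t))\<^sup>2 \<le> \<delta>\<^sup>2 * (2 * \<Gamma>)" using EG b\<theta> unfolding E0_def by linarith
  then have "norm (\<theta>' t) \<le> sqrt (\<delta>\<^sup>2 * (2 * \<Gamma>))" by (rule real_le_rsqrt)
  then have th': "norm (\<theta>' t) \<le> \<delta> * sqrt (2 * \<Gamma>)" using \<delta> by (simp add: real_sqrt_mult)
  have "\<beta> * (norm (lap (\<theta> t)))\<^sup>2 / 2 \<le> b t * (norm (lap (\<theta> t)))\<^sup>2 / 2"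
    using b_bounds[OF t] by (intro divide_right_mono mult_right_mono) auto
  then have "\<beta> * (norm (lap (\<theta> t)))\<^sup>2 \<le> \<delta>\<^sup>2 * (2 * \<Gamma>)"
    using EG zero_le_power2[of "norm (\<theta>' t)"] unfolding E0_def by linarith
  then have "(norm (lap (\<theta> t)))\<^sup>2 \<le> \<delta>\<^sup>2 * (2 * \<Gamma> / \<beta>)" using \<beta> by (simp add: field_simps)
  then have "norm (lap (\<theta> t)) \<le> sqrt (\<delta>\<^sup>2 * (2 * \<Gamma> / \<beta>))" by (rule real_le_rsqrt)
  then have th: "norm (lap (\<theta> t)) \<le> \<delta> * sqrt (2 * \<Gamma> / \<beta>)" using \<delta> by (simp only: real_sqrt_mult) simp
  show "norm (lap (x t - y t)) \<le> \<delta> * (R0 + sqrt (2 * \<Gamma> / \<beta>))"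
  proof -
    have "x t - y t = (x t - ?P (x t)) + \<theta> t" by (simp add: \<theta>_def)
    moreover have "x t - ?P (x t) \<in> VV" "\<theta> t \<in> VV"
      using x_VV[OF t] proj_VV[OF Q(1)] \<theta>Vh[OF t] Vh_VV by (auto intro: subspace_diff subspace_VV)
    ultimately have "lap (x t - y t) = lap (x t - ?P (x t)) + lap (\<theta> t)" by (simp only: lap_add VV_sob)
    then show ?thesis
      using norm_triangle_ineq[of "lap (x t - ?P (x t))" "lap (\<theta> t)"] rho_le[OF Q t] th by (simp add: distrib_left)
  qed
  \<comment> \<open>\<open>x' t\<close> belongs to H^4 at almost all times only, so the
    approximation property gives no pointwise bound here. It is used at time 0 and, under the
    integral, for \<open>x''\<close>.\<close>
  let ?\<sigma> = "\<lambda>t. x' t - P' t"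
  have s0: "norm (?\<sigma> 0) \<le> 4 * (\<delta> * hnorm 4 (x' 0))"
  proof -
    have "?\<sigma> 0 = x' 0 - ?P (x' 0)" using P'eq[of 0] x'0 z by auto
    moreover have "x' 0 - ?P (x' 0) \<in> VV" by (intro subspace_diff subspace_VV x'0 proj_VV Q)
    ultimately show ?thesis using VV_norm_le_lap[of "?\<sigma> 0"] proj_approx[OF Q x'0] by simp
  qed
  have s1: "norm (?\<sigma> t - ?\<sigma> 0) \<le> 4 * \<delta> * ev2.hnorm_total"
  proof -
    let ?\<psi> = "?\<sigma> t - ?\<sigma> 0"
    have t': "0 \<le> t" "t < T" using t by auto
    \<comment> \<open>Paired with its own increment, \<open>?\<sigma>\<close> is a scalar absolutely
      continuous function whose density is the projection error of \<open>x''\<close>.\<close>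
    have A: "AC_on {0..<T} (\<lambda>t. inner (x' t) ?\<psi> - (\<Sum>q\<in>Q. inner q ?\<psi> * \<mu> q t)) (\<lambda>t. inner (x'' t) ?\<psi> - (\<Sum>q\<in>Q. inner q ?\<psi> * \<mu>' q t))"
      by (intro AC_on_diff AC_on_sum AC_on_scale \<mu>_AC ev2.AC)
    have eq: "inner (x' s) ?\<psi> - (\<Sum>q\<in>Q. inner q ?\<psi> * \<mu> q s) = inner (?\<sigma> s) ?\<psi>" for s
      by (simp add: inner_diff_left P'_def inner_sum_left mult.commute)
    have eq': "inner (x'' s) ?\<psi> - (\<Sum>q\<in>Q. inner q ?\<psi> * \<mu>' q s) = inner (x'' s - ?P (x'' s)) ?\<psi>" for s
      by (simp add: inner_diff_left lapf.proj_def \<mu>'_def inner_sum_left mult.commute)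
    have "(norm ?\<psi>)\<^sup>2 = LI 0 t (\<lambda>s. inner (x'' s - ?P (x'' s)) ?\<psi>)"
      using AC_onD(2)[OF A z t t'(1)] unfolding eq eq' by (simp add: power2_norm_eq_inner inner_diff_left)
    also have "\<dots> \<le> LI 0 t (\<lambda>s. (4 * \<delta> * norm ?\<psi>) * ?N2 s)"
    proof (rule LI_mono_AE)
      show "AE s in lebesgue_on {0..t}. inner (x'' s - ?P (x'' s)) ?\<psi> \<le> (4 * \<delta> * norm ?\<psi>) * ?N2 s"
        using AE_open_to_closed[OF x''_VV order_refl t'(2)] ev2.x'_sob_closed[OF order_refl t'(2)]
      proof eventually_elim
        case (elim s)
        have "x'' s - ?P (x'' s) \<in> VV" by (intro subspace_diff subspace_VV elim proj_VV Q)
        from VV_norm_le_lap[OF this] proj_approx[OF Q elim]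
        have "norm (x'' s - ?P (x'' s)) \<le> 4 * \<delta> * ?N2 s" by linarith
        then have "norm (x'' s - ?P (x'' s)) * norm ?\<psi> \<le> 4 * \<delta> * ?N2 s * norm ?\<psi>" by (rule mult_right_mono) simp
        then show ?case using norm_cauchy_schwarz[of "x'' s - ?P (x'' s)" ?\<psi>] by (simp add: mult_ac)
      qed
    qed (use AC_onD(1)[OF A z t t'(1)] ev2.hnorm_integrable[of 0 t] t' eq' in auto)
    also have "\<dots> = (4 * \<delta> * norm ?\<psi>) * LI 0 t ?N2" by simp
    also have "\<dots> \<le> (4 * \<delta> * norm ?\<psi>) * ev2.hnorm_total"
      using \<delta> t' by (intro mult_left_mono ev2.hnorm_LI_le) auto
    finally have "norm ?\<psi> * norm ?\<psi> \<le> (4 * \<delta> * ev2.hnorm_total) * norm ?\<psi>" by (simp add: power2_eq_square mult_ac)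
    then show ?thesis using \<delta> ev2.hnorm_total_nonneg
      by (cases "norm ?\<psi> = 0") (auto simp: mult_le_cancel_right)
  qed
  have s2: "x' t - y' t = (?\<sigma> t - ?\<sigma> 0) + (?\<sigma> 0 + \<theta>' t)" by (simp add: \<theta>'_def)
  have "norm (x' t - y' t) \<le> norm (?\<sigma> t - ?\<sigma> 0) + (norm (?\<sigma> 0) + norm (\<theta>' t))"
    unfolding s2 using norm_triangle_ineq[of "?\<sigma> t - ?\<sigma> 0" "?\<sigma> 0 + \<theta>' t"] norm_triangle_ineq[of "?\<sigma> 0" "\<theta>' t"] by linarith
  then show "norm (x' t - y' t) \<le> \<delta> * (4 * (hnorm 4 (x' 0) + ev2.hnorm_total) + sqrt (2 * \<Gamma>))"
    using s0 s1 th' by (simp add: algebra_simps)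
qed

end

section \<open>The beam equation in terms of classes\<close>

lemma L2_continuous_cls:
  assumes "L2_continuous T u"
  shows "continuous_on {0..<T} (\<lambda>t. cls (u t))"
  unfolding continuous_on_def
proof
  fix t assume t: "t \<in> {0..<T}"
  have L: "u s \<in> L2_space unit_cube" if "s \<in> {0..<T}" for s
    using assms that by (auto simp: L2_continuous_def)
  have "((\<lambda>s. L2_norm unit_cube (u s - u t)) \<longlongrightarrow> 0) (at t within {0..<T})"
    using assms t by (auto simp: L2_continuous_def)
  then have "((\<lambda>s. norm (cls (u s) - cls (u t))) \<longlongrightarrow> 0) (at t within {0..<T})"
  proof (rule Lim_transform_eventually)
    have "\<forall>\<^sub>F s in at t within {0..<T}. s \<in> {0..<T}" by (simp add: eventually_at_filter)
    then show "\<forall>\<^sub>F s in at t within {0..<T}. L2_norm unit_cube (u s - u t) = norm (cls (u s) - cls (u t))"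
      by eventually_elim
        (use L t in \<open>simp add: cls_diff[symmetric] norm_cls L2_space_diff fun_diff_def\<close>)
  qed
  then show "((\<lambda>s. cls (u s)) \<longlongrightarrow> cls (u t)) (at t within {0..<T})"
    by (simp add: LIM_zero_iff tendsto_norm_zero_iff)
qed

lemma borel_measurable_lebesgue_on_subset:
  fixes f :: "real \<Rightarrow> real"
  assumes "f \<in> borel_measurable (lebesgue_on S)" "A \<subseteq> S"
  shows "f \<in> borel_measurable (lebesgue_on A)"
  using assms(1,2) by (rule measurable_restrict_mono)

text \<open>Paired with a representative of \<open>\<psi>\<close>, the distributional derivative
  becomes a scalar one, and a continuous function with an integrable distributional derivative is
  absolutely continuous.\<close>

lemma has_time_deriv_AC:
  fixes u u' :: "real \<Rightarrow> 'a::euclidean_space \<Rightarrow> real"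
  assumes d: "has_time_deriv T u u'" and c: "L2_continuous T u"
  shows "AC_on {0<..<T} (\<lambda>t. inner (cls (u t)) \<psi>) (\<lambda>t. inner (cls (u' t)) \<psi>)"
proof (rule AC_on_of_weak_derivative)
  have L: "u t \<in> L2_space unit_cube" if "t \<in> {0<..<T}" for t
    using c that by (auto simp: L2_continuous_def)
  have u': "strongly_measurable T (L2_space unit_cube) (L2_norm unit_cube) u'"
    "\<And>a b. 0 < a \<Longrightarrow> b < T \<Longrightarrow> integrable (lebesgue_on {a..b}) (\<lambda>t. L2_norm unit_cube (u' t))"
    using d by (auto simp: has_time_deriv_def Bochner_L1loc_def)
  have L': "AE t in lebesgue_on {0<..<T}. u' t \<in> L2_space unit_cube"
    using u'(1) by (simp add: strongly_measurable_def)
  have "(\<lambda>t. inner (dx [] (cls (u' t))) \<psi>) \<in> borel_measurable (lebesgue_on {0<..<T})"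
    by (rule smeas_inner_measurable[OF strongly_measurable_L2_smeas[OF u'(1)]]) (simp add: indices_def)
  then have meas: "(\<lambda>t. inner (cls (u' t)) \<psi>) \<in> borel_measurable (lebesgue_on {0<..<T})"
    by (simp add: dx_Nil)
  show "continuous_on {0<..<T} (\<lambda>t. inner (cls (u t)) \<psi>)"
    by (intro continuous_intros continuous_on_subset[OF L2_continuous_cls[OF c]]) auto
  show "integrable (lebesgue_on {a..b}) (\<lambda>t. inner (cls (u' t)) \<psi>)" if ab: "0 < a" "b < T" for a b
  proof (rule Bochner_Integration.integrable_bound)
    show "integrable (lebesgue_on {a..b}) (\<lambda>t. L2_norm unit_cube (u' t) * norm \<psi>)"
      using u'(2)[OF ab] by simp
    show "(\<lambda>t. inner (cls (u' t)) \<psi>) \<in> borel_measurable (lebesgue_on {a..b})"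
      by (rule borel_measurable_lebesgue_on_subset[OF meas]) (use ab in auto)
    have "AE t in lebesgue_on {a..b}. u' t \<in> L2_space unit_cube"
      by (rule AE_open_to_closed[OF L']) (use ab in auto)
    then show "AE t in lebesgue_on {a..b}. norm (inner (cls (u' t)) \<psi>) \<le> norm (L2_norm unit_cube (u' t) * norm \<psi>)"
    proof eventually_elim
      case (elim t)
      then show ?case
        using Cauchy_Schwarz_ineq2[of "cls (u' t)" \<psi>] by (simp add: norm_cls)
    qed
  qed
  fix \<phi> assume \<phi>: "\<phi> \<in> test_functions {0<..<T}"
  have eq: "(\<integral>t. deriv \<phi> t * ip (u t) (rep_l2 \<psi>) \<partial>(lebesgue_on {0<..<T})) =
        - (\<integral>t. \<phi> t * ip (u' t) (rep_l2 \<psi>) \<partial>(lebesgue_on {0<..<T}))"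
    using d \<phi> rep_l2_mem unfolding has_time_deriv_def by blast
  have 1: "ip f (rep_l2 \<psi>) = inner (cls f) \<psi>" if "f \<in> L2_space unit_cube" for f
    using inner_cls[OF that rep_l2_mem, of \<psi>] by (simp add: cls_rep)
  have "(\<integral>t. deriv \<phi> t * ip (u t) (rep_l2 \<psi>) \<partial>(lebesgue_on {0<..<T})) = (\<integral>t. deriv \<phi> t * inner (cls (u t)) \<psi> \<partial>(lebesgue_on {0<..<T}))"
    by (rule Bochner_Integration.integral_cong) (use L 1 in auto)
  moreover have "(\<integral>t. \<phi> t * ip (u' t) (rep_l2 \<psi>) \<partial>(lebesgue_on {0<..<T})) = (\<integral>t. \<phi> t * inner (cls (u' t)) \<psi> \<partial>(lebesgue_on {0<..<T}))"
  proof (rule integral_cong_AE)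
    have [measurable]: "\<phi> \<in> borel_measurable (lebesgue_on {0<..<T})"
      by (intro continuous_imp_measurable_on_sets_lebesgue smooth_fun_continuous_on test_smooth[OF \<phi>]) auto
    show m: "(\<lambda>t. \<phi> t * inner (cls (u' t)) \<psi>) \<in> borel_measurable (lebesgue_on {0<..<T})"
      using meas by measurable
    show ae: "AE t in lebesgue_on {0<..<T}. \<phi> t * ip (u' t) (rep_l2 \<psi>) = \<phi> t * inner (cls (u' t)) \<psi>"
      using L' by eventually_elim (simp add: 1)
    show "(\<lambda>t. \<phi> t * ip (u' t) (rep_l2 \<psi>)) \<in> borel_measurable (lebesgue_on {0<..<T})"
      by (rule borel_measurable_lebesgue_on_AE[OF m]) (use ae in \<open>auto elim: AE_mp\<close>)
  qed
  ultimately show "(\<integral>t. deriv \<phi> t * inner (cls (u t)) \<psi> \<partial>(lebesgue_on {0<..<T})) =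
        - (\<integral>t. \<phi> t * inner (cls (u' t)) \<psi> \<partial>(lebesgue_on {0<..<T}))"
    using eq by simp
qed

lemma Bochner_L2_hnorm:
  fixes u :: "real \<Rightarrow> 'a::euclidean_space \<Rightarrow> real"
  assumes u: "u \<in> Bochner_L2 T (sobolev_space unit_cube m) (sobolev_norm unit_cube m)"
  shows "smeas T m (\<lambda>t. cls (u t))"
    and "integrable (lebesgue_on {0<..<T}) (\<lambda>t. (hnorm m (cls (u t)))\<^sup>2)"
    and "integrable (lebesgue_on {0<..<T}) (\<lambda>t. hnorm m (cls (u t)))"
proof -
  have sm: "strongly_measurable T (sobolev_space unit_cube m) (sobolev_norm unit_cube m) u"
    and int: "integrable (lebesgue_on {0<..<T}) (\<lambda>t. (sobolev_norm unit_cube m (u t))\<^sup>2)"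
    using u by (auto simp: Bochner_L2_def)
  show s: "smeas T m (\<lambda>t. cls (u t))" by (rule strongly_measurable_smeas[OF sm])
  have meas: "(\<lambda>t. hnorm m (cls (u t))) \<in> borel_measurable (lebesgue_on {0<..<T})"
    using smeas_hnorm_measurable[OF s subspace_0[OF subspace_sob]] by simp
  have ae: "AE t in lebesgue_on {0<..<T}. u t \<in> sobolev_space unit_cube m"
    using sm by (simp add: strongly_measurable_def)
  show sq: "integrable (lebesgue_on {0<..<T}) (\<lambda>t. (hnorm m (cls (u t)))\<^sup>2)"
  proof (rule integrable_cong_AE_imp[OF int])
    show "AE t in lebesgue_on {0<..<T}. (sobolev_norm unit_cube m (u t))\<^sup>2 = (hnorm m (cls (u t)))\<^sup>2"
      using ae by eventually_elim (simp add: sobolev_norm_eq)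
  qed (use meas in measurable)
  show "integrable (lebesgue_on {0<..<T}) (\<lambda>t. hnorm m (cls (u t)))"
  proof (rule Bochner_Integration.integrable_bound[OF _ meas])
    show "integrable (lebesgue_on {0<..<T}) (\<lambda>t. 1 + (hnorm m (cls (u t)))\<^sup>2)"
      using sq by (auto simp: finite_measure.integrable_const finite_measure_lebesgue_on)
    \<comment> \<open>On a bounded time interval square integrability implies integrability by this
      elementary bound.\<close>
    have "a \<le> 1 + a\<^sup>2" for a :: real
      using sum_squares_bound[of a 1] zero_le_power2[of a] unfolding power_one mult_1_right by linarith
    then show "AE t in lebesgue_on {0<..<T}. norm (hnorm m (cls (u t))) \<le> norm (1 + (hnorm m (cls (u t)))\<^sup>2)"
      by (intro AE_I2) (simp add: hnorm_nonneg)
  qed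
qed

definition beam_b :: "(real \<Rightarrow> real) \<Rightarrow> real \<Rightarrow> real" where "beam_b K t = 1 / K t ^ 4"

text \<open>The factor of the coordinate in \<open>coeff_a5\<close>, which is linear in y.\<close>

definition beam_c5 :: "real \<Rightarrow> (real \<Rightarrow> real) \<Rightarrow> (real \<Rightarrow> real) \<Rightarrow> (real \<Rightarrow> real) \<Rightarrow> real \<Rightarrow> real" where
  "beam_c5 \<nu> K K' K'' t =
     (2 * (K' t)\<^sup>2 - K t * (\<nu> * K' t + K'' t)) / (K t)\<^sup>2 - 4 * (K' t / K t)\<^sup>2"

text \<open>The terms of the equation with space derivatives of \<open>u\<close>, other than the biharmonic and
  the nonlocal one, after integration by parts.\<close>

definition beam_L ::
  "real \<Rightarrow> real \<Rightarrow> (real \<Rightarrow> real) \<Rightarrow> (real \<Rightarrow> real) \<Rightarrow> (real \<Rightarrow> real) \<Rightarrow> real \<Rightarrow>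
   'a::euclidean_space l2 \<Rightarrow> 'a l2" where
  "beam_L \<nu> \<zeta>0 K K' K'' t x =
     (\<Sum>i\<in>Basis. (4 * (K' t)\<^sup>2 / (K t)\<^sup>2) *\<^sub>R
          (2 *\<^sub>R coord_mult i (dx [i] x) + coord_mult i (coord_mult i (dx [i, i] x)))
        - (\<zeta>0 / (K t)\<^sup>2) *\<^sub>R dx [i, i] x
        + beam_c5 \<nu> K K' K'' t *\<^sub>R coord_mult i (dx [i] x))
     + (\<Sum>i\<in>Basis. \<Sum>j\<in>Basis. (4 * (K' t / K t)\<^sup>2) *\<^sub>R coord_mult i (coord_mult j (dx [i, j] x)))"

lemma coord_mult_diff: "i \<in> Basis \<Longrightarrow> coord_mult i (x - y) = coord_mult i x - coord_mult i y"
  by (rule linear_diff[OF bounded_linear.linear[OF bounded_linear_coord_mult]])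

lemma beam_L_diff:
  fixes x y :: "'a::euclidean_space l2"
  assumes "x \<in> VV" "y \<in> VV"
  shows "beam_L \<nu> \<zeta>0 K K' K'' t (x - y) = beam_L \<nu> \<zeta>0 K K' K'' t x - beam_L \<nu> \<zeta>0 K K' K'' t y"
proof -
  have d: "dx [i] (x - y) = dx [i] x - dx [i] y" "dx [i, j] (x - y) = dx [i, j] x - dx [i, j] y"
    if "i \<in> Basis" "j \<in> Basis" for i j
    using that assms by (auto simp: dx_diff[where m=2] VV_sob)
  have 1: "(\<Sum>i\<in>Basis. \<Sum>j\<in>Basis. c *\<^sub>R coord_mult i (coord_mult j (dx [i, j] (x - y)))) =
     (\<Sum>i\<in>Basis. \<Sum>j\<in>Basis. c *\<^sub>R coord_mult i (coord_mult j (dx [i, j] x))) - (\<Sum>i\<in>Basis. \<Sum>j\<in>Basis. c *\<^sub>R coord_mult i (coord_mult j (dx [i, j] y)))" for c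
    unfolding sum_subtractf[symmetric] by (intro sum.cong) (auto simp: d coord_mult_diff scaleR_diff_right)
  have 2: "(\<Sum>i\<in>Basis. p *\<^sub>R (2 *\<^sub>R coord_mult i (dx [i] (x - y)) + coord_mult i (coord_mult i (dx [i, i] (x - y)))) - q *\<^sub>R dx [i, i] (x - y) + r *\<^sub>R coord_mult i (dx [i] (x - y)))
    = (\<Sum>i\<in>Basis. p *\<^sub>R (2 *\<^sub>R coord_mult i (dx [i] x) + coord_mult i (coord_mult i (dx [i, i] x))) - q *\<^sub>R dx [i, i] x + r *\<^sub>R coord_mult i (dx [i] x))
    - (\<Sum>i\<in>Basis. p *\<^sub>R (2 *\<^sub>R coord_mult i (dx [i] y) + coord_mult i (coord_mult i (dx [i, i] y))) - q *\<^sub>R dx [i, i] y + r *\<^sub>R coord_mult i (dx [i] y))" for p q r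
    unfolding sum_subtractf[symmetric] by (intro sum.cong) (auto simp: d coord_mult_diff algebra_simps)
  show ?thesis unfolding beam_L_def 1 2 by simp
qed

text \<open>First derivatives cost 2 |lap x| and second derivatives |lap x|, while coordinate
  multiplications cost nothing. Hence 5 = 2 times 2 plus 1 for the bracket with \<open>p\<close>,
  and the double sum adds n^2 p.\<close>

lemma beam_L_le:
  fixes x :: "'a::euclidean_space l2"
  assumes x: "x \<in> VV" and p: "4 * (K' t)\<^sup>2 / (K t)\<^sup>2 \<le> p" and q: "\<bar>\<zeta>0 / (K t)\<^sup>2\<bar> \<le> q"
    and r: "\<bar>beam_c5 \<nu> K K' K'' t\<bar> \<le> r"
  shows "norm (beam_L \<nu> \<zeta>0 K K' K'' t x) \<le> (real DIM('a) * (5 * p + q + 2 * r) + real DIM('a) * (real DIM('a) * p)) * norm (lap x)"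
proof -
  let ?l = "norm (lap x)"
  have p0: "0 \<le> 4 * (K' t)\<^sup>2 / (K t)\<^sup>2" by simp
  have pe: "4 * (K' t / K t)\<^sup>2 = 4 * (K' t)\<^sup>2 / (K t)\<^sup>2" by (simp add: power_divide)
  have c1: "norm (coord_mult i (dx [i] x)) \<le> 2 * ?l" if "i \<in> Basis" for i
    using norm_coord_mult[OF that, of "dx [i] x"] VV_norm_dx1_le_lap[OF x that] by linarith
  have c2: "norm (coord_mult i (coord_mult j (dx [i, j] x))) \<le> ?l" if "i \<in> Basis" "j \<in> Basis" for i j
    using norm_coord_mult[OF that(1), of "coord_mult j (dx [i, j] x)"] norm_coord_mult[OF that(2), of "dx [i, j] x"]
      VV_norm_dx2_le_lap[OF x that] by linarith
  have A: "norm (\<Sum>i\<in>(Basis::'a set). (4 * (K' t)\<^sup>2 / (K t)\<^sup>2) *\<^sub>R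
          (2 *\<^sub>R coord_mult i (dx [i] x) + coord_mult i (coord_mult i (dx [i, i] x)))
        - (\<zeta>0 / (K t)\<^sup>2) *\<^sub>R dx [i, i] x
        + beam_c5 \<nu> K K' K'' t *\<^sub>R coord_mult i (dx [i] x)) \<le> (\<Sum>i\<in>(Basis::'a set). (5 * p + q + 2 * r) * ?l)"
  proof (rule sum_norm_le)
    fix i :: 'a assume i: "i \<in> Basis"
    let ?A = "2 *\<^sub>R coord_mult i (dx [i] x) + coord_mult i (coord_mult i (dx [i, i] x))"
    have "norm ?A \<le> 5 * ?l"
      using norm_triangle_ineq[of "2 *\<^sub>R coord_mult i (dx [i] x)" "coord_mult i (coord_mult i (dx [i, i] x))"] c1[OF i] c2[OF i i]
      by (simp del: norm_triangle_ineq)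
    then have a: "norm ((4 * (K' t)\<^sup>2 / (K t)\<^sup>2) *\<^sub>R ?A) \<le> p * (5 * ?l)"
      unfolding norm_scaleR using p p0 order_trans[OF p0 p] by (intro mult_mono) auto
    have b: "norm ((\<zeta>0 / (K t)\<^sup>2) *\<^sub>R dx [i, i] x) \<le> q * ?l"
      unfolding norm_scaleR using q order_trans[OF abs_ge_zero q] VV_norm_dx2_le_lap[OF x i i] by (intro mult_mono) auto
    have c: "norm (beam_c5 \<nu> K K' K'' t *\<^sub>R coord_mult i (dx [i] x)) \<le> r * (2 * ?l)"
      unfolding norm_scaleR using r order_trans[OF abs_ge_zero r] c1[OF i] by (intro mult_mono) auto
    have "norm ((4 * (K' t)\<^sup>2 / (K t)\<^sup>2) *\<^sub>R ?A - (\<zeta>0 / (K t)\<^sup>2) *\<^sub>R dx [i, i] x + beam_c5 \<nu> K K' K'' t *\<^sub>R coord_mult i (dx [i] x))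
        \<le> norm ((4 * (K' t)\<^sup>2 / (K t)\<^sup>2) *\<^sub>R ?A) + norm ((\<zeta>0 / (K t)\<^sup>2) *\<^sub>R dx [i, i] x) + norm (beam_c5 \<nu> K K' K'' t *\<^sub>R coord_mult i (dx [i] x))"
      by (intro norm_triangle_le add_right_mono norm_triangle_ineq4)
    also have "\<dots> \<le> (5 * p + q + 2 * r) * ?l" using a b c by (simp add: algebra_simps)
    finally show "norm ((4 * (K' t)\<^sup>2 / (K t)\<^sup>2) *\<^sub>R ?A - (\<zeta>0 / (K t)\<^sup>2) *\<^sub>R dx [i, i] x + beam_c5 \<nu> K K' K'' t *\<^sub>R coord_mult i (dx [i] x)) \<le> (5 * p + q + 2 * r) * ?l" .
  qed
  have B: "norm (\<Sum>i\<in>(Basis::'a set). \<Sum>j\<in>(Basis::'a set). (4 * (K' t / K t)\<^sup>2) *\<^sub>R coord_mult i (coord_mult j (dx [i, j] x)))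
      \<le> (\<Sum>i\<in>(Basis::'a set). \<Sum>j\<in>(Basis::'a set). p * ?l)"
  proof (intro sum_norm_le)
    fix i j :: 'a assume ij: "i \<in> Basis" "j \<in> Basis"
    show "norm ((4 * (K' t / K t)\<^sup>2) *\<^sub>R coord_mult i (coord_mult j (dx [i, j] x))) \<le> p * ?l"
      unfolding norm_scaleR pe using p p0 order_trans[OF p0 p] c2[OF ij] by (intro mult_mono) auto
  qed
  have "norm (beam_L \<nu> \<zeta>0 K K' K'' t x) \<le> (\<Sum>i\<in>(Basis::'a set). (5 * p + q + 2 * r) * ?l) + (\<Sum>i\<in>(Basis::'a set). \<Sum>j\<in>(Basis::'a set). p * ?l)"
    unfolding beam_L_def by (rule norm_triangle_le[OF add_mono[OF A B]])
  then show ?thesis by (simp add: algebra_simps)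
qed

lemma V_space_sobolev: "u \<in> V_space \<Longrightarrow> u \<in> sobolev_space unit_cube 2"
  by (simp add: sobolev_space0_def)

lemma grad_inner_cls:
  assumes "u \<in> V_space" "w \<in> V_space"
  shows "grad_inner u w = (\<Sum>i\<in>Basis. inner (dx [i] (cls u)) (dx [i] (cls w)))"
  unfolding grad_inner_def
proof (rule sum.cong)
  fix i :: 'a assume i: "i \<in> Basis"
  show "ip (wd [i] u) (wd [i] w) = inner (dx [i] (cls u)) (dx [i] (cls w))"
    using sobolev_wd[OF V_space_sobolev[OF assms(1)], of "[i]"] sobolev_wd[OF V_space_sobolev[OF assms(2)], of "[i]"] i
    by (simp add: inner_cls[symmetric])
qed simp

lemma grad_norm_sq: "u \<in> V_space \<Longrightarrow> (grad_norm u)\<^sup>2 = grad_sq (cls u)"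
  by (simp add: grad_norm_def grad_inner_cls grad_sq_def power2_norm_eq_inner[symmetric] sum_nonneg)

lemma VV_grad_inner: "x \<in> VV \<Longrightarrow> y \<in> VV \<Longrightarrow> (\<Sum>i\<in>Basis. inner (dx [i] x) (dx [i] y)) = - inner (lap x) y"
  by (simp add: lap_def inner_sum_left VV_inner_dx sum_negf)

lemma coeff_a1_cls:
  assumes "f \<in> L2_space unit_cube" "i \<in> Basis"
  shows "(\<lambda>y. coeff_a1 \<zeta>0 K K' i y t * f y) \<in> L2_space unit_cube"
    "cls (\<lambda>y. coeff_a1 \<zeta>0 K K' i y t * f y) =
     (\<zeta>0 / (K t)\<^sup>2) *\<^sub>R cls f - (4 * (K' t)\<^sup>2 / (K t)\<^sup>2) *\<^sub>R coord_mult i (coord_mult i (cls f))"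
proof -
  have eq: "(\<lambda>y. coeff_a1 \<zeta>0 K K' i y t * f y) =
      (\<lambda>y. \<zeta>0 / (K t)\<^sup>2 * f y - 4 * (K' t)\<^sup>2 / (K t)\<^sup>2 * ((y \<bullet> i) * ((y \<bullet> i) * f y)))"
    by (auto simp: coeff_a1_def power_mult_distrib algebra_simps power2_eq_square diff_divide_distrib)
  note L = assms(1) L2_space_coord_mult[OF assms(2,1)] L2_space_coord_mult[OF assms(2) L2_space_coord_mult[OF assms(2,1)]]
  show "(\<lambda>y. coeff_a1 \<zeta>0 K K' i y t * f y) \<in> L2_space unit_cube"
    unfolding eq by (intro L2_space_diff L2_space_scale L)
  show "cls (\<lambda>y. coeff_a1 \<zeta>0 K K' i y t * f y) =
     (\<zeta>0 / (K t)\<^sup>2) *\<^sub>R cls f - (4 * (K' t)\<^sup>2 / (K t)\<^sup>2) *\<^sub>R coord_mult i (coord_mult i (cls f))"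
    unfolding eq
    by (subst cls_diff[OF L2_space_scale[OF L(1)] L2_space_scale[OF L(3)]])
       (simp only: cls_scale[OF L(1)] cls_scale[OF L(3)] coord_mult_cls[OF assms(2) L(1)] coord_mult_cls[OF assms(2) L(2)])
qed

text \<open>All space derivatives except one Laplacian are moved from \<open>w\<close> to
  \<open>u\<close>. The form with \<open>coeff_a1\<close> becomes second order in \<open>u\<close>,
  with a first order part from differentiating y_i^2. The gradient of \<open>u'\<close> stays where
  it is, \<open>u'\<close> being only in H^1.\<close>

lemma beam_form_eq:
  fixes u u' u'' w :: "'a::euclidean_space \<Rightarrow> real"
  assumes u: "u \<in> V_space" and u': "u' \<in> sobolev_space unit_cube 1" and u'': "u'' \<in> L2_space unit_cube"
    and w: "w \<in> V_space"
  shows "beam_form \<nu> \<zeta>0 \<zeta>1 K K' K'' t u u' u'' w =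
     inner (cls u'') (cls w) + beam_b K t * inner (lap (cls u)) (lap (cls w)) + \<nu> * inner (cls u') (cls w)
     - 2 * K' t / K t * (\<Sum>i\<in>Basis. inner (coord_mult i (dx [i] (cls u'))) (cls w))
     + inner (beam_L \<nu> \<zeta>0 K K' K'' t (cls u)) (cls w)
     - \<zeta>1 * beam_b K t * grad_sq (cls u) * inner (lap (cls u)) (cls w)"
proof -
  let ?x = "cls u" and ?y = "cls w"
  have xV: "?x \<in> VV" and yV: "?y \<in> VV" using u w by (auto intro: V_space_VV)
  note us = V_space_sobolev[OF u] and ws = V_space_sobolev[OF w]
  have wL: "w \<in> L2_space unit_cube" by (rule V_space_L2[OF w])
  have wdu: "wd [i] u \<in> L2_space unit_cube" "cls (wd [i] u) = dx [i] ?x"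
    "wd [i] w \<in> L2_space unit_cube" "cls (wd [i] w) = dx [i] ?y"
    "wd [i] u' \<in> L2_space unit_cube" "cls (wd [i] u') = dx [i] (cls u')" if "i \<in> Basis" for i
    using sobolev_wd[OF us, of "[i]"] sobolev_wd[OF ws, of "[i]"] sobolev_wd[OF u', of "[i]"] that by auto
  have wdu2: "wd [i, j] u \<in> L2_space unit_cube" "cls (wd [i, j] u) = dx [i, j] ?x" if "i \<in> Basis" "j \<in> Basis" for i j
    using sobolev_wd[OF us, of "[i, j]"] that by auto
  have T1: "ip u'' w = inner (cls u'') ?y" "ip u' w = inner (cls u') ?y"
    using u'' wL sobolev_space_L2[OF u'] by (simp_all add: inner_cls)
  have T3: "ip (laplacian u) (laplacian w) = inner (lap ?x) (lap ?y)"
    using laplacian_cls[OF us] laplacian_cls[OF ws] by (simp add: inner_cls[symmetric])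
  let ?p = "4 * (K' t)\<^sup>2 / (K t)\<^sup>2" and ?q = "\<zeta>0 / (K t)\<^sup>2" and ?r = "beam_c5 \<nu> K K' K'' t"
  have T5: "ip (\<lambda>y. coeff_a1 \<zeta>0 K K' i y t * wd [i] u y) (wd [i] w) =
      inner (?p *\<^sub>R (2 *\<^sub>R coord_mult i (dx [i] ?x) + coord_mult i (coord_mult i (dx [i, i] ?x))) - ?q *\<^sub>R dx [i, i] ?x) ?y"
    if i: "i \<in> Basis" for i
    using coeff_a1_cls[OF wdu(1)[OF i] i, of \<zeta>0 K K' t] wdu[OF i]
      VV_inner_coord_coord_dx[OF xV yV i] VV_inner_dx[OF xV yV i]
    by (simp add: inner_cls[symmetric] inner_diff_left)
  have T6: "ip (\<lambda>y. coeff_a2 K K' i j y t * wd [i, j] u y) w =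
      inner ((4 * (K' t / K t)\<^sup>2) *\<^sub>R coord_mult i (coord_mult j (dx [i, j] ?x))) ?y" if ij: "i \<in> Basis" "j \<in> Basis" for i j
  proof -
    note L = wdu2(1)[OF ij] L2_space_coord_mult[OF ij(2) wdu2(1)[OF ij]]
      L2_space_coord_mult[OF ij(1) L2_space_coord_mult[OF ij(2) wdu2(1)[OF ij]]]
    have "(\<lambda>y. coeff_a2 K K' i j y t * wd [i, j] u y) = (\<lambda>y. 4 * (K' t / K t)\<^sup>2 * ((y \<bullet> i) * ((y \<bullet> j) * wd [i, j] u y)))"
      by (simp add: coeff_a2_def mult_ac)
    then have "ip (\<lambda>y. coeff_a2 K K' i j y t * wd [i, j] u y) w = inner (cls (\<lambda>y. 4 * (K' t / K t)\<^sup>2 * ((y \<bullet> i) * ((y \<bullet> j) * wd [i, j] u y)))) ?y"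
      using L2_space_scale[OF L(3)] wL by (simp add: inner_cls)
    then show ?thesis
      by (simp only: cls_scale[OF L(3)] coord_mult_cls[OF ij(1) L(2), symmetric] coord_mult_cls[OF ij(2) L(1), symmetric] wdu2(2)[OF ij])
  qed
  have Tc: "ip (\<lambda>y. c * (y \<bullet> i) * f y) w = c * inner (coord_mult i (cls f)) ?y"
    if "f \<in> L2_space unit_cube" "i \<in> Basis" for f c i
  proof -
    have "(\<lambda>y. c * (y \<bullet> i) * f y) = (\<lambda>y. c * ((y \<bullet> i) * f y))" by (simp add: mult.assoc)
    then show ?thesis
      using L2_space_scale[OF L2_space_coord_mult[OF that(2,1)], of c] wL L2_space_coord_mult[OF that(2,1)] that
      by (simp add: inner_cls[symmetric] cls_scale coord_mult_cls)
  qed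
  have T7: "ip (\<lambda>y. coeff_a4 K K' i y t * wd [i] u' y) w = - (2 * K' t / K t) * inner (coord_mult i (dx [i] (cls u'))) ?y"
    if i: "i \<in> Basis" for i
  proof -
    have "(\<lambda>y. coeff_a4 K K' i y t * wd [i] u' y) = (\<lambda>y. - (2 * K' t / K t) * (y \<bullet> i) * wd [i] u' y)"
      by (simp add: coeff_a4_def mult_ac)
    then show ?thesis using Tc[OF wdu(5)[OF i] i, of "- (2 * K' t / K t)"] wdu(6)[OF i] by simp
  qed
  have T8: "ip (\<lambda>y. coeff_a5 \<nu> K K' K'' i y t * wd [i] u y) w = inner (?r *\<^sub>R coord_mult i (dx [i] ?x)) ?y"
    if i: "i \<in> Basis" for i
  proof -
    have "coeff_a5 \<nu> K K' K'' i y t = ?r * (y \<bullet> i)" for y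
      by (simp add: coeff_a5_def coeff_a3_def coeff_a4_def beam_c5_def power2_eq_square algebra_simps diff_divide_distrib add_divide_distrib)
    then have "(\<lambda>y. coeff_a5 \<nu> K K' K'' i y t * wd [i] u y) = (\<lambda>y. ?r * (y \<bullet> i) * wd [i] u y)" by simp
    then show ?thesis using Tc[OF wdu(1)[OF i] i, of ?r] wdu(2)[OF i] by simp
  qed
  have T2: "(grad_norm u)\<^sup>2 * grad_inner u w = - (grad_sq ?x * inner (lap ?x) ?y)"
    using grad_norm_sq[OF u] grad_inner_cls[OF u w] VV_grad_inner[OF xV yV] by simp
  have LE: "inner (beam_L \<nu> \<zeta>0 K K' K'' t ?x) ?y =
     (\<Sum>i\<in>Basis. ip (\<lambda>y. coeff_a1 \<zeta>0 K K' i y t * wd [i] u y) (wd [i] w))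
     + (\<Sum>i\<in>Basis. ip (\<lambda>y. coeff_a5 \<nu> K K' K'' i y t * wd [i] u y) w)
     + (\<Sum>i\<in>Basis. \<Sum>j\<in>Basis. ip (\<lambda>y. coeff_a2 K K' i j y t * wd [i, j] u y) w)"
    unfolding beam_L_def inner_add_left inner_sum_left sum.distrib[symmetric]
    by (simp add: T5 T6 T8 sum.distrib inner_add_left)
  have S7: "(\<Sum>i\<in>Basis. ip (\<lambda>y. coeff_a4 K K' i y t * wd [i] u' y) w)
      = - (2 * K' t / K t) * (\<Sum>i\<in>Basis. inner (coord_mult i (dx [i] (cls u'))) ?y)"
    unfolding sum_distrib_left by (rule sum.cong) (auto simp: T7)
  have "coeff_b1 \<zeta>1 K t * (grad_norm u)\<^sup>2 * grad_inner u w = - (\<zeta>1 * beam_b K t * grad_sq ?x * inner (lap ?x) ?y)"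
    using T2 by (simp add: coeff_b1_def beam_b_def mult.assoc)
  then show ?thesis
    unfolding beam_form_def LE S7 T1 T3 by (simp add: coeff_b2_def beam_b_def)
qed

context l2_evolution
begin

text \<open>Increments are dominated by those of the scalar primitive of
  \<open>hnorm 4 (x' t)\<close>. The continuity gives measurability of the H^2 norm of the
  error.\<close>

lemma continuous_on_dx:
  assumes x: "\<And>t. t \<in> {0..<T} \<Longrightarrow> x t \<in> sob 2" and \<alpha>: "\<alpha> \<in> indices 2"
  shows "continuous_on {0..<T} (\<lambda>t. dx \<alpha> (x t))"
proof -
  define F where "F t = 0 + LI 0 t (\<lambda>\<tau>. hnorm 4 (x' \<tau>))" for t
  have AC: "AC_on {0..<T} F (\<lambda>\<tau>. hnorm 4 (x' \<tau>))"
    unfolding F_def[abs_def] by (rule AC_on_indefinite) (rule hnorm_integrable; simp)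
  have le: "norm (dx \<alpha> (x b) - dx \<alpha> (x a)) \<le> \<bar>F b - F a\<bar>" if "a \<in> {0..<T}" "b \<in> {0..<T}" "a \<le> b" for a b
  proof -
    have "norm (dx \<alpha> (x b - x a - (b - a) *\<^sub>R 0)) \<le> LI a b (\<lambda>t. hnorm 4 (x' t - 0))"
      by (rule dx_increment_le[OF \<alpha>])
        (use that in \<open>auto intro!: x subspace_diff[OF subspace_sob] subspace_0[OF subspace_sob]\<close>)
    then show ?thesis
      using AC_onD(2)[OF AC that] dx_diff[where m=2, OF x[OF that(2)] x[OF that(1)] \<alpha>] by simp
  qed
  have le': "dist (dx \<alpha> (x b)) (dx \<alpha> (x a)) \<le> dist (F b) (F a)" if "a \<in> {0..<T}" "b \<in> {0..<T}" for a b
    using le[of a b] le[of b a] that by (cases "a \<le> b") (auto simp: dist_norm norm_minus_commute abs_minus_commute)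
  have "continuous_on {0..<T} F" by (rule AC_on_continuous_half_open[OF AC])
  then show ?thesis unfolding continuous_on_iff using le' by (meson le_less_trans)
qed

end

section \<open>Finite element spaces\<close>

lemma polynomials_le_add:
  assumes "p \<in> polynomials_le l" "q \<in> polynomials_le l"
  shows "(\<lambda>y. p y + q y) \<in> polynomials_le l"
proof -
  obtain c d where "p = (\<lambda>y. \<Sum>\<alpha> | (\<forall>i. i \<notin> Basis \<longrightarrow> \<alpha> i = 0) \<and> sum \<alpha> Basis \<le> l. c \<alpha> * (\<Prod>i\<in>Basis. (y \<bullet> i) ^ \<alpha> i))"
    "q = (\<lambda>y. \<Sum>\<alpha> | (\<forall>i. i \<notin> Basis \<longrightarrow> \<alpha> i = 0) \<and> sum \<alpha> Basis \<le> l. d \<alpha> * (\<Prod>i\<in>Basis. (y \<bullet> i) ^ \<alpha> i))"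
    using assms unfolding polynomials_le_def by blast
  then show ?thesis
    unfolding polynomials_le_def
    by (auto intro!: exI[of _ "\<lambda>\<alpha>. c \<alpha> + d \<alpha>"] simp: sum.distrib[symmetric] distrib_right)
qed

lemma polynomials_le_scale:
  assumes "p \<in> polynomials_le l"
  shows "(\<lambda>y. k * p y) \<in> polynomials_le l"
proof -
  obtain c where "p = (\<lambda>y. \<Sum>\<alpha> | (\<forall>i. i \<notin> Basis \<longrightarrow> \<alpha> i = 0) \<and> sum \<alpha> Basis \<le> l. c \<alpha> * (\<Prod>i\<in>Basis. (y \<bullet> i) ^ \<alpha> i))"
    using assms unfolding polynomials_le_def by blast
  then show ?thesis
    unfolding polynomials_le_def
    by (auto intro!: exI[of _ "\<lambda>\<alpha>. k * c \<alpha>"] simp: sum_distrib_left mult.assoc)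
qed

lemma C1_on_add:
  assumes "C1_on S f" "C1_on S g" shows "C1_on S (\<lambda>x. f x + g x)"
  unfolding C1_on_def
proof (intro conjI ballI)
  have d: "f differentiable at x" "g differentiable at x" if "x \<in> S" for x
    using assms that by (auto simp: C1_on_def)
  show "(\<lambda>x. f x + g x) differentiable at x" if "x \<in> S" for x
    using d[OF that] by (rule differentiable_add)
  fix i :: 'a assume i: "i \<in> Basis"
  have "continuous_on S (\<lambda>x. frechet_derivative f (at x) i + frechet_derivative g (at x) i)"
    using assms i by (intro continuous_on_add) (auto simp: C1_on_def)
  then show "continuous_on S (\<lambda>x. frechet_derivative (\<lambda>x. f x + g x) (at x) i)"
  proof (rule continuous_on_eq)
    fix x assume "x \<in> S"
    from d[OF this] have "((\<lambda>x. f x + g x) has_derivative (\<lambda>h. frechet_derivative f (at x) h + frechet_derivative g (at x) h)) (at x)"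
      by (intro has_derivative_add) (simp_all add: frechet_derivative_works[symmetric])
    from frechet_derivative_at[OF this]
    show "frechet_derivative f (at x) i + frechet_derivative g (at x) i = frechet_derivative (\<lambda>x. f x + g x) (at x) i"
      by metis
  qed
qed

lemma C1_on_scale:
  assumes "C1_on S f" shows "C1_on S (\<lambda>x. c * f x)"
  unfolding C1_on_def
proof (intro conjI ballI)
  have d: "f differentiable at x" if "x \<in> S" for x
    using assms that by (auto simp: C1_on_def)
  show "(\<lambda>x. c * f x) differentiable at x" if "x \<in> S" for x
    using d[OF that] by (intro differentiable_mult differentiable_const)
  fix i :: 'a assume i: "i \<in> Basis"
  have "continuous_on S (\<lambda>x. c * frechet_derivative f (at x) i)"
    using assms i by (intro continuous_on_mult_left) (auto simp: C1_on_def)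
  then show "continuous_on S (\<lambda>x. frechet_derivative (\<lambda>x. c * f x) (at x) i)"
  proof (rule continuous_on_eq)
    fix x assume "x \<in> S"
    from d[OF this] have "((\<lambda>x. c * f x) has_derivative (\<lambda>h. c * frechet_derivative f (at x) h)) (at x)"
      by (intro has_derivative_mult_right) (simp add: frechet_derivative_works[symmetric])
    from frechet_derivative_at[OF this]
    show "c * frechet_derivative f (at x) i = frechet_derivative (\<lambda>x. c * f x) (at x) i"
      by metis
  qed
qed

lemma V_space_add:
  assumes "u \<in> V_space" "w \<in> V_space" shows "(\<lambda>y. u y + w y) \<in> V_space"
proof -
  note L = V_space_L2[OF assms(1)] V_space_L2[OF assms(2)]
  have "cls (\<lambda>y. u y + w y) \<in> VV"
    using assms L by (simp add: cls_add subspace_add[OF subspace_VV] V_space_VV)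
  then show ?thesis using V_space_iff[OF L2_space_add[OF L]] by simp
qed

lemma V_space_scale:
  assumes "u \<in> V_space" shows "(\<lambda>y. c * u y) \<in> V_space"
proof -
  note L = V_space_L2[OF assms]
  have "cls (\<lambda>y. c * u y) \<in> VV"
    using assms L by (simp add: cls_scale subspace_scale[OF subspace_VV] V_space_VV)
  then show ?thesis using V_space_iff[OF L2_space_scale[OF L]] by simp
qed

lemma fe_space_L2: "u \<in> fe_space \<T> \<Longrightarrow> u \<in> L2_space unit_cube"
  by (auto simp: fe_space_def intro: V_space_L2)

lemma fe_space_V: "u \<in> fe_space \<T> \<Longrightarrow> u \<in> V_space"
  by (simp add: fe_space_def)

lemma fe_space_add:
  assumes "u \<in> fe_space \<T>" "w \<in> fe_space \<T>" shows "(\<lambda>y. u y + w y) \<in> fe_space \<T>"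
proof -
  have "\<exists>p\<in>polynomials_le 3. \<forall>y\<in>E \<inter> unit_cube. u y + w y = p y" if E: "E \<in> \<T>" for E
  proof -
    obtain p q where "p \<in> polynomials_le 3" "\<forall>y\<in>E \<inter> unit_cube. u y = p y"
      "q \<in> polynomials_le 3" "\<forall>y\<in>E \<inter> unit_cube. w y = q y"
      using assms E unfolding fe_space_def by blast
    then show ?thesis by (intro bexI[OF _ polynomials_le_add[of p 3 q]]) auto
  qed
  then show ?thesis
    using assms by (auto simp: fe_space_def intro!: V_space_add C1_on_add)
qed

lemma fe_space_scale:
  assumes "u \<in> fe_space \<T>" shows "(\<lambda>y. c * u y) \<in> fe_space \<T>"
proof -
  have "\<exists>p\<in>polynomials_le 3. \<forall>y\<in>E \<inter> unit_cube. c * u y = p y" if E: "E \<in> \<T>" for E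
  proof -
    obtain p where "p \<in> polynomials_le 3" "\<forall>y\<in>E \<inter> unit_cube. u y = p y"
      using assms E unfolding fe_space_def by blast
    then show ?thesis by (intro bexI[OF _ polynomials_le_scale[of p 3 c]]) auto
  qed
  then show ?thesis
    using assms by (auto simp: fe_space_def intro!: V_space_scale C1_on_scale)
qed

lemma subspace_fe_space:
  fixes w :: "'a::euclidean_space \<Rightarrow> real"
  assumes w: "w \<in> fe_space \<T>"
  shows "subspace (cls ` fe_space \<T>)"
  unfolding subspace_def
proof (intro conjI ballI allI; clarsimp?)
  show "0 \<in> cls ` fe_space \<T>"
    by (rule image_eqI[OF _ fe_space_scale[OF w, of 0]]) (simp add: cls_zero)
  fix u c assume u: "u \<in> fe_space \<T>"
  show "c *\<^sub>R cls u \<in> cls ` fe_space \<T>"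
    by (rule image_eqI[OF _ fe_space_scale[OF u, of c]]) (simp add: cls_scale fe_space_L2[OF u])
  fix z assume z: "z \<in> fe_space \<T>"
  show "cls u + cls z \<in> cls ` fe_space \<T>"
    by (rule image_eqI[OF _ fe_space_add[OF u z]]) (simp add: cls_add fe_space_L2[OF u] fe_space_L2[OF z])
qed

text \<open>Elements may overlap in their boundaries, so the cube is cut into the sets of points with a
  prescribed set of elements containing them.\<close>

lemma fe_space_span:
  fixes \<T> :: "'a::euclidean_space set set"
  assumes fin: "finite \<T>" and closed: "\<And>E. E \<in> \<T> \<Longrightarrow> closed E" and cover: "unit_cube \<subseteq> \<Union>\<T>"
    and ne: "w \<in> fe_space \<T>"
  shows "\<exists>S. finite S \<and> S \<subseteq> VV \<and> cls ` fe_space \<T> = span S"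
proof -
  define A :: "('a \<Rightarrow> nat) set" where "A = {\<alpha>. (\<forall>i. i \<notin> Basis \<longrightarrow> \<alpha> i = 0) \<and> sum \<alpha> Basis \<le> 3}"
  have "A \<subseteq> {\<alpha>. \<forall>i. (i \<in> Basis \<longrightarrow> \<alpha> i \<in> {..3}) \<and> (i \<notin> Basis \<longrightarrow> \<alpha> i = 0)}"
    unfolding A_def by (auto intro: order_trans[OF member_le_sum[of _ Basis]])
  then have finA: "finite A"
    by (rule finite_subset) (intro finite_set_of_finite_funs; simp)
  \<comment> \<open>The points that lie in all elements of the family and in no other; these sets
    are disjoint and, for nonempty families, cover the cube.\<close>
  define C :: "'a set set \<Rightarrow> 'a set" where "C \<A> = (\<Inter>E\<in>\<A>. E) - \<Union>(\<T> - \<A>)" for \<A>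
  define \<phi> :: "'a set set \<times> ('a \<Rightarrow> nat) \<Rightarrow> 'a \<Rightarrow> real" where
    "\<phi> k y = indicator (C (fst k)) y * (\<Prod>i\<in>Basis. (y \<bullet> i) ^ snd k i)" for k y
  define F where "F = (Pow \<T> - {{}}) \<times> A"
  have finF: "finite F" using fin finA by (simp add: F_def)
  have \<phi>L2: "\<phi> k \<in> L2_space unit_cube" if k: "k \<in> F" for k
  proof (rule L2_bounded)
    have fk: "finite (fst k)" "fst k \<noteq> {}" "fst k \<subseteq> \<T>" using k fin by (auto simp: F_def intro: finite_subset[of _ \<T>])
    have "C (fst k) \<in> sets lebesgue"
      unfolding C_def using fk closed fin
      by (intro sets.Diff sets.finite_INT sets.finite_Union) auto
    then have [measurable]: "(indicator (C (fst k)) :: 'a \<Rightarrow> real) \<in> borel_measurable cube_measure"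
      by (intro measurable_restrict_space1) simp
    have [measurable]: "(\<lambda>y::'a. \<Prod>i\<in>Basis. (y \<bullet> i) ^ snd k i) \<in> borel_measurable cube_measure"
      by (intro continuous_imp_measurable_on_sets_lebesgue continuous_intros) auto
    show "\<phi> k \<in> borel_measurable cube_measure" unfolding \<phi>_def[abs_def] by measurable
    show "\<bar>\<phi> k y\<bar> \<le> 1" if y: "y \<in> unit_cube" for y
    proof -
      have "\<bar>\<Prod>i\<in>Basis. (y \<bullet> i) ^ snd k i\<bar> \<le> 1"
        unfolding abs_prod by (rule prod_le_1) (use y in \<open>auto simp: mem_box power_abs less_imp_le intro!: power_le_one\<close>)
      then show ?thesis by (auto simp: \<phi>_def abs_mult indicator_def)
    qed
  qed
  have sub: "cls ` fe_space \<T> \<subseteq> span (cls ` \<phi> ` F)"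
  proof clarify
    fix w assume w: "w \<in> fe_space \<T>"
    have "\<forall>E\<in>\<T>. \<exists>c. \<forall>y\<in>E \<inter> unit_cube. w y = (\<Sum>\<alpha>\<in>A. c \<alpha> * (\<Prod>i\<in>Basis. (y \<bullet> i) ^ \<alpha> i))"
      using w unfolding fe_space_def polynomials_le_def A_def by fastforce
    then obtain c where c: "\<And>E y. E \<in> \<T> \<Longrightarrow> y \<in> E \<Longrightarrow> y \<in> unit_cube \<Longrightarrow> w y = (\<Sum>\<alpha>\<in>A. c E \<alpha> * (\<Prod>i\<in>Basis. (y \<bullet> i) ^ \<alpha> i))"
      by (auto simp: bchoice_iff)
    define e where "e k = c (SOME E. E \<in> fst k) (snd k)" for k :: "'a set set \<times> ('a \<Rightarrow> nat)"
    have eq: "w y = (\<Sum>k\<in>F. e k * \<phi> k y)" if y: "y \<in> unit_cube" for y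
    proof -
      define \<A> where "\<A> = {E \<in> \<T>. y \<in> E}"
      have \<A>: "\<A> \<in> Pow \<T> - {{}}" using y cover by (auto simp: \<A>_def)
      then have E: "(SOME E. E \<in> \<A>) \<in> \<A>" by (metis Diff_iff insertI1 some_in_eq)
      have ind: "indicator (C \<B>) y = (if \<B> = \<A> then 1 else 0 :: real)" if "\<B> \<in> Pow \<T> - {{}}" for \<B>
        using that by (auto simp: C_def \<A>_def indicator_def)
      have "(\<Sum>k\<in>F. e k * \<phi> k y) = (\<Sum>\<B>\<in>Pow \<T> - {{}}. \<Sum>\<alpha>\<in>A. e (\<B>, \<alpha>) * \<phi> (\<B>, \<alpha>) y)"
        unfolding F_def by (simp add: sum.cartesian_product case_prod_beta)
      also have "\<dots> = (\<Sum>\<B>\<in>Pow \<T> - {{}}. if \<B> = \<A> then (\<Sum>\<alpha>\<in>A. e (\<B>, \<alpha>) * (\<Prod>i\<in>Basis. (y \<bullet> i) ^ \<alpha> i)) else 0)"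
        by (rule sum.cong) (auto simp: \<phi>_def ind)
      also have "\<dots> = (\<Sum>\<alpha>\<in>A. e (\<A>, \<alpha>) * (\<Prod>i\<in>Basis. (y \<bullet> i) ^ \<alpha> i))"
        using \<A> fin by simp
      also have "\<dots> = w y" using c[of "SOME E. E \<in> \<A>" y] E y by (simp add: e_def \<A>_def)
      finally show ?thesis by simp
    qed
    have L: "(\<lambda>y. e k * \<phi> k y) \<in> L2_space unit_cube" if "k \<in> F" for k
      by (rule L2_space_scale[OF \<phi>L2[OF that]])
    have "(\<lambda>y. \<Sum>k\<in>F. e k * \<phi> k y) \<in> L2_space unit_cube" by (rule L2_space_sum[OF L])
    then have "cls w = cls (\<lambda>y. \<Sum>k\<in>F. e k * \<phi> k y)"
      using cls_eq_iff[OF fe_space_L2[OF w]] eq by (auto intro!: AE_I2)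
    also have "\<dots> = (\<Sum>k\<in>F. e k *\<^sub>R cls (\<phi> k))"
      by (subst cls_sum[OF L]) (auto simp: cls_scale \<phi>L2)
    also have "\<dots> \<in> span (cls ` \<phi> ` F)"
      by (intro span_sum span_scale span_base) auto
    finally show "cls w \<in> span (cls ` \<phi> ` F)" .
  qed
  \<comment> \<open>The cut-off monomials span a finite-dimensional space containing the finite
    element space, but need not lie in \<open>VV\<close> themselves; so a basis is selected inside
    the finite element space.\<close>
  obtain B where B: "B \<subseteq> cls ` fe_space \<T>" "independent B" "cls ` fe_space \<T> \<subseteq> span B"
    using maximal_independent_subset by blast
  have "finite B"
    using independent_span_bound[OF _ B(2), of "cls ` \<phi> ` F"] B(1) sub finF by blast
  moreover have "B \<subseteq> VV" using B(1) by (auto simp: fe_space_V V_space_VV)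
  moreover have "cls ` fe_space \<T> = span B"
    using B span_minimal[OF B(1) subspace_fe_space[OF ne]] by blast
  ultimately show ?thesis by blast
qed

section \<open>The Ritz projection\<close>

definition ritz_l2 :: "real \<Rightarrow> real \<Rightarrow> real \<Rightarrow> 'a::euclidean_space l2 \<Rightarrow> 'a l2 \<Rightarrow> real" where
  "ritz_l2 p s \<beta> x y =
     s * (\<Sum>i\<in>Basis. inner (dx [i] x) (dx [i] y))
     - p * (\<Sum>i\<in>Basis. inner (coord_mult i (dx [i] x)) (coord_mult i (dx [i] y)))
     + \<beta> * inner (lap x) (lap y)"

lemma ritz_form_eq:
  fixes \<phi> w :: "'a::euclidean_space \<Rightarrow> real"
  assumes \<phi>: "\<phi> \<in> V_space" and w: "w \<in> V_space" and \<theta>: "\<theta> t \<in> V_space"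
  shows "ritz_form \<zeta>0 \<zeta>1 K K' \<theta> t \<phi> w =
    ritz_l2 (4 * (K' t)\<^sup>2 / (K t)\<^sup>2) (\<zeta>0 / (K t)\<^sup>2 + \<zeta>1 * beam_b K t * grad_sq (cls (\<theta> t))) (beam_b K t) (cls \<phi>) (cls w)"
proof -
  note us = V_space_sobolev[OF \<phi>] and ws = V_space_sobolev[OF w]
  have wdu: "wd [i] \<phi> \<in> L2_space unit_cube" "cls (wd [i] \<phi>) = dx [i] (cls \<phi>)"
    "wd [i] w \<in> L2_space unit_cube" "cls (wd [i] w) = dx [i] (cls w)" if "i \<in> Basis" for i
    using sobolev_wd[OF us, of "[i]"] sobolev_wd[OF ws, of "[i]"] that by auto
  have T3: "ip (laplacian \<phi>) (laplacian w) = inner (lap (cls \<phi>)) (lap (cls w))"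
    using laplacian_cls[OF us] laplacian_cls[OF ws] by (simp add: inner_cls[symmetric])
  let ?p = "4 * (K' t)\<^sup>2 / (K t)\<^sup>2" and ?q = "\<zeta>0 / (K t)\<^sup>2"
  have T5: "ip (\<lambda>y. coeff_a1 \<zeta>0 K K' i y t * wd [i] \<phi> y) (wd [i] w) =
      ?q * inner (dx [i] (cls \<phi>)) (dx [i] (cls w))
      - ?p * inner (coord_mult i (dx [i] (cls \<phi>))) (coord_mult i (dx [i] (cls w)))"
    if i: "i \<in> Basis" for i
    using coeff_a1_cls[OF wdu(1)[OF i] i, of \<zeta>0 K K' t] wdu[OF i]
      inner_coord_mult[OF i, of "coord_mult i (dx [i] (cls \<phi>))" "dx [i] (cls w)"]
    by (simp add: inner_cls[symmetric] inner_diff_left)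
  have S: "(\<Sum>i\<in>Basis. ip (\<lambda>y. coeff_a1 \<zeta>0 K K' i y t * wd [i] \<phi> y) (wd [i] w)) =
      ?q * (\<Sum>i\<in>Basis. inner (dx [i] (cls \<phi>)) (dx [i] (cls w)))
      - ?p * (\<Sum>i\<in>Basis. inner (coord_mult i (dx [i] (cls \<phi>))) (coord_mult i (dx [i] (cls w))))"
    unfolding sum_distrib_left sum_subtractf[symmetric] by (rule sum.cong[OF refl T5])
  show ?thesis
    unfolding ritz_form_def ritz_l2_def S T3 grad_norm_sq[OF \<theta>] grad_inner_cls[OF \<phi> w]
    by (simp add: coeff_b1_def coeff_b2_def beam_b_def distrib_right)
qed

lemma ritz_l2_lower:
  assumes "0 \<le> p" "p \<le> s"
  shows "\<beta> * (norm (lap x))\<^sup>2 \<le> ritz_l2 p s \<beta> x x"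
proof -
  have "(\<Sum>i\<in>Basis. inner (coord_mult i (dx [i] x)) (coord_mult i (dx [i] x))) \<le> (\<Sum>i\<in>Basis. inner (dx [i] x) (dx [i] x))"
    unfolding power2_norm_eq_inner[symmetric] by (intro sum_mono power_mono norm_coord_mult) auto
  then have "p * (\<Sum>i\<in>Basis. inner (coord_mult i (dx [i] x)) (coord_mult i (dx [i] x))) \<le> s * (\<Sum>i\<in>Basis. inner (dx [i] x) (dx [i] x))"
    using assms by (intro mult_mono sum_nonneg) auto
  then show ?thesis by (simp add: ritz_l2_def power2_norm_eq_inner)
qed

lemma ritz_l2_upper:
  fixes x :: "'a::euclidean_space l2"
  assumes "0 \<le> p" "p \<le> s" "x \<in> VV"
  shows "ritz_l2 p s \<beta> x x \<le> (s * (4 * real DIM('a)) + \<beta>) * (norm (lap x))\<^sup>2"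
proof -
  have "s * (\<Sum>i\<in>(Basis::'a set). inner (dx [i] x) (dx [i] x)) \<le> s * (4 * real DIM('a) * (norm (lap x))\<^sup>2)"
    using assms grad_sq_le[OF assms(3)] unfolding grad_sq_def power2_norm_eq_inner[symmetric]
    by (intro mult_left_mono) auto
  moreover have "0 \<le> p * (\<Sum>i\<in>(Basis::'a set). inner (coord_mult i (dx [i] x)) (coord_mult i (dx [i] x)))"
    using assms(1) by (intro mult_nonneg_nonneg sum_nonneg) auto
  ultimately show ?thesis by (simp add: ritz_l2_def power2_norm_eq_inner[symmetric] distrib_right mult.assoc)
qed

lemma pos_form_ritz_l2:
  fixes p s \<beta> :: real
  assumes "0 \<le> p" "p \<le> s" "0 < \<beta>"
  shows "pos_form (VV :: 'a::euclidean_space l2 set) (ritz_l2 p s \<beta>)"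
proof
  show "subspace (VV :: 'a l2 set)" by (rule subspace_VV)
  fix x y z :: "'a l2"
  show "ritz_l2 p s \<beta> (x + y) z = ritz_l2 p s \<beta> x z + ritz_l2 p s \<beta> y z" if "x \<in> VV" "y \<in> VV"
  proof -
    have "dx [i] (x + y) = dx [i] x + dx [i] y" if "i \<in> Basis" for i
      using that \<open>x \<in> VV\<close> \<open>y \<in> VV\<close> by (simp add: dx_add[where m=2] VV_sob)
    then show ?thesis
      using that by (simp add: ritz_l2_def lap_add VV_sob inner_add_left coord_mult_add sum.distrib algebra_simps)
  qed
  show "ritz_l2 p s \<beta> (c *\<^sub>R x) z = c * ritz_l2 p s \<beta> x z" if "x \<in> VV" for c
  proof -
    have "dx [i] (c *\<^sub>R x) = c *\<^sub>R dx [i] x" if "i \<in> Basis" for i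
      using that \<open>x \<in> VV\<close> by (simp add: dx_scale[where m=2] VV_sob)
    then show ?thesis
      using that by (simp add: ritz_l2_def lap_scale VV_sob coord_mult_scale sum_distrib_left algebra_simps)
  qed
  show "ritz_l2 p s \<beta> x y = ritz_l2 p s \<beta> y x"
    by (simp add: ritz_l2_def inner_commute)
  show "0 < ritz_l2 p s \<beta> x x" if "x \<in> VV" "x \<noteq> 0"
  proof -
    have "norm (lap x) > 0" using VV_norm_le_lap[OF that(1)] that(2) by (cases "lap x = 0") auto
    then show ?thesis using ritz_l2_lower[OF assms(1,2), of \<beta> x] assms(3)
      by (auto intro: less_le_trans[rotated])
  qed
qed

text \<open>Pythagoras for any \<open>r\<close> with Galerkin orthogonality. The Ritz projection is
  defined by a choice among such elements, so it is not literally a \<open>proj\<close>.\<close>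

lemma (in pos_form) best_approx:
  assumes U: "subspace U" "U \<subseteq> W" and x: "x \<in> W" and r: "r \<in> U" and w: "w \<in> U"
    and orth: "\<And>u. u \<in> U \<Longrightarrow> B (x - r) u = 0"
  shows "B (x - r) (x - r) \<le> B (x - w) (x - w)"
proof -
  let ?a = "x - r" and ?b = "r - w"
  have ab: "?a \<in> W" "?b \<in> W" "?b \<in> U" "?a + ?b \<in> W"
    using U r w x by (auto intro!: subspace_diff W subspace_add)
  have "B ?a ?b = 0" "B ?b ?a = 0" using orth[OF ab(3)] sym[OF ab(1,2)] by auto
  moreover have "0 \<le> B ?b ?b" using pos[OF ab(2)] zero[OF ab(2)] by (cases "?b = 0") auto
  moreover have "B (?a + ?b) (?a + ?b) = B ?a ?a + B ?a ?b + (B ?b ?a + B ?b ?b)"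
    using add[OF ab(1,2,4)] sym[OF ab(1,4)] sym[OF ab(2,4)] add[OF ab(1,2,1)] add[OF ab(1,2,2)] sym[OF ab(1,2)] by linarith
  ultimately have "B ?a ?a \<le> B (?a + ?b) (?a + ?b)" by linarith
  then show ?thesis by simp
qed

text \<open>Cea's lemma. By symmetry of the form, its constant is the square root of the ratio of
  the upper bound to the coercivity constant. The hypothesis on \<open>K'\<close> is exactly what
  makes the first order part nonnegative.\<close>

lemma ritz_projection_approx:
  fixes \<phi> :: "'a::euclidean_space \<Rightarrow> real"
  assumes K: "0 < K t" and K': "4 * (K' t)\<^sup>2 \<le> \<zeta>0" and \<zeta>1: "0 \<le> \<zeta>1"
    and S: "finite S" "S \<subseteq> VV" "cls ` fe_space \<T> = span S"
    and \<phi>: "\<phi> \<in> V_space" and \<theta>: "\<theta> t \<in> V_space"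
  defines "r \<equiv> ritz_projection \<zeta>0 \<zeta>1 K K' \<theta> t (fe_space \<T>) \<phi>"
    and "s \<equiv> \<zeta>0 / (K t)\<^sup>2 + \<zeta>1 * beam_b K t * grad_sq (cls (\<theta> t))"
  shows "r \<in> fe_space \<T>"
    and "w \<in> cls ` fe_space \<T> \<Longrightarrow>
      norm (lap (cls \<phi> - cls r)) \<le> sqrt ((s * (4 * real DIM('a)) + beam_b K t) / beam_b K t) * norm (lap (cls \<phi> - w))"
proof -
  define p where "p = 4 * (K' t)\<^sup>2 / (K t)\<^sup>2"
  have b: "0 < beam_b K t" using K by (simp add: beam_b_def)
  have p: "0 \<le> p" "p \<le> s"
  proof -
    have "0 \<le> \<zeta>1 * beam_b K t * grad_sq (cls (\<theta> t))" using \<zeta>1 b by (intro mult_nonneg_nonneg grad_sq_nonneg) auto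
    moreover have "p \<le> \<zeta>0 / (K t)\<^sup>2" unfolding p_def by (intro divide_right_mono K') simp
    ultimately show "p \<le> s" by (simp add: s_def)
  qed (simp add: p_def)
  interpret rf: pos_form VV "ritz_l2 p s (beam_b K t) :: 'a l2 \<Rightarrow> 'a l2 \<Rightarrow> real"
    by (rule pos_form_ritz_l2[OF p b])
  obtain Q where Q: "rf.onb Q" "span Q = span S" using rf.onb_exists[OF S(1,2)] by blast
  have form: "ritz_form \<zeta>0 \<zeta>1 K K' \<theta> t (\<phi> - u) w = ritz_l2 p s (beam_b K t) (cls \<phi> - cls u) (cls w)"
    if "u \<in> fe_space \<T>" "w \<in> fe_space \<T>" for u w
  proof -
    have "\<phi> - u \<in> V_space"
      using V_space_add[OF \<phi> V_space_scale[OF fe_space_V[OF that(1)], of "-1"]] by (simp add: fun_diff_def)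
    moreover have "cls (\<phi> - u) = cls \<phi> - cls u"
      using cls_diff[OF V_space_L2[OF \<phi>] fe_space_L2[OF that(1)]] by (simp add: fun_diff_def)
    ultimately show ?thesis using ritz_form_eq[OF _ fe_space_V[OF that(2)], where \<theta>=\<theta> and t=t, OF _ \<theta>] by (simp add: p_def s_def)
  qed
  have "rf.proj Q (cls \<phi>) \<in> cls ` fe_space \<T>" using rf.proj_span[of Q] Q(2) S(3) by simp
  then obtain u where u: "u \<in> fe_space \<T>" "rf.proj Q (cls \<phi>) = cls u" by auto
  \<comment> \<open>A witness for the choice operator: the projection along an orthonormal basis for
    the Ritz form.\<close>
  have "\<exists>u. u \<in> fe_space \<T> \<and> (\<forall>w\<in>fe_space \<T>. ritz_form \<zeta>0 \<zeta>1 K K' \<theta> t (\<phi> - u) w = 0)"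
  proof (intro exI conjI ballI)
    fix w assume w: "w \<in> fe_space \<T>"
    have "cls w \<in> span Q" using w Q(2) S(3) by auto
    from rf.proj_orth[OF Q(1) V_space_VV[OF \<phi>] this]
    show "ritz_form \<zeta>0 \<zeta>1 K K' \<theta> t (\<phi> - u) w = 0" by (simp add: form[OF u(1) w] u(2))
  qed (rule u)
  from someI_ex[OF this]
  have r: "r \<in> fe_space \<T>" "\<And>w. w \<in> fe_space \<T> \<Longrightarrow> ritz_form \<zeta>0 \<zeta>1 K K' \<theta> t (\<phi> - r) w = 0"
    unfolding r_def ritz_projection_def by auto
  show "r \<in> fe_space \<T>" by (rule r)
  show "norm (lap (cls \<phi> - cls r)) \<le> sqrt ((s * (4 * real DIM('a)) + beam_b K t) / beam_b K t) * norm (lap (cls \<phi> - w))"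
    if w: "w \<in> cls ` fe_space \<T>"
  proof -
    let ?c = "s * (4 * real DIM('a)) + beam_b K t"
    have sV: "cls ` fe_space \<T> \<subseteq> VV" by (auto simp: fe_space_V V_space_VV)
    have "beam_b K t * (norm (lap (cls \<phi> - cls r)))\<^sup>2 \<le> ritz_l2 p s (beam_b K t) (cls \<phi> - cls r) (cls \<phi> - cls r)"
      by (rule ritz_l2_lower[OF p])
    also have "\<dots> \<le> ritz_l2 p s (beam_b K t) (cls \<phi> - w) (cls \<phi> - w)"
    proof (rule rf.best_approx[OF _ sV V_space_VV[OF \<phi>] _ w])
      show "ritz_l2 p s (beam_b K t) (cls \<phi> - cls r) u = 0" if "u \<in> cls ` fe_space \<T>" for u
        using that r form[OF r(1)] by auto
    qed (use r S(3) in auto)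
    also have "\<dots> \<le> ?c * (norm (lap (cls \<phi> - w)))\<^sup>2"
      using w sV by (intro ritz_l2_upper p subspace_diff subspace_VV V_space_VV \<phi>) auto
    finally have "(norm (lap (cls \<phi> - cls r)))\<^sup>2 \<le> ?c / beam_b K t * (norm (lap (cls \<phi> - w)))\<^sup>2"
      using b by (simp add: field_simps)
    then have "norm (lap (cls \<phi> - cls r)) \<le> sqrt (?c / beam_b K t * (norm (lap (cls \<phi> - w)))\<^sup>2)"
      by (rule real_le_rsqrt)
    then show ?thesis by (simp only: real_sqrt_mult real_sqrt_abs abs_norm_cancel)
  qed
qed

section \<open>The convergence theorem\<close>

lemma norm_le_hnorm: "norm x \<le> hnorm m x"
  using norm_dx_le_hnorm[of "[]" m x] by (simp add: dx_Nil indices_def)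

lemma l2_evolution_of_Bochner:
  fixes u u' :: "real \<Rightarrow> 'a::euclidean_space \<Rightarrow> real"
  assumes T: "T > 0" and c: "L2_continuous T u" and d: "has_time_deriv T u u'"
    and B: "u' \<in> Bochner_L2 T (sobolev_space unit_cube 4) (sobolev_norm unit_cube 4)"
  shows "l2_evolution T (\<lambda>t. cls (u t)) (\<lambda>t. cls (u' t))"
proof
  show "T > 0" by (rule T)
  show s: "smeas T 4 (\<lambda>t. cls (u' t))" and i: "integrable (lebesgue_on {0<..<T}) (\<lambda>t. hnorm 4 (cls (u' t)))"
    by (rule Bochner_L2_hnorm[OF B])+
  fix \<psi> :: "'a l2"
  have "(\<lambda>t. inner (dx [] (cls (u' t))) \<psi>) \<in> borel_measurable (lebesgue_on {0<..<T})"
    by (rule smeas_inner_measurable[OF s]) (simp add: indices_def)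
  then have meas: "(\<lambda>t. inner (cls (u' t)) \<psi>) \<in> borel_measurable (lebesgue_on {0<..<T})"
    by (simp add: dx_Nil)
  have "integrable (lebesgue_on {0<..<T}) (\<lambda>t. inner (cls (u' t)) \<psi>)"
  proof (rule Bochner_Integration.integrable_bound[OF _ meas])
    show "integrable (lebesgue_on {0<..<T}) (\<lambda>t. hnorm 4 (cls (u' t)) * norm \<psi>)" using i by simp
    have "\<bar>inner (cls (u' t)) \<psi>\<bar> \<le> hnorm 4 (cls (u' t)) * norm \<psi>" for t
      by (rule order_trans[OF Cauchy_Schwarz_ineq2 mult_right_mono[OF norm_le_hnorm norm_ge_zero]])
    then show "AE t in lebesgue_on {0<..<T}. norm (inner (cls (u' t)) \<psi>) \<le> norm (hnorm 4 (cls (u' t)) * norm \<psi>)"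
      by (intro AE_I2) (simp add: hnorm_nonneg)
  qed
  then show "AC_on {0..<T} (\<lambda>t. inner (cls (u t)) \<psi>) (\<lambda>t. inner (cls (u' t)) \<psi>)"
    by (intro AC_on_extend0 continuous_intros L2_continuous_cls[OF c] has_time_deriv_AC[OF d c])
      (rule integrable_open_to_closed, auto)
qed

lemma beam_solutionD:
  fixes u u' u'' :: "real \<Rightarrow> 'a::euclidean_space \<Rightarrow> real"
  assumes s: "beam_solution T \<nu> \<zeta>0 \<zeta>1 K K' K'' X u0 u1 u u' u''" and X: "X \<subseteq> V_space" and T: "T > 0"
  shows "continuous_on {0..<T} (\<lambda>t. cls (u t))" and "continuous_on {0..<T} (\<lambda>t. cls (u' t))"
    and "AC_on {0<..<T} (\<lambda>t. inner (cls (u t)) \<psi>) (\<lambda>t. inner (cls (u' t)) \<psi>)"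
    and "AC_on {0<..<T} (\<lambda>t. inner (cls (u' t)) \<psi>) (\<lambda>t. inner (cls (u'' t)) \<psi>)"
    and "t \<in> {0..<T} \<Longrightarrow> u t \<in> X" and "t \<in> {0..<T} \<Longrightarrow> u' t \<in> L2_space unit_cube"
    and "u0 \<in> L2_space unit_cube \<Longrightarrow> cls (u 0) = cls u0"
    and "u1 \<in> L2_space unit_cube \<Longrightarrow> cls (u' 0) = cls u1"
    and "t \<in> {0<..<T} \<Longrightarrow> w \<in> cls ` X \<Longrightarrow>
     inner (cls (u'' t)) w + beam_b K t * inner (lap (cls (u t))) (lap w) + \<nu> * inner (cls (u' t)) w
     - 2 * K' t / K t * (\<Sum>i\<in>Basis. inner (coord_mult i (dx [i] (cls (u' t)))) w)
     + inner (beam_L \<nu> \<zeta>0 K K' K'' t (cls (u t))) w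
     - \<zeta>1 * beam_b K t * grad_sq (cls (u t)) * inner (lap (cls (u t))) w = 0"
proof -
  have c: "L2_continuous T u" "L2_continuous T u'" and d: "has_time_deriv T u u'" "has_time_deriv T u' u''"
    and i: "AE y in cube_measure. u 0 y = u0 y" "AE y in cube_measure. u' 0 y = u1 y"
    using s by (auto simp: beam_solution_def)
  show "continuous_on {0..<T} (\<lambda>t. cls (u t))" "continuous_on {0..<T} (\<lambda>t. cls (u' t))"
    by (rule L2_continuous_cls[OF c(1)], rule L2_continuous_cls[OF c(2)])
  show "AC_on {0<..<T} (\<lambda>t. inner (cls (u t)) \<psi>) (\<lambda>t. inner (cls (u' t)) \<psi>)"
    "AC_on {0<..<T} (\<lambda>t. inner (cls (u' t)) \<psi>) (\<lambda>t. inner (cls (u'' t)) \<psi>)"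
    by (rule has_time_deriv_AC[OF d(1) c(1)], rule has_time_deriv_AC[OF d(2) c(2)])
  show "u t \<in> X" if "t \<in> {0..<T}" for t using s that by (auto simp: beam_solution_def)
  have uL: "u t \<in> L2_space unit_cube" "u' t \<in> L2_space unit_cube" if "t \<in> {0..<T}" for t
    using c that by (auto simp: L2_continuous_def)
  show "t \<in> {0..<T} \<Longrightarrow> u' t \<in> L2_space unit_cube" by (rule uL)
  show "cls (u 0) = cls u0" if "u0 \<in> L2_space unit_cube"
    using cls_eq_iff[OF uL(1) that, of 0] i(1) T by simp
  show "cls (u' 0) = cls u1" if "u1 \<in> L2_space unit_cube"
    using cls_eq_iff[OF uL(2) that, of 0] i(2) T by simp
  assume t: "t \<in> {0<..<T}" and "w \<in> cls ` X"
  then obtain z where z: "z \<in> X" "w = cls z" by auto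
  have tt: "t \<in> {0..<T}" using t by auto
  have 0: "beam_form \<nu> \<zeta>0 \<zeta>1 K K' K'' t (u t) (u' t) (u'' t) z = 0"
    and p: "u t \<in> X" "u' t \<in> sobolev_space unit_cube 1" "u'' t \<in> L2_space unit_cube"
    using s t tt z(1) unfolding beam_solution_def by blast+
  show "inner (cls (u'' t)) w + beam_b K t * inner (lap (cls (u t))) (lap w) + \<nu> * inner (cls (u' t)) w
     - 2 * K' t / K t * (\<Sum>i\<in>Basis. inner (coord_mult i (dx [i] (cls (u' t)))) w)
     + inner (beam_L \<nu> \<zeta>0 K K' K'' t (cls (u t))) w
     - \<zeta>1 * beam_b K t * grad_sq (cls (u t)) * inner (lap (cls (u t))) w = 0"
    using beam_form_eq[OF subsetD[OF X p(1)] p(2,3) subsetD[OF X z(1)], of \<nu> \<zeta>0 \<zeta>1 K K' K'' t] 0 z(2) by simp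
qed

lemma beam_coeffs_exists:
  fixes K K' K'' :: "real \<Rightarrow> real"
  assumes T: "T > 0" and \<nu>: "\<nu> > 0" and \<zeta>1: "\<zeta>1 > 0"
    and dK: "\<And>t. t \<ge> 0 \<Longrightarrow> (K has_real_derivative K' t) (at t within {0..})"
    and dK': "\<And>t. t \<ge> 0 \<Longrightarrow> (K' has_real_derivative K'' t) (at t within {0..})"
    and cK'': "continuous_on {0..} K''"
    and K0: "K0 > 0" and K: "\<And>t. t \<ge> 0 \<Longrightarrow> K0 \<le> K t \<and> K t \<le> K1"
    and K': "\<And>t. t \<ge> 0 \<Longrightarrow> 0 < K' t \<and> K' t \<le> K2"
  shows "\<exists>CL. beam_coeffs T \<nu> \<zeta>1 (beam_b K) (\<lambda>t. - 4 * K' t / K t ^ 5) (\<lambda>t. 2 * K' t / K t)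
    (beam_L \<nu> \<zeta>0 K K' K'' :: real \<Rightarrow> 'a::euclidean_space l2 \<Rightarrow> 'a l2) CL (1 / K1 ^ 4) (1 / K0 ^ 4) (2 * K2 / K0)"
proof -
  have cK: "continuous_on {0..} K" and cK': "continuous_on {0..} K'"
    using dK dK' by (auto intro: DERIV_continuous_on)
  have Kp: "K t > 0" if "t \<ge> 0" for t using K[OF that] K0 by linarith
  have K1: "K1 > 0" using K[of 0] K0 by auto
  have K2: "K2 > 0" using K'[of 0] by auto
  \<comment> \<open>This coefficient contains \<open>K''\<close>, for which no explicit bound is
    given; compactness of [0, T] supplies one.\<close>
  have "continuous_on {0..T} (beam_c5 \<nu> K K' K'')"
    unfolding beam_c5_def[abs_def]
    by (intro continuous_intros continuous_on_subset[OF cK] continuous_on_subset[OF cK'] continuous_on_subset[OF cK''])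
      (auto simp: less_imp_neq[OF Kp, symmetric])
  then have "bounded (beam_c5 \<nu> K K' K'' ` {0..T})"
    by (intro compact_imp_bounded compact_continuous_image) auto
  then obtain r where r: "\<And>t. t \<in> {0..T} \<Longrightarrow> \<bar>beam_c5 \<nu> K K' K'' t\<bar> \<le> r"
    unfolding bounded_iff by (force simp: image_iff)
  define p where "p = 4 * K2\<^sup>2 / K0\<^sup>2"
  define q where "q = \<bar>\<zeta>0\<bar> / K0\<^sup>2"
  let ?n = "real DIM('a)"
  let ?CL = "?n * (5 * p + q + 2 * r) + ?n * (?n * p)"
  have bnd: "4 * (K' t)\<^sup>2 / (K t)\<^sup>2 \<le> p" "\<bar>\<zeta>0 / (K t)\<^sup>2\<bar> \<le> q" if "t \<ge> 0" for t
  proof -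
    have sq: "K0\<^sup>2 \<le> (K t)\<^sup>2" "(K' t)\<^sup>2 \<le> K2\<^sup>2" using K[OF that] K'[OF that] K0 by (auto intro: power_mono)
    show "4 * (K' t)\<^sup>2 / (K t)\<^sup>2 \<le> p" unfolding p_def using sq K0 by (intro frac_le) auto
    show "\<bar>\<zeta>0 / (K t)\<^sup>2\<bar> \<le> q" unfolding q_def abs_divide using sq K0 by (intro frac_le) auto
  qed
  have r0: "r \<ge> 0" using r[of 0] T by auto
  have "beam_coeffs T \<nu> \<zeta>1 (beam_b K) (\<lambda>t. - 4 * K' t / K t ^ 5) (\<lambda>t. 2 * K' t / K t)
    (beam_L \<nu> \<zeta>0 K K' K'' :: real \<Rightarrow> 'a l2 \<Rightarrow> 'a l2) ?CL (1 / K1 ^ 4) (1 / K0 ^ 4) (2 * K2 / K0)"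
  proof
    show "0 < T" "0 < \<nu>" "0 < \<zeta>1" by fact+
    fix t :: real
    show "(beam_b K has_real_derivative - 4 * K' t / K t ^ 5) (at t)" if "t \<in> {0<..<T}"
    proof -
      have t: "t > 0" using that by auto
      have "at t within {0..} = at t" by (rule at_within_interior) (use t in auto)
      then have "(K has_real_derivative K' t) (at t)" using dK[of t] t by simp
      then show ?thesis
        unfolding beam_b_def[abs_def] using Kp[of t] t
        by (auto intro!: derivative_eq_intros simp: field_simps eval_nat_numeral)
    qed
    show "- 4 * K' t / K t ^ 5 \<le> 0" if "t \<in> {0<..<T}"
      using that Kp[of t] K'[of t] by (auto simp: field_simps)
    show "1 / K1 ^ 4 \<le> beam_b K t \<and> beam_b K t \<le> 1 / K0 ^ 4" if "t \<in> {0..<T}"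
      using that Kp[of t] K[of t] K0 by (auto simp: beam_b_def intro!: divide_left_mono power_mono)
    show "0 \<le> 2 * K' t / K t \<and> 2 * K' t / K t \<le> 2 * K2 / K0" if "t \<in> {0<..<T}"
      using that Kp[of t] K[of t] K'[of t] K0 K2 by (auto intro!: frac_le)
    show "beam_L \<nu> \<zeta>0 K K' K'' t (x - y) = beam_L \<nu> \<zeta>0 K K' K'' t x - beam_L \<nu> \<zeta>0 K K' K'' t y"
      if "x \<in> VV" "y \<in> VV" for x y :: "'a l2"
      by (rule beam_L_diff[OF that])
    show "norm (beam_L \<nu> \<zeta>0 K K' K'' t x) \<le> ?CL * norm (lap x)" if "t \<in> {0<..<T}" "x \<in> VV" for x :: "'a l2"
      by (rule beam_L_le[OF that(2) bnd r]) (use that(1) in auto)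
  next
    show "continuous_on {0..<T} (beam_b K)" "continuous_on {0<..<T} (\<lambda>t. - 4 * K' t / K t ^ 5)"
      unfolding beam_b_def[abs_def]
      by (intro continuous_intros continuous_on_subset[OF cK] continuous_on_subset[OF cK'];
          auto simp: less_imp_neq[OF Kp, symmetric])+
    show "0 < 1 / K1 ^ 4" using K1 by simp
    show "0 \<le> ?CL" using r0 by (simp add: p_def q_def)
  qed
  then show ?thesis by blast
qed

text \<open>The property speaks of curves; it is applied to a constant one and read off at T/2. The
  bound D at least 1 ensures that h^2 is at most D h^2, so that errors of the initial data can be
  measured in the same unit.\<close>

lemma approximation_property_lap:
  fixes \<T> :: "real \<Rightarrow> 'a::euclidean_space set set"
  assumes T: "T > 0" and ap: "approximation_property T H \<T>"
  shows "\<exists>D\<ge>1. \<forall>h\<in>H. \<forall>z::'a l2. z \<in> VV \<longrightarrow> z \<in> sob 4 \<longrightarrow>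
    (\<exists>w\<in>cls ` fe_space (\<T> h). norm (lap (z - w)) \<le> D * h\<^sup>2 * hnorm 4 z)"
proof -
  obtain C1 where C1: "\<forall>h\<in>H. \<forall>w :: real \<Rightarrow> 'a \<Rightarrow> real.
        (\<forall>t\<in>{0<..<T}. w t \<in> sobolev_space unit_cube 4 \<inter> V_space) \<longrightarrow>
        (\<exists>wh :: real \<Rightarrow> 'a \<Rightarrow> real. \<forall>t\<in>{0<..<T}. wh t \<in> fe_space (\<T> h) \<and>
           (\<forall>m\<le>2. sobolev_seminorm unit_cube m (w t - wh t)
                     \<le> C1 * h ^ (4 - m) * sobolev_seminorm unit_cube 4 (w t)) \<and>
           broken_seminorm (\<T> h) 3 (w t - wh t) \<le> C1 * h * sobolev_seminorm unit_cube 4 (w t))"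
    using ap unfolding approximation_property_def by (elim exE)
  \<comment> \<open>The dimension comes from \<open>norm_lap_le_snorm\<close>; |C1| + 1 replaces
    \<open>C1\<close>, whose sign is not known.\<close>
  define D where "D = real DIM('a) * (\<bar>C1\<bar> + 1)"
  have D: "D \<ge> 1" unfolding D_def using mult_mono[of 1 "real DIM('a)" 1 "\<bar>C1\<bar> + 1"] by (simp add: DIM_ge_Suc0)
  show ?thesis
  proof (intro exI[of _ D] conjI D ballI allI impI)
    fix h :: real and z :: "'a l2" assume h: "h \<in> H" and z: "z \<in> VV" "z \<in> sob 4"
    let ?u = "rep_l2 z"
    have uL: "?u \<in> L2_space unit_cube" by (rule rep_l2_mem)
    have u4: "?u \<in> sobolev_space unit_cube 4" and uV: "?u \<in> V_space"
      using z sobolev_space_iff[OF uL] V_space_iff[OF uL] by (auto simp: cls_rep)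
    have "\<exists>wh :: real \<Rightarrow> 'a \<Rightarrow> real. \<forall>t\<in>{0<..<T}. wh t \<in> fe_space (\<T> h) \<and>
        (\<forall>m\<le>2. sobolev_seminorm unit_cube m (?u - wh t) \<le> C1 * h ^ (4 - m) * sobolev_seminorm unit_cube 4 ?u) \<and>
        broken_seminorm (\<T> h) 3 (?u - wh t) \<le> C1 * h * sobolev_seminorm unit_cube 4 ?u"
      by (rule C1[rule_format, OF h, of "\<lambda>_. ?u"]) (use u4 uV in auto)
    then obtain wh :: "real \<Rightarrow> 'a \<Rightarrow> real" where wh: "\<forall>t\<in>{0<..<T}. wh t \<in> fe_space (\<T> h) \<and>
        (\<forall>m\<le>2. sobolev_seminorm unit_cube m (?u - wh t) \<le> C1 * h ^ (4 - m) * sobolev_seminorm unit_cube 4 ?u) \<and>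
        broken_seminorm (\<T> h) 3 (?u - wh t) \<le> C1 * h * sobolev_seminorm unit_cube 4 ?u" ..
    let ?w = "wh (T / 2)"
    have w: "?w \<in> fe_space (\<T> h)" "sobolev_seminorm unit_cube 2 (?u - ?w) \<le> C1 * h\<^sup>2 * sobolev_seminorm unit_cube 4 ?u"
      using bspec[OF wh, of "T / 2"] T by (auto dest!: spec[of _ "2::nat"])
    have wL: "?w \<in> L2_space unit_cube" by (rule fe_space_L2[OF w(1)])
    have "?u - ?w \<in> V_space"
      using V_space_add[OF uV V_space_scale[OF fe_space_V[OF w(1)], of "-1"]] by (simp add: fun_diff_def)
    then have dV: "?u - ?w \<in> sobolev_space unit_cube 2" by (rule V_space_sobolev)
    have c: "cls (?u - ?w) = z - cls ?w"
      using cls_diff[OF uL wL] by (simp add: fun_diff_def cls_rep)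
    have "snorm 2 (z - cls ?w) \<le> C1 * h\<^sup>2 * snorm 4 z"
      using w(2) sobolev_seminorm_eq[OF dV order_refl] sobolev_seminorm_eq[OF u4 order_refl] by (simp add: c cls_rep)
    also have "\<dots> \<le> (\<bar>C1\<bar> + 1) * h\<^sup>2 * hnorm 4 z"
      by (intro mult_mono snorm_le_hnorm) (auto simp: snorm_nonneg)
    finally have "real DIM('a) * snorm 2 (z - cls ?w) \<le> D * h\<^sup>2 * hnorm 4 z"
      unfolding D_def mult.assoc by (intro mult_left_mono) (auto simp: mult.assoc)
    then have "norm (lap (z - cls ?w)) \<le> D * h\<^sup>2 * hnorm 4 z"
      by (rule order_trans[OF norm_lap_le_snorm])
    then show "\<exists>w\<in>cls ` fe_space (\<T> h). norm (lap (z - w)) \<le> D * h\<^sup>2 * hnorm 4 z"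
      using w(1) by blast
  qed
qed

text \<open>Nothing else limits the index set of mesh sizes from above. The bound turns h^4 into a
  fixed multiple of h^2 and makes the discrete initial energies uniformly bounded.\<close>

lemma mesh_size_bounds:
  fixes \<T> :: "'a::euclidean_space set set"
  assumes "polytopal_partition \<T>"
  shows "0 \<le> mesh_size \<T>" and "mesh_size \<T> \<le> diameter (closure unit_cube :: 'a set)"
proof -
  have fin: "finite \<T>" and U: "\<Union>\<T> = closure unit_cube"
    using assms by (auto simp: polytopal_partition_def)
  have "(unit_cube :: 'a set) \<noteq> {}" by (simp add: box_ne_empty)
  then have ne: "\<T> \<noteq> {}" using U by (metis Union_empty closure_eq_empty)
  have b: "bounded (closure unit_cube :: 'a set)" by (intro bounded_closure bounded_box)
  have E: "0 \<le> diameter E \<and> diameter E \<le> diameter (closure unit_cube :: 'a set)" if "E \<in> \<T>" for E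
  proof -
    have "E \<subseteq> closure unit_cube" using that U by auto
    then show ?thesis by (intro conjI diameter_ge_0 diameter_subset bounded_subset[OF b] b)
  qed
  show "mesh_size \<T> \<le> diameter (closure unit_cube :: 'a set)"
    unfolding mesh_size_def using fin ne E by (intro Max.boundedI) auto
  obtain E0 where "E0 \<in> \<T>" using ne by auto
  then show "0 \<le> mesh_size \<T>"
    unfolding mesh_size_def using fin E[of E0] by (intro order_trans[OF _ Max_ge[of "diameter ` \<T>" "diameter E0"]]) auto
qed

text \<open>Bounding an essential supremum asks for measurability, which is taken from a continuous
  function that agrees with the norm.\<close>

lemma Linf_norm_le:
  assumes c: "continuous_on {0..<T} f" and N: "\<And>t. t \<in> {0<..<T} \<Longrightarrow> N (u t) = f t \<and> f t \<le> B"
  shows "Linf_norm T N u \<le> ereal B"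
  unfolding Linf_norm_def
proof (rule esssup_I)
  have "f \<in> borel_measurable (lebesgue_on {0<..<T})"
    by (intro continuous_imp_measurable_on_sets_lebesgue continuous_on_subset[OF c]) auto
  then have "(\<lambda>t. ereal (f t)) \<in> borel_measurable (lebesgue_on {0<..<T})" by measurable
  then show "(\<lambda>t. ereal (N (u t))) \<in> borel_measurable (lebesgue_on {0<..<T})"
    by (rule measurable_cong[THEN iffD1, rotated]) (use N in auto)
  show "AE t in lebesgue_on {0<..<T}. ereal (N (u t)) \<le> ereal B"
    by (rule AE_I2) (use N in auto)
qed

lemma (in l2_evolution) norm_lap_bound:
  assumes x: "\<And>t. t \<in> {0..<T} \<Longrightarrow> x t \<in> sob 2" and t: "t \<in> {0..<T}"
  shows "norm (lap (x t)) \<le> real DIM('a) * (hnorm 4 (x 0) + hnorm_total)"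
proof -
  let ?w = "lap (x t) - lap (x 0)"
  have "norm ?w \<le> real DIM('a) * hnorm_total"
  proof (rule lap_increment_le[OF subset_refl x _ t refl])
    show "AE \<tau> in lebesgue_on {0<..<T}. inner (lap (x' \<tau>)) ?w \<le> real DIM('a) * hnorm 4 (x' \<tau>) * norm ?w"
      by (intro AE_I2 order_trans[OF norm_cauchy_schwarz] mult_right_mono norm_lap_le_hnorm norm_ge_zero)
  qed (use T in auto)
  then show ?thesis
    using norm_triangle_ineq[of ?w "lap (x 0)"] norm_lap_le_hnorm[of "x 0"] by (simp add: distrib_left)
qed

lemma continuous_on_hnorm2:
  assumes c: "\<And>\<alpha>. \<alpha> \<in> indices 2 \<Longrightarrow> continuous_on I (\<lambda>t. dx \<alpha> (x t))"
    "\<And>\<alpha>. \<alpha> \<in> indices 2 \<Longrightarrow> continuous_on I (\<lambda>t. dx \<alpha> (y t))"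
    and s: "\<And>t. t \<in> I \<Longrightarrow> x t \<in> sob 2" "\<And>t. t \<in> I \<Longrightarrow> y t \<in> sob 2"
  shows "continuous_on I (\<lambda>t. hnorm 2 (x t - y t))"
proof (rule continuous_on_eq)
  show "continuous_on I (\<lambda>t. L2_set (\<lambda>\<alpha>. norm (dx \<alpha> (x t) - dx \<alpha> (y t))) (indices 2))"
    unfolding L2_set_def by (intro continuous_intros c)
  show "L2_set (\<lambda>\<alpha>. norm (dx \<alpha> (x t) - dx \<alpha> (y t))) (indices 2) = hnorm 2 (x t - y t)" if "t \<in> I" for t
    unfolding hnorm_def by (rule L2_set_cong) (simp_all add: dx_diff[OF s(1)[OF that] s(2)[OF that]])
qed

theorem theorem4:
  fixes T \<nu> \<zeta>0 \<zeta>1 K0 K1 K2 c1 c2 c3 :: real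
    and K K' K'' :: "real \<Rightarrow> real"
    and v0 v1 :: "'a::euclidean_space \<Rightarrow> real"
    and v v' v'' v''' v'''' :: "real \<Rightarrow> 'a \<Rightarrow> real"
    and H :: "real set"
    and \<T> :: "real \<Rightarrow> 'a set set"
    and v0h v1h :: "real \<Rightarrow> 'a \<Rightarrow> real"
    and vh vh' vh'' :: "real \<Rightarrow> real \<Rightarrow> 'a \<Rightarrow> real"
  defines "R \<equiv> \<lambda>h. ritz_projection \<zeta>0 \<zeta>1 K K' v 0 (fe_space (\<T> h))"
  assumes "T > 0" "\<nu> > 0" "\<zeta>1 > 0"
    and "\<And>t. t \<ge> 0 \<Longrightarrow> (K has_real_derivative K' t) (at t within {0..})"
    and "\<And>t. t \<ge> 0 \<Longrightarrow> (K' has_real_derivative K'' t) (at t within {0..})"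
    and "continuous_on {0..} K''"
    and "K0 > 0" "K1 > 0" "K2 > 0"
    and "\<And>t. t \<ge> 0 \<Longrightarrow> K0 \<le> K t \<and> K t \<le> K1"
    and "\<And>t. t \<ge> 0 \<Longrightarrow> 0 < K' t \<and> K' t \<le> K2"
    and "(SUP t\<in>{0..T}. (K' t)\<^sup>2) < \<zeta>0 / 4"
    and "\<And>h. h \<in> H \<Longrightarrow> polytopal_partition (\<T> h) \<and> h = mesh_size (\<T> h)"
    and "min_angle_condition (\<T> ` H)"
    and "approximation_property T H \<T>"
    and "v0 \<in> V_space \<inter> sobolev_space unit_cube 4"
    and "v1 \<in> V_space \<inter> sobolev_space unit_cube 4"
    and "beam_solution T \<nu> \<zeta>0 \<zeta>1 K K' K'' V_space v0 v1 v v' v''"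
    and "has_time_deriv T v'' v'''" "has_time_deriv T v''' v''''"
    and "v' \<in> Bochner_L2 T (sobolev_space unit_cube 4) (sobolev_norm unit_cube 4)"
    and "v'' \<in> Bochner_L2 T (sobolev_space unit_cube 4) (sobolev_norm unit_cube 4)"
    and "v''' \<in> Bochner_Linf T (sobolev_space unit_cube 1) (sobolev_norm unit_cube 1)"
    and "v'''' \<in> Bochner_Linf T (L2_space unit_cube) (L2_norm unit_cube)"
    and "c1 \<ge> 0" "c2 \<ge> 0" "c3 \<ge> 0"
    and "\<And>h. h \<in> H \<Longrightarrow> v0h h \<in> fe_space (\<T> h) \<and> v1h h \<in> fe_space (\<T> h)"
    and "\<And>h. h \<in> H \<Longrightarrow>
           beam_solution T \<nu> \<zeta>0 \<zeta>1 K K' K'' (fe_space (\<T> h)) (v0h h) (v1h h) (vh h) (vh' h) (vh'' h)"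
    and "\<And>h. h \<in> H \<Longrightarrow> L2_norm unit_cube (v1h h - R h v1) \<le> c1 * h ^ 4"
    and "\<And>h. h \<in> H \<Longrightarrow> grad_norm (v0h h - R h v0) \<le> c2 * h ^ 3"
    and "\<And>h. h \<in> H \<Longrightarrow> L2_norm unit_cube (laplacian (v0h h) - laplacian (R h v0)) \<le> c3 * h\<^sup>2"
  shows "\<exists>C>0. \<forall>h\<in>H.
           Linf_norm T (L2_norm unit_cube) (\<lambda>t. v' t - vh' h t)
           + Linf_norm T (sobolev_norm unit_cube 2) (\<lambda>t. v t - vh h t)
           \<le> ereal (C * h\<^sup>2)"
proof -
  note T = assms(2) and \<nu> = assms(3) and \<zeta>1 = assms(4) and dK = assms(5) and dK' = assms(6) and cK'' = assms(7)
  note K0 = assms(8) and K = assms(11) and K' = assms(12) and sup = assms(13) and part = assms(14) and ap = assms(16)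
  note v0 = assms(17) and v1 = assms(18) and sol = assms(19)
  note v' = assms(22) and v'' = assms(23) and c0 = assms(26-28) and vh01 = assms(29) and solh = assms(30)
  note i1 = assms(31) and i0 = assms(33)
  let ?x = "\<lambda>t. cls (v t)" and ?x' = "\<lambda>t. cls (v' t)" and ?x'' = "\<lambda>t. cls (v'' t)"
  let ?n = "real DIM('a)" and ?b = "beam_b K" and ?b' = "\<lambda>t. - 4 * K' t / K t ^ 5"
    and ?\<kappa> = "\<lambda>t. 2 * K' t / K t" and ?LL = "beam_L \<nu> \<zeta>0 K K' K'' :: real \<Rightarrow> 'a l2 \<Rightarrow> 'a l2"
    and ?\<beta> = "1 / K1 ^ 4" and ?Bb = "1 / K0 ^ 4" and ?\<kappa>1 = "2 * K2 / K0"
  obtain CL where "beam_coeffs T \<nu> \<zeta>1 ?b ?b' ?\<kappa> ?LL CL ?\<beta> ?Bb ?\<kappa>1"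
    using beam_coeffs_exists[OF T \<nu> \<zeta>1 dK dK' cK'' K0 K K'] by blast
  then interpret bc: beam_coeffs T \<nu> \<zeta>1 ?b ?b' ?\<kappa> ?LL CL ?\<beta> ?Bb ?\<kappa>1 .
  note xD = beam_solutionD[OF sol subset_refl T]
  have cv: "L2_continuous T v" "L2_continuous T v'" and dv: "has_time_deriv T v v'" "has_time_deriv T v' v''"
    using sol by (auto simp: beam_solution_def)
  interpret ev1: l2_evolution T ?x ?x' by (rule l2_evolution_of_Bochner[OF T cv(1) dv(1) v'])
  interpret ev2: l2_evolution T ?x' ?x'' by (rule l2_evolution_of_Bochner[OF T cv(2) dv(2) v''])
  have z: "0 \<in> {0..<T}" using T by auto
  have v0V: "v0 \<in> V_space" "cls v0 \<in> VV" "cls v0 \<in> sob 4" and v1V: "v1 \<in> V_space" "cls v1 \<in> VV" "cls v1 \<in> sob 4"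
    using v0 v1 by (auto intro: V_space_VV sobolev_space_sob)
  have x0: "?x 0 = cls v0" "?x' 0 = cls v1"
    by (rule xD(7)[OF V_space_L2[OF v0V(1)]], rule xD(8)[OF V_space_L2[OF v1V(1)]])
  have xV: "?x t \<in> VV" if "t \<in> {0..<T}" for t by (rule V_space_VV[OF xD(5)[OF that]])
  obtain D where D: "D \<ge> 1" "\<And>h u. h \<in> H \<Longrightarrow> u \<in> VV \<Longrightarrow> u \<in> sob 4 \<Longrightarrow>
      \<exists>w\<in>cls ` fe_space (\<T> h). norm (lap (u - w)) \<le> D * h\<^sup>2 * hnorm 4 u"
    using approximation_property_lap[OF T ap] by blast
  \<comment> \<open>\<open>s\<close> is the gradient coefficient of the Ritz form at time 0, and
    \<open>G\<close> below is Cea's constant for it.\<close>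
  define s where "s = \<zeta>0 / (K 0)\<^sup>2 + \<zeta>1 * beam_b K 0 * grad_sq (cls (v 0))"
  define G where "G = sqrt ((s * (4 * ?n) + beam_b K 0) / beam_b K 0)"
  define m where "m = diameter (closure unit_cube :: 'a set)"
  define N0 where "N0 = hnorm 4 (cls v0)"
  define N1 where "N1 = hnorm 4 (cls v1)"
  \<comment> \<open>Initial errors divided by \<open>\<delta>\<close>. In \<open>a0\<close>, the
    first 4 N1 is the projection error of v1 and 4 G N1 its Ritz error, the 4 being the factor of
    \<open>VV_norm_le_lap\<close>; the rest is the data error, with h^4 at most m^2 times
    \<open>\<delta>\<close>.\<close>
  define a0 where "a0 = 4 * N1 + (4 * G * N1 + c1 * m\<^sup>2)"
  define a1 where "a1 = N0 + (G * N0 + c3)"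
  \<comment> \<open>\<open>Y0\<close> and \<open>Y1\<close> bound the discrete initial data for all
    h at once, since \<open>\<delta>\<close> is at most D m^2. \<open>W\<close> is the resulting
    bound for the discrete energy, and from it \<open>M\<close> bounds the Laplacians of both
    solutions.\<close>
  define Y0 where "Y0 = norm (lap (cls v0)) + D * m\<^sup>2 * (G * N0 + c3)"
  define Y1 where "Y1 = norm (cls v1) + D * m\<^sup>2 * (4 * G * N1 + c1 * m\<^sup>2)"
  define W where "W = ((Y1\<^sup>2 / 2 + ?Bb * Y0\<^sup>2 / 2) + \<zeta>1 * ?Bb * (4 * ?n * Y0\<^sup>2)\<^sup>2 / 4) * exp ((CL + CL / ?\<beta>) * T)"
  define M where "M = max (?n * (hnorm 4 (?x 0) + ev1.hnorm_total)) (sqrt (2 * W / ?\<beta>))"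
  \<comment> \<open>The constants of the error locale are named with explicit arguments before h is
    fixed; this makes their independence of h visible.\<close>
  define \<Gamma> where "\<Gamma> = galerkin_error.\<Gamma> T \<nu> \<zeta>1 CL ?\<beta> ?Bb ?\<kappa>1 ?x ?x' ?x'' a0 a1 M"
  define E1 where "E1 = 4 * (hnorm 4 (?x' 0) + ev2.hnorm_total) + sqrt (2 * \<Gamma>)"
  define E2 where "E2 = galerkin_error.R0 T ?x ?x' + sqrt (2 * \<Gamma> / ?\<beta>)"
  define k where "k = 4 * real (card (indices 2 :: 'a list set))"
  \<comment> \<open>Absolute values and the summand 1 give positivity without a discussion of the
    signs of the parts.\<close>
  define C where "C = \<bar>D * E1\<bar> + \<bar>k * (D * E2)\<bar> + 1"
  have nn: "0 \<le> N0" "0 \<le> N1" "0 \<le> m" by (simp_all add: N0_def N1_def m_def hnorm_nonneg diameter_ge_0 bounded_closure)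
  \<comment> \<open>The bound by \<open>K2\<close> makes the supremum one of a bounded set, so that
    it dominates the value at 0.\<close>
  have K'0: "4 * (K' 0)\<^sup>2 \<le> \<zeta>0"
  proof -
    have "(K' t)\<^sup>2 \<le> K2\<^sup>2" if "t \<in> {0..T}" for t using K'[of t] that by (auto intro: power_mono)
    then have "bdd_above ((\<lambda>t. (K' t)\<^sup>2) ` {0..T})" by (rule bdd_aboveI2)
    then have "(K' 0)\<^sup>2 \<le> (SUP t\<in>{0..T}. (K' t)\<^sup>2)" by (rule cSUP_upper[rotated]) (use T in auto)
    then show ?thesis using sup by linarith
  qed
  have Kp: "0 < K 0" using K[of 0] K0 by auto
  have b0: "0 < beam_b K 0" using Kp by (simp add: beam_b_def)
  have "0 \<le> \<zeta>0 / (K 0)\<^sup>2" by (rule divide_nonneg_nonneg[OF order_trans[OF _ K'0]]) auto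
  then have s0: "0 \<le> s"
    unfolding s_def using b0 \<zeta>1 by (intro add_nonneg_nonneg mult_nonneg_nonneg grad_sq_nonneg) auto
  have G: "0 \<le> G" unfolding G_def using s0 b0 by simp

  have "Linf_norm T (L2_norm unit_cube) (\<lambda>t. v' t - vh' h t) + Linf_norm T (sobolev_norm unit_cube 2) (\<lambda>t. v t - vh h t)
      \<le> ereal (C * h\<^sup>2)" if h: "h \<in> H" for h
  proof -
    let ?V = "fe_space (\<T> h)" and ?y = "\<lambda>t. cls (vh h t)" and ?y' = "\<lambda>t. cls (vh' h t)" and ?y'' = "\<lambda>t. cls (vh'' h t)"
    define \<delta> where "\<delta> = D * h\<^sup>2"
    have P: "polytopal_partition (\<T> h)" "h = mesh_size (\<T> h)" using part[OF h] by auto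
    have hm: "0 \<le> h" "h \<le> m" using mesh_size_bounds[OF P(1)] P(2) by (auto simp: m_def)
    have h2: "h\<^sup>2 \<le> m\<^sup>2" using hm by (intro power_mono)
    have \<delta>: "0 \<le> \<delta>" "h\<^sup>2 \<le> \<delta>" "\<delta> \<le> D * m\<^sup>2"
      using D(1) h2 mult_right_mono[OF D(1), of "h\<^sup>2"] by (auto simp: \<delta>_def intro: mult_left_mono)
    have h4: "h ^ 4 \<le> m\<^sup>2 * \<delta>"
    proof -
      have "h ^ 4 = h\<^sup>2 * h\<^sup>2" by (simp add: power_add[symmetric])
      also have "\<dots> \<le> m\<^sup>2 * \<delta>" using h2 \<delta> by (intro mult_mono) auto
      finally show ?thesis .
    qed
    have V: "v0h h \<in> ?V" "v1h h \<in> ?V" using vh01[OF h] by auto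
    have "closed E" if "E \<in> \<T> h" for E
      using P(1) that by (auto simp: polytopal_partition_def intro: polytope_imp_closed)
    moreover have "finite (\<T> h)" "unit_cube \<subseteq> \<Union>(\<T> h)"
      using P(1) closure_subset[of "unit_cube :: 'a set"] by (auto simp: polytopal_partition_def)
    ultimately obtain S where S: "finite S" "S \<subseteq> VV" "cls ` ?V = span S"
      using fe_space_span[of "\<T> h", OF _ _ _ V(1)] by blast
    have VX: "?V \<subseteq> V_space" by (auto simp: fe_space_V)
    note yD = beam_solutionD[OF solh[OF h] VX T]
    interpret g: galerkin T \<nu> \<zeta>1 ?b ?b' ?\<kappa> ?LL CL ?\<beta> ?Bb ?\<kappa>1 "cls ` ?V" ?y ?y' ?y''
    proof
      show "\<exists>S. finite S \<and> S \<subseteq> VV \<and> cls ` ?V = span S" using S by blast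
      show "\<And>t. t \<in> {0..<T} \<Longrightarrow> ?y t \<in> cls ` ?V" using yD(5) by blast
      show "continuous_on {0..<T} ?y" "continuous_on {0..<T} ?y'" by (rule yD(1), rule yD(2))
      show "AC_on {0<..<T} (\<lambda>t. inner (?y t) \<psi>) (\<lambda>t. inner (?y' t) \<psi>)"
        "AC_on {0<..<T} (\<lambda>t. inner (?y' t) \<psi>) (\<lambda>t. inner (?y'' t) \<psi>)" for \<psi>
        by (rule yD(3), rule yD(4))
      show "bc.beam_eq t (?y t) (?y' t) (?y'' t) w" if "t \<in> {0<..<T}" "w \<in> cls ` ?V" for t w
        unfolding bc.beam_eq_def by (rule yD(9)[OF that])
    qed
    have y0: "?y 0 = cls (v0h h)" "?y' 0 = cls (v1h h)"
      by (rule yD(7)[OF fe_space_L2[OF V(1)]], rule yD(8)[OF fe_space_L2[OF V(2)]])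
    have ritz: "R h \<phi> \<in> ?V" "norm (lap (cls \<phi> - cls (R h \<phi>))) \<le> G * (\<delta> * hnorm 4 (cls \<phi>))"
      if \<phi>: "\<phi> \<in> V_space" "cls \<phi> \<in> VV" "cls \<phi> \<in> sob 4" for \<phi>
    proof -
      note ra = ritz_projection_approx[where K=K and K'=K' and t=0 and \<theta>=v, OF Kp K'0 less_imp_le[OF \<zeta>1] S \<phi>(1) xD(5)[OF z]]
      show "R h \<phi> \<in> ?V" unfolding R_def by (rule ra(1))
      obtain w where w: "w \<in> cls ` ?V" "norm (lap (cls \<phi> - w)) \<le> \<delta> * hnorm 4 (cls \<phi>)"
        using D(2)[OF h \<phi>(2,3)] by (auto simp: \<delta>_def)
      show "norm (lap (cls \<phi> - cls (R h \<phi>))) \<le> G * (\<delta> * hnorm 4 (cls \<phi>))"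
        using ra(2)[OF w(1)] mult_left_mono[OF w(2) G] unfolding R_def G_def s_def by linarith
    qed
    have RV: "R h v0 \<in> ?V" "R h v1 \<in> ?V" using ritz v0V v1V by auto
    \<comment> \<open>The discrete data are compared with v0 through the Ritz projection, whose
      distance from v0 is bounded by Cea's constant.\<close>
    have d0: "norm (lap (cls v0 - ?y 0)) \<le> \<delta> * (G * N0 + c3)"
    proof -
      note V2 = V_space_sobolev[OF fe_space_V[OF V(1)]] V_space_sobolev[OF fe_space_V[OF RV(1)]]
      have "laplacian (v0h h) - laplacian (R h v0) = (\<lambda>y. laplacian (v0h h) y - laplacian (R h v0) y)" by auto
      then have "norm (lap (?y 0) - lap (cls (R h v0))) = L2_norm unit_cube (laplacian (v0h h) - laplacian (R h v0))"
        using laplacian_cls[OF V2(1)] laplacian_cls[OF V2(2)] y0 cls_diff[of "laplacian (v0h h)" "laplacian (R h v0)"]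
        by (simp add: norm_cls[symmetric] L2_space_diff)
      then have "norm (lap (?y 0) - lap (cls (R h v0))) \<le> c3 * h\<^sup>2" using i0[OF h] by simp
      also have "\<dots> \<le> c3 * \<delta>" using c0 \<delta> by (intro mult_left_mono)
      finally have 1: "norm (lap (?y 0) - lap (cls (R h v0))) \<le> c3 * \<delta>" .
      have VV: "?y 0 \<in> VV" "cls (R h v0) \<in> VV" using y0 V RV by (auto simp: fe_space_V V_space_VV)
      have "lap (cls v0 - ?y 0) = lap (cls v0 - cls (R h v0)) - (lap (?y 0) - lap (cls (R h v0)))"
        using VV v0V by (simp add: lap_diff VV_sob)
      then have "norm (lap (cls v0 - ?y 0)) \<le> G * (\<delta> * N0) + c3 * \<delta>"
        unfolding N0_def
        by (simp only: order_trans[OF norm_triangle_ineq4 add_mono[OF ritz(2)[OF v0V] 1]])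
      then show ?thesis by (simp add: algebra_simps)
    qed
    have d1: "norm (cls v1 - ?y' 0) \<le> \<delta> * (4 * G * N1 + c1 * m\<^sup>2)"
    proof -
      have "v1h h - R h v1 = (\<lambda>y. v1h h y - R h v1 y)" by auto
      then have "norm (?y' 0 - cls (R h v1)) = L2_norm unit_cube (v1h h - R h v1)"
        using y0 V RV cls_diff[of "v1h h" "R h v1"]
        by (simp add: norm_cls[symmetric] L2_space_diff fe_space_L2)
      then have "norm (?y' 0 - cls (R h v1)) \<le> c1 * h ^ 4" using i1[OF h] by simp
      also have "\<dots> \<le> c1 * (m\<^sup>2 * \<delta>)" using c0 h4 by (intro mult_left_mono)
      finally have 1: "norm (?y' 0 - cls (R h v1)) \<le> c1 * (m\<^sup>2 * \<delta>)" .
      have "cls v1 - cls (R h v1) \<in> VV"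
        using v1V RV by (intro subspace_diff subspace_VV) (auto simp: fe_space_V V_space_VV)
      from VV_norm_le_lap[OF this] ritz(2)[OF v1V]
      have 2: "norm (cls v1 - cls (R h v1)) \<le> 4 * (G * (\<delta> * N1))" unfolding N1_def by linarith
      have "cls v1 - ?y' 0 = (cls v1 - cls (R h v1)) - (?y' 0 - cls (R h v1))" by simp
      then have "norm (cls v1 - ?y' 0) \<le> 4 * (G * (\<delta> * N1)) + c1 * (m\<^sup>2 * \<delta>)"
        by (simp only: order_trans[OF norm_triangle_ineq4 add_mono[OF 2 1]])
      then show ?thesis by (simp add: algebra_simps)
    qed
    have proj: "norm (lap (u - lapf.proj Q u)) \<le> \<delta> * hnorm 4 u"
      if Q: "lapf.onb Q" "span Q = cls ` ?V" and u: "u \<in> VV" "u \<in> sob 4" for Q u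
    proof -
      obtain w where w: "w \<in> span Q" "norm (lap (u - w)) \<le> \<delta> * hnorm 4 u"
        using D(2)[OF h u] unfolding Q(2) \<delta>_def by blast
      show ?thesis by (rule order_trans[OF lap_best_approx[OF Q(1) u(1) w(1)] w(2)])
    qed
    have proj_VV: "lapf.proj Q u \<in> VV" if "lapf.onb Q" for Q u
      using lapf.proj_span lapf.onb_span_W[OF that] by blast
    have My: "norm (lap (?y t)) \<le> M" if t: "t \<in> {0..<T}" for t
    proof -
      have y0V: "?y 0 \<in> VV" using y0 V by (auto simp: fe_space_V V_space_VV)
      have G0: "0 \<le> G * N0 + c3" "0 \<le> 4 * G * N1 + c1 * m\<^sup>2" using G nn c0 by auto
      have "lap (cls v0 - ?y 0) = lap (cls v0) - lap (?y 0)" using y0V v0V by (simp add: lap_diff VV_sob)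
      then have "norm (lap (?y 0)) \<le> norm (lap (cls v0)) + norm (lap (cls v0 - ?y 0))"
        using norm_triangle_ineq4[of "lap (cls v0)" "lap (cls v0 - ?y 0)"] by simp
      then have Y0: "norm (lap (?y 0)) \<le> Y0"
        using d0 mult_right_mono[OF \<delta>(3) G0(1)] unfolding Y0_def by linarith
      have "norm (?y' 0) \<le> norm (cls v1) + norm (cls v1 - ?y' 0)"
        using norm_triangle_ineq4[of "cls v1" "cls v1 - ?y' 0"] by simp
      then have Y1: "norm (?y' 0) \<le> Y1"
        using d1 mult_right_mono[OF \<delta>(3) G0(2)] unfolding Y1_def by linarith
      have b: "0 \<le> beam_b K 0" "beam_b K 0 \<le> ?Bb" using b0 bc.b_bounds[OF z] by auto
      have lsq: "(norm (lap (?y 0)))\<^sup>2 \<le> Y0\<^sup>2" using Y0 by (intro power_mono) auto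
      have g: "grad_sq (?y 0) \<le> 4 * ?n * Y0\<^sup>2"
        using grad_sq_le[OF y0V] lsq mult_left_mono[OF lsq, of "4 * ?n"] by linarith
      have "(norm (?y' 0))\<^sup>2 / 2 \<le> Y1\<^sup>2 / 2" using Y1 by (intro divide_right_mono power_mono) auto
      moreover have "beam_b K 0 * (norm (lap (?y 0)))\<^sup>2 / 2 \<le> ?Bb * Y0\<^sup>2 / 2"
        using b lsq by (intro divide_right_mono mult_mono) auto
      moreover have "\<zeta>1 * beam_b K 0 * (grad_sq (?y 0))\<^sup>2 / 4 \<le> \<zeta>1 * ?Bb * (4 * ?n * Y0\<^sup>2)\<^sup>2 / 4"
        using b \<zeta>1 K0 by (intro divide_right_mono mult_mono mult_left_mono power_mono g grad_sq_nonneg) auto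
      ultimately have "g.energy0 0 \<le> (Y1\<^sup>2 / 2 + ?Bb * Y0\<^sup>2 / 2) + \<zeta>1 * ?Bb * (4 * ?n * Y0\<^sup>2)\<^sup>2 / 4"
        unfolding g.energy0_def by linarith
      then have "g.energy0 0 * exp ((CL + CL / ?\<beta>) * T) \<le> W" unfolding W_def by (rule mult_right_mono) simp
      then have "?\<beta> * (norm (lap (?y t)))\<^sup>2 / 2 \<le> W" using g.apriori[OF t] by linarith
      then have "(norm (lap (?y t)))\<^sup>2 \<le> 2 * W / ?\<beta>" using bc.\<beta> by (simp add: field_simps)
      then have "norm (lap (?y t)) \<le> sqrt (2 * W / ?\<beta>)" by (rule real_le_rsqrt)
      then show ?thesis unfolding M_def by linarith
    qed
    interpret ge: galerkin_error T \<nu> \<zeta>1 ?b ?b' ?\<kappa> ?LL CL ?\<beta> ?Bb ?\<kappa>1 "cls ` ?V" ?y ?y' ?y'' ?x ?x' ?x'' \<delta> a0 a1 M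
    proof
      show "?x t \<in> VV" if "t \<in> {0..<T}" for t by (rule xV[OF that])
      show "?x 0 \<in> sob 4" "?x' 0 \<in> VV" "?x' 0 \<in> sob 4" unfolding x0 by (rule v0V v1V)+
      show "bc.beam_eq t (?x t) (?x' t) (?x'' t) w" if "t \<in> {0<..<T}" "w \<in> VV" for t w
      proof -
        have "rep_l2 w \<in> V_space" using V_space_iff[OF rep_l2_mem, of w] that(2) by (simp add: cls_rep)
        then have "w \<in> cls ` V_space" by (metis cls_rep imageI)
        from xD(9)[OF that(1) this] show ?thesis unfolding bc.beam_eq_def .
      qed
      show "integrable (lebesgue_on {0<..<T}) (\<lambda>t. (hnorm 4 (?x' t))\<^sup>2)" by (rule Bochner_L2_hnorm(2)[OF v'])
      show "integrable (lebesgue_on {0<..<T}) (\<lambda>t. (hnorm 4 (?x'' t))\<^sup>2)" by (rule Bochner_L2_hnorm(2)[OF v''])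
      show "\<exists>w\<in>cls ` ?V. norm (lap (u - w)) \<le> \<delta> * hnorm 4 u" if "u \<in> VV" "u \<in> sob 4" for u
        unfolding \<delta>_def by (rule D(2)[OF h that])
      show "0 \<le> \<delta>" by (rule \<delta>)
      show "norm (lapf.proj Q (?x' 0) - ?y' 0) \<le> \<delta> * a0" if Q: "lapf.onb Q" "span Q = cls ` ?V" for Q
      proof -
        have "cls v1 - lapf.proj Q (cls v1) \<in> VV" by (intro subspace_diff subspace_VV v1V proj_VV Q)
        from VV_norm_le_lap[OF this] proj[OF Q v1V(2,3)]
        have 1: "norm (cls v1 - lapf.proj Q (cls v1)) \<le> 4 * (\<delta> * N1)" unfolding N1_def by linarith
        have "lapf.proj Q (cls v1) - ?y' 0 = (cls v1 - ?y' 0) - (cls v1 - lapf.proj Q (cls v1))" by simp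
        then have "norm (lapf.proj Q (cls v1) - ?y' 0) \<le> \<delta> * (4 * G * N1 + c1 * m\<^sup>2) + 4 * (\<delta> * N1)"
          by (simp only: order_trans[OF norm_triangle_ineq4 add_mono[OF d1 1]])
        then show ?thesis unfolding x0 a0_def by (simp add: algebra_simps)
      qed
      show "norm (lap (lapf.proj Q (?x 0) - ?y 0)) \<le> \<delta> * a1" if Q: "lapf.onb Q" "span Q = cls ` ?V" for Q
      proof -
        have VV: "cls v0 \<in> sob 2" "lapf.proj Q (cls v0) \<in> sob 2" "?y 0 \<in> sob 2"
          using y0 V v0V proj_VV[OF Q(1)] by (auto simp: fe_space_V V_space_VV intro!: VV_sob)
        have "lap (lapf.proj Q (cls v0) - ?y 0) = lap (cls v0 - ?y 0) - lap (cls v0 - lapf.proj Q (cls v0))"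
          using VV by (simp add: lap_diff)
        then have "norm (lap (lapf.proj Q (cls v0) - ?y 0)) \<le> \<delta> * (G * N0 + c3) + \<delta> * N0"
          using order_trans[OF norm_triangle_ineq4 add_mono[OF d0 proj[OF Q v0V(2,3)]]] by (simp only: N0_def)
        then show ?thesis unfolding x0 a1_def by (simp add: algebra_simps)
      qed
      show "norm (lap (?x t)) \<le> M" if "t \<in> {0..<T}" for t
        unfolding M_def by (rule order_trans[OF ev1.norm_lap_bound[OF VV_sob[OF xV] that] max.cobounded1])
      show "norm (lap (?y t)) \<le> M" if "t \<in> {0..<T}" for t by (rule My[OF that])
      show "0 \<le> ?\<kappa>1" using K'[of 0] K0 by auto
    qed
    have yV: "vh h t \<in> V_space" if "t \<in> {0..<T}" for t using yD(5)[OF that] VX by blast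
    have k0: "0 \<le> k" by (simp add: k_def)
    have "Linf_norm T (L2_norm unit_cube) (\<lambda>t. v' t - vh' h t) \<le> ereal (\<delta> * E1)"
    proof (rule Linf_norm_le)
      show "continuous_on {0..<T} (\<lambda>t. norm (?x' t - ?y' t))"
        by (intro continuous_intros xD(2) yD(2))
      fix t assume "t \<in> {0<..<T}"
      then have t: "t \<in> {0..<T}" by auto
      have "L2_norm unit_cube (v' t - vh' h t) = norm (?x' t - ?y' t)"
        using xD(6)[OF t] yD(6)[OF t] cls_diff[OF xD(6)[OF t] yD(6)[OF t]] L2_space_diff[OF xD(6)[OF t] yD(6)[OF t]]
        by (simp add: norm_cls[symmetric] fun_diff_def)
      then show "L2_norm unit_cube (v' t - vh' h t) = norm (?x' t - ?y' t) \<and> norm (?x' t - ?y' t) \<le> \<delta> * E1"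
        using ge.error_bound(1)[OF t] by (simp add: E1_def \<Gamma>_def)
    qed
    moreover have "Linf_norm T (sobolev_norm unit_cube 2) (\<lambda>t. v t - vh h t) \<le> ereal (k * (\<delta> * E2))"
    proof (rule Linf_norm_le)
      show "continuous_on {0..<T} (\<lambda>t. hnorm 2 (?x t - ?y t))"
      proof (rule continuous_on_hnorm2)
        show "continuous_on {0..<T} (\<lambda>t. dx \<alpha> (?x t))" if "\<alpha> \<in> indices 2" for \<alpha>
          by (rule ev1.continuous_on_dx[OF VV_sob[OF xV] that])
        show "continuous_on {0..<T} (\<lambda>t. dx \<alpha> (?y t))" if "\<alpha> \<in> indices 2" for \<alpha>
          by (rule g.dx_cont[OF g.y_cont g.y_Vh that])
      qed (intro VV_sob xV V_space_VV yV; assumption)+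
      fix t assume "t \<in> {0<..<T}"
      then have t: "t \<in> {0..<T}" by auto
      have L: "v t \<in> L2_space unit_cube" "vh h t \<in> L2_space unit_cube"
        by (rule V_space_L2[OF xD(5)[OF t]], rule V_space_L2[OF yV[OF t]])
      have "v t - vh h t \<in> V_space"
        using V_space_add[OF xD(5)[OF t] V_space_scale[OF yV[OF t], of "-1"]] by (simp add: fun_diff_def)
      then have "sobolev_norm unit_cube 2 (v t - vh h t) = hnorm 2 (cls (v t - vh h t))"
        by (intro sobolev_norm_eq V_space_sobolev)
      then have 1: "sobolev_norm unit_cube 2 (v t - vh h t) = hnorm 2 (?x t - ?y t)"
        using cls_diff[OF L] by (simp add: fun_diff_def)
      have "?x t - ?y t \<in> VV" by (intro subspace_diff subspace_VV xV t V_space_VV yV)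
      from VV_hnorm_le_lap[OF this] have "hnorm 2 (?x t - ?y t) \<le> k * norm (lap (?x t - ?y t))" by (simp add: k_def)
      also have "\<dots> \<le> k * (\<delta> * E2)"
        using ge.error_bound(2)[OF t] by (intro mult_left_mono k0) (simp add: E2_def \<Gamma>_def)
      finally show "sobolev_norm unit_cube 2 (v t - vh h t) = hnorm 2 (?x t - ?y t) \<and> hnorm 2 (?x t - ?y t) \<le> k * (\<delta> * E2)"
        using 1 by simp
    qed
    ultimately have "Linf_norm T (L2_norm unit_cube) (\<lambda>t. v' t - vh' h t) + Linf_norm T (sobolev_norm unit_cube 2) (\<lambda>t. v t - vh h t)
        \<le> ereal (\<delta> * E1) + ereal (k * (\<delta> * E2))" by (rule add_mono)
    also have "\<dots> = ereal ((D * E1 + k * (D * E2)) * h\<^sup>2)" by (simp add: \<delta>_def algebra_simps)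
    also have "\<dots> \<le> ereal (C * h\<^sup>2)"
      unfolding C_def ereal_less_eq by (intro mult_right_mono) auto
    finally show ?thesis .
  qed
  moreover have "C > 0" unfolding C_def by linarith
  ultimately show ?thesis by blast
qed

end
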